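(* Let $(V,c)$ be a finite-dimensional braided vector space over $\Bbbk$ with generic braiding. Then the following are equivalent: (a) The Nichols algebra $\mathcal B(V)$ has finite Gelfand-Kirillov dimension. (b) $(V,c)$ is twist-equivalent to a braiding of DJ-type with finite Cartan matrix.
   Context: $\Bbbk$ is an algebraically closed field of characteristic $0$. A braided vector space is a pair $(V,c)$ with $V$ a vector space and $c\in\operatorname{Aut}(V\otimes V)$ satisfying $(c\otimes \mathrm{id})(\mathrm{id}\otimes c)(c\otimes \mathrm{id})=(\mathrm{id}\otimes c)(c\otimes \mathrm{id})(\mathrm{id}\otimes c)$. It is of diagonal type if $V$ has a finite basis $x_1,\dots,x_\theta$ and there are $q_{ij}\in\Bbbk^\times$ with $c(x_i\otimes x_j)=q_{ij}\,x_j\otimes x_i$ for all $1\le i,j\le\theta$; $(q_{ij})$ is its braiding matrix. The braiding is generic if it is diagonal with matrix $(q_{ij})$ where no $q_{ii}$ is a root of $1$. The Nichols algebra is $\mathcal B(V)=T(V)/\widetilde I(V)$, where $T(V)$ is the tensor algebra, regarded as a braided Hopf algebra with the elements of $V$ primitive, and $\widetilde I(V)$ is the largest homogeneous Hopf ideal of $T(V)$ having trivial intersection with $V\oplus\Bbbk$. Two braidings of diagonal type with matrices $(q_{ij})_{1\le i,j\le\theta}$ and $(\widehat q_{ij})_{1\le i,j\le\theta}$ are twist-equivalent if $q_{ii}=\widehat q_{ii}$ and $q_{ij}q_{ji}=\widehat q_{ij}\widehat q_{ji}$ for all $1\le i,j\le\theta$. A braiding of diagonal type with matrix $(q_{ij})_{1\le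 i,j\le\theta}$ is of DJ-type (Drinfeld-Jimbo type) with Cartan matrix $(a_{ij})$ if $(a_{ij})$ is a generalized Cartan matrix, there are positive integers $d_1,\dots,d_\theta$ with $d_ia_{ij}=d_ja_{ji}$ for all $i,j$, and for every connected component $J$ of the Dynkin diagram of $(a_{ij})$ there is $q_J\in\Bbbk^\times$, not a root of $1$, such that $q_{ij}=q_J^{d_ia_{ij}}$ for all $i\in J$, $1\le j\le\theta$. "Finite Cartan matrix" means that $(a_{ij})$ is of finite type. *)

theory Defs
  imports
    "HOL-Computational_Algebra.Polynomial"
    "HOL-Library.Function_Algebras"
    "HOL-Library.Extended_Real"
    "HOL-Library.Liminf_Limsup"
    "HOL-Algebra.Embedded_Algebras"
    "HOL-Algebra.QuotRing"
begin

section \<open>The tensor algebra\<close>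

definition fun_scale :: "'k::field \<Rightarrow> ('x \<Rightarrow> 'k) \<Rightarrow> 'x \<Rightarrow> 'k"
  where "fun_scale a f = (\<lambda>x. a * f x)"

abbreviation fun_span :: "('x \<Rightarrow> 'k::field) set \<Rightarrow> ('x \<Rightarrow> 'k) set"
  where "fun_span \<equiv> module.span fun_scale"

definition linear_on_subspace ::
    "('x \<Rightarrow> 'k::field) set \<Rightarrow> (('x \<Rightarrow> 'k) \<Rightarrow> 'y \<Rightarrow> 'k) \<Rightarrow> bool"
  where "linear_on_subspace S f \<longleftrightarrow>
    (\<forall>s\<in>S. \<forall>t\<in>S. f (s + t) = f s + f t) \<and>
    (\<forall>a. \<forall>s\<in>S. f (fun_scale a s) = fun_scale a (f s))"

text \<open>
  Tensors are modelled without a choice of basis and without quotients. Over a field, the map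
  sending \<open>v\<^sub>1 \<otimes> \<dots> \<otimes> v\<^sub>n\<close> to the multilinear form
  \<open>(f\<^sub>1, \<dots>, f\<^sub>n) \<mapsto> f\<^sub>1(v\<^sub>1) \<cdots> f\<^sub>n(v\<^sub>n)\<close> on the dual space
  embeds the \<open>n\<close>-th tensor power of \<open>V\<close> into the multilinear forms. A tensor is therefore a
  function on lists of linear functionals, its degree \<open>n\<close> component being the restriction to lists
  of length \<open>n\<close>; an element of \<open>T(V) \<otimes> T(V)\<close> is a function on pairs of such lists.
  By convention these functions vanish on lists with a non-linear entry.
\<close>

type_synonym ('v, 'k) tensor = "('v \<Rightarrow> 'k) list \<Rightarrow> 'k"
type_synonym ('v, 'k) tensor2 = "('v \<Rightarrow> 'k) list \<times> ('v \<Rightarrow> 'k) list \<Rightarrow> 'k"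

context
  fixes scale :: "'k::field \<Rightarrow> 'v::ab_group_add \<Rightarrow> 'v"
begin

definition pure_tensor :: "'v list \<Rightarrow> ('v, 'k) tensor"
  where "pure_tensor vs = (\<lambda>fs.
    if length fs = length vs \<and> (\<forall>f\<in>set fs. Vector_Spaces.linear scale (*) f)
    then \<Prod>i<length vs. (fs ! i) (vs ! i) else 0)"

definition tensor_power :: "nat \<Rightarrow> ('v, 'k) tensor set"
  where "tensor_power n = fun_span {pure_tensor vs | vs. length vs = n}"

definition tensor_mult :: "('v, 'k) tensor \<Rightarrow> ('v, 'k) tensor \<Rightarrow> ('v, 'k) tensor"
  where "tensor_mult s t = (\<lambda>fs. \<Sum>i\<le>length fs. s (take i fs) * t (drop i fs))"

definition tensor_algebra :: "('v, 'k) tensor ring"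
  where "tensor_algebra =
    \<lparr>carrier = fun_span (range pure_tensor), mult = tensor_mult, one = pure_tensor [],
     zero = 0, add = (+)\<rparr>"

definition tensor_component :: "nat \<Rightarrow> ('v, 'k) tensor \<Rightarrow> ('v, 'k) tensor"
  where "tensor_component n t = (\<lambda>fs. if length fs = n then t fs else 0)"

definition tensor2_pure :: "('v, 'k) tensor \<Rightarrow> ('v, 'k) tensor \<Rightarrow> ('v, 'k) tensor2"
  where "tensor2_pure s t = (\<lambda>(fs, gs). s fs * t gs)"

definition tensor2_of :: "('v, 'k) tensor set \<Rightarrow> ('v, 'k) tensor set \<Rightarrow> ('v, 'k) tensor2 set"
  where "tensor2_of A B = fun_span {tensor2_pure a b | a b. a \<in> A \<and> b \<in> B}"

section \<open>Braided vector spaces\<close>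

text \<open>
  The operator \<open>id \<otimes> c \<otimes> id\<close> with \<open>c\<close> acting on the tensor factors
  \<open>p\<close> and \<open>p + 1\<close>, counted from 0: all other arguments are frozen and \<open>c\<close> is applied to the
  resulting element of \<open>V \<otimes> V\<close>.
\<close>

definition braid_at ::
    "(('v, 'k) tensor \<Rightarrow> ('v, 'k) tensor) \<Rightarrow> nat \<Rightarrow> ('v, 'k) tensor \<Rightarrow> ('v, 'k) tensor"
  where "braid_at c p t = (\<lambda>fs.
    if p + 2 \<le> length fs
    then c (\<lambda>gs. if length gs = 2 then t (take p fs @ gs @ drop (p + 2) fs) else 0)
           (take 2 (drop p fs))
    else 0)"

definition braided_vector_space :: "(('v, 'k) tensor \<Rightarrow> ('v, 'k) tensor) \<Rightarrow> bool"
  where "braided_vector_space c \<longleftrightarrow>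
    linear_on_subspace (tensor_power 2) c \<and> bij_betw c (tensor_power 2) (tensor_power 2) \<and>
    (\<forall>t\<in>tensor_power 3.
       braid_at c 0 (braid_at c 1 (braid_at c 0 t)) = braid_at c 1 (braid_at c 0 (braid_at c 1 t)))"

definition diagonal_type ::
    "(('v, 'k) tensor \<Rightarrow> ('v, 'k) tensor) \<Rightarrow> 'v list \<Rightarrow> (nat \<Rightarrow> nat \<Rightarrow> 'k) \<Rightarrow> bool"
  where "diagonal_type c xs q \<longleftrightarrow>
    distinct xs \<and> \<not> module.dependent scale (set xs) \<and> module.span scale (set xs) = UNIV \<and>
    (\<forall>i<length xs. \<forall>j<length xs.
       q i j \<noteq> 0 \<and>
       c (pure_tensor [xs ! i, xs ! j]) = fun_scale (q i j) (pure_tensor [xs ! j, xs ! i]))"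

definition root_of_one :: "'k \<Rightarrow> bool"
  where "root_of_one x \<longleftrightarrow> (\<exists>n>0. x ^ n = 1)"

definition generic_braiding :: "(('v, 'k) tensor \<Rightarrow> ('v, 'k) tensor) \<Rightarrow> bool"
  where "generic_braiding c \<longleftrightarrow>
    (\<exists>xs q. diagonal_type c xs q \<and> (\<forall>i<length xs. \<not> root_of_one (q i i)))"

section \<open>The braided Hopf algebra structure of the tensor algebra\<close>

text \<open>
  The braiding \<open>V\<^sup>m \<otimes> V\<^sup>n \<rightarrow> V\<^sup>n \<otimes> V\<^sup>m\<close> of tensor powers: the \<open>n\<close> factors of
  the second block are moved to the left past the first block one after the other
  (\<open>fold\<close> applies the operator of the first list element first).
\<close>

definition block_braid ::
    "(('v, 'k) tensor \<Rightarrow> ('v, 'k) tensor) \<Rightarrow> nat \<Rightarrow> nat \<Rightarrow> ('v, 'k) tensor \<Rightarrow> ('v, 'k) tensor"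
  where "block_braid c m n = fold (braid_at c) (concat (map (\<lambda>j. rev [j..<j + m]) [0..<n]))"

text \<open>
  The braiding of \<open>T(V) \<otimes> T(V)\<close>: its value at \<open>(gs, hs)\<close> is determined by the component in
  \<open>V\<^sup>m \<otimes> V\<^sup>n\<close> with \<open>m = length hs\<close> and \<open>n = length gs\<close>, regarded as a tensor of degree
  \<open>m + n\<close>.
\<close>

definition tensor2_braid ::
    "(('v, 'k) tensor \<Rightarrow> ('v, 'k) tensor) \<Rightarrow> ('v, 'k) tensor2 \<Rightarrow> ('v, 'k) tensor2"
  where "tensor2_braid c x = (\<lambda>(gs, hs).
    block_braid c (length hs) (length gs)
      (\<lambda>fs. if length fs = length hs + length gs
            then x (take (length hs) fs, drop (length hs) fs) else 0)
      (gs @ hs))"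

text \<open>
  The product \<open>(\<mu> \<otimes> \<mu>) \<circ> (id \<otimes> c \<otimes> id)\<close> of the braided tensor product algebra
  \<open>T(V) \<otimes> T(V)\<close>.
\<close>

definition tensor2_mult ::
    "(('v, 'k) tensor \<Rightarrow> ('v, 'k) tensor) \<Rightarrow> ('v, 'k) tensor2 \<Rightarrow> ('v, 'k) tensor2 \<Rightarrow> ('v, 'k) tensor2"
  where "tensor2_mult c x y = (\<lambda>(fs, gs).
    \<Sum>i\<le>length fs. \<Sum>j\<le>length gs.
      tensor2_braid c (\<lambda>(us, ws). x (take i fs, us) * y (ws, drop j gs)) (drop i fs, take j gs))"

definition is_coproduct ::
    "(('v, 'k) tensor \<Rightarrow> ('v, 'k) tensor) \<Rightarrow> (('v, 'k) tensor \<Rightarrow> ('v, 'k) tensor2) \<Rightarrow> bool"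
  where "is_coproduct c D \<longleftrightarrow>
    D \<in> carrier tensor_algebra
          \<rightarrow>\<^sub>E tensor2_of (carrier tensor_algebra) (carrier tensor_algebra) \<and>
    linear_on_subspace (carrier tensor_algebra) D \<and>
    D (pure_tensor []) = tensor2_pure (pure_tensor []) (pure_tensor []) \<and>
    (\<forall>s\<in>carrier tensor_algebra. \<forall>t\<in>carrier tensor_algebra.
       D (tensor_mult s t) = tensor2_mult c (D s) (D t)) \<and>
    (\<forall>v. D (pure_tensor [v]) =
       tensor2_pure (pure_tensor [v]) (pure_tensor []) +
       tensor2_pure (pure_tensor []) (pure_tensor [v]))"

definition coproduct ::
    "(('v, 'k) tensor \<Rightarrow> ('v, 'k) tensor) \<Rightarrow> ('v, 'k) tensor \<Rightarrow> ('v, 'k) tensor2"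
  where "coproduct c = (THE D. is_coproduct c D)"

definition counit :: "('v, 'k) tensor \<Rightarrow> 'k"
  where "counit t = t []"

text \<open>
  The two equations say that \<open>S\<close> is a convolution inverse of the identity:
  \<open>\<mu> (S \<otimes> id) \<Delta> = \<eta> \<epsilon> = \<mu> (id \<otimes> S) \<Delta>\<close>.
\<close>

definition is_antipode ::
    "(('v, 'k) tensor \<Rightarrow> ('v, 'k) tensor) \<Rightarrow> (('v, 'k) tensor \<Rightarrow> ('v, 'k) tensor) \<Rightarrow> bool"
  where "is_antipode c S \<longleftrightarrow>
    S \<in> carrier tensor_algebra \<rightarrow>\<^sub>E carrier tensor_algebra \<and>
    linear_on_subspace (carrier tensor_algebra) S \<and>
    (\<forall>t\<in>carrier tensor_algebra.
       (\<lambda>fs. \<Sum>i\<le>length fs. S (\<lambda>us. coproduct c t (us, drop i fs)) (take i fs))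
         = fun_scale (counit t) (pure_tensor []) \<and>
       (\<lambda>fs. \<Sum>i\<le>length fs. S (\<lambda>us. coproduct c t (take i fs, us)) (drop i fs))
         = fun_scale (counit t) (pure_tensor []))"

definition antipode ::
    "(('v, 'k) tensor \<Rightarrow> ('v, 'k) tensor) \<Rightarrow> ('v, 'k) tensor \<Rightarrow> ('v, 'k) tensor"
  where "antipode c = (THE S. is_antipode c S)"

definition hopf_ideal ::
    "(('v, 'k) tensor \<Rightarrow> ('v, 'k) tensor) \<Rightarrow> ('v, 'k) tensor set \<Rightarrow> bool"
  where "hopf_ideal c I \<longleftrightarrow>
    ideal I tensor_algebra \<and>
    coproduct c ` I \<subseteq> fun_span (tensor2_of I (carrier tensor_algebra)
                              \<union> tensor2_of (carrier tensor_algebra) I) \<and>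
    counit ` I \<subseteq> {0} \<and>
    antipode c ` I \<subseteq> I"

definition homogeneous :: "('v, 'k) tensor set \<Rightarrow> bool"
  where "homogeneous I \<longleftrightarrow> (\<forall>t\<in>I. \<forall>n. tensor_component n t \<in> I)"

section \<open>Nichols algebras\<close>

definition nichols_ideal :: "(('v, 'k) tensor \<Rightarrow> ('v, 'k) tensor) \<Rightarrow> ('v, 'k) tensor set"
  where "nichols_ideal c = (GREATEST I.
    hopf_ideal c I \<and> homogeneous I \<and> I \<inter> fun_span (tensor_power 1 \<union> tensor_power 0) = {0})"

definition nichols_algebra :: "(('v, 'k) tensor \<Rightarrow> ('v, 'k) tensor) \<Rightarrow> ('v, 'k) tensor set ring"
  where "nichols_algebra c = tensor_algebra Quot nichols_ideal c"

definition nichols_scalars :: "(('v, 'k) tensor \<Rightarrow> ('v, 'k) tensor) \<Rightarrow> ('v, 'k) tensor set set"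
  where "nichols_scalars c =
    range (\<lambda>a. nichols_ideal c +>\<^bsub>tensor_algebra\<^esub> fun_scale a (pure_tensor []))"

end

section \<open>Gelfand-Kirillov dimension\<close>

text \<open>
  The products of at most \<open>n\<close> elements of \<open>us\<close>. They span \<open>U\<^sup>0 + U\<^sup>1 + \<dots> + U\<^sup>n\<close>,
  where \<open>U\<close> is the span of \<open>us\<close>.
\<close>

definition monomials_upto :: "('a, 'b) ring_scheme \<Rightarrow> nat \<Rightarrow> 'a list \<Rightarrow> 'a list"
  where "monomials_upto R n us =
    map (\<lambda>ws. foldr (\<otimes>\<^bsub>R\<^esub>) ws \<one>\<^bsub>R\<^esub>) (concat (map (\<lambda>m. List.n_lists m us) [0..<Suc n]))"

text \<open>
  For a ring \<open>R\<close> that is an algebra over its central subfield \<open>K\<close>. The supremum is over all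
  finite-dimensional subspaces of \<open>R\<close>, each given by a finite list \<open>us\<close> of spanning elements.
\<close>

definition GKdim :: "'a set \<Rightarrow> ('a, 'b) ring_scheme \<Rightarrow> ereal"
  where "GKdim K R =
    (SUP us\<in>{us. set us \<subseteq> carrier R}.
       limsup (\<lambda>n. ereal (ln (real (ring.dim R K (ring.Span R K (monomials_upto R n us))))
                          / ln (real n))))"

section \<open>Twist-equivalence and braidings of Drinfeld-Jimbo type\<close>

definition twist_equivalent :: "nat \<Rightarrow> (nat \<Rightarrow> nat \<Rightarrow> 'k::field) \<Rightarrow> (nat \<Rightarrow> nat \<Rightarrow> 'k) \<Rightarrow> bool"
  where "twist_equivalent \<theta> q q' \<longleftrightarrow>
    (\<forall>i<\<theta>. q i i = q' i i) \<and>
    (\<forall>i<\<theta>. \<forall>j<\<theta>. q i j * q j i = q' i j * q' j i)"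

definition generalized_cartan_matrix :: "nat \<Rightarrow> (nat \<Rightarrow> nat \<Rightarrow> int) \<Rightarrow> bool"
  where "generalized_cartan_matrix \<theta> a \<longleftrightarrow>
    (\<forall>i<\<theta>. a i i = 2) \<and>
    (\<forall>i<\<theta>. \<forall>j<\<theta>. i \<noteq> j \<longrightarrow> a i j \<le> 0 \<and> (a i j = 0 \<longrightarrow> a j i = 0))"

definition symmetrizes :: "nat \<Rightarrow> (nat \<Rightarrow> int) \<Rightarrow> (nat \<Rightarrow> nat \<Rightarrow> int) \<Rightarrow> bool"
  where "symmetrizes \<theta> d a \<longleftrightarrow>
    (\<forall>i<\<theta>. d i > 0) \<and> (\<forall>i<\<theta>. \<forall>j<\<theta>. d i * a i j = d j * a j i)"

definition dynkin_edges :: "nat \<Rightarrow> (nat \<Rightarrow> nat \<Rightarrow> int) \<Rightarrow> (nat \<times> nat) set"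
  where "dynkin_edges \<theta> a = {(i, j). i < \<theta> \<and> j < \<theta> \<and> i \<noteq> j \<and> a i j \<noteq> 0}"

definition dynkin_components :: "nat \<Rightarrow> (nat \<Rightarrow> nat \<Rightarrow> int) \<Rightarrow> nat set set"
  where "dynkin_components \<theta> a = (\<lambda>i. (dynkin_edges \<theta> a)\<^sup>* `` {i}) ` {..<\<theta>}"

definition DJ_type :: "nat \<Rightarrow> (nat \<Rightarrow> nat \<Rightarrow> 'k::field) \<Rightarrow> (nat \<Rightarrow> nat \<Rightarrow> int) \<Rightarrow> bool"
  where "DJ_type \<theta> q a \<longleftrightarrow>
    generalized_cartan_matrix \<theta> a \<and>
    (\<exists>d. symmetrizes \<theta> d a \<and>
      (\<forall>J\<in>dynkin_components \<theta> a. \<exists>qJ. qJ \<noteq> 0 \<and> \<not> root_of_one qJ \<and>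
        (\<forall>i\<in>J. \<forall>j<\<theta>. q i j = qJ powi (d i * a i j))))"

text \<open>Finite type: some symmetrization \<open>(d\<^sub>i a\<^sub>i\<^sub>j)\<close> is positive definite.\<close>

definition finite_cartan_matrix :: "nat \<Rightarrow> (nat \<Rightarrow> nat \<Rightarrow> int) \<Rightarrow> bool"
  where "finite_cartan_matrix \<theta> a \<longleftrightarrow>
    generalized_cartan_matrix \<theta> a \<and>
    (\<exists>d. symmetrizes \<theta> d a \<and>
      (\<forall>x :: nat \<Rightarrow> real. (\<exists>i<\<theta>. x i \<noteq> 0) \<longrightarrow>
        (\<Sum>i<\<theta>. \<Sum>j<\<theta>. of_int (d i * a i j) * x i * x j) > 0))"

end

theory Submission
  imports Defs
begin

text \<open>
  Sending the word \<open>x\<^bsub>i\<^esub> \<cdots> x\<^bsub>j\<^esub>\<close> to the quantum shuffle product of its letters is an algebra map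
  whose kernel is the Nichols ideal: it is a homogeneous Hopf ideal, and a competing ideal is stable
  under the skew derivations, hence killed by the map. So the Nichols algebra is the subalgebra of
  the quantum shuffle algebra generated by the letters, and everything takes place inside it.

  If its growth is polynomial, then for \<open>i \<noteq> j\<close> some \<open>q\<^sub>i\<^sub>i\<^sup>m q\<^sub>i\<^sub>j q\<^sub>j\<^sub>i\<close> is 1, since otherwise the products of the infinitely
  many elements \<open>ad(x\<^sub>i)\<^sup>m(x\<^sub>j)\<close> over finite sets of exponents \<open>m\<close> are independent (Rosso). The
  braiding is then of Cartan type, and the algebra is, as a graded vector space, the product of \<open>k[x\<^sub>i]\<close>
  and the kernel of a skew derivation, which a reflection embeds as a right coideal subalgebra into
  the Nichols algebra of the reflected braiding. Iterating, every chain of reflections splits off one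
  polynomial generator for each positive root it meets. Polynomial growth bounds the length of such
  chains, hence the orbit of the simple roots under the Weyl group is finite, and averaging over it gives
  an invariant positive definite form, that is, finite type. Conversely, in finite type there are
  only finitely many roots, the chains end, and the algebra grows like a polynomial ring.
\<close>

section \<open>The quantum shuffle algebra\<close>

text \<open>Genericity enters through the quantum integers \<open>qnum n (q i i)\<close>, which do
  not vanish for \<open>n > 0\<close>: divided powers of a letter exist, so \<open>der i\<close> is
  onto every right coideal subalgebra containing \<open>letter i\<close>, and the dimension count of
  one reflection is exact on every finite set of weights. The obstacle is that a reflection does not
  return the whole Nichols algebra of the reflected braiding, only a right coideal subalgebra that
  misses \<open>letter i\<close>. Chains run through such subalgebras, which contain some letter
  unless they are trivial, but depend on choices. Two devices repair this. The weights of a full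
  chain are determined by dimensions, hence independent of choices. And the reflected Nichols
  algebra exceeds the subalgebra by right multiples of one letter only, so its growth rises by at
  most one degree, and a full chain can be rotated into one for the reflected braiding. Then the
  orbit of a simple root stays, up to sign, in weight sets of constant size. No classification of
  finite type is used: the relation between the \<open>q i i\<close> of one component comes from a
  Cauchy-Schwarz estimate.\<close>

global_interpretation fv: vector_space "fun_scale :: 'k::field \<Rightarrow> ('x \<Rightarrow> 'k) \<Rightarrow> 'x \<Rightarrow> 'k"
  by unfold_locales (auto simp: fun_scale_def fun_eq_iff algebra_simps)

lemma fun_scale_apply [simp]: "fun_scale a f x = a * f x"
  by (simp add: fun_scale_def)

lemma zero_fun_app [simp]: "(0 :: 'x \<Rightarrow> 'k::field) x = 0"
  by (simp add: zero_fun_def)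

text \<open>
  Functions on words are the elements of the shuffle algebra. Words are listed from right to left:
  the head of a list is the last letter of the word.
\<close>

definition der :: "nat \<Rightarrow> (nat list \<Rightarrow> 'k::field) \<Rightarrow> nat list \<Rightarrow> 'k"
  where "der i f = (\<lambda>w. f (i # w))"

text \<open>The action of the torus: a word of weight \<alpha> is scaled by the value at \<alpha> of
  the character \<kappa>. For \<open>\<kappa> = q i\<close> this is the scalar of braiding
  \<open>letter i\<close> past the word.\<close>

definition twist :: "(nat \<Rightarrow> 'k) \<Rightarrow> (nat list \<Rightarrow> 'k::field) \<Rightarrow> nat list \<Rightarrow> 'k"
  where "twist \<kappa> f = (\<lambda>w. prod_list (map \<kappa> w) * f w)"

text \<open>The product is defined by its skew Leibniz rule: the last letter \<open>i\<close> comes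
  from the right factor, or from the left factor after passing the right one, which costs
  \<open>twist (q i)\<close>. Unfolding the recursion gives the usual sum over shuffles; the proofs
  use the rule itself.\<close>

fun qsh :: "(nat \<Rightarrow> nat \<Rightarrow> 'k) \<Rightarrow> (nat list \<Rightarrow> 'k::field) \<Rightarrow> (nat list \<Rightarrow> 'k) \<Rightarrow> nat list \<Rightarrow> 'k"
  where
    "qsh q f g [] = f [] * g []"
  | "qsh q f g (i # w) = qsh q f (der i g) w + qsh q (der i f) (twist (q i) g) w"

definition sone :: "nat list \<Rightarrow> 'k::field"
  where "sone = (\<lambda>w. if w = [] then 1 else 0)"

definition letter :: "nat \<Rightarrow> nat list \<Rightarrow> 'k::field"
  where "letter i = (\<lambda>w. if w = [i] then 1 else 0)"

lemma der_apply: "der i f w = f (i # w)"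
  by (simp add: der_def)

lemma der_linear [simp]:
  "der i (f + g) = der i f + der i g" "der i (f - g) = der i f - der i g"
  "der i (- f) = - der i f" "der i 0 = 0" "der i (fun_scale a f) = fun_scale a (der i f)"
  by (auto simp: der_def fun_eq_iff)

lemma sum_fun_apply: "(sum f A :: 'x \<Rightarrow> 'k::field) w = (\<Sum>x\<in>A. f x w)"
  by (induction A rule: infinite_finite_induct) auto

lemma twist_linear [simp]:
  "twist \<kappa> (f + g) = twist \<kappa> f + twist \<kappa> g" "twist \<kappa> (f - g) = twist \<kappa> f - twist \<kappa> g"
  "twist \<kappa> (- f) = - twist \<kappa> f" "twist \<kappa> 0 = 0"
  "twist \<kappa> (fun_scale a f) = fun_scale a (twist \<kappa> f)"
  by (auto simp: twist_def fun_eq_iff algebra_simps)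

lemma der_twist [simp]: "der i (twist \<kappa> f) = fun_scale (\<kappa> i) (twist \<kappa> (der i f))"
  by (auto simp: der_def twist_def fun_eq_iff)

lemma twist_nil [simp]: "twist \<kappa> f [] = f []"
  by (simp add: twist_def)

lemma twist_twist: "twist \<kappa> (twist \<mu> f) = twist (\<lambda>i. \<kappa> i * \<mu> i) f"
proof
  fix w show "twist \<kappa> (twist \<mu> f) w = twist (\<lambda>i. \<kappa> i * \<mu> i) f w"
    by (induction w arbitrary: f) (auto simp: twist_def algebra_simps)
qed

lemma twist_const_one [simp]: "twist (\<lambda>i. 1) f = f"
  by (auto simp: twist_def fun_eq_iff map_replicate_const)

section \<open>Bilinearity, associativity and unit of the shuffle product\<close>

lemma qsh_add_left: "qsh q (f + f') g = qsh q f g + qsh q f' g"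
proof
  fix w show "qsh q (f + f') g w = (qsh q f g + qsh q f' g) w"
    by (induction w arbitrary: f f' g) (auto simp: algebra_simps)
qed

lemma qsh_add_right: "qsh q f (g + g') = qsh q f g + qsh q f g'"
proof
  fix w show "qsh q f (g + g') w = (qsh q f g + qsh q f g') w"
    by (induction w arbitrary: f g g') (auto simp: algebra_simps)
qed

lemma qsh_scale_left: "qsh q (fun_scale a f) g = fun_scale a (qsh q f g)"
proof
  fix w show "qsh q (fun_scale a f) g w = fun_scale a (qsh q f g) w"
    by (induction w arbitrary: f g) (auto simp: algebra_simps)
qed

lemma qsh_scale_right: "qsh q f (fun_scale a g) = fun_scale a (qsh q f g)"
proof
  fix w show "qsh q f (fun_scale a g) w = fun_scale a (qsh q f g) w"
    by (induction w arbitrary: f g) (auto simp: algebra_simps)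
qed

lemma qsh_zero_left [simp]: "qsh q 0 g = 0"
  using qsh_scale_left[of q 0 0 g] by (simp add: fun_eq_iff)

lemma qsh_zero_right [simp]: "qsh q f 0 = 0"
  using qsh_scale_right[of q f 0 0] by (simp add: fun_eq_iff)

lemma minus_eq_scale: "- f = fun_scale (-1) f"
  by (auto simp: fun_eq_iff)

lemma qsh_minus_left: "qsh q (- f) g = - qsh q f g"
  unfolding minus_eq_scale qsh_scale_left ..

lemma qsh_minus_right: "qsh q f (- g) = - qsh q f g"
  unfolding minus_eq_scale qsh_scale_right ..

lemma qsh_diff_left: "qsh q (f - f') g = qsh q f g - qsh q f' g"
  using qsh_add_left[of q f "- f'" g] by (simp add: qsh_minus_left)

lemma qsh_diff_right: "qsh q f (g - g') = qsh q f g - qsh q f g'"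
  using qsh_add_right[of q f g "- g'"] by (simp add: qsh_minus_right)

lemmas qsh_linear = qsh_add_left qsh_add_right qsh_scale_left qsh_scale_right
  qsh_diff_left qsh_diff_right qsh_minus_left qsh_minus_right

lemma der_qsh: "der i (qsh q f g) = qsh q f (der i g) + qsh q (der i f) (twist (q i) g)"
  by (auto simp: der_def fun_eq_iff)

text \<open>An element consists of its constant term and its skew derivatives. Closed formulas are
  proved by comparing these, by induction on the degree.\<close>

lemma sh_ext: "f = g" if "f [] = g []" "\<And>i. der i f = der i g"
proof
  fix w show "f w = g w"
    using that by (cases w) (auto simp: der_def fun_eq_iff)
qed

lemma twist_qsh: "twist \<kappa> (qsh q f g) = qsh q (twist \<kappa> f) (twist \<kappa> g)"
proof
  fix w show "twist \<kappa> (qsh q f g) w = qsh q (twist \<kappa> f) (twist \<kappa> g) w"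
  proof (induction w arbitrary: f g)
    case (Cons i w)
    have "twist \<kappa> (qsh q f g) (i # w) = der i (twist \<kappa> (qsh q f g)) w"
      by (simp only: der_apply)
    also have "\<dots> = \<kappa> i * (twist \<kappa> (qsh q f (der i g)) w + twist \<kappa> (qsh q (der i f) (twist (q i) g)) w)"
      by (simp add: der_qsh)
    also have "\<dots> = qsh q (twist \<kappa> f) (twist \<kappa> g) (i # w)"
      by (simp add: Cons qsh_linear twist_twist algebra_simps)
    finally show ?case .
  qed simp
qed

lemma qsh_assoc: "qsh q (qsh q f g) h = qsh q f (qsh q g h)"
proof
  fix w show "qsh q (qsh q f g) h w = qsh q f (qsh q g h) w"
    by (induction w arbitrary: f g h) (auto simp: der_qsh twist_qsh qsh_linear)
qed

lemma der_sone [simp]: "der i sone = 0"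
  by (auto simp: der_def sone_def fun_eq_iff)

lemma twist_sone [simp]: "twist \<kappa> sone = sone"
  by (auto simp: twist_def sone_def fun_eq_iff)

lemma sone_nil [simp]: "sone [] = 1"
  by (simp add: sone_def)

lemma qsh_sone_left [simp]: "qsh q sone g = g"
proof
  fix w show "qsh q sone g w = g w"
    by (induction w arbitrary: g) (auto simp: der_apply)
qed

lemma qsh_sone_right [simp]: "qsh q f sone = f"
proof
  fix w show "qsh q f sone w = f w"
    by (induction w arbitrary: f) (auto simp: der_apply)
qed

lemma der_letter: "der j (letter i) = (if i = j then sone else 0)"
  by (auto simp: der_def letter_def sone_def fun_eq_iff)

lemma letter_nil [simp]: "letter i [] = 0"
  by (simp add: letter_def)

lemma twist_letter [simp]: "twist \<kappa> (letter i) = fun_scale (\<kappa> i) (letter i)"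
  by (auto simp: twist_def letter_def fun_eq_iff)

lemma funpow_der_linear:
  "(der i ^^ n) (f + g) = (der i ^^ n) f + (der i ^^ n) g"
  "(der i ^^ n) (f - g) = (der i ^^ n) f - (der i ^^ n) g"
  "(der i ^^ n) (fun_scale a f) = fun_scale a ((der i ^^ n) f)"
  "(der i ^^ n) 0 = 0"
  by (induction n) auto

subsection \<open>Weights and supports\<close>

definition wt :: "nat list \<Rightarrow> nat \<Rightarrow> int"
  where "wt w = (\<lambda>i. int (count_list w i))"

definition simple :: "nat \<Rightarrow> nat \<Rightarrow> int"
  where "simple i = (\<lambda>j. if j = i then 1 else 0)"

definition supported :: "(nat \<Rightarrow> int) set \<Rightarrow> (nat list \<Rightarrow> 'k::field) \<Rightarrow> bool"
  where "supported A f \<longleftrightarrow> (\<forall>w. f w \<noteq> 0 \<longrightarrow> wt w \<in> A)"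

definition trunc :: "(nat \<Rightarrow> int) set \<Rightarrow> (nat list \<Rightarrow> 'k::field) \<Rightarrow> nat list \<Rightarrow> 'k"
  where "trunc A f = (\<lambda>w. if wt w \<in> A then f w else 0)"

lemma wt_nil [simp]: "wt [] = 0"
  by (auto simp: wt_def)

lemma wt_Cons [simp]: "wt (i # w) = simple i + wt w"
  by (auto simp: wt_def simple_def fun_eq_iff)

lemma wt_nonneg: "0 \<le> wt w j"
  by (simp add: wt_def)

lemma supported_trunc [simp]: "supported A (trunc A f)"
  by (auto simp: supported_def trunc_def)

lemma trunc_supported: "supported A f \<Longrightarrow> trunc A f = f"
  by (auto simp: supported_def trunc_def fun_eq_iff)

lemma trunc_linear [simp]: "trunc A (f + g) = trunc A f + trunc A g" "trunc A 0 = 0"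
  "trunc A (fun_scale a f) = fun_scale a (trunc A f)" "trunc A (f - g) = trunc A f - trunc A g"
  by (auto simp: trunc_def fun_eq_iff)

lemma der_trunc: "der i (trunc A f) = trunc {\<alpha>. \<alpha> + simple i \<in> A} (der i f)"
  by (auto simp: der_def trunc_def fun_eq_iff add.commute)

lemma supported_linear:
  "supported A f \<Longrightarrow> supported A g \<Longrightarrow> supported A (f + g)" "supported A 0"
  "supported A f \<Longrightarrow> supported A g \<Longrightarrow> supported A (f - g)"
  "supported A f \<Longrightarrow> supported A (fun_scale a f)"
  by (auto simp: supported_def) (metis add.right_neutral, metis diff_zero)

lemma supported_twist: "supported A f \<Longrightarrow> supported A (twist \<kappa> f)"
  by (auto simp: supported_def twist_def)

lemma supported_der: "supported A f \<Longrightarrow> supported {\<alpha>. \<alpha> + simple i \<in> A} (der i f)"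
  by (auto simp: supported_def der_def add.commute)

lemma supported_mono: "supported A f \<Longrightarrow> A \<subseteq> B \<Longrightarrow> supported B f"
  by (auto simp: supported_def)

lemma qsh_nonzero: "qsh q f g w \<noteq> 0 \<Longrightarrow> \<exists>u v. f u \<noteq> 0 \<and> g v \<noteq> 0 \<and> wt w = wt u + wt v \<and> length w = length u + length v"
proof (induction w arbitrary: f g)
  case Nil then show ?case by (auto intro!: exI[of _ "[]"])
next
  case (Cons i w)
  then consider "qsh q f (der i g) w \<noteq> 0" | "qsh q (der i f) (twist (q i) g) w \<noteq> 0"
    by fastforce
  then show ?case
  proof cases
    case 1
    from Cons.IH[OF this] obtain u v where *: "f u \<noteq> 0" "g (i # v) \<noteq> 0" "wt w = wt u + wt v" "length w = length u + length v"
      unfolding der_def by blast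
    then show ?thesis by (intro exI[of _ u] exI[of _ "i # v"]) (auto simp: algebra_simps)
  next
    case 2
    from Cons.IH[OF this] obtain u v where *: "f (i # u) \<noteq> 0" "g v \<noteq> 0" "wt w = wt u + wt v" "length w = length u + length v"
      unfolding der_def twist_def mult_eq_0_iff de_Morgan_disj by blast
    then show ?thesis by (intro exI[of _ "i # u"] exI[of _ "v"]) (auto simp: algebra_simps)
  qed
qed

lemma supported_qsh: "supported A f \<Longrightarrow> supported B g \<Longrightarrow> (\<And>\<alpha> \<beta>. \<alpha> \<in> A \<Longrightarrow> \<beta> \<in> B \<Longrightarrow> \<alpha> + \<beta> \<in> C)
    \<Longrightarrow> supported C (qsh q f g)"
  unfolding supported_def by (metis qsh_nonzero)

lemma trunc_qsh_homogeneous: "supported {\<alpha>} f \<Longrightarrow> trunc A (qsh q f g) = qsh q f (trunc {\<beta>. \<alpha> + \<beta> \<in> A} g)"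
proof -
  assume f: "supported {\<alpha>} f"
  let ?B = "{\<beta>. \<alpha> + \<beta> \<in> A}"
  have g: "g = trunc ?B g + trunc (- ?B) g"
    by (auto simp: trunc_def fun_eq_iff)
  have 1: "supported A (qsh q f (trunc ?B g))"
    by (rule supported_qsh[OF f supported_trunc]) auto
  have 2: "supported (- A) (qsh q f (trunc (- ?B) g))"
    by (rule supported_qsh[OF f supported_trunc]) auto
  have 3: "trunc A (qsh q f (trunc (- ?B) g)) = 0"
    using 2 by (auto simp: supported_def trunc_def fun_eq_iff)
  have "trunc A (qsh q f g) = trunc A (qsh q f (trunc ?B g)) + trunc A (qsh q f (trunc (- ?B) g))"
    by (subst g) (simp add: qsh_linear)
  then show ?thesis using 1 3 by (simp add: trunc_supported)
qed

subsection \<open>Divided powers of a letter\<close>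

text \<open>By \<open>letter_dpow\<close>, the \<open>m\<close>-th power of \<open>letter i\<close>
  is a quantum factorial times this element, which is therefore the divided power.\<close>

definition dpow :: "nat \<Rightarrow> nat \<Rightarrow> nat list \<Rightarrow> 'k::field"
  where "dpow i m = (\<lambda>w. if w = replicate m i then 1 else 0)"

definition qnum :: "nat \<Rightarrow> 'k::field \<Rightarrow> 'k"
  where "qnum n x = (\<Sum>k<n. x ^ k)"

lemma qnum_simps [simp]: "qnum 0 x = 0" "qnum (Suc n) x = qnum n x + x ^ n"
  by (auto simp: qnum_def)

lemma qnum_Suc': "qnum (Suc n) x = 1 + x * qnum n x"
  unfolding qnum_def sum_distrib_left by (subst sum.lessThan_Suc_shift) simp

text \<open>Since 1 is itself a root of one, \<open>x\<close> differs from 1 and the geometric sum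
  formula applies.\<close>

lemma qnum_nonzero:
  assumes "\<not> root_of_one (x :: 'k::field_char_0)" "n > 0" shows "qnum n x \<noteq> 0"
proof
  assume 0: "qnum n x = 0"
  have "x \<noteq> 1" using assms unfolding root_of_one_def by (metis power_one)
  moreover have "(x - 1) * qnum n x = x ^ n - 1"
    unfolding qnum_def by (simp add: power_diff_1_eq)
  ultimately have "x ^ n = 1" using 0 by simp
  then show False using assms unfolding root_of_one_def by blast
qed

lemma dpow_0 [simp]: "dpow i 0 = sone"
  by (auto simp: dpow_def sone_def)

lemma dpow_1: "dpow i (Suc 0) = letter i"
  by (auto simp: dpow_def letter_def)

lemma dpow_nil [simp]: "dpow i (Suc m) [] = 0"
  by (simp add: dpow_def)

lemma der_dpow: "der j (dpow i (Suc m)) = (if i = j then dpow i m else 0)"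
  by (auto simp: dpow_def der_def fun_eq_iff)

lemma twist_dpow [simp]: "twist \<kappa> (dpow i m) = fun_scale (\<kappa> i ^ m) (dpow i m)"
  by (auto simp: dpow_def twist_def fun_eq_iff prod_list_replicate)

lemma letter_dpow: "qsh q (letter i) (dpow i m) = fun_scale (qnum (Suc m) (q i i)) (dpow i (Suc m))"
proof (induction m)
  case 0 then show ?case by (auto simp: dpow_1 fun_eq_iff)
next
  case (Suc m)
  show ?case
  proof (rule sh_ext)
    fix j
    show "der j (qsh q (letter i) (dpow i (Suc m))) = der j (fun_scale (qnum (Suc (Suc m)) (q i i)) (dpow i (Suc (Suc m))))"
    proof (cases "j = i")
      case True
      have "der i (qsh q (letter i) (dpow i (Suc m))) = qsh q (letter i) (dpow i m) + fun_scale (q i i ^ Suc m) (dpow i (Suc m))"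
        by (simp add: der_qsh der_dpow der_letter qsh_linear)
      then show ?thesis
        unfolding Suc True by (auto simp: der_dpow fun_eq_iff algebra_simps)
    qed (simp add: der_qsh der_dpow der_letter)
  qed simp
qed

lemma dpow_letter: "qsh q (dpow i m) (letter i) = fun_scale (qnum (Suc m) (q i i)) (dpow i (Suc m))"
proof (induction m)
  case 0 then show ?case by (auto simp: dpow_1 fun_eq_iff)
next
  case (Suc m)
  show ?case
  proof (rule sh_ext)
    fix j
    show "der j (qsh q (dpow i (Suc m)) (letter i)) = der j (fun_scale (qnum (Suc (Suc m)) (q i i)) (dpow i (Suc (Suc m))))"
    proof (cases "j = i")
      case True
      have "der i (qsh q (dpow i (Suc m)) (letter i)) = dpow i (Suc m) + fun_scale (q i i) (qsh q (dpow i m) (letter i))"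
        by (simp add: der_qsh der_dpow der_letter qsh_linear)
      then show ?thesis
        unfolding Suc True qnum_Suc'[of "Suc m"]
        by (auto simp: der_dpow fun_eq_iff algebra_simps)
    qed (simp add: der_qsh der_dpow der_letter)
  qed simp
qed

lemma funpow_der_dpow: "(der i ^^ n) (dpow i m) = (if n \<le> m then dpow i (m - n) else 0)"
proof (induction n)
  case (Suc n)
  have "der i (dpow i (m - n)) = (if Suc n \<le> m then dpow i (m - Suc n) else 0)"
  proof (cases "Suc n \<le> m")
    case True
    then have "m - n = Suc (m - Suc n)" by simp
    with True show ?thesis by (simp add: der_dpow)
  qed (simp add: der_def dpow_def fun_eq_iff)
  then show ?case using Suc
    by (cases "n \<le> m") (auto simp: Suc_le_eq fun_eq_iff der_def)
qed simp

text \<open>Each of the \<open>n + 1\<close> derivations may remove the right factor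
  \<open>letter i\<close>; the earlier ones have passed it at the cost of one factor
  \<open>q i i\<close> each, and these powers add up to a quantum integer.\<close>

lemma funpow_der_qsh_letter:
  "(der i ^^ Suc n) (qsh q f (letter i)) = fun_scale (qnum (Suc n) (q i i)) ((der i ^^ n) f)
    + fun_scale (q i i ^ Suc n) (qsh q ((der i ^^ Suc n) f) (letter i))"
proof (induction n arbitrary: f)
  case 0 then show ?case by (auto simp: der_qsh der_letter qsh_linear fun_eq_iff)
next
  case (Suc n)
  have "(der i ^^ Suc (Suc n)) (qsh q f (letter i))
      = (der i ^^ Suc n) (f + fun_scale (q i i) (qsh q (der i f) (letter i)))"
    by (simp add: funpow_Suc_right der_qsh der_letter qsh_linear del: funpow.simps)
  also have "\<dots> = (der i ^^ Suc n) f + fun_scale (q i i) ((der i ^^ Suc n) (qsh q (der i f) (letter i)))"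
    by (simp only: funpow_der_linear)
  also have "\<dots> = fun_scale (qnum (Suc (Suc n)) (q i i)) ((der i ^^ Suc n) f)
    + fun_scale (q i i ^ Suc (Suc n)) (qsh q ((der i ^^ Suc (Suc n)) f) (letter i))"
    unfolding Suc qnum_Suc'[of "Suc n"]
    by (auto simp: fun_eq_iff funpow_swap1 algebra_simps simp del: qnum_simps)
  finally show ?case .
qed

section \<open>The Nichols algebra inside the shuffle algebra\<close>

lemmas pointwise = plus_fun_apply zero_fun_apply minus_apply uminus_apply fun_scale_apply zero_fun_app

declare pointwise [simp del]

lemma fun_scale_zero_one [simp]: "fun_scale 0 f = 0" "fun_scale 1 f = f" "fun_scale c 0 = 0"
  by (auto simp: fun_eq_iff pointwise)

text \<open>The subalgebra generated by the letters. Only left multiplication by letters is built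
  in, so that inductions have a single multiplicative case; closure under all products is
  \<open>nich_qsh\<close>.\<close>

inductive_set nich :: "nat \<Rightarrow> (nat \<Rightarrow> nat \<Rightarrow> 'k::field) \<Rightarrow> (nat list \<Rightarrow> 'k) set"
  for \<theta> :: nat and q :: "nat \<Rightarrow> nat \<Rightarrow> 'k"
  where
    nich_sone: "sone \<in> nich \<theta> q"
  | nich_add: "f \<in> nich \<theta> q \<Longrightarrow> g \<in> nich \<theta> q \<Longrightarrow> f + g \<in> nich \<theta> q"
  | nich_scale: "f \<in> nich \<theta> q \<Longrightarrow> fun_scale a f \<in> nich \<theta> q"
  | nich_letter_mult: "i < \<theta> \<Longrightarrow> f \<in> nich \<theta> q \<Longrightarrow> qsh q (letter i) f \<in> nich \<theta> q"

lemma nich_zero: "0 \<in> nich \<theta> q"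
  using nich_scale[OF nich_sone, of 0] by simp

lemma nich_letter: "i < \<theta> \<Longrightarrow> letter i \<in> nich \<theta> q"
  using nich_letter_mult[OF _ nich_sone] by simp

lemma subspace_nich: "fv.subspace (nich \<theta> q)"
  by (intro fv.subspaceI nich_zero nich_add nich_scale)

lemma nich_diff: "f \<in> nich \<theta> q \<Longrightarrow> g \<in> nich \<theta> q \<Longrightarrow> f - g \<in> nich \<theta> q"
  by (rule fv.subspace_diff[OF subspace_nich])

lemma nich_qsh: "f \<in> nich \<theta> q \<Longrightarrow> g \<in> nich \<theta> q \<Longrightarrow> qsh q f g \<in> nich \<theta> q"
  by (induction rule: nich.induct) (auto simp: qsh_linear qsh_assoc intro: nich.intros)

lemma nich_twist: "f \<in> nich \<theta> q \<Longrightarrow> twist \<kappa> f \<in> nich \<theta> q"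
  by (induction rule: nich.induct) (auto simp: twist_qsh qsh_linear intro: nich.intros)

lemma nich_der: "f \<in> nich \<theta> q \<Longrightarrow> der k f \<in> nich \<theta> q"
  by (induction rule: nich.induct)
    (auto simp: der_qsh der_letter intro!: nich.intros nich_twist nich_zero)

lemma supported_letter: "supported {simple i} (letter i)"
  by (auto simp: supported_def letter_def)

lemma supported_sone: "supported {0} sone"
  by (auto simp: supported_def sone_def)

lemma nich_trunc: "f \<in> nich \<theta> q \<Longrightarrow> trunc A f \<in> nich \<theta> q"
proof (induction arbitrary: A rule: nich.induct)
  case nich_sone
  have "trunc A sone = (if 0 \<in> A then sone else 0 :: nat list \<Rightarrow> 'a)"
    by (auto simp: trunc_def sone_def fun_eq_iff pointwise)
  then show ?case by (simp add: nich.nich_sone nich_zero)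
next
  case (nich_letter_mult i f)
  then show ?case by (subst trunc_qsh_homogeneous[OF supported_letter]) (auto intro: nich.intros)
qed (auto intro: nich.intros)

lemma nich_set: "f \<in> nich \<theta> q \<Longrightarrow> f w \<noteq> 0 \<Longrightarrow> set w \<subseteq> {..<\<theta>}"
proof (induction arbitrary: w rule: nich.induct)
  case (nich_letter_mult i f)
  from qsh_nonzero[OF nich_letter_mult.prems] obtain u v where *: "letter i u \<noteq> (0::'a)" "f v \<noteq> 0" "wt w = wt u + wt v"
    by blast
  from *(1) have "u = [i]" by (auto simp: letter_def split: if_splits)
  have "set v \<subseteq> {..<\<theta>}" using nich_letter_mult.IH *(2) by blast
  moreover have "j \<in> set w \<Longrightarrow> j = i \<or> j \<in> set v" for j
    using fun_cong[OF *(3), of j] \<open>u = [i]\<close>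
    by (auto simp: wt_def pointwise split: if_splits) (metis count_list_0_iff of_nat_0_eq_iff)
  ultimately show ?case using \<open>i < \<theta>\<close> by blast
next
  case (nich_add f g)
  then show ?case by (metis add.right_neutral plus_fun_apply)
qed (auto simp: sone_def pointwise split: if_splits)

lemma nich_der_outside: "f \<in> nich \<theta> q \<Longrightarrow> k \<ge> \<theta> \<Longrightarrow> der k f = 0"
  using nich_set[of f \<theta> q] by (force simp: der_def fun_eq_iff pointwise)

lemma nich_length_bounded: "f \<in> nich \<theta> q \<Longrightarrow> \<exists>L. \<forall>w. length w > L \<longrightarrow> f w = 0"
proof (induction rule: nich.induct)
  case nich_sone show ?case by (auto simp: sone_def)
next
  case (nich_add f g)
  then obtain L L' where "\<forall>w. length w > L \<longrightarrow> f w = 0" "\<forall>w. length w > L' \<longrightarrow> g w = 0" by blast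
  then show ?case by (intro exI[of _ "max L L'"]) (auto simp: pointwise)
next
  case (nich_scale f a) then show ?case by (auto simp: pointwise)
next
  case (nich_letter_mult i f)
  then obtain L where L: "\<forall>w. length w > L \<longrightarrow> f w = 0" by blast
  have "qsh q (letter i) f w = 0" if "length w > Suc L" for w
  proof (rule ccontr)
    assume "qsh q (letter i) f w \<noteq> 0"
    from qsh_nonzero[OF this] obtain u v where *: "letter i u \<noteq> (0::'a)" "f v \<noteq> 0" "length w = length u + length v"
      by blast
    from *(1) have "length u = 1" by (auto simp: letter_def split: if_splits)
    moreover have "length v \<le> L" using L *(2) by (meson not_less)
    ultimately show False using *(3) that by simp
  qed
  then show ?case by blast
qed

lemma nich_der_nilpotent: "f \<in> nich \<theta> q \<Longrightarrow> \<exists>n. (der k ^^ n) f = 0"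
proof -
  assume "f \<in> nich \<theta> q"
  then obtain L where L: "\<forall>w. length w > L \<longrightarrow> f w = 0" using nich_length_bounded by blast
  have *: "(der k ^^ n) g w = g (replicate n k @ w)" for n and g :: "nat list \<Rightarrow> 'a" and w
    by (induction n arbitrary: g w) (auto simp: der_def replicate_app_Cons_same)
  show ?thesis using L by (intro exI[of _ "Suc L"] ext) (simp only: *, simp add: pointwise)
qed

lemma funpow_der_qsh_left: "der i f = 0 \<Longrightarrow> (der i ^^ n) (qsh q f g) = qsh q f ((der i ^^ n) g)"
  by (induction n) (auto simp: der_qsh)

lemma funpow_der_qsh_right: "der i g = 0 \<Longrightarrow> (der i ^^ n) (qsh q f g) = qsh q ((der i ^^ n) f) (twist (\<lambda>l. q i l ^ n) g)"
  by (induction n) (auto simp: der_qsh twist_twist)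

text \<open>Up to a torus twist this is the braided adjoint action of \<open>letter i\<close>,
  namely \<open>x_i g - (q_i . g) x_i\<close> with
  \<open>g = twist (\<lambda>l. inverse (q i l)) f\<close>. With the twist on the first term, the
  two copies of \<open>f\<close> produced by \<open>der i\<close> cancel, so the kernel of
  \<open>der i\<close> is preserved.\<close>

definition badj :: "(nat \<Rightarrow> nat \<Rightarrow> 'k::field) \<Rightarrow> nat \<Rightarrow> (nat list \<Rightarrow> 'k) \<Rightarrow> nat list \<Rightarrow> 'k"
  where "badj q i f = qsh q (letter i) (twist (\<lambda>l. inverse (q i l)) f) - qsh q f (letter i)"

lemma der_badj:
  assumes "\<And>l. q i l \<noteq> 0"
  shows "der k (badj q i f) = fun_scale (inverse (q i k)) (qsh q (letter i) (twist (\<lambda>l. inverse (q i l)) (der k f)))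
    - fun_scale (q k i) (qsh q (der k f) (letter i))"
  using assms by (auto simp: badj_def der_qsh der_letter qsh_linear twist_twist)

lemma nich_badj: "i < \<theta> \<Longrightarrow> f \<in> nich \<theta> q \<Longrightarrow> badj q i f \<in> nich \<theta> q"
  unfolding badj_def by (intro nich_diff nich_qsh nich_letter nich_twist)

text \<open>As lists are read from right to left, this is the basis element of the word
  \<open>x_i^m x_j\<close>.\<close>

definition jpow :: "nat \<Rightarrow> nat \<Rightarrow> nat \<Rightarrow> nat list \<Rightarrow> 'k::field"
  where "jpow i j m = (\<lambda>w. if w = j # replicate m i then 1 else 0)"

lemma der_jpow: "der k (jpow i j m) = (if k = j then dpow i m else 0)"
  by (auto simp: der_def jpow_def dpow_def fun_eq_iff pointwise)

lemma jpow_nil [simp]: "jpow i j m [] = 0"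
  by (simp add: jpow_def)

lemma jpow_0: "jpow i j 0 = letter j"
  by (auto simp: jpow_def letter_def)

lemma twist_jpow [simp]: "twist \<kappa> (jpow i j m) = fun_scale (\<kappa> j * \<kappa> i ^ m) (jpow i j m)"
  by (auto simp: jpow_def twist_def fun_eq_iff pointwise prod_list_replicate)

text \<open>The first factor of the coefficient vanishes exactly when
  \<open>q i j * q j i * q i i ^ m = 1\<close>. There the sequence of iterated adjoints of
  \<open>letter j\<close> stops: this is the origin of the Cartan integers.\<close>

lemma badj_jpow:
  assumes nz: "\<And>l. q i l \<noteq> 0"
  shows "badj q i (jpow i j m) = fun_scale ((inverse (q i j) * inverse (q i i) ^ m - q j i) * qnum (Suc m) (q i i)) (jpow i j (Suc m))"
proof (rule sh_ext)
  fix k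
  show "der k (badj q i (jpow i j m)) = der k (fun_scale ((inverse (q i j) * inverse (q i i) ^ m - q j i) * qnum (Suc m) (q i i)) (jpow i j (Suc m)))"
  proof (cases "k = j")
    case True
    have "twist (\<lambda>l. inverse (q i l)) (dpow i m) = fun_scale (inverse (q i i) ^ m) (dpow i m)"
      by simp
    then have "der j (badj q i (jpow i j m)) = fun_scale (inverse (q i j)) (fun_scale (inverse (q i i) ^ m)
        (fun_scale (qnum (Suc m) (q i i)) (dpow i (Suc m)))) - fun_scale (q j i) (fun_scale (qnum (Suc m) (q i i)) (dpow i (Suc m)))"
      by (simp only: der_badj[of q i, OF nz] der_jpow if_True simp_thms qsh_linear letter_dpow dpow_letter)
    then show ?thesis
      unfolding True by (simp add: der_jpow fv.scale_left_diff_distrib left_diff_distrib mult.assoc del: qnum_simps)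
  qed (simp add: der_badj[of q i, OF nz] der_jpow)
qed (simp add: badj_def pointwise)

lemma trunc_split: "f = trunc A f + trunc (- A) f"
  by (auto simp: trunc_def fun_eq_iff pointwise)

subsection \<open>Graded pieces and growth\<close>

text \<open>The finite set \<open>F\<close> guards against the convention that an
  infinite-dimensional space has \<open>dim\<close> 0.\<close>

lemma dim_mono_fin:
  fixes U :: "('x \<Rightarrow> 'k::field) set"
  assumes "U \<subseteq> V" "V \<subseteq> fv.span F" "finite F" shows "fv.dim U \<le> fv.dim V"
proof -
  obtain B where B: "B \<subseteq> V" "fv.independent B" "V \<subseteq> fv.span B" "card B = fv.dim V"
    by (rule fv.basis_exists)
  have "finite B" using fv.independent_span_bound[OF assms(3) B(2)] B(1) assms(2) by blast
  then show ?thesis using fv.dim_le_card[of U B] B assms(1) by simp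
qed

definition wordsn :: "nat \<Rightarrow> nat \<Rightarrow> nat list set"
  where "wordsn \<theta> L = {w. set w \<subseteq> {..<\<theta>} \<and> length w \<le> L}"

lemma finite_wordsn: "finite (wordsn \<theta> L)"
  unfolding wordsn_def by (rule finite_lists_length_le) simp

definition ind :: "nat list \<Rightarrow> nat list \<Rightarrow> 'k::field"
  where "ind v = (\<lambda>w. if w = v then 1 else 0)"

lemma span_ind:
  assumes "finite W" and "\<And>w. f w \<noteq> 0 \<Longrightarrow> w \<in> W" shows "f \<in> fv.span (ind ` W)"
proof -
  have "f = (\<Sum>v\<in>W. fun_scale (f v) (ind v))"
  proof
    fix w
    have "(\<Sum>v\<in>W. fun_scale (f v) (ind v)) w = (\<Sum>v\<in>W. if v = w then f v else 0)"
      by (auto simp: sum_fun_apply pointwise ind_def intro!: sum.cong)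
    then show "f w = (\<Sum>v\<in>W. fun_scale (f v) (ind v)) w"
      using assms by auto
  qed
  then show ?thesis by (metis (no_types, lifting) fv.span_sum fv.span_scale fv.span_base imageI)
qed

locale letters =
  fixes \<theta> :: nat
begin

definition ht :: "(nat \<Rightarrow> int) \<Rightarrow> int"
  where "ht \<alpha> = (\<Sum>l<\<theta>. \<alpha> l)"

lemma ht_add: "ht (\<alpha> + \<beta>) = ht \<alpha> + ht \<beta>"
  by (simp add: ht_def sum.distrib pointwise)

lemma ht_simple: "i < \<theta> \<Longrightarrow> ht (simple i) = 1"
  by (simp add: ht_def simple_def)

definition part :: "(nat list \<Rightarrow> 'k::field_char_0) set \<Rightarrow> (nat \<Rightarrow> int) set \<Rightarrow> (nat list \<Rightarrow> 'k) set"
  where "part S A = {f \<in> S. supported A f}"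

text \<open>A multigraded Hilbert function, evaluated on sets of weights instead of single weights
  so that shifts and reflections act on the argument.\<close>

definition hdim :: "(nat list \<Rightarrow> 'k::field_char_0) set \<Rightarrow> (nat \<Rightarrow> int) set \<Rightarrow> nat"
  where "hdim S A = fv.dim (part S A)"

lemma wt_length: "set w \<subseteq> {..<\<theta>} \<Longrightarrow> ht (wt w) = int (length w)"
proof (induction w)
  case Nil show ?case by (simp add: ht_def pointwise)
qed (auto simp: ht_add ht_simple)

lemma part_finite:
  assumes "S \<subseteq> nich \<theta> q" "finite A"
  shows "\<exists>F. finite F \<and> part S A \<subseteq> fv.span F"
proof -
  define L where "L = nat (\<Sum>\<alpha>\<in>A. \<bar>ht \<alpha>\<bar>)"
  have "f \<in> fv.span (ind ` wordsn \<theta> L)" if f: "f \<in> part S A" for f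
  proof (rule span_ind[OF finite_wordsn])
    fix w assume w: "f w \<noteq> 0"
    have "f \<in> nich \<theta> q" using f assms(1) by (auto simp: part_def)
    from nich_set[OF this w] have s: "set w \<subseteq> {..<\<theta>}" .
    have "wt w \<in> A" using f w by (auto simp: part_def supported_def)
    then have "\<bar>ht (wt w)\<bar> \<le> (\<Sum>\<alpha>\<in>A. \<bar>ht \<alpha>\<bar>)" by (intro member_le_sum assms(2)) auto
    then have "length w \<le> L" using wt_length[OF s] by (simp add: L_def)
    then show "w \<in> wordsn \<theta> L" using s by (simp add: wordsn_def)
  qed
  then show ?thesis using finite_wordsn by blast
qed

lemma subspace_part: "fv.subspace S \<Longrightarrow> fv.subspace (part S A)"
  by (auto simp: part_def fv.subspace_def supported_linear)

lemma hdim_mono: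
  assumes "S \<subseteq> T" "T \<subseteq> nich \<theta> q" "finite A" shows "hdim S A \<le> hdim T A"
proof -
  obtain F where "finite F" "part T A \<subseteq> fv.span F" using part_finite[OF assms(2,3)] by blast
  then show ?thesis unfolding hdim_def
    by (intro dim_mono_fin[of _ _ F]) (use assms(1) in \<open>auto simp: part_def\<close>)
qed

definition wball :: "nat \<Rightarrow> (nat \<Rightarrow> int) set"
  where "wball n = {\<alpha>. (\<forall>l. 0 \<le> \<alpha> l) \<and> (\<forall>l\<ge>\<theta>. \<alpha> l = 0) \<and> ht \<alpha> \<le> int n}"

definition growth :: "(nat list \<Rightarrow> 'k::field_char_0) set \<Rightarrow> nat \<Rightarrow> bool"
  where "growth S d \<longleftrightarrow> (\<exists>c. \<forall>n. hdim S (wball n) \<le> c * (n + 1) ^ d)"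

lemma finite_wball: "finite (wball n)"
proof -
  have "wball n \<subseteq> {\<alpha>. \<forall>l. (l \<in> {..<\<theta>} \<longrightarrow> \<alpha> l \<in> {0..int n}) \<and> (l \<notin> {..<\<theta>} \<longrightarrow> \<alpha> l = 0)}"
  proof
    fix \<alpha> assume \<alpha>: "\<alpha> \<in> wball n"
    have "\<alpha> l \<le> int n" if "l < \<theta>" for l
    proof -
      have "\<alpha> l \<le> ht \<alpha>" unfolding ht_def using that \<alpha> by (intro member_le_sum) (auto simp: wball_def)
      then show ?thesis using \<alpha> by (simp add: wball_def)
    qed
    then show "\<alpha> \<in> {\<alpha>. \<forall>l. (l \<in> {..<\<theta>} \<longrightarrow> \<alpha> l \<in> {0..int n}) \<and> (l \<notin> {..<\<theta>} \<longrightarrow> \<alpha> l = 0)}"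
      using \<alpha> by (auto simp: wball_def)
  qed
  then show ?thesis by (rule finite_subset) (rule finite_set_of_finite_funs; simp)
qed

end

section \<open>Reflections of braidings of Cartan type\<close>

locale cartan = letters \<theta> for \<theta> :: nat +
  fixes a :: "nat \<Rightarrow> nat \<Rightarrow> int"
  assumes gcm: "generalized_cartan_matrix \<theta> a"
begin

lemma a_diag [simp]: "i < \<theta> \<Longrightarrow> a i i = 2"
  using gcm by (simp add: generalized_cartan_matrix_def)

lemma a_off: "i < \<theta> \<Longrightarrow> j < \<theta> \<Longrightarrow> i \<noteq> j \<Longrightarrow> a i j \<le> 0"
  using gcm by (simp add: generalized_cartan_matrix_def)

text \<open>Generic braidings of Cartan type. Entries are nonzero for all indices, so that inverses
  and integer powers need no range conditions.\<close>

definition cbraid :: "(nat \<Rightarrow> nat \<Rightarrow> 'k::field_char_0) \<Rightarrow> bool"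
  where "cbraid q \<longleftrightarrow> (\<forall>i j. q i j \<noteq> 0) \<and> (\<forall>i<\<theta>. \<not> root_of_one (q i i)) \<and>
    (\<forall>i<\<theta>. \<forall>j<\<theta>. q i j * q j i = q i i powi a i j)"

section \<open>Reflections of weights and of braiding matrices\<close>

definition mm :: "nat \<Rightarrow> nat \<Rightarrow> nat"
  where "mm i j = nat (- a i j)"

text \<open>Evaluation at the \<open>i\<close>-th simple coroot; \<open>srefl i\<close> is the
  corresponding simple reflection of the root lattice.\<close>

definition pairing :: "nat \<Rightarrow> (nat \<Rightarrow> int) \<Rightarrow> int"
  where "pairing i \<alpha> = (\<Sum>l<\<theta>. a i l * \<alpha> l)"

definition srefl :: "nat \<Rightarrow> (nat \<Rightarrow> int) \<Rightarrow> nat \<Rightarrow> int"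
  where "srefl i \<alpha> = (\<lambda>j. if j = i then \<alpha> i - pairing i \<alpha> else \<alpha> j)"

text \<open>The bicharacter \<chi> of \<open>q\<close> pulled back along the simple reflection:
  expand \<open>\<chi>(\<alpha>_j - a_ij \<alpha>_i, \<alpha>_k - a_ik \<alpha>_i)\<close>.\<close>

definition refl :: "nat \<Rightarrow> (nat \<Rightarrow> nat \<Rightarrow> 'k::field_char_0) \<Rightarrow> nat \<Rightarrow> nat \<Rightarrow> 'k"
  where "refl i q = (\<lambda>j k. q j k * q j i powi (- a i k) * q i k powi (- a i j) * q i i powi (a i j * a i k))"

text \<open>The character \<open>\<chi>(s_i \<alpha>_k, -)\<close>, which governs the Leibniz rule
  of \<open>op q i k\<close>.\<close>

definition opchar :: "(nat \<Rightarrow> nat \<Rightarrow> 'k::field_char_0) \<Rightarrow> nat \<Rightarrow> nat \<Rightarrow> nat \<Rightarrow> 'k"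
  where "opchar q i k = (\<lambda>l. q k l * q i l powi (- a i k))"

text \<open>
  On the kernel of \<open>der i\<close> the operators \<open>op q i k\<close> take the place of the derivations of the
  reflected braiding \<open>refl i q\<close>, and \<open>phi q i\<close> reads off the coordinates with respect to them.
\<close>

definition op :: "(nat \<Rightarrow> nat \<Rightarrow> 'k::field_char_0) \<Rightarrow> nat \<Rightarrow> nat \<Rightarrow> (nat list \<Rightarrow> 'k) \<Rightarrow> nat list \<Rightarrow> 'k"
  where "op q i k f = (if k = i
    then badj q i f
    else (der i ^^ mm i k) (der k f))"

fun phi :: "(nat \<Rightarrow> nat \<Rightarrow> 'k::field_char_0) \<Rightarrow> nat \<Rightarrow> (nat list \<Rightarrow> 'k) \<Rightarrow> nat list \<Rightarrow> 'k"
  where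
    "phi q i f [] = f []"
  | "phi q i f (k # w) = phi q i (op q i k f) w"

lemma pairing_add: "pairing i (\<alpha> + \<beta>) = pairing i \<alpha> + pairing i \<beta>"
  by (simp add: pairing_def pointwise algebra_simps sum.distrib)

lemma pairing_simple: "l < \<theta> \<Longrightarrow> pairing i (simple l) = a i l"
  by (simp add: pairing_def simple_def if_distrib [of "\<lambda>x. _ * x"] cong: if_cong)

lemma srefl_add: "srefl i (\<alpha> + \<beta>) = srefl i \<alpha> + srefl i \<beta>"
  by (auto simp: srefl_def pairing_add fun_eq_iff pointwise)

lemma srefl_zero [simp]: "srefl i 0 = 0"
  by (auto simp: srefl_def pairing_def fun_eq_iff pointwise)

lemma srefl_minus: "srefl i (- \<alpha>) = - srefl i \<alpha>"
  by (auto simp: srefl_def pairing_def fun_eq_iff pointwise sum_negf)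

lemma srefl_simple: "l < \<theta> \<Longrightarrow> srefl i (simple l) = (\<lambda>j. simple l j - a i l * simple i j)"
  unfolding srefl_def pairing_simple[of l i] by (auto simp: fun_eq_iff simple_def pairing_simple[unfolded simple_def])

lemma srefl_simple_self: "i < \<theta> \<Longrightarrow> srefl i (simple i) = - simple i"
  by (auto simp: srefl_simple fun_eq_iff pointwise)

lemma pairing_srefl: "i < \<theta> \<Longrightarrow> pairing i (srefl i \<alpha>) = - pairing i \<alpha>"
proof -
  assume i: "i < \<theta>"
  have "pairing i (srefl i \<alpha>) = (\<Sum>l<\<theta>. a i l * \<alpha> l - (if l = i then 2 * pairing i \<alpha> else 0))"
    unfolding pairing_def[of i "srefl i \<alpha>"]
    by (intro sum.cong) (auto simp: srefl_def algebra_simps i)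
  also have "\<dots> = pairing i \<alpha> - 2 * pairing i \<alpha>"
    using i by (simp add: sum_subtractf pairing_def)
  finally show ?thesis by simp
qed

lemma srefl_srefl [simp]: "i < \<theta> \<Longrightarrow> srefl i (srefl i \<alpha>) = \<alpha>"
  unfolding srefl_def[of i "srefl i \<alpha>"] pairing_srefl by (auto simp: srefl_def)

lemma cbraid_nz: "cbraid q \<Longrightarrow> q i j \<noteq> 0"
  by (simp add: cbraid_def)

lemma cbraid_inverse: "cbraid q \<Longrightarrow> i < \<theta> \<Longrightarrow> j < \<theta> \<Longrightarrow> i \<noteq> j \<Longrightarrow> q i j * q j i * q i i ^ mm i j = 1"
proof -
  assume *: "cbraid q" "i < \<theta>" "j < \<theta>" "i \<noteq> j"
  then have "q i j * q j i = q i i powi a i j" by (simp add: cbraid_def)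
  moreover have "a i j = - int (mm i j)" using a_off * by (simp add: mm_def)
  ultimately show ?thesis using cbraid_nz[OF *(1), of i i] by (simp add: power_int_minus)
qed

text \<open>The powers of \<open>q i i\<close> are pairwise distinct because it is not a root of
  one.\<close>

lemma cbraid_minimal: "cbraid q \<Longrightarrow> i < \<theta> \<Longrightarrow> j < \<theta> \<Longrightarrow> i \<noteq> j \<Longrightarrow> q i j * q j i * q i i ^ n = 1 \<Longrightarrow> n = mm i j"
proof -
  assume *: "cbraid q" "i < \<theta>" "j < \<theta>" "i \<noteq> j" "q i j * q j i * q i i ^ n = 1"
  have 1: "q i i ^ n = q i i ^ mm i j"
    using cbraid_inverse[OF *(1-4)] *(5) by (metis mult_cancel_left mult_zero_left zero_neq_one)
  have r: "\<not> root_of_one (q i i)" using * by (simp add: cbraid_def)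
  have "n' = n" if "q i i ^ n = q i i ^ n'" "n \<le> n'" for n n'
  proof (rule ccontr)
    assume ne: "n' \<noteq> n"
    from that(2) obtain d where d: "n' = n + d" using le_Suc_ex by blast
    with that(1) have "q i i ^ d = 1" using cbraid_nz[OF *(1), of i i] by (simp add: power_add)
    with r ne d show False unfolding root_of_one_def by (cases d) auto
  qed
  then show ?thesis using 1 by (metis nat_le_linear)
qed

lemma refl_diag: "cbraid q \<Longrightarrow> i < \<theta> \<Longrightarrow> j < \<theta> \<Longrightarrow> refl i q j j = q j j"
proof -
  assume *: "cbraid q" "i < \<theta>" "j < \<theta>"
  have p: "q i j * q j i = q i i powi a i j" and nz: "q i i \<noteq> 0" using * by (auto simp: cbraid_def)
  have "refl i q j j = q j j * ((q i j * q j i) powi (- a i j) * q i i powi (a i j * a i j))"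
    by (simp add: refl_def power_int_mult_distrib algebra_simps)
  also have "\<dots> = q j j" unfolding p using nz
    by (simp add: power_int_mult[symmetric] power_int_minus)
  finally show ?thesis .
qed

text \<open>In Cartan type the symmetrized bicharacter is invariant under simple reflections.
  Together with \<open>refl_diag\<close> this makes the reflected matrix twist-equivalent to the
  original one, so the Cartan matrix never changes along a chain.\<close>

lemma refl_sym: "cbraid q \<Longrightarrow> i < \<theta> \<Longrightarrow> j < \<theta> \<Longrightarrow> k < \<theta> \<Longrightarrow> refl i q j k * refl i q k j = q j k * q k j"
proof -
  assume *: "cbraid q" "i < \<theta>" "j < \<theta>" "k < \<theta>"
  have p: "q i j * q j i = q i i powi a i j" "q i k * q k i = q i i powi a i k" and nz: "q i i \<noteq> 0"
    using * by (auto simp: cbraid_def)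
  have "refl i q j k * refl i q k j = q j k * q k j * ((q i j * q j i) powi (- a i k) *
      (q i k * q k i) powi (- a i j) * (q i i powi (a i j * a i k) * q i i powi (a i j * a i k)))"
    by (simp add: refl_def power_int_mult_distrib algebra_simps)
  also have "\<dots> = q j k * q k j" unfolding p using nz
    by (simp add: power_int_mult[symmetric] power_int_minus mult.commute[of "a i k"] field_simps)
  finally show ?thesis .
qed

lemma cbraid_refl: "cbraid q \<Longrightarrow> i < \<theta> \<Longrightarrow> cbraid (refl i q)"
proof -
  assume *: "cbraid q" "i < \<theta>"
  have "refl i q j k \<noteq> 0" for j k using cbraid_nz[OF *(1)] by (simp add: refl_def)
  then show ?thesis
    using * refl_diag[OF *] refl_sym[OF *] unfolding cbraid_def by auto
qed

lemma opchar_self: "i < \<theta> \<Longrightarrow> q i l \<noteq> 0 \<Longrightarrow> opchar q i i l = inverse (q i l)"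
  by (simp add: opchar_def power_int_minus power2_eq_square field_simps)

lemma op_self: "op q i i f = badj q i f"
  by (simp add: op_def)

lemma op_self_eq: "op q i i f = qsh q (letter i) (twist (\<lambda>l. inverse (q i l)) f) - qsh q f (letter i)"
  by (simp add: op_def badj_def)

lemma op_linear: "op q i k (f + g) = op q i k f + op q i k g" "op q i k (fun_scale c f) = fun_scale c (op q i k f)"
    "op q i k 0 = 0" "op q i k (f - g) = op q i k f - op q i k g"
  by (auto simp: op_def badj_def qsh_linear funpow_der_linear fun_eq_iff pointwise algebra_simps)

lemma phi_linear: "phi q i (f + g) = phi q i f + phi q i g" "phi q i (fun_scale c f) = fun_scale c (phi q i f)"
    "phi q i 0 = 0" "phi q i (f - g) = phi q i f - phi q i g"
proof -
  have 1: "phi q i (f + g) w = phi q i f w + phi q i g w" for w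
    by (induction w arbitrary: f g) (auto simp: op_linear pointwise)
  have 2: "phi q i (fun_scale c f) w = c * phi q i f w" for w c f
    by (induction w arbitrary: f) (auto simp: op_linear pointwise)
  have 4: "phi q i (f - g) w = phi q i f w - phi q i g w" for w
    by (induction w arbitrary: f g) (auto simp: op_linear pointwise)
  show "phi q i (f + g) = phi q i f + phi q i g" "phi q i (fun_scale c f) = fun_scale c (phi q i f)"
    "phi q i (f - g) = phi q i f - phi q i g"
    using 1 2 4 by (auto simp: fun_eq_iff pointwise)
  show "phi q i 0 = 0" using 2[of 0 0] by (auto simp: fun_eq_iff pointwise) 
qed

lemma der_phi: "der k (phi q i f) = phi q i (op q i k f)"
  by (auto simp: der_def)

lemma der_op_self:
  assumes "\<And>l. q i l \<noteq> 0"
  shows "der k (op q i i f) = fun_scale (inverse (q i k)) (qsh q (letter i) (twist (\<lambda>l. inverse (q i l)) (der k f)))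
    - fun_scale (q k i) (qsh q (der k f) (letter i))"
  unfolding op_self by (rule der_badj[of q i, OF assms])

text \<open>For \<open>k \<noteq> i\<close> no mixed terms arise: the powers of \<open>der i\<close>
  act on one factor only, the other being in the kernel. For \<open>k = i\<close> the mixed term,
  with \<open>letter i\<close> between the two factors, cancels.\<close>

lemma op_qsh:
  assumes q: "cbraid q" and i: "i < \<theta>" and k: "k < \<theta>" and f: "der i f = 0" and g: "der i g = 0"
  shows "op q i k (qsh q f g) = qsh q f (op q i k g) + qsh q (op q i k f) (twist (opchar q i k) g)"
proof (cases "k = i")
  case True
  have "opchar q i i = (\<lambda>l. inverse (q i l))"
    using opchar_self[OF i] cbraid_nz[OF q] by (auto simp: fun_eq_iff pointwise)
  then show ?thesis unfolding True op_self_eq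
    by (simp add: twist_qsh qsh_linear qsh_assoc)
next
  case False
  have a: "- a i k = int (mm i k)" using a_off[OF i k] False by (simp add: mm_def)
  have "(der i ^^ mm i k) (qsh q (der k f) (twist (q k) g))
      = qsh q ((der i ^^ mm i k) (der k f)) (twist (\<lambda>l. q i l ^ mm i k) (twist (q k) g))"
    by (rule funpow_der_qsh_right) (simp add: g)
  moreover have "twist (\<lambda>l. q i l ^ mm i k) (twist (q k) g) = twist (opchar q i k) g"
    unfolding twist_twist opchar_def a by (simp add: mult.commute)
  ultimately show ?thesis using False f
    by (simp add: op_def der_qsh funpow_der_linear funpow_der_qsh_left)
qed

section \<open>The kernel of a skew derivation and its generators\<close>

definition kern :: "(nat \<Rightarrow> nat \<Rightarrow> 'k::field_char_0) \<Rightarrow> nat \<Rightarrow> (nat list \<Rightarrow> 'k) set"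
  where "kern q i = {f \<in> nich \<theta> q. der i f = 0}"

definition adlet :: "(nat \<Rightarrow> nat \<Rightarrow> 'k::field_char_0) \<Rightarrow> nat \<Rightarrow> nat \<Rightarrow> nat \<Rightarrow> nat list \<Rightarrow> 'k"
  where "adlet q i j m = (op q i i ^^ m) (letter j)"

definition adcoeff :: "(nat \<Rightarrow> nat \<Rightarrow> 'k::field_char_0) \<Rightarrow> nat \<Rightarrow> nat \<Rightarrow> nat \<Rightarrow> 'k"
  where "adcoeff q i j m = (\<Prod>k<m. (inverse (q i j) * inverse (q i i) ^ k - q j i) * qnum (Suc k) (q i i))"

text \<open>Candidate for the kernel of \<open>der i\<close>: the subalgebra generated by the
  iterated adjoints of the other letters.\<close>

inductive_set kgen :: "(nat \<Rightarrow> nat \<Rightarrow> 'k::field_char_0) \<Rightarrow> nat \<Rightarrow> (nat list \<Rightarrow> 'k) set"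
  for q :: "nat \<Rightarrow> nat \<Rightarrow> 'k" and i :: nat
  where
    kgen_sone: "sone \<in> kgen q i"
  | kgen_add: "f \<in> kgen q i \<Longrightarrow> g \<in> kgen q i \<Longrightarrow> f + g \<in> kgen q i"
  | kgen_scale: "f \<in> kgen q i \<Longrightarrow> fun_scale c f \<in> kgen q i"
  | kgen_mult: "j < \<theta> \<Longrightarrow> j \<noteq> i \<Longrightarrow> f \<in> kgen q i \<Longrightarrow> qsh q (adlet q i j m) f \<in> kgen q i"

lemma kgen_zero: "0 \<in> kgen q i"
  using kgen_scale[OF kgen_sone, of 0] by simp

lemma kgen_adlet: "j < \<theta> \<Longrightarrow> j \<noteq> i \<Longrightarrow> adlet q i j m \<in> kgen q i"
  using kgen_mult[OF _ _ kgen_sone] by simp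

lemma op_self_jpow: "cbraid q \<Longrightarrow> op q i i (jpow i j m)
    = fun_scale ((inverse (q i j) * inverse (q i i) ^ m - q j i) * qnum (Suc m) (q i i)) (jpow i j (Suc m))"
  unfolding op_self by (rule badj_jpow) (rule cbraid_nz)

lemma adlet_eq: "cbraid q \<Longrightarrow> adlet q i j m = fun_scale (adcoeff q i j m) (jpow i j m)"
proof (induction m)
  case 0 then show ?case by (simp add: adlet_def adcoeff_def jpow_0)
next
  case (Suc m)
  have "adlet q i j (Suc m) = op q i i (adlet q i j m)" by (simp add: adlet_def)
  also have "\<dots> = fun_scale (adcoeff q i j (Suc m)) (jpow i j (Suc m))"
    unfolding Suc.IH[OF Suc.prems] op_linear op_self_jpow[OF Suc.prems]
    by (simp add: adcoeff_def fun_eq_iff pointwise)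
  finally show ?case .
qed

lemma adcoeff_factor_zero:
  assumes q: "cbraid q" and ij: "i < \<theta>" "j < \<theta>" "i \<noteq> j"
  shows "inverse (q i j) * inverse (q i i) ^ k - q j i = 0 \<longleftrightarrow> k = mm i j"
proof -
  have "inverse (q i j) * inverse (q i i) ^ k - q j i = 0 \<longleftrightarrow> q i j * q j i * q i i ^ k = 1"
  proof -
    define x where "x = q i j * q i i ^ k"
    have x: "x \<noteq> 0" using cbraid_nz[OF q] by (simp add: x_def)
    have 1: "inverse x - q j i = 0 \<longleftrightarrow> x * q j i = 1"
      using x by (auto simp: field_simps)
    have 2: "inverse (q i j) * inverse (q i i) ^ k = inverse x"
      unfolding x_def power_inverse inverse_mult_distrib ..
    have 3: "x * q j i = q i j * q j i * q i i ^ k"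
      by (simp only: x_def mult.assoc mult.commute[of "q i i ^ k" "q j i"])
    show ?thesis unfolding 2 1 3 ..
  qed
  then show ?thesis using cbraid_inverse[OF q ij] cbraid_minimal[OF q ij] by metis
qed

lemma cbraid_not_root: "cbraid q \<Longrightarrow> i < \<theta> \<Longrightarrow> \<not> root_of_one (q i i)"
  by (simp add: cbraid_def)

text \<open>The quantum integers do not vanish, and the factor with \<open>k = mm i j\<close> is the
  only zero one. So the iterated adjoints form a string of \<open>mm i j + 1\<close> nonzero
  elements, the \<alpha>_i-string through \<alpha>_j.\<close>

lemma adcoeff_zero_iff:
  assumes q: "cbraid q" and ij: "i < \<theta>" "j < \<theta>" "i \<noteq> j"
  shows "adcoeff q i j m = 0 \<longleftrightarrow> mm i j < m"
proof -
  have "adcoeff q i j m = 0 \<longleftrightarrow> (\<exists>k<m. inverse (q i j) * inverse (q i i) ^ k - q j i = 0)"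
    unfolding adcoeff_def prod_zero_iff[OF finite_lessThan] mult_eq_0_iff
    using qnum_nonzero[OF cbraid_not_root[OF q ij(1)] zero_less_Suc] by blast
  then show ?thesis unfolding adcoeff_factor_zero[OF assms] by auto
qed

lemma der_adlet: "cbraid q \<Longrightarrow> der k (adlet q i j m) = (if k = j then fun_scale (adcoeff q i j m) (dpow i m) else 0)"
  by (simp add: adlet_eq der_jpow)

lemma nich_op_self: "i < \<theta> \<Longrightarrow> f \<in> nich \<theta> q \<Longrightarrow> op q i i f \<in> nich \<theta> q"
  unfolding op_self by (rule nich_badj)

lemma nich_adlet: "i < \<theta> \<Longrightarrow> j < \<theta> \<Longrightarrow> adlet q i j m \<in> nich \<theta> q"
  unfolding adlet_def by (induction m) (auto intro: nich_op_self nich_letter)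

lemma kgen_subset_kern:
  assumes q: "cbraid q" and i: "i < \<theta>" shows "kgen q i \<subseteq> kern q i"
proof
  fix f assume "f \<in> kgen q i" then show "f \<in> kern q i"
    by (induction rule: kgen.induct)
      (auto simp: kern_def der_qsh der_adlet[OF q] i intro!: nich.intros nich_qsh nich_adlet nich_sone)
qed

lemma op_sone: "i < \<theta> \<Longrightarrow> op q i k sone = 0"
  by (auto simp: op_def badj_def funpow_der_linear)

text \<open>Among the operators, \<open>op q i i\<close> climbs the string and
  \<open>op q i j\<close> sees only its top: lower terms are killed by too many
  \<open>der i\<close>, higher terms are 0.\<close>

lemma op_adlet:
  assumes q: "cbraid q" and i: "i < \<theta>" and j: "j < \<theta>" "j \<noteq> i" and k: "k < \<theta>"
  shows "op q i k (adlet q i j m) = (if k = i then adlet q i j (Suc m)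
      else if k = j \<and> m = mm i j then fun_scale (adcoeff q i j m) sone else 0)"
proof (cases "k = i")
  case True then show ?thesis by (simp add: adlet_def)
next
  case False
  have "adcoeff q i j m = 0" if "m > mm i j" using adcoeff_zero_iff[OF q i j(1)] j that by auto
  then show ?thesis using False
    by (auto simp: op_def der_adlet[OF q] funpow_der_linear funpow_der_dpow not_le)
qed

lemma twist_adlet: "cbraid q \<Longrightarrow> twist \<kappa> (adlet q i j m) = fun_scale (\<kappa> j * \<kappa> i ^ m) (adlet q i j m)"
  by (simp add: adlet_eq fun_eq_iff pointwise)

lemma kgen_twist: "cbraid q \<Longrightarrow> f \<in> kgen q i \<Longrightarrow> twist \<kappa> f \<in> kgen q i"
proof -
  assume q: "cbraid q" and "f \<in> kgen q i"
  from this(2) show ?thesis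
    by (induction rule: kgen.induct) (auto simp: twist_qsh twist_adlet[OF q] qsh_linear intro: kgen.intros)
qed

lemma kgen_op:
  assumes q: "cbraid q" and i: "i < \<theta>" and k: "k < \<theta>"
  shows "f \<in> kgen q i \<Longrightarrow> op q i k f \<in> kgen q i"
proof (induction rule: kgen.induct)
  case kgen_sone show ?case by (simp add: op_sone[OF i] kgen_zero)
next
  case (kgen_mult j f m)
  have d: "der i (adlet q i j m) = 0" "der i f = 0"
    using kgen_subset_kern[OF q i] kgen_adlet[OF kgen_mult(1,2), of q m] kgen_mult(3) by (auto simp: kern_def)
  have "op q i k (qsh q (adlet q i j m) f) = qsh q (adlet q i j m) (op q i k f)
    + qsh q (op q i k (adlet q i j m)) (twist (opchar q i k) f)"
    by (rule op_qsh[OF q i k d])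
  moreover have "qsh q (op q i k (adlet q i j m)) (twist (opchar q i k) f) \<in> kgen q i"
    using kgen_mult kgen_twist[OF q, of f i]
    by (auto simp: op_adlet[OF q i _ _ k] qsh_linear intro!: kgen.intros kgen_zero)
  ultimately show ?case using kgen_mult by (auto intro: kgen.intros)
qed (auto simp: op_linear intro: kgen.intros)

lemma letter_kgen:
  assumes q: "cbraid q"
  shows "qsh q (letter i) f = op q i i (twist (q i) f) + qsh q (twist (q i) f) (letter i)"
  by (simp add: op_self_eq twist_twist cbraid_nz[OF q])

text \<open>The decomposition survives left multiplication by letters: a letter other than
  \<open>letter i\<close> lies in \<open>kgen q i\<close>, and \<open>letter i\<close> can be moved
  to the right of an element of \<open>kgen q i\<close> at the cost of an adjoint, which is again in
  \<open>kgen q i\<close>.\<close>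

lemma nich_decompose:
  assumes q: "cbraid q" and i: "i < \<theta>"
  shows "f \<in> nich \<theta> q \<Longrightarrow> \<exists>k \<in> kgen q i. \<exists>g \<in> nich \<theta> q. f = k + qsh q g (letter i)"
proof (induction rule: nich.induct)
  case nich_sone
  show ?case by (intro bexI[OF _ kgen_sone] bexI[OF _ nich_zero]) simp
next
  case (nich_add f f')
  then obtain k g k' g' where "k \<in> kgen q i" "g \<in> nich \<theta> q" "f = k + qsh q g (letter i)"
    "k' \<in> kgen q i" "g' \<in> nich \<theta> q" "f' = k' + qsh q g' (letter i)" by blast
  then show ?case
    by (intro bexI[of _ "k + k'"] bexI[of _ "g + g'"]) (auto simp: qsh_linear algebra_simps intro: kgen.intros nich.intros)
next
  case (nich_scale f c)
  then obtain k g where "k \<in> kgen q i" "g \<in> nich \<theta> q" "f = k + qsh q g (letter i)" by blast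
  then show ?case
    by (intro bexI[of _ "fun_scale c k"] bexI[of _ "fun_scale c g"])
      (auto simp: qsh_linear fv.scale_right_distrib intro: kgen.intros nich.intros)
next
  case (nich_letter_mult j f)
  then obtain k g where *: "k \<in> kgen q i" "g \<in> nich \<theta> q" "f = k + qsh q g (letter i)" by blast
  have kn: "k \<in> nich \<theta> q" using * kgen_subset_kern[OF q i] by (auto simp: kern_def)
  show ?case
  proof (cases "j = i")
    case True
    have "qsh q (letter j) f = op q i i (twist (q i) k) + qsh q (twist (q i) k + qsh q (letter i) g) (letter i)"
      unfolding *(3) True qsh_linear letter_kgen[OF q, of i k] by (simp add: qsh_assoc add.assoc)
    moreover have "op q i i (twist (q i) k) \<in> kgen q i" by (rule kgen_op[OF q i i kgen_twist[OF q *(1)]])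
    moreover have "twist (q i) k + qsh q (letter i) g \<in> nich \<theta> q"
      by (intro nich.intros nich_twist i kn *)
    ultimately show ?thesis by blast
  next
    case False
    have "qsh q (letter j) k \<in> kgen q i"
      using kgen_mult[OF nich_letter_mult(1) False *(1), of 0] by (simp add: adlet_def)
    then show ?thesis
      by (intro bexI[of _ "qsh q (letter j) k"] bexI[of _ "qsh q (letter j) g"])
        (auto simp: * qsh_linear qsh_assoc intro: nich.intros nich_letter_mult)
  qed
qed

lemma fun_scale_eq_zero: "fun_scale c f = 0 \<longleftrightarrow> c = 0 \<or> f = (0 :: _ \<Rightarrow> 'k::field)"
  by (rule fv.scale_eq_0_iff)

text \<open>If \<open>f = k + g x_i\<close> lies in the kernel, then \<open>g\<close> vanishes:
  \<open>der i f = 0\<close> turns into an equation for \<open>g\<close>, and applying powers of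
  \<open>der i\<close> from the nilpotency degree downwards leaves a nonzero quantum integer times
  the next lower derivative.\<close>

lemma kern_eq_kgen:
  assumes q: "cbraid q" and i: "i < \<theta>" shows "kern q i = kgen q i"
proof
  show "kern q i \<subseteq> kgen q i"
  proof
    fix f assume f: "f \<in> kern q i"
    then obtain k g where *: "k \<in> kgen q i" "g \<in> nich \<theta> q" "f = k + qsh q g (letter i)"
      using nich_decompose[OF q i] unfolding kern_def by blast
    have "der i f = 0" "der i k = 0" using f *(1) kgen_subset_kern[OF q i] by (auto simp: kern_def)
    then have 0: "g + fun_scale (q i i) (qsh q (der i g) (letter i)) = 0"
      using *(3) by (simp add: der_qsh der_letter qsh_linear)
    have step: "(der i ^^ n) g = 0" if n: "(der i ^^ Suc n) g = 0" for n
    proof -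
      have 1: "(der i ^^ n) (qsh q (der i g) (letter i)) = fun_scale (qnum n (q i i)) ((der i ^^ n) g)"
      proof (cases n)
        case (Suc n')
        show ?thesis
          unfolding Suc funpow_der_qsh_letter using n
          by (simp add: Suc funpow_swap1 del: qnum_simps)
      next
        case 0
        then show ?thesis using n by simp
      qed
      have "(der i ^^ n) (g + fun_scale (q i i) (qsh q (der i g) (letter i))) = 0"
        unfolding 0 by (simp add: funpow_der_linear)
      then have "fun_scale (qnum (Suc n) (q i i)) ((der i ^^ n) g) = 0"
        unfolding funpow_der_linear 1 qnum_Suc' by (simp add: fun_eq_iff pointwise algebra_simps)
      then show ?thesis
        using qnum_nonzero[OF cbraid_not_root[OF q i], of "Suc n"] unfolding fun_scale_eq_zero by simp
    qed
    obtain n where "(der i ^^ n) g = 0" using nich_der_nilpotent[OF *(2)] by blast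
    then have "g = 0"
    proof (induction n)
      case (Suc n) then show ?case using step by blast
    qed simp
    then show "f \<in> kgen q i" using * by simp
  qed
qed (rule kgen_subset_kern[OF assms])

section \<open>The reflection map as an algebra homomorphism\<close>

lemma kern_op: "cbraid q \<Longrightarrow> i < \<theta> \<Longrightarrow> k < \<theta> \<Longrightarrow> f \<in> kern q i \<Longrightarrow> op q i k f \<in> kern q i"
  using kgen_op kern_eq_kgen by metis

lemma kern_twist: "f \<in> kern q i \<Longrightarrow> twist \<kappa> f \<in> kern q i"
  by (auto simp: kern_def nich_twist)

text \<open>The character \<kappa> composed with the simple reflection.\<close>

definition crefl :: "nat \<Rightarrow> (nat \<Rightarrow> 'k::field_char_0) \<Rightarrow> nat \<Rightarrow> 'k"
  where "crefl i \<kappa> = (\<lambda>l. \<kappa> l * \<kappa> i powi (- a i l))"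

lemma crefl_opchar: "cbraid q \<Longrightarrow> crefl i (opchar q i k) = refl i q k"
  by (simp add: crefl_def opchar_def refl_def fun_eq_iff power_int_mult_distrib power_int_mult[symmetric]
      mult.assoc mult.commute mult.left_commute)

lemma funpow_der_twist: "(der i ^^ n) (twist \<kappa> f) = fun_scale (\<kappa> i ^ n) (twist \<kappa> ((der i ^^ n) f))"
  by (induction n) auto

lemma op_twist:
  assumes i: "i < \<theta>" and k: "k < \<theta>" and nz: "\<kappa> i \<noteq> 0"
  shows "op q i k (twist \<kappa> f) = fun_scale (crefl i \<kappa> k) (twist \<kappa> (op q i k f))"
proof (cases "k = i")
  case True
  have "twist (\<lambda>l. inverse (q i l)) (twist \<kappa> f) = twist \<kappa> (twist (\<lambda>l. inverse (q i l)) f)"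
    by (simp add: twist_twist mult.commute)
  moreover have "crefl i \<kappa> i = inverse (\<kappa> i)"
    using nz i by (simp add: crefl_def power_int_minus power2_eq_square)
  ultimately show ?thesis using nz True
    by (simp add: op_self_eq twist_qsh qsh_linear fv.scale_right_diff_distrib)
next
  case False
  have "- a i k = int (mm i k)" using a_off[OF i k] False by (simp add: mm_def)
  then show ?thesis using False
    by (simp add: op_def crefl_def funpow_der_twist funpow_der_linear mult.commute)
qed

lemma op_outside: "i < \<theta> \<Longrightarrow> k \<ge> \<theta> \<Longrightarrow> f \<in> nich \<theta> q \<Longrightarrow> op q i k f = 0"
  by (auto simp: op_def nich_der_outside funpow_der_linear)

lemma kern_nich: "f \<in> kern q i \<Longrightarrow> f \<in> nich \<theta> q"
  by (simp add: kern_def)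

lemma kern_zero: "0 \<in> kern q i"
  by (simp add: kern_def nich_zero)

lemma kern_op': "cbraid q \<Longrightarrow> i < \<theta> \<Longrightarrow> f \<in> kern q i \<Longrightarrow> op q i k f \<in> kern q i"
  using kern_op[of q i k f] op_outside[of i k f q] by (cases "k < \<theta>") (auto simp: kern_nich kern_zero)

lemma phi_twist:
  assumes q: "cbraid q" and i: "i < \<theta>" and nz: "\<kappa> i \<noteq> 0"
  shows "f \<in> kern q i \<Longrightarrow> phi q i (twist \<kappa> f) = twist (crefl i \<kappa>) (phi q i f)"
proof
  fix w show "f \<in> kern q i \<Longrightarrow> phi q i (twist \<kappa> f) w = twist (crefl i \<kappa>) (phi q i f) w"
  proof (induction w arbitrary: f)
    case (Cons k w)
    have op: "op q i k f \<in> kern q i" by (rule kern_op'[OF q i Cons.prems])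
    have "op q i k (twist \<kappa> f) = fun_scale (crefl i \<kappa> k) (twist \<kappa> (op q i k f))"
      using op_twist[where \<kappa> = \<kappa> and k = k, OF i _ nz] op_outside[OF i, of k, OF _ kern_nich[OF Cons.prems]]
        op_outside[OF i, of k, OF _ nich_twist[OF kern_nich[OF Cons.prems]]]
      by (cases "k < \<theta>") simp_all
    then show ?case using Cons.IH[OF op]
      by (simp add: phi_linear pointwise twist_def)
  qed simp
qed

text \<open>\<open>phi\<close> turns \<open>op q i k\<close> into \<open>der k\<close>, and both
  obey skew Leibniz rules; their characters correspond by \<open>crefl_opchar\<close>.\<close>

lemma phi_qsh:
  assumes q: "cbraid q" and i: "i < \<theta>"
  shows "f \<in> kern q i \<Longrightarrow> g \<in> kern q i \<Longrightarrow> phi q i (qsh q f g) = qsh (refl i q) (phi q i f) (phi q i g)"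
proof
  fix w show "f \<in> kern q i \<Longrightarrow> g \<in> kern q i \<Longrightarrow> phi q i (qsh q f g) w = qsh (refl i q) (phi q i f) (phi q i g) w"
  proof (induction w arbitrary: f g)
    case (Cons k w)
    note opk = kern_op'[OF q i Cons.prems(1), of k] kern_op'[OF q i Cons.prems(2), of k]
    have fg: "f \<in> nich \<theta> q" "g \<in> nich \<theta> q" "der i f = 0" "der i g = 0"
      using Cons.prems by (auto simp: kern_def)
    have "op q i k (qsh q f g) = qsh q f (op q i k g) + qsh q (op q i k f) (twist (opchar q i k) g)"
      using op_qsh[OF q i _ fg(3,4), of k] op_outside[OF i, of k, OF _ fg(1)] op_outside[OF i, of k, OF _ fg(2)]
        op_outside[OF i, of k, OF _ nich_qsh[OF fg(1,2)]]
      by (cases "k < \<theta>") auto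
    moreover have "phi q i (twist (opchar q i k) g) = twist (refl i q k) (phi q i g)"
      unfolding crefl_opchar[OF q, symmetric]
      by (rule phi_twist[OF q i _ Cons.prems(2)]) (simp add: opchar_def cbraid_nz[OF q])
    ultimately show ?case
      using Cons.IH[OF Cons.prems(1) opk(2)] Cons.IH[OF opk(1) kern_twist[OF Cons.prems(2)]]
      by (simp add: phi_linear pointwise der_phi)
  qed simp
qed

end

subsection \<open>The reflection map\<close>

context cartan
begin

text \<open>Mirror image of \<open>jpow\<close>: the basis element of the word
  \<open>x_j x_i^n\<close>.\<close>

definition lpow :: "nat \<Rightarrow> nat \<Rightarrow> nat \<Rightarrow> nat list \<Rightarrow> 'k::field"
  where "lpow i j n = (\<lambda>w. if w = replicate n i @ [j] then 1 else 0)"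

lemma der_lpow_0: "der k (lpow i j 0) = (if k = j then sone else 0)"
  by (auto simp: lpow_def der_def sone_def fun_eq_iff pointwise)

lemma der_lpow_Suc: "der k (lpow i j (Suc n)) = (if k = i then lpow i j n else 0)"
  by (auto simp: lpow_def der_def fun_eq_iff pointwise)

lemma lpow_nil [simp]: "lpow i j n [] = 0"
  by (simp add: lpow_def)

lemma lpow_0: "lpow i j 0 = letter j"
  by (auto simp: lpow_def letter_def)

lemma twist_lpow: "twist \<kappa> (lpow i j n) = fun_scale (\<kappa> j * \<kappa> i ^ n) (lpow i j n)"
  by (auto simp: lpow_def twist_def fun_eq_iff pointwise prod_list_replicate)

text \<open>The string is reversed: its top goes to a multiple of \<open>letter j\<close>, and each
  step down adds one letter \<open>i\<close>, because climbing the string by \<open>op q i i\<close>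
  corresponds to stripping that letter by \<open>der i\<close>.\<close>

lemma phi_adlet:
  assumes q: "cbraid q" and i: "i < \<theta>" and j: "j < \<theta>" "j \<noteq> i"
  shows "n \<le> mm i j \<Longrightarrow> phi q i (adlet q i j (mm i j - n)) = fun_scale (adcoeff q i j (mm i j)) (lpow i j n)"
proof (induction n)
  case 0
  have z: "adlet q i j (Suc (mm i j)) = 0"
    using adcoeff_zero_iff[OF q i j(1)] j by (simp add: adlet_eq[OF q])
  show ?case
  proof (rule sh_ext)
    fix k
    show "der k (phi q i (adlet q i j (mm i j - 0))) = der k (fun_scale (adcoeff q i j (mm i j)) (lpow i j 0))"
    proof (cases "k < \<theta>")
      case True
      have "phi q i sone = sone"
      proof (rule sh_ext)
        fix l show "der l (phi q i sone) = der l sone"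
          by (simp add: der_phi op_sone[OF i] phi_linear)
      qed simp
      then show ?thesis using z j
        by (auto simp: der_phi op_adlet[OF q i j True] phi_linear der_lpow_0)
    next
      case False
      then show ?thesis using j
        by (auto simp: der_phi op_outside[OF i _ nich_adlet[OF i j(1)]] phi_linear der_lpow_0)
    qed
  qed (simp add: adlet_eq[OF q] pointwise)
next
  case (Suc n)
  then have n: "Suc (mm i j - Suc n) = mm i j - n" by simp
  show ?case
  proof (rule sh_ext)
    fix k
    show "der k (phi q i (adlet q i j (mm i j - Suc n))) = der k (fun_scale (adcoeff q i j (mm i j)) (lpow i j (Suc n)))"
    proof (cases "k < \<theta>")
      case True
      then show ?thesis using Suc j
        by (auto simp: der_phi op_adlet[OF q i j True] n phi_linear der_lpow_Suc simp del: diff_Suc_Suc)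
    next
      case False
      then show ?thesis using i
        by (auto simp: der_phi op_outside[OF i _ nich_adlet[OF i j(1)]] phi_linear der_lpow_Suc)
    qed
  qed (simp add: adlet_eq[OF q] pointwise)
qed

definition lcoeff :: "(nat \<Rightarrow> nat \<Rightarrow> 'k::field_char_0) \<Rightarrow> nat \<Rightarrow> nat \<Rightarrow> nat \<Rightarrow> 'k"
  where "lcoeff q i j n = qnum (Suc n) (q i i) * (1 - q i i ^ n * (q i j * q j i))"

lemma lcoeff_Suc:
  fixes q :: "nat \<Rightarrow> nat \<Rightarrow> 'b::field_char_0"
  shows "1 - (q j i * q i i ^ Suc n) * (q i j * q i i ^ Suc n) + q i i * lcoeff q i j n = lcoeff q i j (Suc n)"
proof -
  \<comment> \<open>Here \<open>x\<close> and \<open>X\<close> stand for \<open>q i i\<close> and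
    its \<open>n\<close>-th power, \<open>N\<close> for the quantum integer of
    \<open>n + 1\<close>.\<close>
  have aux: "1 - (y * (x * X)) * (z * (x * X)) + x * (N * (1 - X * (z * y))) = (1 + x * N) * (1 - x * X * (z * y))"
    if "N + x * X = 1 + x * N" for x y z N X :: 'b
  proof -
    have "1 - (y * (x * X)) * (z * (x * X)) + x * (N * (1 - X * (z * y))) - (1 + x * N) * (1 - x * X * (z * y))
      = - (x * X * (z * y)) * (N + x * X - (1 + x * N))"
      by (simp add: algebra_simps)
    then show ?thesis using that by simp
  qed
  have "qnum (Suc n) (q i i) + q i i * q i i ^ n = 1 + q i i * qnum (Suc n) (q i i)"
    using qnum_simps(2)[of "Suc n" "q i i"] qnum_Suc'[of "Suc n" "q i i"] by simp
  from aux[OF this, of "q j i" "q i j"] show ?thesis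
    unfolding lcoeff_def qnum_Suc'[of "Suc n"] power_Suc .
qed

text \<open>Right-handed analogue of \<open>badj_jpow\<close>: a braided commutator with
  \<open>letter i\<close> lengthens the word. In Cartan type the coefficient \<open>lcoeff\<close>
  vanishes precisely at \<open>n = mm i j\<close>.\<close>

lemma lpow_commutator:
  assumes ij: "i \<noteq> j"
  shows "qsh q (lpow i j n) (letter i) - fun_scale (q j i * q i i ^ n) (qsh q (letter i) (lpow i j n))
    = fun_scale (lcoeff q i j n) (lpow i j (Suc n))"
proof (induction n)
  case 0
  show ?case
  proof (rule sh_ext)
    fix k
    show "der k (qsh q (lpow i j 0) (letter i) - fun_scale (q j i * q i i ^ 0) (qsh q (letter i) (lpow i j 0)))
      = der k (fun_scale (lcoeff q i j 0) (lpow i j (Suc 0)))"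
      using ij by (auto simp: der_qsh der_letter der_lpow_0 der_lpow_Suc twist_lpow lcoeff_def qsh_linear
          fun_eq_iff pointwise algebra_simps)
  qed (simp add: pointwise)
next
  case (Suc n)
  show ?case
  proof (rule sh_ext)
    fix k
    show "der k (qsh q (lpow i j (Suc n)) (letter i) - fun_scale (q j i * q i i ^ Suc n) (qsh q (letter i) (lpow i j (Suc n))))
      = der k (fun_scale (lcoeff q i j (Suc n)) (lpow i j (Suc (Suc n))))"
    proof (cases "k = i")
      case True
      let ?P = "qsh q (lpow i j n) (letter i)" and ?Q = "qsh q (letter i) (lpow i j n)"
      have "der i (qsh q (lpow i j (Suc n)) (letter i) - fun_scale (q j i * q i i ^ Suc n) (qsh q (letter i) (lpow i j (Suc n))))
        = fun_scale (1 - (q j i * q i i ^ Suc n) * (q i j * q i i ^ Suc n)) (lpow i j (Suc n))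
          + fun_scale (q i i) (?P - fun_scale (q j i * q i i ^ n) ?Q)"
        by (auto simp: der_qsh der_letter der_lpow_Suc twist_lpow qsh_linear fun_eq_iff pointwise algebra_simps)
      also have "\<dots> = fun_scale (1 - (q j i * q i i ^ Suc n) * (q i j * q i i ^ Suc n) + q i i * lcoeff q i j n) (lpow i j (Suc n))"
        unfolding Suc by (simp add: fun_eq_iff pointwise algebra_simps)
      also have "1 - (q j i * q i i ^ Suc n) * (q i j * q i i ^ Suc n) + q i i * lcoeff q i j n = lcoeff q i j (Suc n)"
        by (rule lcoeff_Suc)
      finally show ?thesis unfolding True by (simp add: der_lpow_Suc)
    next
      case False
      then show ?thesis by (auto simp: der_qsh der_letter der_lpow_Suc)
    qed
  qed (simp add: pointwise)
qed

lemma nich_lpow: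
  assumes q: "cbraid q" and i: "i < \<theta>" and j: "j < \<theta>" "j \<noteq> i"
  shows "n \<le> mm i j \<Longrightarrow> lpow i j n \<in> nich \<theta> q"
proof (induction n)
  case 0 then show ?case using j by (simp add: lpow_0 nich_letter)
next
  case (Suc n)
  have "q i j * q j i * q i i ^ n \<noteq> 1"
    using cbraid_minimal[OF q i j(1), of n] Suc.prems j(2) by auto
  then have nz: "lcoeff q i j n \<noteq> 0"
    using qnum_nonzero[OF cbraid_not_root[OF q i] zero_less_Suc, of n]
    by (simp add: lcoeff_def mult.commute del: qnum_simps)
  have "fun_scale (lcoeff q i j n) (lpow i j (Suc n)) \<in> nich \<theta> q"
    unfolding lpow_commutator[OF j(2)[symmetric], symmetric] using Suc i
    by (intro nich_diff nich.intros nich_qsh nich_letter) auto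
  from nich_scale[OF this, of "inverse (lcoeff q i j n)"] nz show ?case by simp
qed

lemma phi_sone: "i < \<theta> \<Longrightarrow> phi q i sone = sone"
  by (rule sh_ext) (simp_all add: der_phi op_sone phi_linear)

text \<open>By \<open>kern_eq_kgen\<close> and multiplicativity it is enough to consider the
  adjoints; their images are multiples of \<open>lpow i j n\<close> with
  \<open>n \<le> mm i j\<close>, which \<open>nich_lpow\<close> builds from letters.\<close>

lemma phi_kern_nich:
  assumes q: "cbraid q" and i: "i < \<theta>" and f: "f \<in> kern q i"
  shows "phi q i f \<in> nich \<theta> (refl i q)"
  using f unfolding kern_eq_kgen[OF q i]
proof (induction rule: kgen.induct)
  case kgen_sone show ?case by (simp add: phi_sone[OF i] nich_sone)
next
  case (kgen_mult j f m)
  have ad: "phi q i (adlet q i j m) \<in> nich \<theta> (refl i q)"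
  proof (cases "m \<le> mm i j")
    case True
    then show ?thesis
      using phi_adlet[OF q i kgen_mult(1,2), of "mm i j - m"]
        nich_lpow[OF cbraid_refl[OF q i] i kgen_mult(1,2), of "mm i j - m"]
      by (auto intro: nich_scale)
  next
    case False
    then have "adcoeff q i j m = 0" using adcoeff_zero_iff[OF q i kgen_mult(1)] kgen_mult(2) by simp
    then show ?thesis by (simp add: adlet_eq[OF q] phi_linear nich_zero)
  qed
  have "phi q i (qsh q (adlet q i j m) f) = qsh (refl i q) (phi q i (adlet q i j m)) (phi q i f)"
    using kgen_adlet[OF kgen_mult(1,2), of q m] kgen_mult(3)
    by (intro phi_qsh[OF q i]) (auto simp: kern_eq_kgen[OF q i])
  then show ?case using ad kgen_mult by (simp add: nich_qsh)
qed (auto simp: phi_linear intro: nich.intros)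

section \<open>Injectivity of the reflection map\<close>

lemma qnum_inverse: "x \<noteq> 0 \<Longrightarrow> qnum (Suc n) (inverse x) = inverse x ^ n * qnum (Suc n) (x :: 'k::field)"
proof (induction n)
  case (Suc n)
  have "qnum (Suc (Suc n)) (inverse x) = inverse x ^ n * qnum (Suc n) x + inverse x ^ Suc n"
    using Suc by simp
  also have "\<dots> = inverse x ^ Suc n * (1 + x * qnum (Suc n) x)"
    using Suc.prems by (simp add: field_simps del: qnum_simps)
  finally show ?case unfolding qnum_Suc'[of "Suc n" x] .
qed simp

lemma funpow_der_letter_qsh:
  assumes nz: "\<And>l. q i l \<noteq> 0"
  shows "(der i ^^ Suc n) (qsh q (letter i) (twist (\<lambda>l. inverse (q i l)) g))
    = fun_scale (inverse (q i i) ^ Suc n) (qsh q (letter i) (twist (\<lambda>l. inverse (q i l)) ((der i ^^ Suc n) g)))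
      + fun_scale (qnum (Suc n) (inverse (q i i))) ((der i ^^ n) g)"
proof (induction n arbitrary: g)
  case 0 then show ?case using nz by (simp add: der_qsh der_letter qsh_linear twist_twist)
next
  case (Suc n)
  have "(der i ^^ Suc (Suc n)) (qsh q (letter i) (twist (\<lambda>l. inverse (q i l)) g))
    = (der i ^^ Suc n) (fun_scale (inverse (q i i)) (qsh q (letter i) (twist (\<lambda>l. inverse (q i l)) (der i g))) + g)"
    using nz by (simp add: funpow_Suc_right der_qsh der_letter qsh_linear twist_twist del: funpow.simps)
  also have "\<dots> = fun_scale (inverse (q i i)) ((der i ^^ Suc n) (qsh q (letter i) (twist (\<lambda>l. inverse (q i l)) (der i g))))
      + (der i ^^ Suc n) g"
    by (simp only: funpow_der_linear)
  also have "\<dots> = fun_scale (inverse (q i i) ^ Suc (Suc n)) (qsh q (letter i) (twist (\<lambda>l. inverse (q i l)) ((der i ^^ Suc (Suc n)) g)))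
      + fun_scale (qnum (Suc (Suc n)) (inverse (q i i))) ((der i ^^ Suc n) g)"
    unfolding Suc qnum_Suc'[of "Suc n"]
    by (simp add: fun_eq_iff pointwise funpow_swap1 algebra_simps del: qnum_simps)
  finally show ?case .
qed

text \<open>Put \<open>g = der j f\<close> for \<open>j \<noteq> i\<close>. Vanishing of
  \<open>op q i j f\<close> bounds the order of \<open>g\<close> under \<open>der i\<close>, and
  vanishing of \<open>op q i i f\<close> gives a commutation relation between \<open>g\<close> and
  \<open>letter i\<close>. Comparing the derivatives of order \<open>n + 1\<close> of its two sides
  brings the order down to 0, as the coefficients are nonzero for \<open>n < mm i j\<close>.\<close>

lemma op_all_zero:
  assumes q: "cbraid q" and i: "i < \<theta>" and f: "f \<in> kern q i" and z: "\<And>k. k < \<theta> \<Longrightarrow> op q i k f = 0"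
  shows "f = fun_scale (f []) sone"
proof (rule sh_ext)
  fix j
  have "der j f = 0"
  proof (cases "j < \<theta> \<and> j \<noteq> i")
    case True
    then have j: "j < \<theta>" "j \<noteq> i" by auto
    let ?g = "der j f"
    have top: "(der i ^^ mm i j) ?g = 0" using z[OF j(1)] j(2) by (simp add: op_def)
    have "der j (op q i i f) = 0" using z[OF i] by simp
    then have eq: "fun_scale (inverse (q i j)) (qsh q (letter i) (twist (\<lambda>l. inverse (q i l)) ?g)) = fun_scale (q j i) (qsh q ?g (letter i))"
      by (simp add: der_op_self[OF cbraid_nz[OF q]])
    have step: "(der i ^^ n) ?g = 0" if n: "(der i ^^ Suc n) ?g = 0" "n < mm i j" for n
    proof -
      let ?L = "fun_scale (inverse (q i j)) (qsh q (letter i) (twist (\<lambda>l. inverse (q i l)) ?g))"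
      have "(der i ^^ Suc n) ?L = fun_scale (inverse (q i j)) (fun_scale (qnum (Suc n) (inverse (q i i))) ((der i ^^ n) ?g))"
        unfolding funpow_der_linear funpow_der_letter_qsh[of q i n ?g, OF cbraid_nz[OF q]] n(1) by simp
      moreover have "(der i ^^ Suc n) ?L = fun_scale (q j i) (fun_scale (qnum (Suc n) (q i i)) ((der i ^^ n) ?g))"
        unfolding eq unfolding funpow_der_linear funpow_der_qsh_letter n(1) by simp
      ultimately have "fun_scale (inverse (q i j)) (fun_scale (qnum (Suc n) (inverse (q i i))) ((der i ^^ n) ?g))
          = fun_scale (q j i) (fun_scale (qnum (Suc n) (q i i)) ((der i ^^ n) ?g))"
        by (rule trans[OF sym])
      then have "fun_scale ((inverse (q i j) * inverse (q i i) ^ n - q j i) * qnum (Suc n) (q i i)) ((der i ^^ n) ?g) = 0"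
        unfolding qnum_inverse[OF cbraid_nz[OF q]] by (simp add: left_diff_distrib fv.scale_left_diff_distrib mult.assoc del: qnum_simps)
      moreover have "inverse (q i j) * inverse (q i i) ^ n - q j i \<noteq> 0"
        using adcoeff_factor_zero[OF q i j(1), of n] j(2) n(2) by auto
      ultimately show ?thesis
        using qnum_nonzero[OF cbraid_not_root[OF q i] zero_less_Suc, of n] unfolding fun_scale_eq_zero mult_eq_0_iff by blast
    qed
    have "(der i ^^ (mm i j - n)) ?g = 0" if "n \<le> mm i j" for n
      using that
    proof (induction n)
      case 0 then show ?case using top by simp
    next
      case (Suc n)
      then have "Suc (mm i j - Suc n) = mm i j - n" by simp
      then show ?case using Suc by (auto intro!: step[of "mm i j - Suc n"] simp del: diff_Suc_Suc)
    qed
    from this[of "mm i j"] show ?thesis by simp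
  next
    case False
    then show ?thesis using f nich_der_outside[of f \<theta> q j] by (auto simp: kern_def not_less)
  qed
  then show "der j f = der j (fun_scale (f []) sone)" by simp
qed (simp add: pointwise)

text \<open>It suffices to look at generators, and the reflection sends
  \<open>\<alpha>_j + m \<alpha>_i\<close> to
  \<open>\<alpha>_j + (mm i j - m) \<alpha>_i\<close>.\<close>

lemma srefl_nonneg_kern:
  assumes q: "cbraid q" and i: "i < \<theta>" and f: "f \<in> kern q i"
  shows "f w \<noteq> 0 \<Longrightarrow> 0 \<le> srefl i (wt w) l"
proof -
  define A where "A = {\<alpha>. \<forall>l. 0 \<le> srefl i \<alpha> l}"
  have "supported A f"
    using f unfolding kern_eq_kgen[OF q i]
  proof (induction rule: kgen.induct)
    case kgen_sone
    show ?case by (rule supported_mono[OF supported_sone]) (auto simp: A_def pointwise)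
  next
    case (kgen_mult j f m)
    have "supported A (adlet q i j m)"
    proof (cases "m \<le> mm i j")
      case True
      have "mm i j = - a i j" using a_off[OF i kgen_mult(1)] kgen_mult(2) by (simp add: mm_def)
      moreover have "wt (replicate m i) = (\<lambda>l. int m * simple i l)"
        by (induction m) (auto simp: fun_eq_iff pointwise algebra_simps)
      ultimately have "simple j + wt (replicate m i) \<in> A"
        using True kgen_mult(1,2) i
        by (auto simp: A_def srefl_def pairing_add pairing_simple) 
          (auto simp: pairing_def simple_def pointwise if_distrib cong: if_cong)
      then show ?thesis by (auto simp: adlet_eq[OF q] supported_def jpow_def pointwise)
    next
      case False
      then have "adcoeff q i j m = 0" using adcoeff_zero_iff[OF q i kgen_mult(1)] kgen_mult(2) by simp
      then show ?thesis by (simp add: adlet_eq[OF q] supported_linear)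
    qed
    then show ?case by (rule supported_qsh[OF _ kgen_mult.IH]) (auto simp: A_def srefl_add pointwise)
  qed (auto intro: supported_linear)
  then show "f w \<noteq> 0 \<Longrightarrow> 0 \<le> srefl i (wt w) l" by (auto simp: supported_def A_def)
qed

lemma op_supported:
  assumes i: "i < \<theta>" and k: "k < \<theta>" and f: "supported A f"
  shows "supported {\<gamma>. \<gamma> + srefl i (simple k) \<in> A} (op q i k f)"
proof (cases "k = i")
  case True
  let ?B = "{\<gamma>. \<gamma> + srefl i (simple i) \<in> A}"
  have "supported ?B (qsh q (letter i) (twist (\<lambda>l. inverse (q i l)) f))"
    by (rule supported_qsh[OF supported_letter supported_twist[OF f]]) (simp add: srefl_simple_self[OF i])
  moreover have "supported ?B (qsh q f (letter i))"
    by (rule supported_qsh[OF f supported_letter]) (simp add: srefl_simple_self[OF i])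
  ultimately show ?thesis unfolding True op_self_eq by (rule supported_linear)
next
  case False
  have "supported {\<gamma>. \<gamma> + (\<lambda>l. int m * simple i l) + simple k \<in> A} ((der i ^^ m) (der k f))" for m
  proof (induction m)
    case 0
    show ?case using supported_der[OF f, of k] by (simp add: zero_fun_def[symmetric])
  next
    case (Suc m)
    have "(\<lambda>l. int (Suc m) * simple i l) = simple i + (\<lambda>l. int m * simple i l)"
      by (auto simp: fun_eq_iff pointwise algebra_simps)
    then show ?case using supported_der[OF Suc, of i] by (simp add: add.assoc)
  qed
  moreover have "srefl i (simple k) = (\<lambda>l. int (mm i k) * simple i l) + simple k"
    using a_off[OF i k] False by (auto simp: srefl_simple[OF k] fun_eq_iff pointwise mm_def)
  ultimately show ?thesis using False by (simp add: op_def add.assoc)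
qed

text \<open>Induction on the height of the reflected weight, which is nonnegative on the kernel and
  drops by 1 under every operator \<open>op q i k\<close>; an element killed by all operators is a
  scalar.\<close>

lemma phi_inj:
  assumes q: "cbraid q" and i: "i < \<theta>" and f: "f \<in> kern q i" and z: "phi q i f = 0"
  shows "f = 0"
proof -
  have main: "g \<in> kern q i \<Longrightarrow> supported {\<alpha>. ht (srefl i \<alpha>) < int n} g \<Longrightarrow> phi q i g = 0 \<Longrightarrow> g = 0" for n g
  proof (induction n arbitrary: g)
    case 0
    have "g w = 0" for w
    proof (rule ccontr)
      assume w: "g w \<noteq> 0"
      have "0 \<le> ht (srefl i (wt w))" unfolding ht_def
        by (intro sum_nonneg srefl_nonneg_kern[OF q i 0(1) w])
      moreover have "ht (srefl i (wt w)) < 0" using 0(2) w by (auto simp: supported_def)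
      ultimately show False by simp
    qed
    then show ?case by (simp add: fun_eq_iff pointwise)
  next
    case (Suc n)
    have "op q i k g = 0" if k: "k < \<theta>" for k
    proof (rule Suc.IH)
      show "op q i k g \<in> kern q i" by (rule kern_op[OF q i k Suc.prems(1)])
      show "supported {\<alpha>. ht (srefl i \<alpha>) < int n} (op q i k g)"
        by (rule supported_mono[OF op_supported[OF i k Suc.prems(2)]])
          (auto simp: srefl_add srefl_srefl[OF i] ht_add ht_simple[OF k])
      have "der k (phi q i g) = 0" using Suc.prems(3) by simp
      then show "phi q i (op q i k g) = 0" by (simp add: der_phi)
    qed
    from op_all_zero[OF q i Suc.prems(1) this] have "g = fun_scale (g []) sone" by blast
    moreover have "g [] = 0" using fun_cong[OF Suc.prems(3), of "[]"] by (simp add: pointwise)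
    ultimately show ?case by simp
  qed
  have fn: "f \<in> nich \<theta> q" using f by (simp add: kern_def)
  obtain L where L: "\<forall>w. length w > L \<longrightarrow> f w = 0" using nich_length_bounded[OF fn] by blast
  define W where "W = {w :: nat list. set w \<subseteq> {..<\<theta>} \<and> length w \<le> L}"
  have fin: "finite W" unfolding W_def by (rule finite_lists_length_le) simp
  have fW: "w \<in> W" if "f w \<noteq> 0" for w
    using that L nich_set[OF fn] unfolding W_def by (auto simp: not_less[symmetric])
  define n where "n = Suc (nat (\<Sum>w\<in>W. \<bar>ht (srefl i (wt w))\<bar>))"
  have "ht (srefl i (wt w)) < int n" if "w \<in> W" for w
  proof -
    have "\<bar>ht (srefl i (wt w))\<bar> \<le> (\<Sum>w\<in>W. \<bar>ht (srefl i (wt w))\<bar>)"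
      by (rule member_le_sum[OF that _ fin]) simp
    then show ?thesis by (simp add: n_def)
  qed
  then have "supported {\<alpha>. ht (srefl i \<alpha>) < int n} f" using fW by (auto simp: supported_def)
  then show ?thesis by (rule main[OF f _ z])
qed

lemma phi_supported:
  assumes q: "cbraid q" and i: "i < \<theta>"
  shows "f \<in> kern q i \<Longrightarrow> supported A f \<Longrightarrow> supported {\<gamma>. srefl i \<gamma> \<in> A} (phi q i f)"
  unfolding supported_def
proof (intro allI impI)
  fix w
  show "f \<in> kern q i \<Longrightarrow> \<forall>w. f w \<noteq> 0 \<longrightarrow> wt w \<in> A \<Longrightarrow> phi q i f w \<noteq> 0 \<Longrightarrow> wt w \<in> {\<gamma>. srefl i \<gamma> \<in> A}"
  proof (induction w arbitrary: f A)
    case Nil then show ?case by auto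
  next
    case (Cons k w)
    have k: "k < \<theta>"
      using Cons.prems(3) op_outside[OF i, of k f q] Cons.prems(1)
      by (cases "k < \<theta>") (auto simp: kern_nich phi_linear pointwise not_less)
    have s: "supported A f" using Cons.prems(2) by (simp add: supported_def)
    have "wt w \<in> {\<gamma>. srefl i \<gamma> \<in> {\<gamma>. \<gamma> + srefl i (simple k) \<in> A}}"
      by (rule Cons.IH[OF kern_op[OF q i k Cons.prems(1)] op_supported[OF i k s, of q, unfolded supported_def]])
        (use Cons.prems(3) in simp)
    then show ?case by (simp add: srefl_add add.commute)
  qed
qed

lemma kern_trunc: "f \<in> kern q i \<Longrightarrow> trunc A f \<in> kern q i"
  by (auto simp: kern_def nich_trunc der_trunc)

lemma phi_trunc:
  assumes q: "cbraid q" and i: "i < \<theta>" and f: "f \<in> kern q i"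
  shows "trunc {\<gamma>. srefl i \<gamma> \<in> A} (phi q i f) = phi q i (trunc A f)"
proof -
  let ?B = "{\<gamma>. srefl i \<gamma> \<in> A}"
  have 1: "supported ?B (phi q i (trunc A f))" by (rule phi_supported[OF q i kern_trunc[OF f] supported_trunc])
  have 2: "supported {\<gamma>. srefl i \<gamma> \<in> - A} (phi q i (trunc (- A) f))" by (rule phi_supported[OF q i kern_trunc[OF f] supported_trunc])
  have "trunc ?B (phi q i (trunc (- A) f)) = 0"
    using 2 by (auto simp: supported_def trunc_def fun_eq_iff pointwise)
  moreover have "phi q i f = phi q i (trunc A f) + phi q i (trunc (- A) f)"
    unfolding phi_linear(1)[symmetric] trunc_split[symmetric] ..
  ultimately show ?thesis using trunc_supported[OF 1] by simp
qed

end

subsection \<open>Dimensions\<close>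

lemma dim_kernel_image:
  fixes f :: "('x \<Rightarrow> 'k::field) \<Rightarrow> 'y \<Rightarrow> 'k"
  assumes lin: "Vector_Spaces.linear fun_scale fun_scale f"
    and U: "fv.subspace U" "U \<subseteq> fv.span F" "finite F"
  shows "fv.dim U = fv.dim {x \<in> U. f x = 0} + fv.dim (f ` U)"
proof -
  interpret f: Vector_Spaces.linear fun_scale fun_scale f by (rule lin)
  define N where "N = {x \<in> U. f x = 0}"
  obtain B1 where B1: "B1 \<subseteq> N" "fv.independent B1" "N \<subseteq> fv.span B1"
    by (rule fv.basis_exists)
  have "B1 \<subseteq> U" using B1(1) by (auto simp: N_def)
  then obtain B where B: "B1 \<subseteq> B" "B \<subseteq> U" "fv.independent B" "U \<subseteq> fv.span B"
    by (rule fv.maximal_independent_subset_extend[OF _ B1(2)])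
  have fin: "finite B"
    using fv.independent_span_bound[OF U(3) B(3)] B(2) U(2) by blast
  have dU: "fv.dim U = card B" by (rule fv.basis_card_eq_dim[OF B(2,4,3), symmetric])
  have dN: "fv.dim N = card B1" by (rule fv.basis_card_eq_dim[OF B1(1,3,2), symmetric])
  have ind2: "fv.independent (B - B1)" by (rule fv.independent_mono[OF B(3)]) auto
  have zero: "x = 0" if x: "x \<in> fv.span (B - B1)" "f x = 0" for x
  proof -
    have "fv.span (B - B1) \<subseteq> U" using B(2) by (intro fv.span_minimal[OF _ U(1)]) auto
    then have x1: "x \<in> fv.span B1" using x B1(3) by (auto simp: N_def)
    \<comment> \<open>The coordinates of \<open>x\<close> are supported both on \<open>B1\<close>
      and on its complement in \<open>B\<close>, hence are all 0.\<close>
    have "fv.representation B x = fv.representation (B - B1) x"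
      by (rule fv.representation_extend[OF B(3) x(1)]) auto
    moreover have "fv.representation B x = fv.representation B1 x"
      by (rule fv.representation_extend[OF B(3) x1 B(1)])
    ultimately have "fv.representation B x b = 0" for b
      using fv.representation_ne_zero[of B1 x b] fv.representation_ne_zero[of "B - B1" x b] by force
    moreover have "x \<in> fv.span B" using x1 fv.span_mono[OF B(1)] by blast
    ultimately show ?thesis
      using fv.sum_nonzero_representation_eq[OF B(3), of x] by simp
  qed
  have inj: "inj_on f (fv.span (B - B1))"
  proof (rule inj_onI)
    fix x y assume xy: "x \<in> fv.span (B - B1)" "y \<in> fv.span (B - B1)" "f x = f y"
    then have "x - y = 0" by (intro zero fv.span_diff) (auto simp: f.diff)
    then show "x = y" by simp
  qed
  have ind: "fv.independent (f ` (B - B1))"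
    by (rule f.independent_injective_image[OF ind2 inj])
  have "f ` U \<subseteq> fv.span (f ` (B - B1))"
  proof -
    have "f ` B \<subseteq> fv.span (f ` (B - B1))"
    proof
      fix y assume "y \<in> f ` B"
      then obtain b where b: "b \<in> B" "y = f b" by blast
      show "y \<in> fv.span (f ` (B - B1))"
      proof (cases "b \<in> B1")
        case True
        then have "y = 0" using b B1(1) by (auto simp: N_def)
        then show ?thesis by (simp add: fv.span_zero)
      qed (use b in \<open>auto intro: fv.span_base\<close>)
    qed
    then have "fv.span (f ` B) \<subseteq> fv.span (f ` (B - B1))"
      by (rule fv.span_minimal[OF _ fv.subspace_span])
    moreover have "f ` U \<subseteq> fv.span (f ` B)" using B(4) f.span_image[of B] by auto
    ultimately show ?thesis by blast
  qed
  moreover have "f ` (B - B1) \<subseteq> f ` U" using B(2) by blast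
  ultimately have "fv.dim (f ` U) = card (f ` (B - B1))"
    using fv.basis_card_eq_dim[OF _ _ ind] by metis
  also have "\<dots> = card (B - B1)"
    by (rule card_image[OF inj_on_subset[OF inj fv.span_superset]])
  finally show ?thesis
    using dU dN card_Diff_subset[OF finite_subset[OF B(1) fin] B(1)] card_mono[OF fin B(1)]
    unfolding N_def by simp
qed

subsection \<open>Right coideal subalgebras and their reflections\<close>

context cartan
begin

text \<open>Right coideal subalgebras, homogeneous for the grading by weights and the action of the torus.\<close>

definition coideal_subalg :: "(nat \<Rightarrow> nat \<Rightarrow> 'k::field_char_0) \<Rightarrow> (nat list \<Rightarrow> 'k) set \<Rightarrow> bool"
  where "coideal_subalg q S \<longleftrightarrow> fv.subspace S \<and> S \<subseteq> nich \<theta> q \<and> sone \<in> S \<and>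
    (\<forall>f\<in>S. \<forall>g\<in>S. qsh q f g \<in> S) \<and> (\<forall>f\<in>S. \<forall>k. der k f \<in> S) \<and>
    (\<forall>f\<in>S. \<forall>\<kappa>. (\<forall>l. \<kappa> l \<noteq> 0) \<longrightarrow> twist \<kappa> f \<in> S) \<and> (\<forall>f\<in>S. \<forall>A. trunc A f \<in> S)"

definition step :: "(nat \<Rightarrow> nat \<Rightarrow> 'k::field_char_0) \<Rightarrow> nat \<Rightarrow> (nat list \<Rightarrow> 'k) set \<Rightarrow> (nat list \<Rightarrow> 'k) set"
  where "step q i S = phi q i ` (S \<inter> {f. der i f = 0})"

lemma coideal_subalg_nich: "coideal_subalg q (nich \<theta> q)"
  unfolding coideal_subalg_def by (auto intro: subspace_nich nich_sone nich_qsh nich_der nich_twist nich_trunc)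

lemma coideal_subalgD:
  assumes "coideal_subalg q S"
  shows "fv.subspace S" "S \<subseteq> nich \<theta> q" "sone \<in> S" "\<And>f g. f \<in> S \<Longrightarrow> g \<in> S \<Longrightarrow> qsh q f g \<in> S"
    "\<And>f k. f \<in> S \<Longrightarrow> der k f \<in> S" "\<And>f \<kappa>. f \<in> S \<Longrightarrow> (\<And>l. \<kappa> l \<noteq> 0) \<Longrightarrow> twist \<kappa> f \<in> S"
    "\<And>f A. f \<in> S \<Longrightarrow> trunc A f \<in> S"
  using assms unfolding coideal_subalg_def by auto

lemma step_mono: "S \<subseteq> T \<Longrightarrow> step q i S \<subseteq> step q i T"
  by (auto simp: step_def)

lemma linear_der: "Vector_Spaces.linear fun_scale fun_scale (der i :: (nat list \<Rightarrow> 'k::field) \<Rightarrow> _)"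
  unfolding Vector_Spaces.linear_iff using fv.vector_space_axioms by auto

lemma linear_phi: "Vector_Spaces.linear fun_scale fun_scale (phi q i)"
  unfolding Vector_Spaces.linear_iff using fv.vector_space_axioms by (auto simp: phi_linear)

lemma crefl_crefl: "i < \<theta> \<Longrightarrow> (\<And>l. \<kappa> l \<noteq> 0) \<Longrightarrow> crefl i (crefl i \<kappa>) = \<kappa>"
proof
  fix l
  assume i: "i < \<theta>" and nz: "\<And>l. \<kappa> l \<noteq> 0"
  have "crefl i \<kappa> i = inverse (\<kappa> i)"
    using nz[of i] i by (simp add: crefl_def power_int_minus power2_eq_square)
  then have "crefl i (crefl i \<kappa>) l = \<kappa> l * (\<kappa> i powi (- a i l) * inverse (\<kappa> i) powi (- a i l))"
    unfolding crefl_def[of i "crefl i \<kappa>"] by (simp add: crefl_def)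
  also have "\<dots> = \<kappa> l"
    unfolding power_int_mult_distrib[symmetric] using nz[of i] by simp
  finally show "crefl i (crefl i \<kappa>) l = \<kappa> l" .
qed

lemma coideal_subalg_kern: "coideal_subalg q S \<Longrightarrow> f \<in> S \<Longrightarrow> der i f = 0 \<Longrightarrow> f \<in> kern q i"
  using coideal_subalgD(2) by (auto simp: kern_def)

lemma coideal_subalg_op:
  assumes q: "cbraid q" and i: "i < \<theta>" and S: "coideal_subalg q S" and li: "letter i \<in> S" and f: "f \<in> S" "der i f = 0"
  shows "op q i k f \<in> S" "der i (op q i k f) = 0"
proof -
  have dpw: "(der i ^^ n) g \<in> S" if "g \<in> S" for n g
    using that by (induction n) (auto intro: coideal_subalgD(5)[OF S])
  show "op q i k f \<in> S"
    unfolding op_def badj_def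
    by (auto intro!: fv.subspace_diff[OF coideal_subalgD(1)[OF S]] coideal_subalgD[OF S] dpw li f simp: cbraid_nz[OF q])
  show "der i (op q i k f) = 0"
    using kern_op'[OF q i coideal_subalg_kern[OF S f], of k] by (simp add: kern_def)
qed

text \<open>The hypothesis \<open>letter i \<in> S\<close> serves stability under derivations: on
  the image these are the operators \<open>op q i k\<close>, and \<open>op q i i\<close> multiplies
  by \<open>letter i\<close>.\<close>

lemma coideal_subalg_step:
  assumes q: "cbraid q" and i: "i < \<theta>" and S: "coideal_subalg q S" and li: "letter i \<in> S"
  shows "coideal_subalg (refl i q) (step q i S)"
proof -
  let ?K = "S \<inter> {f. der i f = 0}"
  have sub: "fv.subspace ?K"
    using coideal_subalgD(1)[OF S] by (auto simp: fv.subspace_def)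
  have K: "f \<in> kern q i" if "f \<in> ?K" for f using that coideal_subalg_kern[OF S] by blast
  show ?thesis
    unfolding coideal_subalg_def
  proof (intro conjI ballI allI impI)
    interpret p: Vector_Spaces.linear fun_scale fun_scale "phi q i" by (rule linear_phi)
    show "fv.subspace (step q i S)" unfolding step_def by (rule p.subspace_image[OF sub])
    show "step q i S \<subseteq> nich \<theta> (refl i q)"
      using phi_kern_nich[OF q i] K by (auto simp: step_def)
    have "sone = phi q i sone" by (simp add: phi_sone[OF i])
    then show "sone \<in> step q i S" using coideal_subalgD(3)[OF S] unfolding step_def by (metis (mono_tags) IntI der_sone imageI mem_Collect_eq)
    fix F assume "F \<in> step q i S"
    then obtain f where f: "f \<in> S" "der i f = 0" "F = phi q i f" by (auto simp: step_def)
    then have fK: "f \<in> kern q i" using K by blast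
    { fix G assume "G \<in> step q i S"
      then obtain g where g: "g \<in> S" "der i g = 0" "G = phi q i g" by (auto simp: step_def)
      then have "g \<in> kern q i" using K by blast
      from phi_qsh[OF q i fK this] show "qsh (refl i q) F G \<in> step q i S"
        using coideal_subalgD(4)[OF S f(1) g(1)] f g by (auto simp: step_def der_qsh intro!: image_eqI[of _ _ "qsh q f g"]) }
    { fix k show "der k F \<in> step q i S"
        unfolding f(3) der_phi using coideal_subalg_op[OF q i S li f(1,2)] by (auto simp: step_def) }
    { fix \<kappa> :: "nat \<Rightarrow> 'a" assume nz: "\<forall>l. \<kappa> l \<noteq> 0"
      let ?k = "crefl i \<kappa>"
      have nz': "?k l \<noteq> 0" for l using nz by (simp add: crefl_def)
      have "phi q i (twist ?k f) = twist \<kappa> F"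
        using phi_twist[where \<kappa> = ?k, OF q i nz' fK] crefl_crefl[OF i, of \<kappa>] nz f by simp
      moreover have "twist ?k f \<in> ?K" using coideal_subalgD(6)[OF S f(1) nz'] f(2) by simp
      ultimately show "twist \<kappa> F \<in> step q i S" unfolding step_def by (metis imageI) }
    { fix A :: "(nat \<Rightarrow> int) set"
      have "{\<gamma>. srefl i \<gamma> \<in> {\<gamma>. srefl i \<gamma> \<in> A}} = A" using srefl_srefl[OF i] by auto
      then have "trunc A F = phi q i (trunc {\<gamma>. srefl i \<gamma> \<in> A} f)"
        unfolding f(3) using phi_trunc[OF q i fK, of "{\<gamma>. srefl i \<gamma> \<in> A}"] by simp
      moreover have "trunc {\<gamma>. srefl i \<gamma> \<in> A} f \<in> ?K" using coideal_subalgD(7)[OF S f(1)] f(2) by (simp add: der_trunc)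
      ultimately show "trunc A F \<in> step q i S" unfolding step_def by (metis imageI) }
  qed
qed

lemma coideal_subalg_fold_der: "coideal_subalg q S \<Longrightarrow> f \<in> S \<Longrightarrow> fold der v f \<in> S"
  by (induction v arbitrary: f) (auto intro: coideal_subalgD(5))

lemma fold_der_apply: "fold der v f w = f (v @ w)"
  by (induction v arbitrary: f) (auto simp: der_def)

lemma wt_eq_simple: "wt w = simple i \<Longrightarrow> w = [i]"
proof (cases w)
  case Nil
  assume "wt w = simple i"
  then have "wt w i = 1" by (simp add: simple_def)
  then show ?thesis using Nil by (simp add: pointwise)
next
  case (Cons j v)
  assume eq: "wt w = simple i"
  have "wt w j \<ge> 1" using wt_nonneg[of v j] by (simp add: Cons pointwise simple_def)
  then have j: "j = i" using eq by (auto simp: simple_def split: if_splits)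
  have "wt v = 0" using eq by (auto simp: Cons j)
  then have "v = []" by (cases v) (auto simp: fun_eq_iff pointwise simple_def wt_def split: if_splits dest!: spec[of _ "hd v"])
  then show ?thesis by (simp add: Cons j)
qed

lemma trunc_simple: "trunc {simple i} f = fun_scale (f [i]) (letter i)"
proof
  fix w show "trunc {simple i} f w = fun_scale (f [i]) (letter i) w"
    using wt_eq_simple[of w i] by (cases "w = [i]") (auto simp: trunc_def letter_def pointwise)
qed

text \<open>Strip all but one letter of a word in the support by derivations and cut out the weight
  of the remaining letter.\<close>

lemma coideal_subalg_letter:
  assumes S: "coideal_subalg q S" and f: "f \<in> S" and w: "w \<noteq> []" "f w \<noteq> 0"
  shows "\<exists>i<\<theta>. letter i \<in> S"
proof -
  obtain v i where v: "w = v @ [i]" using w(1) by (metis append_butlast_last_id)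
  let ?g = "fold der v f"
  have g: "?g [i] \<noteq> 0" using w v by (simp add: fold_der_apply)
  have "trunc {simple i} ?g \<in> S" by (intro coideal_subalgD(7)[OF S] coideal_subalg_fold_der[OF S f])
  then have "fun_scale (inverse (?g [i])) (fun_scale (?g [i]) (letter i)) \<in> S"
    unfolding trunc_simple by (rule fv.subspace_scale[OF coideal_subalgD(1)[OF S]])
  then have "letter i \<in> S" using g by simp
  moreover have "i < \<theta>" using nich_set[of f \<theta> q w] coideal_subalgD(2)[OF S] f w v by auto
  ultimately show ?thesis by blast
qed

lemma coideal_subalg_dpow:
  assumes q: "cbraid q" and i: "i < \<theta>" and S: "coideal_subalg q S" and li: "letter i \<in> S"
  shows "dpow i m \<in> S"
proof (induction m)
  case 0 then show ?case using coideal_subalgD(3)[OF S] by simp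
next
  case (Suc m)
  have "fun_scale (inverse (qnum (Suc m) (q i i))) (qsh q (letter i) (dpow i m)) \<in> S"
    by (intro fv.subspace_scale[OF coideal_subalgD(1)[OF S]] coideal_subalgD(4)[OF S] li Suc)
  then show ?case
    using qnum_nonzero[OF cbraid_not_root[OF q i] zero_less_Suc, of m] by (simp add: letter_dpow del: qnum_simps)
qed

text \<open>Integration by parts: \<open>f * dpow i m\<close> is the derivative of
  \<open>f * dpow i (m + 1)\<close> up to a term with \<open>der i f\<close> in place of
  \<open>f\<close>. The process ends because \<open>der i\<close> is nilpotent on
  \<open>f\<close>.\<close>

lemma coideal_subalg_der_surj:
  assumes q: "cbraid q" and i: "i < \<theta>" and S: "coideal_subalg q S" and li: "letter i \<in> S" and f: "f \<in> S"
  shows "\<exists>g\<in>S. der i g = f"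
proof -
  have main: "f \<in> S \<Longrightarrow> (der i ^^ n) f = 0 \<Longrightarrow> \<exists>g\<in>S. der i g = qsh q f (dpow i m)" for n f m
  proof (induction n arbitrary: f m)
    case 0
    then show ?case by (intro bexI[of _ 0]) (auto simp: fv.subspace_0[OF coideal_subalgD(1)[OF S]])
  next
    case (Suc n)
    have "(der i ^^ n) (der i f) = 0" using Suc.prems(2) by (simp add: funpow_swap1)
    from Suc.IH[OF coideal_subalgD(5)[OF S Suc.prems(1)] this, of "Suc m"]
    obtain g where g: "g \<in> S" "der i g = qsh q (der i f) (dpow i (Suc m))" by blast
    let ?g = "qsh q f (dpow i (Suc m)) - fun_scale (q i i ^ Suc m) g"
    have "?g \<in> S"
      by (intro fv.subspace_diff[OF coideal_subalgD(1)[OF S]] fv.subspace_scale[OF coideal_subalgD(1)[OF S]] coideal_subalgD(4)[OF S] g Suc.prems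
          coideal_subalg_dpow[OF q i S li])
    moreover have "der i ?g = qsh q f (dpow i m)"
      by (simp add: der_qsh der_dpow qsh_linear g)
    ultimately show ?case by blast
  qed
  obtain n where "(der i ^^ n) f = 0" using nich_der_nilpotent coideal_subalgD(2)[OF S] f by blast
  from main[OF f this, of 0] show ?thesis by simp
qed

text \<open>Rank and nullity for \<open>der i\<close> on the part with weights in \<open>A\<close>:
  the image is the part with shifted weights, and \<open>phi\<close> identifies the kernel with a
  part of the next algebra, where weights are reflected.\<close>

lemma hdim_step:
  assumes q: "cbraid q" and i: "i < \<theta>" and S: "coideal_subalg q S" and li: "letter i \<in> S" and A: "finite A"
  shows "hdim S A = hdim S {\<alpha>. \<alpha> + simple i \<in> A} + hdim (step q i S) (srefl i ` A)"
proof -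
  let ?P = "part S A"
  obtain F where F: "finite F" "?P \<subseteq> fv.span F" using part_finite[OF coideal_subalgD(2)[OF S] A] by blast
  have sub: "fv.subspace ?P" by (rule subspace_part[OF coideal_subalgD(1)[OF S]])
  have im: "der i ` ?P = part S {\<alpha>. \<alpha> + simple i \<in> A}"
  proof
    show "der i ` ?P \<subseteq> part S {\<alpha>. \<alpha> + simple i \<in> A}"
      using coideal_subalgD(5)[OF S] supported_der by (auto simp: part_def)
    show "part S {\<alpha>. \<alpha> + simple i \<in> A} \<subseteq> der i ` ?P"
    proof
      fix f assume f: "f \<in> part S {\<alpha>. \<alpha> + simple i \<in> A}"
      then obtain g where g: "g \<in> S" "der i g = f" using coideal_subalg_der_surj[OF q i S li] by (auto simp: part_def)
      have "der i (trunc A g) = f" using f by (simp add: der_trunc g trunc_supported part_def)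
      moreover have "trunc A g \<in> ?P" using coideal_subalgD(7)[OF S g(1)] by (simp add: part_def)
      ultimately show "f \<in> der i ` ?P" by blast
    qed
  qed
  have K: "{f \<in> ?P. der i f = 0} \<subseteq> kern q i" using coideal_subalg_kern[OF S] by (auto simp: part_def)
  have im2: "phi q i ` {f \<in> ?P. der i f = 0} = part (step q i S) (srefl i ` A)"
  proof
    have pre: "{\<gamma>. srefl i \<gamma> \<in> A} = srefl i ` A" using srefl_srefl[OF i] by (auto intro: rev_image_eqI)
    show "phi q i ` {f \<in> ?P. der i f = 0} \<subseteq> part (step q i S) (srefl i ` A)"
      using phi_supported[OF q i] coideal_subalg_kern[OF S] pre by (fastforce simp: part_def step_def)
    show "part (step q i S) (srefl i ` A) \<subseteq> phi q i ` {f \<in> ?P. der i f = 0}"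
    proof
      fix F assume F: "F \<in> part (step q i S) (srefl i ` A)"
      then obtain f where f: "f \<in> S" "der i f = 0" "F = phi q i f" by (auto simp: part_def step_def)
      have "F = trunc (srefl i ` A) F" using F by (simp add: part_def trunc_supported)
      also have "\<dots> = phi q i (trunc A f)"
        using phi_trunc[OF q i coideal_subalg_kern[OF S f(1,2)], of A] by (simp add: pre f(3))
      finally show "F \<in> phi q i ` {f \<in> ?P. der i f = 0}"
        using coideal_subalgD(7)[OF S f(1), of A] f(2) by (auto simp: part_def der_trunc)
    qed
  qed
  have subK: "fv.subspace {f \<in> ?P. der i f = 0}" using sub by (auto simp: fv.subspace_def)
  have "fv.dim (phi q i ` {f \<in> ?P. der i f = 0}) = fv.dim {f \<in> ?P. der i f = 0}"
  proof -
    have "fv.dim {f \<in> ?P. der i f = 0}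
      = fv.dim {f \<in> {f \<in> ?P. der i f = 0}. phi q i f = 0} + fv.dim (phi q i ` {f \<in> ?P. der i f = 0})"
      by (rule dim_kernel_image[OF linear_phi subK _ F(1)]) (use F(2) in blast)
    moreover have "{f \<in> {f \<in> ?P. der i f = 0}. phi q i f = 0} \<subseteq> {0}"
      using phi_inj[OF q i] K by blast
    then have "fv.dim {f \<in> {f \<in> ?P. der i f = 0}. phi q i f = 0} = 0"
      using fv.dim_le_card[of "{f \<in> {f \<in> ?P. der i f = 0}. phi q i f = 0}" "{}"] unfolding fv.span_empty by simp
    ultimately show ?thesis by simp
  qed
  then show ?thesis
    using dim_kernel_image[OF linear_der sub F(2,1), of i] unfolding im im2 hdim_def by simp
qed

end

subsection \<open>Counting partitions into positive weights\<close>

definition comb :: "(nat \<Rightarrow> int) set \<Rightarrow> ((nat \<Rightarrow> int) \<Rightarrow> nat) \<Rightarrow> nat \<Rightarrow> int"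
  where "comb X n = (\<lambda>l. \<Sum>x\<in>X. int (n x) * x l)"

text \<open>These count the monomials with weight in \<open>A\<close> of a polynomial ring that has
  one generator for each weight in \<open>X\<close>.\<close>

definition partitions :: "(nat \<Rightarrow> int) set \<Rightarrow> (nat \<Rightarrow> int) set \<Rightarrow> ((nat \<Rightarrow> int) \<Rightarrow> nat) set"
  where "partitions X A = {n. (\<forall>x. x \<notin> X \<longrightarrow> n x = 0) \<and> comb X n \<in> A}"

context cartan
begin

definition pos :: "(nat \<Rightarrow> int) \<Rightarrow> bool"
  where "pos \<beta> \<longleftrightarrow> (\<forall>l. 0 \<le> \<beta> l) \<and> (\<forall>l\<ge>\<theta>. \<beta> l = 0) \<and> \<beta> \<noteq> 0"

lemma pos_ht: "pos \<beta> \<Longrightarrow> 1 \<le> ht \<beta>"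
proof -
  assume p: "pos \<beta>"
  then obtain l where l: "\<beta> l \<noteq> 0" by (auto simp: pos_def fun_eq_iff pointwise)
  then have "l < \<theta>" using p by (auto simp: pos_def not_le[symmetric])
  then have "\<beta> l \<le> ht \<beta>" unfolding ht_def by (intro member_le_sum) (use p in \<open>auto simp: pos_def\<close>)
  moreover have "1 \<le> \<beta> l" using l p by (metis pos_def int_one_le_iff_zero_less order_le_less)
  ultimately show ?thesis by simp
qed

lemma ht_comb: "ht (comb X n) = (\<Sum>x\<in>X. int (n x) * ht x)"
  unfolding ht_def comb_def by (subst sum.swap) (simp add: sum_distrib_left)

lemma comb_bound:
  assumes "finite X" "\<forall>x\<in>X. pos x" "x \<in> X" shows "int (n x) * ht x \<le> ht (comb X n)"
proof -
  have "0 \<le> ht y" if "y \<in> X" for y using pos_ht[of y] assms(2) that by auto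
  then show ?thesis unfolding ht_comb using assms by (intro member_le_sum) auto
qed

lemma finite_bounded_funs:
  assumes "finite X" shows "finite {n :: 'b \<Rightarrow> nat. (\<forall>x. x \<notin> X \<longrightarrow> n x = 0) \<and> (\<forall>x\<in>X. n x \<le> N)}"
proof -
  have "{n :: 'b \<Rightarrow> nat. (\<forall>x. x \<notin> X \<longrightarrow> n x = 0) \<and> (\<forall>x\<in>X. n x \<le> N)}
     = {n. (\<forall>x. x \<in> X \<longrightarrow> n x \<in> {..N}) \<and> (\<forall>x. x \<notin> X \<longrightarrow> n x = 0)}" by auto
  then show ?thesis using finite_set_of_finite_funs[OF assms finite_atMost[of N], of 0]
    by (simp only: all_conj_distrib)
qed

lemma partitions_bound:
  assumes X: "finite X" "\<forall>x\<in>X. pos x" and A: "\<And>\<alpha>. \<alpha> \<in> A \<Longrightarrow> ht \<alpha> \<le> int N"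
  shows "partitions X A \<subseteq> {n. (\<forall>x. x \<notin> X \<longrightarrow> n x = 0) \<and> (\<forall>x\<in>X. n x \<le> N)}"
proof
  fix n assume n: "n \<in> partitions X A"
  have "n x \<le> N" if x: "x \<in> X" for x
  proof -
    have "int (n x) * 1 \<le> int (n x) * ht x" using pos_ht X(2) x by (intro mult_left_mono) auto
    also have "\<dots> \<le> ht (comb X n)" by (rule comb_bound[OF X x])
    also have "\<dots> \<le> int N" using n A by (auto simp: partitions_def)
    finally show ?thesis by simp
  qed
  then show "n \<in> {n. (\<forall>x. x \<notin> X \<longrightarrow> n x = 0) \<and> (\<forall>x\<in>X. n x \<le> N)}"
    using n by (auto simp: partitions_def)
qed

lemma ht_bounded: "finite A \<Longrightarrow> \<exists>N. \<forall>\<alpha>\<in>A. ht \<alpha> \<le> int N"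
proof -
  assume A: "finite A"
  have "ht \<alpha> \<le> int (nat (\<Sum>\<alpha>\<in>A. \<bar>ht \<alpha>\<bar>))" if "\<alpha> \<in> A" for \<alpha>
    using member_le_sum[OF that, of "\<lambda>\<alpha>. \<bar>ht \<alpha>\<bar>"] A by simp
  then show ?thesis by blast
qed

lemma finite_partitions:
  assumes X: "finite X" "\<forall>x\<in>X. pos x" and A: "finite A" shows "finite (partitions X A)"
proof -
  obtain N where "\<forall>\<alpha>\<in>A. ht \<alpha> \<le> int N" using ht_bounded[OF A] by blast
  then show ?thesis
    using partitions_bound[OF X, of A N] finite_bounded_funs[OF X(1)] by (meson finite_subset)
qed

lemma finite_shift: "finite A \<Longrightarrow> finite {\<alpha>. \<alpha> + \<beta> \<in> A}" for \<beta> :: "nat \<Rightarrow> int"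
proof -
  assume "finite A"
  moreover have "{\<alpha>. \<alpha> + \<beta> \<in> A} = (\<lambda>\<alpha>. \<alpha> - \<beta>) ` A" by (auto intro: rev_image_eqI)
  ultimately show ?thesis by simp
qed

lemma comb_insert: "finite X \<Longrightarrow> \<beta> \<notin> X \<Longrightarrow> comb (insert \<beta> X) n = (\<lambda>l. int (n \<beta>) * \<beta> l) + comb X n"
  by (auto simp: comb_def fun_eq_iff pointwise)

lemma comb_cong: "(\<And>x. x \<in> X \<Longrightarrow> n x = m x) \<Longrightarrow> comb X n = comb X m"
  by (auto simp: comb_def)

text \<open>Counterpart of \<open>hdim_step\<close>: either \<beta> occurs and one copy of it is
  removed, or it does not occur.\<close>

lemma card_partitions_insert:
  assumes X: "finite X" "\<beta> \<notin> X" "\<forall>x\<in>insert \<beta> X. pos x" and A: "finite A"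
  shows "card (partitions (insert \<beta> X) A) = card (partitions (insert \<beta> X) {\<alpha>. \<alpha> + \<beta> \<in> A}) + card (partitions X A)"
proof -
  let ?up = "\<lambda>n :: (nat \<Rightarrow> int) \<Rightarrow> nat. n(\<beta> := Suc (n \<beta>))"
  let ?P = "partitions (insert \<beta> X) {\<alpha>. \<alpha> + \<beta> \<in> A}"
  have upc: "comb (insert \<beta> X) (?up n) = comb (insert \<beta> X) n + \<beta>" for n
  proof -
    have "comb X (?up n) = comb X n" using X(2) by (intro comb_cong) auto
    then show ?thesis unfolding comb_insert[OF X(1,2)] by (auto simp: fun_eq_iff pointwise algebra_simps)
  qed
  have 0: "comb (insert \<beta> X) n = comb X n" if "n \<beta> = 0" for n
    unfolding comb_insert[OF X(1,2)] using that by (auto simp: fun_eq_iff pointwise)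
  have "partitions (insert \<beta> X) A = ?up ` ?P \<union> partitions X A"
  proof
    show "partitions (insert \<beta> X) A \<subseteq> ?up ` ?P \<union> partitions X A"
    proof
      fix n assume n: "n \<in> partitions (insert \<beta> X) A"
      show "n \<in> ?up ` ?P \<union> partitions X A"
      proof (cases "n \<beta>")
        case 0
        have "n x = 0" if "x \<notin> X" for x using n that \<open>n \<beta> = 0\<close> by (cases "x = \<beta>") (auto simp: partitions_def)
        then have "n \<in> partitions X A" using n \<open>n \<beta> = 0 \<Longrightarrow> comb (insert \<beta> X) n = comb X n\<close>[OF 0]
          by (simp add: partitions_def)
        then show ?thesis ..
      next
        case (Suc k)
        then have "n = ?up (n(\<beta> := k))" by auto
        moreover from this have "n(\<beta> := k) \<in> ?P"
          using n upc[of "n(\<beta> := k)"] by (auto simp: partitions_def)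
        ultimately show ?thesis by blast
      qed
    qed
    show "?up ` ?P \<union> partitions X A \<subseteq> partitions (insert \<beta> X) A"
      using upc 0 X(2) by (auto simp: partitions_def)
  qed
  moreover have "?up ` ?P \<inter> partitions X A = {}"
    using X(2) by (auto simp: partitions_def)
  moreover have "inj_on ?up ?P"
  proof (rule inj_onI, rule ext)
    fix n m :: "(nat \<Rightarrow> int) \<Rightarrow> nat" and x assume "?up n = ?up m"
    from fun_cong[OF this, of x] show "n x = m x" by (auto split: if_splits)
  qed
  moreover have "finite ?P" "finite (partitions X A)"
    using X A by (auto intro!: finite_partitions finite_shift)
  ultimately show ?thesis by (simp add: card_Un_disjoint card_image)
qed

lemma card_partitions_srefl:
  assumes i: "i < \<theta>" and X: "finite X"
  shows "card (partitions (srefl i ` X) A) = card (partitions X (srefl i ` A))"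
proof -
  have inj: "inj_on (srefl i) Y" for Y by (rule inj_on_inverseI[of _ "srefl i"]) (simp add: i)
  have sc: "srefl i (comb X n) = (\<lambda>l. \<Sum>x\<in>X. int (n x) * srefl i x l)" for n
  proof
    fix l
    have "pairing i (comb X n) = (\<Sum>x\<in>X. int (n x) * pairing i x)"
      unfolding pairing_def comb_def sum_distrib_left by (subst sum.swap) (simp add: ac_simps)
    then show "srefl i (comb X n) l = (\<Sum>x\<in>X. int (n x) * srefl i x l)"
      by (auto simp: srefl_def comb_def algebra_simps sum_subtractf)
  qed
  have eq: "comb (srefl i ` X) n = srefl i (comb X (n \<circ> srefl i))" for n
    unfolding sc unfolding comb_def sum.reindex[OF inj] by simp
  have "bij_betw (\<lambda>n. n \<circ> srefl i) (partitions (srefl i ` X) A) (partitions X (srefl i ` A))"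
  proof (rule bij_betwI[where g = "\<lambda>n. n \<circ> srefl i"])
    show "(\<lambda>n. n \<circ> srefl i) \<in> partitions (srefl i ` X) A \<rightarrow> partitions X (srefl i ` A)"
    proof
      fix n assume n: "n \<in> partitions (srefl i ` X) A"
      have "n (srefl i x) = 0" if "x \<notin> X" for x
      proof -
        have "srefl i x \<notin> srefl i ` X"
        proof
          assume "srefl i x \<in> srefl i ` X"
          then obtain y where "y \<in> X" "srefl i x = srefl i y" by blast
          then have "x = y" using srefl_srefl[OF i] by metis
          then show False using \<open>y \<in> X\<close> that by simp
        qed
        then show ?thesis using n by (simp add: partitions_def)
      qed
      moreover have "comb X (n \<circ> srefl i) = srefl i (comb (srefl i ` X) n)" unfolding eq using i by simp
      ultimately show "n \<circ> srefl i \<in> partitions X (srefl i ` A)"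
        using n unfolding partitions_def by auto
    qed
    show "(\<lambda>n. n \<circ> srefl i) \<in> partitions X (srefl i ` A) \<rightarrow> partitions (srefl i ` X) A"
    proof
      fix n assume n: "n \<in> partitions X (srefl i ` A)"
      have "n (srefl i x) = 0" if "x \<notin> srefl i ` X" for x
      proof -
        have "srefl i x \<notin> X"
        proof
          assume "srefl i x \<in> X"
          then have "srefl i (srefl i x) \<in> srefl i ` X" by (rule imageI)
          then show False using that i by simp
        qed
        then show ?thesis using n by (simp add: partitions_def)
      qed
      moreover have "comb (srefl i ` X) (n \<circ> srefl i) = srefl i (comb X n)"
        unfolding eq using i by (simp add: comp_def)
      moreover have "srefl i (comb X n) \<in> A" using n i unfolding partitions_def by auto
      ultimately show "n \<circ> srefl i \<in> partitions (srefl i ` X) A"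
        unfolding partitions_def by auto
    qed
  qed (auto simp: comp_def i)
  then show ?thesis by (rule bij_betw_same_card)
qed

lemma comb_nonneg: "\<forall>x\<in>X. pos x \<Longrightarrow> 0 \<le> comb X n l"
  unfolding comb_def by (intro sum_nonneg mult_nonneg_nonneg) (auto simp: pos_def)

text \<open>Heights of positive weights are at least 1, so a sum of two or more elements of
  \<open>X\<close> is higher than each of them.\<close>

lemma partitions_minimal:
  assumes X: "finite X" "\<forall>x\<in>X. pos x" and n: "n \<in> partitions X {\<beta>}"
    and min: "\<And>x. x \<in> X \<Longrightarrow> ht \<beta> \<le> ht x" and \<beta>: "pos \<beta>"
  shows "\<beta> \<in> X"
proof -
  have c: "comb X n = \<beta>" using n by (auto simp: partitions_def)
  obtain x where x: "x \<in> X" "n x \<noteq> 0"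
  proof -
    have "comb X n \<noteq> 0" using c \<beta> by (auto simp: pos_def)
    then obtain l where "(\<Sum>x\<in>X. int (n x) * x l) \<noteq> 0" by (auto simp: comb_def fun_eq_iff pointwise)
    then show ?thesis using that by (metis (no_types, lifting) mult_zero_left of_nat_0 sum.neutral)
  qed
  have "int (n x) * ht x \<le> ht \<beta>" using comb_bound[OF X x(1), of n] c by simp
  have "ht x \<ge> 1" using pos_ht X(2) x(1) by blast
  have nx: "n x = 1"
  proof (rule ccontr)
    assume "n x \<noteq> 1"
    then have "2 * ht x \<le> int (n x) * ht x" using x(2) \<open>ht x \<ge> 1\<close> by (intro mult_right_mono) auto
    then show False using \<open>ht x \<ge> 1\<close> \<open>int (n x) * ht x \<le> ht \<beta>\<close> min[OF x(1)] by linarith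
  qed
  have eq: "\<beta> = x + comb (X - {x}) n"
    using comb_insert[of "X - {x}" x n] X(1) x(1) nx c by (simp add: insert_absorb)
  then have h0: "ht (comb (X - {x}) n) \<le> 0" using min[OF x(1)] by (simp add: ht_add)
  have nn: "0 \<le> comb (X - {x}) n l" for l using X(2) by (intro comb_nonneg) auto
  have "comb (X - {x}) n l = 0" for l
  proof (cases "l < \<theta>")
    case True
    then have "comb (X - {x}) n l \<le> ht (comb (X - {x}) n)"
      unfolding ht_def by (intro member_le_sum) (use nn in auto)
    then show ?thesis using h0 nn[of l] by simp
  next
    case False
    then have "y l = 0" if "y \<in> X" for y using X(2) that by (simp add: pos_def)
    then show ?thesis unfolding comb_def by (intro sum.neutral) auto
  qed
  then show ?thesis using eq x(1) by (metis ext add.right_neutral zero_fun_def)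
qed

lemma partitions_singleton: "finite X \<Longrightarrow> \<beta> \<in> X \<Longrightarrow> (\<lambda>x. if x = \<beta> then 1 else 0) \<in> partitions X {\<beta>}"
proof -
  assume X: "finite X" "\<beta> \<in> X"
  have "(\<Sum>x\<in>X. int (if x = \<beta> then 1 else 0) * x l) = (\<Sum>x\<in>X. if x = \<beta> then x l else 0)" for l
    by (intro sum.cong) auto
  then have "comb X (\<lambda>x. if x = \<beta> then 1 else 0) = \<beta>" using X by (simp add: comb_def)
  then show ?thesis using X by (auto simp: partitions_def)
qed

text \<open>A weight of minimal height in \<open>X \<union> Y\<close> is detected by its own count,
  so it lies in both sets; removing it keeps the counts equal by
  \<open>card_partitions_insert\<close>.\<close>

lemma partitions_unique:
  assumes "finite X" "finite Y" "\<forall>x\<in>X. pos x" "\<forall>x\<in>Y. pos x"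
    and "\<And>A. finite A \<Longrightarrow> card (partitions X A) = card (partitions Y A)"
  shows "X = Y"
  using assms
proof (induction "card X" arbitrary: X Y)
  case 0
  then have X: "X = {}" by simp
  have "Y = {}"
  proof (rule ccontr)
    assume "Y \<noteq> {}"
    then obtain y where y: "y \<in> Y" by blast
    have "card (partitions Y {y}) \<noteq> 0"
      using partitions_singleton[OF 0(3) y] finite_partitions[OF 0(3,5), of "{y}"] by auto
    moreover have "partitions X {y} = {}" using 0(5) y by (auto simp: X partitions_def comb_def pos_def zero_fun_def)
    ultimately show False using 0(6)[of "{y}"] by simp
  qed
  then show ?case using X by simp
next
  case (Suc k)
  have ne: "X \<union> Y \<noteq> {}" "finite (X \<union> Y)" using Suc by auto
  define \<beta> where "\<beta> = arg_min_on ht (X \<union> Y)"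
  have \<beta>: "\<beta> \<in> X \<union> Y" "\<And>x. x \<in> X \<union> Y \<Longrightarrow> ht \<beta> \<le> ht x"
    unfolding \<beta>_def using arg_min_if_finite[OF ne(2,1), of ht] by (auto simp: not_less[symmetric])
  have pb: "pos \<beta>" using \<beta>(1) Suc by auto
  have both: "\<beta> \<in> X \<and> \<beta> \<in> Y"
  proof -
    have a: "\<beta> \<in> V'"
      if V: "\<beta> \<in> V" "finite V" "finite V'" "\<forall>x\<in>V. pos x" "\<forall>x\<in>V'. pos x" "V' \<subseteq> X \<union> Y"
        "card (partitions V {\<beta>}) = card (partitions V' {\<beta>})" for V V'
    proof -
      have "card (partitions V {\<beta>}) \<noteq> 0"
        using partitions_singleton[OF V(2,1)] finite_partitions[OF V(2,4), of "{\<beta>}"] by auto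
      then obtain n where "n \<in> partitions V' {\<beta>}" using V(7) by (metis card.empty ex_in_conv)
      then show ?thesis using partitions_minimal[OF V(3,5) _ _ pb] \<beta>(2) V(6) by blast
    qed
    show ?thesis using \<beta>(1) a[of X Y] a[of Y X] Suc by auto
  qed
  have rem: "card (partitions (V - {\<beta>}) A) = card (partitions V A) - card (partitions V {\<alpha>. \<alpha> + \<beta> \<in> A})"
    if "\<beta> \<in> V" "finite V" "\<forall>x\<in>V. pos x" "finite A" for V A
    using card_partitions_insert[of "V - {\<beta>}" \<beta> A] that by (simp add: insert_absorb)
  have "X - {\<beta>} = Y - {\<beta>}"
  proof (rule Suc.hyps(1))
    show "k = card (X - {\<beta>})" using Suc.hyps(2) both Suc.prems(1) by simp
    fix A :: "(nat \<Rightarrow> int) set" assume A: "finite A"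
    show "card (partitions (X - {\<beta>}) A) = card (partitions (Y - {\<beta>}) A)"
      using rem[of X A] rem[of Y A] both Suc.prems A by (simp add: finite_shift)
  qed (use Suc.prems in auto)
  then show ?case using both by blast
qed

subsection \<open>Chains of reflections\<close>

text \<open>
  The set collects the weights of the generators split off by successive reflections, transported
  back to the original basis of simple roots.
\<close>

inductive partial_chain :: "(nat \<Rightarrow> nat \<Rightarrow> 'k::field_char_0) \<Rightarrow> (nat list \<Rightarrow> 'k) set \<Rightarrow> (nat \<Rightarrow> int) set \<Rightarrow> bool"
  where
    partial_chain_nil: "partial_chain q S {}"
  | partial_chain_step: "i < \<theta> \<Longrightarrow> letter i \<in> S \<Longrightarrow> partial_chain (refl i q) (step q i S) X \<Longrightarrow> partial_chain q S (insert (simple i) (srefl i ` X))"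

inductive full_chain :: "(nat \<Rightarrow> nat \<Rightarrow> 'k::field_char_0) \<Rightarrow> (nat list \<Rightarrow> 'k) set \<Rightarrow> (nat \<Rightarrow> int) set \<Rightarrow> bool"
  where
    full_chain_nil: "S \<subseteq> range (\<lambda>c. fun_scale c sone) \<Longrightarrow> full_chain q S {}"
  | full_chain_step: "i < \<theta> \<Longrightarrow> letter i \<in> S \<Longrightarrow> full_chain (refl i q) (step q i S) X \<Longrightarrow> full_chain q S (insert (simple i) (srefl i ` X))"

lemma full_chain_partial_chain: "full_chain q S X \<Longrightarrow> partial_chain q S X"
  by (induction rule: full_chain.induct) (auto intro: partial_chain.intros)

lemma partial_chain_finite: "partial_chain q S X \<Longrightarrow> finite X"
  by (induction rule: partial_chain.induct) auto

lemma inj_srefl: "i < \<theta> \<Longrightarrow> inj_on (srefl i) Y"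
  by (rule inj_on_inverseI[of _ "srefl i"]) simp

lemma wt_zero: "wt w = 0 \<Longrightarrow> w = []"
proof (cases w)
  case (Cons j v)
  assume "wt w = 0"
  then have "wt w j = 0" by (simp add: pointwise)
  then show ?thesis by (simp add: wt_def Cons)
qed

lemma wt_pos: "f \<in> nich \<theta> q \<Longrightarrow> f w \<noteq> 0 \<Longrightarrow> w \<noteq> [] \<Longrightarrow> pos (wt w)"
  using nich_set[of f \<theta> q w] wt_zero[of w] wt_nonneg[of w]
  by (auto simp: pos_def wt_def subset_iff count_list_0_iff)

text \<open>Source of positivity: a weight of a chain is realized in \<open>S\<close>, since a
  homogeneous element of the next algebra is the image under \<open>phi\<close> of an element of
  \<open>S\<close> that can be cut down to the reflected weight.\<close>

lemma partial_chain_weights: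
  assumes "partial_chain q S X" "cbraid q" "coideal_subalg q S" "\<beta> \<in> X"
  shows "\<exists>f\<in>S. \<exists>w. w \<noteq> [] \<and> f w \<noteq> 0 \<and> supported {\<beta>} f"
  using assms
proof (induction arbitrary: \<beta> rule: partial_chain.induct)
  case (partial_chain_step i S q X)
  note rs = coideal_subalg_step[OF partial_chain_step.prems(1) partial_chain_step.hyps(1) partial_chain_step.prems(2) partial_chain_step.hyps(2)]
  note cb = cbraid_refl[OF partial_chain_step.prems(1) partial_chain_step.hyps(1)]
  consider "\<beta> = simple i" | \<beta>' where "\<beta>' \<in> X" "\<beta> = srefl i \<beta>'" using partial_chain_step.prems(3) by blast
  then show ?case
  proof cases
    case 1
    then show ?thesis
      using partial_chain_step.hyps(2) supported_letter by (intro bexI[of _ "letter i"] exI[of _ "[i]"]) (auto simp: letter_def)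
  next
    case 2
    from partial_chain_step.IH[OF cb rs 2(1)] obtain F w where F: "F \<in> step q i S" "w \<noteq> []" "F w \<noteq> 0" "supported {\<beta>'} F"
      by blast
    then obtain f where f: "f \<in> S" "der i f = 0" "F = phi q i f" by (auto simp: step_def)
    note fK = coideal_subalg_kern[OF partial_chain_step.prems(2) f(1,2)]
    let ?g = "trunc {\<beta>} f"
    have "{\<gamma>. srefl i \<gamma> \<in> {\<beta>}} = {\<beta>'}"
      using 2 partial_chain_step.hyps(1) inj_onD[OF inj_srefl[of i UNIV]] by auto
    then have pg: "phi q i ?g = F"
      using phi_trunc[OF partial_chain_step.prems(1) partial_chain_step.hyps(1) fK, of "{\<beta>}"] F(4) f(3) by (simp add: trunc_supported)
    then have "?g \<noteq> 0" using F(3) by (auto simp: phi_linear pointwise)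
    then obtain v where v: "?g v \<noteq> 0" by (auto simp: fun_eq_iff pointwise)
    have "v \<noteq> []"
    proof
      assume "v = []"
      then have "\<beta> = 0" using v by (auto simp: trunc_def split: if_splits)
      then have "\<beta>' = 0" using 2 partial_chain_step.hyps(1) srefl_srefl[of i \<beta>'] by simp
      then have "wt w = 0" using F(3,4) by (auto simp: supported_def)
      then show False using F(2) wt_zero by blast
    qed
    then show ?thesis using coideal_subalgD(7)[OF partial_chain_step.prems(2) f(1), of "{\<beta>}"] v supported_trunc by blast
  qed
qed simp

lemma partial_chain_pos:
  assumes "partial_chain q S X" "cbraid q" "coideal_subalg q S" shows "\<forall>\<beta>\<in>X. pos \<beta>"
proof
  fix \<beta> assume "\<beta> \<in> X"
  from partial_chain_weights[OF assms this] obtain f w where f: "f \<in> S" "w \<noteq> []" "f w \<noteq> 0" "supported {\<beta>} f" by blast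
  then have "\<beta> = wt w" by (auto simp: supported_def)
  then show "pos \<beta>" using wt_pos[of f q w] coideal_subalgD(2)[OF assms(3)] f by auto
qed

text \<open>Otherwise \<open>- simple i\<close> would be a weight of the remaining chain, whose
  weights are positive.\<close>

lemma partial_chain_step_notin:
  assumes "i < \<theta>" "letter i \<in> S" "partial_chain (refl i q) (step q i S) X" "cbraid q" "coideal_subalg q S"
  shows "simple i \<notin> srefl i ` X" "\<forall>\<beta>\<in>X. pos \<beta>"
proof -
  show p: "\<forall>\<beta>\<in>X. pos \<beta>"
    by (rule partial_chain_pos[OF assms(3) cbraid_refl[OF assms(4,1)] coideal_subalg_step[OF assms(4,1,5,2)]])
  show "simple i \<notin> srefl i ` X"
  proof
    assume "simple i \<in> srefl i ` X"
    then obtain \<beta> where "\<beta> \<in> X" "simple i = srefl i \<beta>" by blast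
    then have "\<beta> = srefl i (simple i)" using assms(1) by simp
    then have "\<beta> = - simple i" using assms(1) by (simp only: srefl_simple_self)
    then have "\<beta> i = - 1" by (simp add: pointwise simple_def)
    then show False using p \<open>\<beta> \<in> X\<close> by (auto simp: pos_def dest!: bspec spec[of _ i])
  qed
qed

lemma partial_chain_card:
  "i < \<theta> \<Longrightarrow> letter i \<in> S \<Longrightarrow> partial_chain (refl i q) (step q i S) X \<Longrightarrow> cbraid q \<Longrightarrow> coideal_subalg q S
    \<Longrightarrow> card (insert (simple i) (srefl i ` X)) = Suc (card X)"
  using partial_chain_step_notin(1)[of i S q X] partial_chain_finite[of "refl i q" "step q i S" X] by (simp add: card_image inj_srefl)

section \<open>Dimension counts along chains\<close>

lemma part_nonneg: "S \<subseteq> nich \<theta> q \<Longrightarrow> part S A = part S (A \<inter> {\<alpha>. (\<forall>l. 0 \<le> \<alpha> l) \<and> (\<forall>l\<ge>\<theta>. \<alpha> l = 0)})"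
  using nich_set wt_nonneg
  by (fastforce simp: part_def supported_def wt_def count_list_0_iff subset_iff)

text \<open>One induction for two results: \<open>R\<close> is equality for full chains and an
  inequality for partial ones. The induction runs over a bound on the \<open>i\<close>-th
  coordinates of the weights in \<open>A\<close>, which drops when \<open>A\<close> is shifted by
  \<open>simple i\<close>.\<close>

lemma hdim_recursion:
  assumes q: "cbraid q" and i: "i < \<theta>" and S: "coideal_subalg q S" and li: "letter i \<in> S"
    and X: "finite X" "\<forall>\<beta>\<in>insert (simple i) (srefl i ` X). pos \<beta>" "simple i \<notin> srefl i ` X"
    and R: "\<And>x y z w :: nat. R x y \<Longrightarrow> R z w \<Longrightarrow> R (x + z) (y + w)" "R 0 0"
    and IH: "\<And>A. finite A \<Longrightarrow> R (hdim (step q i S) A) (card (partitions X A))"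
    and A: "finite A"
  shows "R (hdim S A) (card (partitions (insert (simple i) (srefl i ` X)) A))"
proof -
  let ?Y = "insert (simple i) (srefl i ` X)"
  have main: "finite A \<Longrightarrow> (\<And>\<alpha>. \<alpha> \<in> A \<Longrightarrow> \<alpha> i < int N) \<Longrightarrow> R (hdim S A) (card (partitions ?Y A))" for N A
  proof (induction N arbitrary: A)
    case 0
    have "part S A \<subseteq> {0}"
    proof
      fix f assume f: "f \<in> part S A"
      have "f w = 0" for w
      proof (rule ccontr)
        assume "f w \<noteq> 0"
        then have "wt w \<in> A" using f by (auto simp: part_def supported_def)
        then show False using 0 wt_nonneg[of w i] by fastforce
      qed
      then show "f \<in> {0}" by (auto simp: fun_eq_iff pointwise)
    qed
    then have "hdim S A = 0"
      using fv.dim_le_card[of "part S A" "{}"] unfolding fv.span_empty hdim_def by simp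
    moreover have "partitions ?Y A = {}"
    proof -
      have "comb ?Y n \<notin> A" for n using comb_nonneg[OF X(2), of n i] 0(2)[of "comb ?Y n"] by auto
      then show ?thesis by (auto simp: partitions_def)
    qed
    ultimately show ?case using R(2) by simp
  next
    case (Suc N)
    have s: "finite {\<alpha>. \<alpha> + simple i \<in> A}" by (rule finite_shift[OF Suc.prems(1)])
    have "R (hdim S {\<alpha>. \<alpha> + simple i \<in> A}) (card (partitions ?Y {\<alpha>. \<alpha> + simple i \<in> A}))"
      using Suc.prems(2) by (intro Suc.IH s) (force simp: pointwise simple_def)
    moreover have "R (hdim (step q i S) (srefl i ` A)) (card (partitions (srefl i ` X) A))"
      unfolding card_partitions_srefl[OF i X(1)] by (rule IH) (simp add: Suc.prems)
    ultimately show ?case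
      using X by (subst hdim_step[OF q i S li Suc.prems(1)], subst card_partitions_insert) (auto intro: R Suc.prems)
  qed
  have "\<alpha> i < int (Suc (nat (\<Sum>\<alpha>\<in>A. \<bar>\<alpha> i\<bar>)))" if "\<alpha> \<in> A" for \<alpha>
    using member_le_sum[OF that, of "\<lambda>\<alpha>. \<bar>\<alpha> i\<bar>"] A by simp
  then show ?thesis by (rule main[OF A])
qed

lemma hdim_scalars:
  assumes "S = range (\<lambda>c. fun_scale c sone :: nat list \<Rightarrow> 'k::field_char_0)"
  shows "hdim S A = card (partitions {} A)"
proof -
  have p: "partitions {} A = (if 0 \<in> A then {\<lambda>x. 0} else {})"
    by (auto simp: partitions_def comb_def zero_fun_def fun_eq_iff)
  show ?thesis
  proof (cases "0 \<in> A")
    case True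
    have sp: "part S A = fv.span {sone}"
      unfolding part_def assms fv.span_singleton using supported_mono[OF supported_sone, of A] True
      by (auto intro!: supported_linear)
    have "fv.independent {sone :: nat list \<Rightarrow> 'k}"
      using fv.independent_insert[of sone "{}"] by (auto simp: fun_eq_iff sone_def pointwise)
    then have "hdim S A = 1" unfolding hdim_def sp using fv.dim_span_eq_card_independent by fastforce
    then show ?thesis using True by (simp add: p)
  next
    case False
    have "part S A \<subseteq> {0}"
    proof
      fix f assume f: "f \<in> part S A"
      then obtain c where c: "f = fun_scale c sone" by (auto simp: part_def assms)
      have "c = 0"
      proof (rule ccontr)
        assume "c \<noteq> 0"
        then have "f [] \<noteq> 0" by (simp add: c pointwise)
        then have "wt [] \<in> A" using f unfolding part_def supported_def by blast
        then show False using False by simp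
      qed
      then show "f \<in> {0}" by (simp add: c)
    qed
    then have "hdim S A = 0"
      using fv.dim_le_card[of "part S A" "{}"] unfolding fv.span_empty hdim_def by simp
    then show ?thesis using False by (simp add: p)
  qed
qed

lemma scalars_subset: "coideal_subalg q S \<Longrightarrow> range (\<lambda>c. fun_scale c sone) \<subseteq> S"
  using coideal_subalgD(3) fv.subspace_scale[OF coideal_subalgD(1)] by blast

lemma hdim_full_chain:
  assumes "full_chain q S X" "cbraid q" "coideal_subalg q S" "finite A"
  shows "hdim S A = card (partitions X A)"
  using assms
proof (induction arbitrary: A rule: full_chain.induct)
  case (full_chain_nil S q)
  then show ?case using scalars_subset[of q S] by (intro hdim_scalars) blast
next
  case (full_chain_step i S q X)
  note p = full_chain_partial_chain[OF full_chain_step.hyps(3)]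
  note cb = cbraid_refl[OF full_chain_step.prems(1) full_chain_step.hyps(1)]
  note rs = coideal_subalg_step[OF full_chain_step.prems(1) full_chain_step.hyps(1) full_chain_step.prems(2) full_chain_step.hyps(2)]
  note nn = partial_chain_step_notin[OF full_chain_step.hyps(1,2) p full_chain_step.prems(1,2)]
  note pp = partial_chain_pos[OF partial_chain_step[OF full_chain_step.hyps(1,2) p] full_chain_step.prems(1,2)]
  show ?case
    by (rule hdim_recursion[OF full_chain_step.prems(1) full_chain_step.hyps(1) full_chain_step.prems(2) full_chain_step.hyps(2)
          partial_chain_finite[OF p] pp nn(1) _ _ _ full_chain_step.prems(3)])
      (auto intro: full_chain_step.IH[OF cb rs])
qed

lemma hdim_partial_chain:
  fixes S :: "(nat list \<Rightarrow> 'k::field_char_0) set"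
  assumes "partial_chain q S X" "cbraid q" "coideal_subalg q S" "finite A"
  shows "card (partitions X A) \<le> hdim S A"
  using assms
proof (induction arbitrary: A rule: partial_chain.induct)
  case (partial_chain_nil q S)
  let ?T = "range (\<lambda>c. fun_scale c sone :: nat list \<Rightarrow> 'k)"
  have "card (partitions {} A) = hdim ?T A" by (rule hdim_scalars[OF refl, symmetric])
  also have "\<dots> \<le> hdim S A"
    by (rule hdim_mono[OF scalars_subset[OF partial_chain_nil(2)] coideal_subalgD(2)[OF partial_chain_nil(2)] partial_chain_nil(3)])
  finally show ?case .
next
  case (partial_chain_step i S q X)
  note p = partial_chain_step.hyps(3)
  note cb = cbraid_refl[OF partial_chain_step.prems(1) partial_chain_step.hyps(1)]
  note rs = coideal_subalg_step[OF partial_chain_step.prems(1) partial_chain_step.hyps(1) partial_chain_step.prems(2) partial_chain_step.hyps(2)]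
  note nn = partial_chain_step_notin[OF partial_chain_step.hyps(1,2) p partial_chain_step.prems(1,2)]
  note pp = partial_chain_pos[OF partial_chain.partial_chain_step[OF partial_chain_step.hyps(1,2) p] partial_chain_step.prems(1,2)]
  show ?case
    by (rule hdim_recursion[where R = "\<lambda>x y. y \<le> x", OF partial_chain_step.prems(1) partial_chain_step.hyps(1) partial_chain_step.prems(2) partial_chain_step.hyps(2)
          partial_chain_finite[OF p] pp nn(1) _ _ _ partial_chain_step.prems(3)])
      (auto intro: partial_chain_step.IH[OF cb rs])
qed

section \<open>Existence and extension of chains\<close>

lemma coideal_subalg_nontrivial:
  assumes "coideal_subalg q S" "\<not> S \<subseteq> range (\<lambda>c. fun_scale c sone)" shows "\<exists>i<\<theta>. letter i \<in> S"
proof -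
  from assms(2) obtain f where f: "f \<in> S" "f \<notin> range (\<lambda>c. fun_scale c sone)" by blast
  have "\<exists>w. w \<noteq> [] \<and> f w \<noteq> 0"
  proof (rule ccontr)
    assume "\<nexists>w. w \<noteq> [] \<and> f w \<noteq> 0"
    then have "f = fun_scale (f []) sone" by (auto simp: fun_eq_iff pointwise sone_def)
    then show False using f(2) by blast
  qed
  then show ?thesis using coideal_subalg_letter[OF assms(1) f(1)] by blast
qed

text \<open>Greedy construction: an algebra larger than the scalars contains a letter and admits one
  more link, and every link lowers the bound \<open>N\<close> by 1.\<close>

lemma full_chain_exists:
  assumes "\<And>X. partial_chain q S X \<Longrightarrow> card X \<le> N" "cbraid q" "coideal_subalg q S"
  shows "\<exists>X. full_chain q S X"
  using assms
proof (induction N arbitrary: q S)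
  case (0 q S)
  show ?case
  proof (cases "S \<subseteq> range (\<lambda>c. fun_scale c sone)")
    case False
    then obtain i where "i < \<theta>" "letter i \<in> S" using coideal_subalg_nontrivial[OF 0(3)] by blast
    from partial_chain_step[OF this partial_chain_nil] have "partial_chain q S {simple i}" by simp
    from 0(1)[OF this] show ?thesis by simp
  qed (blast intro: full_chain_nil)
next
  case (Suc N q S)
  show ?case
  proof (cases "S \<subseteq> range (\<lambda>c. fun_scale c sone)")
    case False
    then obtain i where i: "i < \<theta>" "letter i \<in> S" using coideal_subalg_nontrivial[OF Suc(4)] by blast
    have "\<exists>X. full_chain (refl i q) (step q i S) X"
    proof (rule Suc.IH[OF _ cbraid_refl[OF Suc(3) i(1)] coideal_subalg_step[OF Suc(3) i(1) Suc(4) i(2)]])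
      fix X assume X: "partial_chain (refl i q) (step q i S) X"
      from Suc(2)[OF partial_chain_step[OF i X]] show "card X \<le> N"
        unfolding partial_chain_card[OF i X Suc(3,4)] by simp
    qed
    then show ?thesis using full_chain_step[OF i] by blast
  qed (blast intro: full_chain_nil)
qed

text \<open>The reflections made in \<open>E\<close> can also be made in \<open>F\<close> because
  \<open>step\<close> is monotone; when the chain of \<open>E\<close> is exhausted, it is continued
  greedily in what remains of \<open>F\<close>.\<close>

lemma partial_chain_extend:
  assumes "partial_chain q E X" "cbraid q" "coideal_subalg q E" "coideal_subalg q F" "E \<subseteq> F" "\<And>Y. partial_chain q F Y \<Longrightarrow> card Y \<le> N"
  shows "\<exists>Y. full_chain q F Y \<and> X \<subseteq> Y"
  using assms
proof (induction arbitrary: F N rule: partial_chain.induct)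
  case (partial_chain_nil q S)
  then show ?case using full_chain_exists[of q F N] by blast
next
  case (partial_chain_step i S q X F N)
  have li: "letter i \<in> F" using partial_chain_step by blast
  note cb = cbraid_refl[OF partial_chain_step.prems(1) partial_chain_step.hyps(1)]
  note rs = coideal_subalg_step[OF partial_chain_step.prems(1) partial_chain_step.hyps(1) partial_chain_step.prems(2) partial_chain_step.hyps(2)]
  note rF = coideal_subalg_step[OF partial_chain_step.prems(1) partial_chain_step.hyps(1) partial_chain_step.prems(3) li]
  have "card Y \<le> N" if Y: "partial_chain (refl i q) (step q i F) Y" for Y
    using partial_chain_step.prems(5)[OF partial_chain.partial_chain_step[OF partial_chain_step.hyps(1) li Y]]
    unfolding partial_chain_card[OF partial_chain_step.hyps(1) li Y partial_chain_step.prems(1,3)] by simp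
  from partial_chain_step.IH[OF cb rs rF step_mono[OF partial_chain_step.prems(4)] this]
  obtain Y where "full_chain (refl i q) (step q i F) Y" "X \<subseteq> Y" by blast
  then show ?case using full_chain_step[OF partial_chain_step.hyps(1) li] by blast
qed

subsection \<open>Growth and chains\<close>

lemma card_bounded_funs_le:
  assumes X: "finite X"
  shows "card {n :: 'b \<Rightarrow> nat. (\<forall>x. x \<notin> X \<longrightarrow> n x = 0) \<and> (\<forall>x\<in>X. n x \<le> N)} \<le> (N + 1) ^ card X"
proof -
  let ?S = "{n :: 'b \<Rightarrow> nat. (\<forall>x. x \<notin> X \<longrightarrow> n x = 0) \<and> (\<forall>x\<in>X. n x \<le> N)}"
  have "card ?S \<le> card (X \<rightarrow>\<^sub>E {..N})"
  proof (rule card_inj_on_le)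
    show "inj_on (\<lambda>n. restrict n X) ?S"
    proof (rule inj_onI, rule ext)
      fix n m x assume nm: "n \<in> ?S" "m \<in> ?S" and e: "restrict n X = restrict m X"
      show "n x = m x" using fun_cong[OF e, of x] nm by (cases "x \<in> X") simp_all
    qed
  qed (auto intro: finite_PiE X)
  then show ?thesis using X by (simp add: card_PiE)
qed

lemma comb_outside: "\<forall>x\<in>X. pos x \<Longrightarrow> l \<ge> \<theta> \<Longrightarrow> comb X n l = 0"
  unfolding comb_def by (intro sum.neutral) (simp add: pos_def)

lemma hdim_zero: "part S A \<subseteq> {0} \<Longrightarrow> hdim S A = 0"
  using fv.dim_le_card[of "part S A" "{}"] unfolding fv.span_empty hdim_def by simp

lemma partitions_lower:
  assumes X: "finite X" "\<forall>x\<in>X. pos x" and C: "\<forall>x\<in>X. ht x \<le> int C"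
  shows "(m + 1) ^ card X \<le> card (partitions X (wball (card X * C * m)))"
proof -
  have "card (X \<rightarrow>\<^sub>E {..m}) \<le> card (partitions X (wball (card X * C * m)))"
  proof (rule card_inj_on_le)
    let ?g = "\<lambda>f x. if x \<in> X then f x else (0::nat)"
    show "inj_on ?g (X \<rightarrow>\<^sub>E {..m})"
    proof (rule inj_onI, rule ext)
      fix f f' x assume f: "f \<in> X \<rightarrow>\<^sub>E {..m}" "f' \<in> X \<rightarrow>\<^sub>E {..m}" and e: "?g f = ?g f'"
      show "f x = f' x"
        using fun_cong[OF e, of x] PiE_arb[OF f(1), of x] PiE_arb[OF f(2), of x] by (cases "x \<in> X") simp_all
    qed
    show "?g ` (X \<rightarrow>\<^sub>E {..m}) \<subseteq> partitions X (wball (card X * C * m))"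
    proof
      fix n assume "n \<in> ?g ` (X \<rightarrow>\<^sub>E {..m})"
      then have n: "\<And>x. x \<notin> X \<Longrightarrow> n x = 0" "\<And>x. x \<in> X \<Longrightarrow> n x \<le> m" by auto
      have "ht (comb X n) \<le> (\<Sum>x\<in>X. int m * int C)"
        unfolding ht_comb using n(2) C pos_ht X(2)
        by (intro sum_mono mult_mono) (auto intro: order_trans[OF zero_le_one])
      also have "\<dots> = int (card X * C * m)" by simp
      finally have "comb X n \<in> wball (card X * C * m)"
        using comb_nonneg[OF X(2)] comb_outside[OF X(2)] by (auto simp: wball_def)
      then show "n \<in> partitions X (wball (card X * C * m))" using n by (simp add: partitions_def)
    qed
    show "finite (partitions X (wball (card X * C * m)))" by (rule finite_partitions[OF X finite_wball])
  qed
  then show ?thesis using X by (simp add: card_PiE)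
qed

lemma growth_partial_chain:
  assumes "growth S d" "partial_chain q S X" "cbraid q" "coideal_subalg q S" shows "card X \<le> d"
proof (rule ccontr)
  assume k: "\<not> card X \<le> d"
  obtain c where c: "\<And>n. hdim S (wball n) \<le> c * (n + 1) ^ d" using assms(1) unfolding growth_def by blast
  note X = partial_chain_finite[OF assms(2)] partial_chain_pos[OF assms(2-4)]
  obtain C where C: "\<forall>x\<in>X. ht x \<le> int C" using ht_bounded[OF X(1)] by blast
  let ?K = "card X * C + 1"
  \<comment> \<open>Chosen such that a chain with more than \<open>d\<close> weights would give
    \<open>(m + 1)^(d + 1) \<le> m (m + 1)^d\<close>.\<close>
  define m where "m = c * ?K ^ d"
  have "(m + 1) ^ d * (m + 1) = (m + 1) ^ Suc d" by simp
  also have "\<dots> \<le> (m + 1) ^ card X" using k by (intro power_increasing) auto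
  also have "\<dots> \<le> card (partitions X (wball (card X * C * m)))" by (rule partitions_lower[OF X C])
  also have "\<dots> \<le> hdim S (wball (card X * C * m))" by (rule hdim_partial_chain[OF assms(2-4) finite_wball])
  also have "\<dots> \<le> c * (card X * C * m + 1) ^ d" by (rule c)
  also have "\<dots> \<le> c * (?K * (m + 1)) ^ d" by (intro mult_le_mono power_mono) (auto simp: algebra_simps)
  also have "\<dots> = (m + 1) ^ d * (c * ?K ^ d)" by (simp only: power_mult_distrib mult.commute mult.left_commute)
  also have "c * ?K ^ d = m" by (simp add: m_def)
  finally have "m + 1 \<le> m" by (simp only: nat_mult_le_cancel1 zero_less_power add_gr_0 zero_less_one disj_not1 simp_thms)
  then show False by simp
qed

lemma hdim_full_chain_le:
  assumes "full_chain q S X" "cbraid q" "coideal_subalg q S" shows "hdim S (wball n) \<le> (n + 1) ^ card X"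
proof -
  note p = full_chain_partial_chain[OF assms(1)]
  note X = partial_chain_finite[OF p] partial_chain_pos[OF p assms(2,3)]
  have "card (partitions X (wball n)) \<le> card {m. (\<forall>x. x \<notin> X \<longrightarrow> m x = 0) \<and> (\<forall>x\<in>X. m x \<le> n)}"
    by (rule card_mono[OF finite_bounded_funs[OF X(1)] partitions_bound[OF X]]) (simp add: wball_def)
  also have "\<dots> \<le> (n + 1) ^ card X" by (rule card_bounded_funs_le[OF X(1)])
  finally show ?thesis using hdim_full_chain[OF assms finite_wball] by simp
qed

lemma full_chain_growth: "full_chain q S X \<Longrightarrow> cbraid q \<Longrightarrow> coideal_subalg q S \<Longrightarrow> growth S (card X)"
  unfolding growth_def using hdim_full_chain_le by (metis mult_1)

subsection \<open>Rotation of chains\<close>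

lemma trunc_qsh_letter: "trunc A (qsh q f (letter i)) = qsh q (trunc {\<alpha>. \<alpha> + simple i \<in> A} f) (letter i)"
proof -
  let ?B = "{\<alpha>. \<alpha> + simple i \<in> A}"
  have 1: "supported A (qsh q (trunc ?B f) (letter i))"
    by (rule supported_qsh[OF supported_trunc supported_letter]) auto
  have 2: "supported (- A) (qsh q (trunc (- ?B) f) (letter i))"
    by (rule supported_qsh[OF supported_trunc supported_letter]) auto
  have "trunc A (qsh q (trunc (- ?B) f) (letter i)) = 0"
    using 2 by (auto simp: supported_def trunc_def fun_eq_iff pointwise)
  moreover have "qsh q f (letter i) = qsh q (trunc ?B f) (letter i) + qsh q (trunc (- ?B) f) (letter i)"
    unfolding qsh_add_left[symmetric] trunc_split[symmetric] ..
  ultimately show ?thesis using trunc_supported[OF 1] by simp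
qed

lemma coideal_subalg_step_nich: "cbraid q \<Longrightarrow> i < \<theta> \<Longrightarrow> coideal_subalg (refl i q) (step q i (nich \<theta> q))"
  by (rule coideal_subalg_step[OF _ _ coideal_subalg_nich nich_letter])

lemma step_nich: "step q i (nich \<theta> q) = phi q i ` kern q i"
  by (auto simp: step_def kern_def)

lemma lpow_step:
  assumes q: "cbraid q" and i: "i < \<theta>" and j: "j < \<theta>" "j \<noteq> i" and n: "n \<le> mm i j"
  shows "lpow i j n \<in> step q i (nich \<theta> q)"
proof -
  have nz: "adcoeff q i j (mm i j) \<noteq> 0" using adcoeff_zero_iff[OF q i j(1)] j(2) by simp
  have "adlet q i j (mm i j - n) \<in> kern q i" using kgen_adlet[OF j] by (simp add: kern_eq_kgen[OF q i])
  then have "fun_scale (adcoeff q i j (mm i j)) (lpow i j n) \<in> step q i (nich \<theta> q)"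
    unfolding step_nich phi_adlet[OF q i j n, symmetric] by blast
  from fv.subspace_scale[OF coideal_subalgD(1)[OF coideal_subalg_step_nich[OF q i]] this, of "inverse (adcoeff q i j (mm i j))"]
  show ?thesis using nz by simp
qed

text \<open>By \<open>lpow_commutator\<close> the letter moves to the right past the generators of
  the subalgebra. The correction term stays in the subalgebra; at the end of the string, where the
  next \<open>lpow\<close> would leave it, the coefficient is 0.\<close>

lemma letter_phi:
  assumes q: "cbraid q" and i: "i < \<theta>"
  shows "f \<in> kgen q i \<Longrightarrow> \<exists>e\<in>step q i (nich \<theta> q). \<exists>g\<in>nich \<theta> (refl i q).
    qsh (refl i q) (letter i) (phi q i f) = e + qsh (refl i q) g (letter i)"
proof (induction rule: kgen.induct)
  case kgen_sone
  show ?case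
    by (rule bexI[OF _ fv.subspace_0[OF coideal_subalgD(1)[OF coideal_subalg_step_nich[OF q i]]]], rule bexI[OF _ nich_sone])
      (simp add: phi_sone[OF i])
next
  case (kgen_add f f')
  then obtain e g e' g' where *: "e \<in> step q i (nich \<theta> q)" "g \<in> nich \<theta> (refl i q)"
    "e' \<in> step q i (nich \<theta> q)" "g' \<in> nich \<theta> (refl i q)"
    "qsh (refl i q) (letter i) (phi q i f) = e + qsh (refl i q) g (letter i)"
    "qsh (refl i q) (letter i) (phi q i f') = e' + qsh (refl i q) g' (letter i)" by blast
  show ?case
    by (rule bexI[OF _ fv.subspace_add[OF coideal_subalgD(1)[OF coideal_subalg_step_nich[OF q i]] *(1,3)]], rule bexI[OF _ nich_add[OF *(2,4)]])
      (simp add: phi_linear qsh_linear *)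
next
  case (kgen_scale f c)
  then obtain e g where *: "e \<in> step q i (nich \<theta> q)" "g \<in> nich \<theta> (refl i q)"
    "qsh (refl i q) (letter i) (phi q i f) = e + qsh (refl i q) g (letter i)" by blast
  show ?case
    by (rule bexI[OF _ fv.subspace_scale[OF coideal_subalgD(1)[OF coideal_subalg_step_nich[OF q i]] *(1)]], rule bexI[OF _ nich_scale[OF *(2)]])
      (simp add: phi_linear qsh_linear * fv.scale_right_distrib)
next
  case (kgen_mult j f m)
  let ?q = "refl i q" and ?E = "step q i (nich \<theta> q)"
  note E = coideal_subalgD[OF coideal_subalg_step_nich[OF q i]] and cb = cbraid_refl[OF q i]
  obtain e g where *: "e \<in> ?E" "g \<in> nich \<theta> ?q" "qsh ?q (letter i) (phi q i f) = e + qsh ?q g (letter i)"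
    using kgen_mult by blast
  have fK: "f \<in> kern q i" "adlet q i j m \<in> kern q i"
    using kgen_mult kgen_adlet[of j i q m] by (auto simp: kern_eq_kgen[OF q i])
  have mult: "phi q i (qsh q (adlet q i j m) f) = qsh ?q (phi q i (adlet q i j m)) (phi q i f)"
    by (rule phi_qsh[OF q i fK(2,1)])
  show ?case
  proof (cases "m \<le> mm i j")
    case False
    then have "adcoeff q i j m = 0" using adcoeff_zero_iff[OF q i kgen_mult(1)] kgen_mult(2) by simp
    then have "phi q i (qsh q (adlet q i j m) f) = 0" unfolding mult by (simp add: adlet_eq[OF q] phi_linear)
    then show ?thesis by (intro bexI[OF _ fv.subspace_0[OF E(1)]] bexI[OF _ nich_zero]) simp
  next
    case True
    define n where "n = mm i j - m"
    have n: "n \<le> mm i j" "m = mm i j - n" using True by (auto simp: n_def)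
    define c where "c = ?q j i * ?q i i ^ n"
    have c: "c \<noteq> 0" using cbraid_nz[OF cb] by (simp add: c_def)
    define r where "r = fun_scale (lcoeff ?q i j n) (lpow i j (Suc n))"
    have r: "r \<in> ?E"
    \<comment> \<open>This is the end of the string.\<close>
    proof (cases "n = mm i j")
      case True
      have "lcoeff ?q i j n = 0"
        using cbraid_inverse[OF cb i kgen_mult(1)] kgen_mult(2) True by (simp add: lcoeff_def mult.commute)
      then show ?thesis using fv.subspace_0[OF E(1)] by (simp add: r_def)
    next
      case False
      then show ?thesis unfolding r_def using lpow_step[OF q i kgen_mult(1,2), of "Suc n"] n(1)
        by (intro fv.subspace_scale[OF E(1)]) auto
    qed
    have lp: "lpow i j n \<in> ?E" by (rule lpow_step[OF q i kgen_mult(1,2) n(1)])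
    have comm: "qsh ?q (lpow i j n) (letter i) - fun_scale c (qsh ?q (letter i) (lpow i j n)) = r"
      unfolding c_def r_def by (rule lpow_commutator) (use kgen_mult(2) in simp)
    have "fun_scale c (qsh ?q (letter i) (lpow i j n)) = qsh ?q (lpow i j n) (letter i) - r"
      unfolding comm[symmetric] by simp
    then have "fun_scale (inverse c) (fun_scale c (qsh ?q (letter i) (lpow i j n)))
      = fun_scale (inverse c) (qsh ?q (lpow i j n) (letter i) - r)" by simp
    then have comm': "qsh ?q (letter i) (lpow i j n) = fun_scale (inverse c) (qsh ?q (lpow i j n) (letter i) - r)"
      using c by simp
    let ?d = "adcoeff q i j (mm i j)"
    have "qsh ?q (letter i) (phi q i (qsh q (adlet q i j m) f))
        = fun_scale ?d (qsh ?q (qsh ?q (letter i) (lpow i j n)) (phi q i f))"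
      unfolding mult unfolding n(2) phi_adlet[OF q i kgen_mult(1,2) n(1)] by (simp add: qsh_linear qsh_assoc)
    also have "\<dots> = fun_scale ?d (fun_scale (inverse c) (qsh ?q (lpow i j n) e - qsh ?q r (phi q i f)))
        + qsh ?q (fun_scale ?d (fun_scale (inverse c) (qsh ?q (lpow i j n) g))) (letter i)"
      unfolding comm' by (simp add: qsh_linear qsh_assoc *(3) fv.scale_right_diff_distrib fv.scale_right_distrib)
    finally have eq: "qsh ?q (letter i) (phi q i (qsh q (adlet q i j m) f))
      = fun_scale ?d (fun_scale (inverse c) (qsh ?q (lpow i j n) e - qsh ?q r (phi q i f)))
        + qsh ?q (fun_scale ?d (fun_scale (inverse c) (qsh ?q (lpow i j n) g))) (letter i)" .
    have phE: "phi q i f \<in> ?E" using fK(1) unfolding step_nich by blast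
    have "fun_scale ?d (fun_scale (inverse c) (qsh ?q (lpow i j n) e - qsh ?q r (phi q i f))) \<in> ?E"
      by (intro fv.subspace_scale[OF E(1)] fv.subspace_diff[OF E(1)] E(4) lp *(1) r phE)
    moreover have "fun_scale ?d (fun_scale (inverse c) (qsh ?q (lpow i j n) g)) \<in> nich \<theta> ?q"
      using lp E(2) *(2) by (intro nich_scale nich_qsh) auto
    ultimately show ?thesis using eq by blast
  qed
qed

text \<open>Counterpart of \<open>nich_decompose\<close> on the reflected side. It bounds the
  reflected Nichols algebra from above, whereas chains only bound it from below.\<close>

lemma nich_refl_decompose:
  assumes q: "cbraid q" and i: "i < \<theta>"
  shows "F \<in> nich \<theta> (refl i q) \<Longrightarrow> \<exists>e\<in>step q i (nich \<theta> q). \<exists>g\<in>nich \<theta> (refl i q).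
    F = e + qsh (refl i q) g (letter i)"
proof (induction rule: nich.induct)
  note E = coideal_subalgD[OF coideal_subalg_step_nich[OF q i]] and cb = cbraid_refl[OF q i]
  {
    case nich_sone
    show ?case by (rule bexI[OF _ E(3)], rule bexI[OF _ nich_zero]) simp
  next
    case (nich_add f f')
    then obtain e g e' g' where *: "e \<in> step q i (nich \<theta> q)" "g \<in> nich \<theta> (refl i q)"
      "e' \<in> step q i (nich \<theta> q)" "g' \<in> nich \<theta> (refl i q)"
      "f = e + qsh (refl i q) g (letter i)" "f' = e' + qsh (refl i q) g' (letter i)" by blast
    show ?case
      by (rule bexI[OF _ fv.subspace_add[OF E(1) *(1,3)]], rule bexI[OF _ nich.nich_add[OF *(2,4)]])
        (simp add: qsh_linear *(5,6))
  next
    case (nich_scale f c)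
    then obtain e g where *: "e \<in> step q i (nich \<theta> q)" "g \<in> nich \<theta> (refl i q)"
      "f = e + qsh (refl i q) g (letter i)" by blast
    show ?case
      by (rule bexI[OF _ fv.subspace_scale[OF E(1) *(1)]], rule bexI[OF _ nich.nich_scale[OF *(2)]])
        (simp add: qsh_linear *(3) fv.scale_right_distrib)
  next
    case (nich_letter_mult j f)
    then obtain e g where *: "e \<in> step q i (nich \<theta> q)" "g \<in> nich \<theta> (refl i q)"
      "f = e + qsh (refl i q) g (letter i)" by blast
    have g': "qsh (refl i q) (letter j) g \<in> nich \<theta> (refl i q)"
      by (rule nich.nich_letter_mult[OF nich_letter_mult.hyps(1) *(2)])
    show ?case
    proof (cases "j = i")
      case True
      obtain h where h: "h \<in> kgen q i" "e = phi q i h" using *(1) unfolding step_nich kern_eq_kgen[OF q i] by blast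
      from letter_phi[OF q i h(1)] obtain e' g'' where **: "e' \<in> step q i (nich \<theta> q)" "g'' \<in> nich \<theta> (refl i q)"
        "qsh (refl i q) (letter i) e = e' + qsh (refl i q) g'' (letter i)" unfolding h(2) by blast
      show ?thesis
        by (rule bexI[OF _ **(1)], rule bexI[OF _ nich.nich_add[OF **(2) g']])
          (simp add: *(3) True qsh_linear **(3) qsh_assoc)
    next
      case False
      have "letter j \<in> step q i (nich \<theta> q)" using lpow_step[OF q i nich_letter_mult.hyps(1) False, of 0] by (simp add: lpow_0)
      from E(4)[OF this *(1)] show ?thesis
        by (rule bexI[rotated], intro bexI[OF _ g']) (simp add: *(3) qsh_linear qsh_assoc)
    qed
  }
qed

lemma hdim_refl_le:
  assumes q: "cbraid q" and i: "i < \<theta>" and A: "finite A"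
  shows "hdim (nich \<theta> (refl i q)) A \<le> hdim (step q i (nich \<theta> q)) A + hdim (nich \<theta> (refl i q)) {\<alpha>. \<alpha> + simple i \<in> A}"
proof -
  let ?E = "step q i (nich \<theta> q)" and ?q = "refl i q" and ?A = "{\<alpha>. \<alpha> + simple i \<in> A}"
  note E = coideal_subalgD[OF coideal_subalg_step_nich[OF q i]]
  obtain B where B: "B \<subseteq> part ?E A" "fv.independent B" "part ?E A \<subseteq> fv.span B" "card B = fv.dim (part ?E A)"
    by (rule fv.basis_exists)
  obtain C where C: "C \<subseteq> part (nich \<theta> ?q) ?A" "fv.independent C" "part (nich \<theta> ?q) ?A \<subseteq> fv.span C"
      "card C = fv.dim (part (nich \<theta> ?q) ?A)"
    by (rule fv.basis_exists)
  have fB: "finite B"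
    using part_finite[OF E(2) A] fv.independent_span_bound[OF _ B(2)] B(1) by (meson order_trans)
  have fC: "finite C"
    using part_finite[OF order_refl finite_shift[OF A, of "simple i"], of "refl i q"] fv.independent_span_bound[OF _ C(2)] C(1)
    by (meson order_trans)
  let ?R = "\<lambda>g. qsh ?q g (letter i)"
  have lin: "Vector_Spaces.linear fun_scale fun_scale ?R"
    unfolding Vector_Spaces.linear_iff using fv.vector_space_axioms by (auto simp: qsh_linear)
  interpret R: Vector_Spaces.linear fun_scale fun_scale ?R by (rule lin)
  have "part (nich \<theta> ?q) A \<subseteq> fv.span (B \<union> ?R ` C)"
  proof
    fix F assume F: "F \<in> part (nich \<theta> ?q) A"
    then obtain e g where eg: "e \<in> ?E" "g \<in> nich \<theta> ?q" "F = e + qsh ?q g (letter i)"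
      using nich_refl_decompose[OF q i, of F] by (auto simp: part_def)
    have "F = trunc A F" using F by (simp add: part_def trunc_supported)
    also have "\<dots> = trunc A e + ?R (trunc ?A g)" by (simp add: eg trunc_qsh_letter)
    finally have eq: "F = trunc A e + ?R (trunc ?A g)" .
    have "trunc A e \<in> fv.span B" using B(3) E(7)[OF eg(1)] by (auto simp: part_def)
    then have 1: "trunc A e \<in> fv.span (B \<union> ?R ` C)" using fv.span_mono[of B "B \<union> ?R ` C"] by blast
    have "trunc ?A g \<in> fv.span C" using C(3) nich_trunc[OF eg(2)] by (auto simp: part_def)
    then have "?R (trunc ?A g) \<in> fv.span (?R ` C)" using R.span_image[of C] by blast
    then have 2: "?R (trunc ?A g) \<in> fv.span (B \<union> ?R ` C)" using fv.span_mono[of "?R ` C" "B \<union> ?R ` C"] by blast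
    show "F \<in> fv.span (B \<union> ?R ` C)" unfolding eq using 1 2 by (rule fv.span_add)
  qed
  then have "hdim (nich \<theta> ?q) A \<le> card (B \<union> ?R ` C)"
    unfolding hdim_def by (rule fv.dim_le_card) (use fB fC in simp)
  also have "\<dots> \<le> card B + card C"
    using card_Un_le[of B "?R ` C"] card_image_le[OF fC, of ?R] by simp
  finally show ?thesis unfolding hdim_def B(4) C(4) .
qed

text \<open>Shifting by \<open>simple i\<close> lowers the radius of a ball by 1, so the bound
  \<open>(n + 1) ^ card X\<close> is summed over all radii up to \<open>n\<close>, which costs one
  more factor \<open>n + 1\<close>.\<close>

lemma hdim_refl_growth:
  assumes q: "cbraid q" and i: "i < \<theta>" and X: "full_chain (refl i q) (step q i (nich \<theta> q)) X"
  shows "growth (nich \<theta> (refl i q)) (Suc (card X))"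
proof -
  let ?E = "step q i (nich \<theta> q)" and ?N = "nich \<theta> (refl i q)"
  have E: "hdim ?E (wball n) \<le> (n + 1) ^ card X" for n
    by (rule hdim_full_chain_le[OF X cbraid_refl[OF q i] coideal_subalg_step_nich[OF q i]])
  have "hdim ?N (wball n) \<le> (n + 1) * (n + 1) ^ card X" for n
  proof (induction n)
    case 0
    have "{\<alpha>. \<alpha> + simple i \<in> wball 0} \<inter> {\<alpha>. (\<forall>l. 0 \<le> \<alpha> l) \<and> (\<forall>l\<ge>\<theta>. \<alpha> l = 0)} = {}"
    proof -
      have "0 \<le> ht \<alpha>" if "\<forall>l. 0 \<le> \<alpha> l" for \<alpha> using that by (simp add: ht_def sum_nonneg)
      moreover have "ht \<alpha> + 1 \<le> 0" if "\<alpha> + simple i \<in> wball 0" for \<alpha>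
        using that ht_add[of \<alpha> "simple i"] ht_simple[OF i] by (simp add: wball_def)
      ultimately have False if "\<alpha> + simple i \<in> wball 0" "\<forall>l. 0 \<le> \<alpha> l" for \<alpha>
        using that by (metis add_increasing zero_less_one linorder_not_le zle_add1_eq_le)
      then show ?thesis by blast
    qed
    then have "part ?N {\<alpha>. \<alpha> + simple i \<in> wball 0} = part ?N {}"
      using part_nonneg[OF order_refl, where A = "{\<alpha>. \<alpha> + simple i \<in> wball 0}"] by simp
    also have "\<dots> \<subseteq> {0}" by (auto simp: part_def supported_def fun_eq_iff pointwise)
    finally have "hdim ?N {\<alpha>. \<alpha> + simple i \<in> wball 0} = 0"
      by (rule hdim_zero)
    then show ?case using hdim_refl_le[OF q i finite_wball, of 0] E[of 0] by simp
  next
    case (Suc n)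
    have "{\<alpha>. \<alpha> + simple i \<in> wball (Suc n)} \<inter> {\<alpha>. (\<forall>l. 0 \<le> \<alpha> l) \<and> (\<forall>l\<ge>\<theta>. \<alpha> l = 0)} \<subseteq> wball n"
      using i by (auto simp: wball_def ht_add ht_simple)
    then have "part ?N {\<alpha>. \<alpha> + simple i \<in> wball (Suc n)} \<subseteq> part ?N (wball n)"
      using part_nonneg[OF order_refl, where A = "{\<alpha>. \<alpha> + simple i \<in> wball (Suc n)}"]
      by (auto simp: part_def intro: supported_mono)
    moreover obtain F where "finite F" "part ?N (wball n) \<subseteq> fv.span F"
      using part_finite[OF order_refl finite_wball] by blast
    ultimately have "hdim ?N {\<alpha>. \<alpha> + simple i \<in> wball (Suc n)} \<le> hdim ?N (wball n)"
      unfolding hdim_def by (intro dim_mono_fin)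
    then have "hdim ?N (wball (Suc n)) \<le> (Suc n + 1) ^ card X + (n + 1) * (n + 1) ^ card X"
      using hdim_refl_le[OF q i finite_wball, of "Suc n"] E[of "Suc n"] Suc by linarith
    also have "\<dots> \<le> (Suc n + 1) ^ card X + (n + 1) * (Suc n + 1) ^ card X"
      by (intro add_left_mono mult_left_mono power_mono) auto
    also have "\<dots> = (Suc n + 1) * (Suc n + 1) ^ card X" by simp
    finally show ?case .
  qed
  then show ?thesis unfolding growth_def by (intro exI[of _ 1]) (simp add: ac_simps)
qed

section \<open>Uniqueness and rotation of full chains\<close>

lemma full_chain_unique:
  assumes "full_chain q S X" "full_chain q S Y" "cbraid q" "coideal_subalg q S" shows "X = Y"
proof (rule partitions_unique)
  note p = full_chain_partial_chain[OF assms(1)] full_chain_partial_chain[OF assms(2)]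
  show "finite X" "finite Y" using p partial_chain_finite by blast+
  show "\<forall>x\<in>X. pos x" "\<forall>x\<in>Y. pos x" using p assms(3,4) partial_chain_pos by blast+
  show "card (partitions X A) = card (partitions Y A)" if "finite A" for A
    using hdim_full_chain[OF assms(1,3,4) that] hdim_full_chain[OF assms(2,3,4) that] by simp
qed

text \<open>The weight space contains the letter, so the weight is a sum of elements of
  \<open>X\<close>; having the minimal height 1 it is not a proper sum.\<close>

lemma full_chain_simple:
  assumes "full_chain q (nich \<theta> q) X" "cbraid q" "i < \<theta>" shows "simple i \<in> X"
proof -
  note p = full_chain_partial_chain[OF assms(1)]
  note X = partial_chain_finite[OF p] partial_chain_pos[OF p assms(2) coideal_subalg_nich]
  have ps: "pos (simple i)" using assms(3) by (auto simp: pos_def simple_def fun_eq_iff pointwise)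
  have "hdim (nich \<theta> q) {simple i} \<noteq> 0"
  proof -
    have "partial_chain q (nich \<theta> q) {simple i}"
      using partial_chain_step[OF assms(3) nich_letter[OF assms(3)] partial_chain_nil] by simp
    from hdim_partial_chain[OF this assms(2) coideal_subalg_nich, of "{simple i}"]
    have "card (partitions {simple i} {simple i}) \<le> hdim (nich \<theta> q) {simple i}" by simp
    moreover have "partitions {simple i} {simple i} \<noteq> {}" using partitions_singleton[of "{simple i}" "simple i"] by blast
    moreover have "finite (partitions {simple i} {simple i})" using ps by (intro finite_partitions) auto
    ultimately show ?thesis by (metis card_gt_0_iff le_zero_eq less_irrefl)
  qed
  then have "card (partitions X {simple i}) \<noteq> 0" using hdim_full_chain[OF assms(1,2) coideal_subalg_nich] by simp
  then obtain n where n: "n \<in> partitions X {simple i}" by (metis card.empty ex_in_conv)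
  show ?thesis
    by (rule partitions_minimal[OF X n _ ps]) (use pos_ht X(2) ht_simple[OF assms(3)] in auto)
qed

text \<open>By uniqueness the chain of \<open>q\<close> may be started with \<open>i\<close>. The
  rest \<open>X1\<close> is a chain of the subalgebra and extends to a full chain of the reflected
  Nichols algebra. By \<open>hdim_refl_growth\<close> there is room for only one further weight, and
  \<open>simple i\<close> must occur.\<close>

lemma full_chain_rotate:
  assumes X: "full_chain q (nich \<theta> q) X" and q: "cbraid q" and i: "i < \<theta>"
  shows "full_chain (refl i q) (nich \<theta> (refl i q)) (insert (simple i) (srefl i ` (X - {simple i})))"
    "card (insert (simple i) (srefl i ` (X - {simple i}))) = card X"
proof -
  let ?E = "step q i (nich \<theta> q)" and ?q = "refl i q"
  note li = nich_letter[OF i, of q] and cb = cbraid_refl[OF q i] and rE = coideal_subalg_step_nich[OF q i]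
  have bd: "card Y \<le> card X" if "partial_chain q (nich \<theta> q) Y" for Y
    by (rule growth_partial_chain[OF full_chain_growth[OF X q coideal_subalg_nich] that q coideal_subalg_nich])
  have "card Y \<le> card X" if Y: "partial_chain ?q ?E Y" for Y
    using bd[OF partial_chain_step[OF i li Y]] unfolding partial_chain_card[OF i li Y q coideal_subalg_nich] by simp
  from full_chain_exists[OF this cb rE] obtain X1 where X1: "full_chain ?q ?E X1" by blast
  note p1 = full_chain_partial_chain[OF X1]
  have Xeq: "X = insert (simple i) (srefl i ` X1)"
    by (rule full_chain_unique[OF X full_chain_step[OF i li X1] q coideal_subalg_nich])
  have cX: "card X = Suc (card X1)" unfolding Xeq by (rule partial_chain_card[OF i li p1 q coideal_subalg_nich])
  have ni: "simple i \<notin> srefl i ` X1" by (rule partial_chain_step_notin(1)[OF i li p1 q coideal_subalg_nich])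
  then have X1eq: "X1 = srefl i ` (X - {simple i})"
    unfolding Xeq using i by (auto simp: image_image)
  have "card Y \<le> Suc (card X1)" if "partial_chain ?q (nich \<theta> ?q) Y" for Y
    by (rule growth_partial_chain[OF hdim_refl_growth[OF q i X1] that cb coideal_subalg_nich])
  note bd' = this
  from partial_chain_extend[OF p1 cb rE coideal_subalg_nich coideal_subalgD(2)[OF rE] bd']
  obtain Y where Y: "full_chain ?q (nich \<theta> ?q) Y" "X1 \<subseteq> Y" by blast
  \<comment> \<open>Otherwise its reflection, a negative weight, would belong to
    \<open>X\<close>.\<close>
  have n1: "simple i \<notin> X1"
  proof
    assume "simple i \<in> X1"
    then have "srefl i (simple i) \<in> X" unfolding Xeq by blast
    then have "pos (- simple i)" using partial_chain_pos[OF full_chain_partial_chain[OF X] q coideal_subalg_nich] i by (simp add: srefl_simple_self)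
    then show False by (auto simp: pos_def simple_def pointwise dest!: spec[of _ i])
  qed
  have fY: "finite Y" by (rule partial_chain_finite[OF full_chain_partial_chain[OF Y(1)]])
  have sub: "insert (simple i) X1 \<subseteq> Y" using Y full_chain_simple[OF Y(1) cb i] by simp
  moreover have "card Y \<le> card (insert (simple i) X1)"
    using bd'[OF full_chain_partial_chain[OF Y(1)]] n1 partial_chain_finite[OF p1] by simp
  ultimately have "Y = insert (simple i) X1" by (metis card_seteq fY)
  then show "full_chain ?q (nich \<theta> ?q) (insert (simple i) (srefl i ` (X - {simple i})))"
    "card (insert (simple i) (srefl i ` (X - {simple i}))) = card X"
    using Y(1) n1 cX partial_chain_finite[OF p1] unfolding X1eq by auto
qed

subsection \<open>Finiteness of the Cartan matrix\<close>

text \<open>Bounds the factor by which a simple reflection can enlarge the greatest coordinate of a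
  weight.\<close>

definition amax :: int
  where "amax = 1 + (\<Sum>i<\<theta>. \<Sum>j<\<theta>. \<bar>a i j\<bar>)"

lemma amax_ge_1: "1 \<le> amax"
  by (simp add: amax_def sum_nonneg)

lemma srefl_bound:
  assumes i: "i < \<theta>" and B: "\<And>l. \<bar>\<beta> l\<bar> \<le> B" shows "\<bar>srefl i \<beta> l\<bar> \<le> amax * B"
proof -
  have B0: "0 \<le> B" using B[of 0] by linarith
  have "\<bar>pairing i \<beta>\<bar> \<le> (\<Sum>l<\<theta>. \<bar>a i l\<bar> * B)"
    unfolding pairing_def by (rule order_trans[OF sum_abs]) (auto simp: abs_mult intro!: sum_mono mult_left_mono B)
  also have "\<dots> = (\<Sum>l<\<theta>. \<bar>a i l\<bar>) * B" by (simp add: sum_distrib_right)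
  also have "\<dots> \<le> (\<Sum>i<\<theta>. \<Sum>j<\<theta>. \<bar>a i j\<bar>) * B"
    using i B0 by (intro mult_right_mono member_le_sum[of i _ "\<lambda>i. \<Sum>j<\<theta>. \<bar>a i j\<bar>"]) (auto intro: sum_nonneg)
  finally have p: "\<bar>pairing i \<beta>\<bar> \<le> (amax - 1) * B" by (simp add: amax_def)
  have "\<bar>srefl i \<beta> l\<bar> \<le> \<bar>\<beta> l\<bar> + \<bar>pairing i \<beta>\<bar>" by (auto simp: srefl_def)
  also have "\<dots> \<le> B + (amax - 1) * B" using B[of l] p by linarith
  finally show ?thesis by (simp add: algebra_simps)
qed

lemma partial_chain_bound:
  assumes "partial_chain q S X" "cbraid q" "coideal_subalg q S" "\<beta> \<in> X"
  shows "\<bar>\<beta> l\<bar> \<le> amax ^ card X"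
  using assms
proof (induction arbitrary: \<beta> l rule: partial_chain.induct)
  case (partial_chain_step i S q X)
  note rs = coideal_subalg_step[OF partial_chain_step.prems(1) partial_chain_step.hyps(1) partial_chain_step.prems(2) partial_chain_step.hyps(2)]
  note cb = cbraid_refl[OF partial_chain_step.prems(1) partial_chain_step.hyps(1)]
  have c: "card (insert (simple i) (srefl i ` X)) = Suc (card X)"
    by (rule partial_chain_card[OF partial_chain_step.hyps partial_chain_step.prems(1,2)])
  consider "\<beta> = simple i" | \<beta>' where "\<beta>' \<in> X" "\<beta> = srefl i \<beta>'" using partial_chain_step.prems(3) by blast
  then show ?case
  proof cases
    case 1
    have "\<bar>simple i l\<bar> \<le> 1" by (simp add: simple_def)
    also have "1 \<le> amax ^ Suc (card X)" using amax_ge_1 by (rule one_le_power)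
    finally show ?thesis unfolding c 1 .
  next
    case 2
    show ?thesis unfolding c 2(2) power_Suc
      by (rule srefl_bound[OF partial_chain_step.hyps(1) partial_chain_step.IH[OF cb rs 2(1)]])
  qed
qed simp

text \<open>Up to sign, each element of the orbit of a simple root is a weight of a full chain for
  some iterated reflection of \<open>q\<close>. All these chains have the same size, and a weight of
  a chain arises from a simple root by fewer reflections than the chain has weights.\<close>

lemma roots_bounded:
  fixes q :: "nat \<Rightarrow> nat \<Rightarrow> 'k::field_char_0"
  assumes X: "full_chain q (nich \<theta> q) X" and q: "cbraid q" and ks: "set ks \<subseteq> {..<\<theta>}" and j: "j < \<theta>"
  shows "\<bar>foldr srefl ks (simple j) l\<bar> \<le> amax ^ card X"
proof -
  have "\<exists>(q' :: nat \<Rightarrow> nat \<Rightarrow> 'k) Y. cbraid q' \<and> full_chain q' (nich \<theta> q') Y \<and> card Y = card X \<and>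
      (foldr srefl ks (simple j) \<in> Y \<or> - foldr srefl ks (simple j) \<in> Y)"
    using ks
  proof (induction ks)
    case Nil
    then show ?case using X q full_chain_simple[OF X q j] by (intro exI[of _ q] exI[of _ X]) simp
  next
    case (Cons k ks)
    then have k: "k < \<theta>" by simp
    have "set ks \<subseteq> {..<\<theta>}" using Cons.prems by simp
    from Cons.IH[OF this] obtain q' :: "nat \<Rightarrow> nat \<Rightarrow> 'k" and Y where Y: "cbraid q'" "full_chain q' (nich \<theta> q') Y" "card Y = card X"
      "foldr srefl ks (simple j) \<in> Y \<or> - foldr srefl ks (simple j) \<in> Y" by blast
    let ?\<beta> = "foldr srefl ks (simple j)" and ?Z = "insert (simple k) (srefl k ` (Y - {simple k}))"
    note rot = full_chain_rotate[OF Y(2,1) k]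
    \<comment> \<open>Rotation keeps \<open>simple k\<close>, while \<open>srefl k\<close> negates
      it; this is the reason for working up to sign.\<close>
    have "srefl k \<gamma> \<in> ?Z \<or> - srefl k \<gamma> \<in> ?Z" if "\<gamma> \<in> Y" for \<gamma>
      using that k by (cases "\<gamma> = simple k") (auto simp: srefl_simple_self)
    from this[of ?\<beta>] this[of "- ?\<beta>"] Y(4)
    have "srefl k ?\<beta> \<in> ?Z \<or> - srefl k ?\<beta> \<in> ?Z" by (auto simp: srefl_minus)
    then show ?case using rot Y(3) cbraid_refl[OF Y(1) k] by (intro exI[of _ "refl k q'"] exI[of _ ?Z]) simp
  qed
  then obtain q' :: "nat \<Rightarrow> nat \<Rightarrow> 'k" and Y where Y: "cbraid q'" "full_chain q' (nich \<theta> q') Y" "card Y = card X"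
      "foldr srefl ks (simple j) \<in> Y \<or> - foldr srefl ks (simple j) \<in> Y" by blast
  from partial_chain_bound[OF full_chain_partial_chain[OF Y(2)] Y(1) coideal_subalg_nich] Y(3,4)
  show ?thesis by (metis abs_minus_cancel uminus_apply)
qed

text \<open>
  The orbit of the basis of simple roots under the Weyl group; averaging the standard inner product
  over it yields an invariant form.
\<close>

definition frames :: "(nat \<Rightarrow> nat \<Rightarrow> int) set"
  where "frames = {\<lambda>j. if j < \<theta> then foldr srefl ks (simple j) else 0 | ks. set ks \<subseteq> {..<\<theta>}}"

text \<open>Right multiplication of a Weyl group element by the \<open>k\<close>-th simple
  reflection, expressed through the rows of its frame.\<close>

definition frame_refl :: "nat \<Rightarrow> (nat \<Rightarrow> nat \<Rightarrow> int) \<Rightarrow> nat \<Rightarrow> nat \<Rightarrow> int"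
  where "frame_refl k F = (\<lambda>j. if j < \<theta> then (\<lambda>l. F j l - a k j * F k l) else 0)"

lemma foldr_srefl_outside: "set ks \<subseteq> {..<\<theta>} \<Longrightarrow> l \<ge> \<theta> \<Longrightarrow> foldr srefl ks \<beta> l = \<beta> l"
  by (induction ks) (auto simp: srefl_def)

lemma srefl_linear: "srefl k (\<lambda>l. \<beta> l - c * \<gamma> l) = (\<lambda>l. srefl k \<beta> l - c * srefl k \<gamma> l)"
proof -
  have "pairing k (\<lambda>l. \<beta> l - c * \<gamma> l) = pairing k \<beta> - c * pairing k \<gamma>"
    by (simp add: pairing_def algebra_simps sum_subtractf sum_distrib_left)
  then show ?thesis by (auto simp: srefl_def algebra_simps)
qed

lemma foldr_srefl_linear: "foldr srefl ks (\<lambda>l. \<beta> l - c * \<gamma> l) = (\<lambda>l. foldr srefl ks \<beta> l - c * foldr srefl ks \<gamma> l)"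
  by (induction ks) (auto simp: srefl_linear)

lemma frame_refl_frames: "k < \<theta> \<Longrightarrow> F \<in> frames \<Longrightarrow> frame_refl k F \<in> frames"
proof -
  assume k: "k < \<theta>" and "F \<in> frames"
  then obtain ks where ks: "set ks \<subseteq> {..<\<theta>}" "F = (\<lambda>j. if j < \<theta> then foldr srefl ks (simple j) else 0)"
    by (auto simp: frames_def)
  have "frame_refl k F = (\<lambda>j. if j < \<theta> then foldr srefl (ks @ [k]) (simple j) else 0)"
    using k by (auto simp: frame_refl_def ks(2) fun_eq_iff srefl_simple foldr_srefl_linear)
  then show ?thesis using ks(1) k unfolding frames_def by (intro CollectI exI[of _ "ks @ [k]"]) simp
qed

lemma frame_refl_invol: "k < \<theta> \<Longrightarrow> F \<in> frames \<Longrightarrow> frame_refl k (frame_refl k F) = F"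
  by (auto simp: frame_refl_def frames_def fun_eq_iff)

lemma finite_frames:
  assumes X: "full_chain q (nich \<theta> q) X" and q: "cbraid q" shows "finite frames"
proof -
  let ?B = "{\<beta> :: nat \<Rightarrow> int. \<forall>l. (l \<in> {..<\<theta>} \<longrightarrow> \<beta> l \<in> {- (amax ^ card X)..amax ^ card X}) \<and> (l \<notin> {..<\<theta>} \<longrightarrow> \<beta> l = 0)}"
  have B: "finite ?B" by (rule finite_set_of_finite_funs) auto
  have "frames \<subseteq> {F. \<forall>j. (j \<in> {..<\<theta>} \<longrightarrow> F j \<in> ?B) \<and> (j \<notin> {..<\<theta>} \<longrightarrow> F j = 0)}"
  proof
    fix F assume "F \<in> frames"
    then obtain ks where ks: "set ks \<subseteq> {..<\<theta>}" "F = (\<lambda>j. if j < \<theta> then foldr srefl ks (simple j) else 0)"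
      by (auto simp: frames_def)
    have "foldr srefl ks (simple j) \<in> ?B" if j: "j < \<theta>" for j
    proof -
      have "- (amax ^ card X) \<le> foldr srefl ks (simple j) l \<and> foldr srefl ks (simple j) l \<le> amax ^ card X" for l
        using roots_bounded[OF X q ks(1) j, of l] by (simp add: abs_le_iff)
      moreover have "foldr srefl ks (simple j) l = 0" if "l \<ge> \<theta>" for l
        using foldr_srefl_outside[OF ks(1) that] j that by (simp add: simple_def)
      ultimately show ?thesis by auto
    qed
    then show "F \<in> {F. \<forall>j. (j \<in> {..<\<theta>} \<longrightarrow> F j \<in> ?B) \<and> (j \<notin> {..<\<theta>} \<longrightarrow> F j = 0)}"
      by (simp add: ks(2))
  qed
  then show ?thesis by (rule finite_subset) (rule finite_set_of_finite_funs[OF _ B]; simp)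
qed

text \<open>Invariance of the averaged form \<open>g\<close> says
  \<open>2 * g k j = a k j * g k k\<close>. So the diagonal of \<open>g\<close> symmetrizes
  \<open>a\<close>, and the symmetrized matrix is \<open>2 * g\<close>.\<close>

lemma finite_type:
  fixes q :: "nat \<Rightarrow> nat \<Rightarrow> 'k::field_char_0"
  assumes X: "full_chain q (nich \<theta> q) X" and q: "cbraid q" shows "finite_cartan_matrix \<theta> a"
proof -
  note fin = finite_frames[OF X q]
  \<comment> \<open>The frame of the identity; its summand alone makes the form positive
    definite.\<close>
  define F0 where "F0 = (\<lambda>j. if j < \<theta> then simple j else 0)"
  have F0: "F0 \<in> frames" unfolding frames_def F0_def by (intro CollectI exI[of _ "[]"]) (simp add: fun_eq_iff)
  define g where "g i j = (\<Sum>F\<in>frames. \<Sum>l<\<theta>. F i l * F j l)" for i j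
  have sym: "g i j = g j i" for i j by (simp add: g_def mult.commute)
  have key: "2 * g k j = a k j * g k k" if k: "k < \<theta>" and j: "j < \<theta>" for k j
  proof -
    have "g k j = (\<Sum>F\<in>frames. \<Sum>l<\<theta>. frame_refl k F k l * frame_refl k F j l)"
      unfolding g_def
      by (rule sum.reindex_bij_witness[where i = "frame_refl k" and j = "frame_refl k"])
        (auto simp: frame_refl_invol frame_refl_frames k)
    also have "\<dots> = (\<Sum>F\<in>frames. \<Sum>l<\<theta>. a k j * (F k l * F k l) - F k l * F j l)"
      using k j by (intro sum.cong refl) (simp add: frame_refl_def algebra_simps)
    also have "\<dots> = a k j * g k k - g k j"
      by (simp add: g_def sum_subtractf sum_distrib_left)
    finally show ?thesis by simp
  qed
  have posg: "g k k > 0" if k: "k < \<theta>" for k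
  proof -
    have "(\<Sum>l<\<theta>. F0 k l * F0 k l) \<le> g k k"
      unfolding g_def using fin F0
      by (intro member_le_sum[of F0 frames "\<lambda>F. \<Sum>l<\<theta>. F k l * F k l"]) (auto intro: sum_nonneg)
    moreover have "1 \<le> (\<Sum>l<\<theta>. F0 k l * F0 k l)"
      using k member_le_sum[of k "{..<\<theta>}" "\<lambda>l. F0 k l * F0 k l"] by (simp add: F0_def simple_def)
    ultimately show ?thesis by linarith
  qed
  have symm: "symmetrizes \<theta> (\<lambda>i. g i i) a"
    unfolding symmetrizes_def
  proof (intro conjI allI impI)
    fix i j assume "i < \<theta>" "j < \<theta>"
    then show "g i i * a i j = g j j * a j i" using key[of i j] key[of j i] sym[of i j] by (simp add: mult.commute)
  qed (rule posg)
  have posdef: "(\<Sum>i<\<theta>. \<Sum>j<\<theta>. of_int (g i i * a i j) * x i * x j) > 0"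
    if x: "\<exists>i<\<theta>. x i \<noteq> 0" for x :: "nat \<Rightarrow> real"
  proof -
    let ?s = "\<lambda>F. \<Sum>l<\<theta>. (\<Sum>i<\<theta>. x i * of_int (F i l))\<^sup>2"
    have "(\<Sum>i<\<theta>. \<Sum>j<\<theta>. of_int (g i i * a i j) * x i * x j)
      = (\<Sum>i<\<theta>. \<Sum>j<\<theta>. 2 * (\<Sum>F\<in>frames. \<Sum>l<\<theta>. (x i * of_int (F i l)) * (x j * of_int (F j l))))"
    proof (intro sum.cong refl)
      fix i j assume ij: "i \<in> {..<\<theta>}" "j \<in> {..<\<theta>}"
      have "of_int (g i i * a i j) * x i * x j = of_int (2 * g i j) * x i * x j"
        using key[of i j] ij by (simp add: mult.commute)
      also have "\<dots> = 2 * (\<Sum>F\<in>frames. \<Sum>l<\<theta>. (x i * of_int (F i l)) * (x j * of_int (F j l)))"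
        by (simp add: g_def sum_distrib_left sum_distrib_right ac_simps)
      finally show "of_int (g i i * a i j) * x i * x j = \<dots>" .
    qed
    also have "\<dots> = 2 * (\<Sum>F\<in>frames. ?s F)"
    proof -
      have "?s F = (\<Sum>i<\<theta>. \<Sum>j<\<theta>. \<Sum>l<\<theta>. (x i * of_int (F i l)) * (x j * of_int (F j l)))" for F :: "nat \<Rightarrow> nat \<Rightarrow> int"
        unfolding power2_eq_square sum_product
        by (subst sum.swap, rule sum.cong[OF refl], rule sum.swap)
      then have "(\<Sum>F\<in>frames. ?s F) = (\<Sum>F\<in>frames. \<Sum>i<\<theta>. \<Sum>j<\<theta>. \<Sum>l<\<theta>. (x i * of_int (F i l)) * (x j * of_int (F j l)))" by simp
      also have "\<dots> = (\<Sum>i<\<theta>. \<Sum>j<\<theta>. \<Sum>F\<in>frames. \<Sum>l<\<theta>. (x i * of_int (F i l)) * (x j * of_int (F j l)))"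
        by (subst sum.swap, rule sum.cong[OF refl], rule sum.swap)
      finally show ?thesis by (simp add: sum_distrib_left)
    qed
    also have "\<dots> > 0"
    proof -
      obtain k where k: "k < \<theta>" "x k \<noteq> 0" using x by blast
      have "(\<Sum>i<\<theta>. x i * of_int (F0 i k)) = (\<Sum>i<\<theta>. if i = k then x i else 0)"
        by (intro sum.cong) (auto simp: F0_def simple_def)
      also have "\<dots> = x k" using k by simp
      finally have "0 < (\<Sum>i<\<theta>. x i * of_int (F0 i k))\<^sup>2" using k by simp
      also have "\<dots> \<le> ?s F0"
        by (rule member_le_sum[of k "{..<\<theta>}" "\<lambda>l. (\<Sum>i<\<theta>. x i * of_int (F0 i l))\<^sup>2"]) (use k in auto)
      also have "\<dots> \<le> (\<Sum>F\<in>frames. ?s F)"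
        by (rule member_le_sum[of F0 frames ?s]) (use fin F0 in \<open>auto intro: sum_nonneg\<close>)
      finally show ?thesis by simp
    qed
    finally show ?thesis .
  qed
  show ?thesis
    unfolding finite_cartan_matrix_def
    by (intro conjI gcm exI[of _ "\<lambda>i. g i i"] symm allI impI posdef)
qed

subsection \<open>Chains for a finite Cartan matrix\<close>

definition bform :: "(nat \<Rightarrow> int) \<Rightarrow> (nat \<Rightarrow> int) \<Rightarrow> (nat \<Rightarrow> int) \<Rightarrow> int"
  where "bform d x y = (\<Sum>i<\<theta>. \<Sum>j<\<theta>. d i * a i j * x i * y j)"

lemma bform_simple_left: "i < \<theta> \<Longrightarrow> bform d (simple i) y = d i * pairing i y"
proof -
  assume i: "i < \<theta>"
  have "bform d (simple i) y = (\<Sum>k<\<theta>. if k = i then \<Sum>j<\<theta>. d i * a i j * y j else 0)"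
    unfolding bform_def by (intro sum.cong) (auto simp: simple_def)
  then show ?thesis using i by (simp add: pairing_def sum_distrib_left mult.assoc)
qed

lemma bform_sym: "symmetrizes \<theta> d a \<Longrightarrow> bform d x y = bform d y x"
proof -
  assume s: "symmetrizes \<theta> d a"
  have "bform d x y = (\<Sum>i<\<theta>. \<Sum>j<\<theta>. d j * a j i * x i * y j)"
    unfolding bform_def using s by (intro sum.cong) (auto simp: symmetrizes_def)
  also have "\<dots> = bform d y x" unfolding bform_def by (subst sum.swap) (simp add: ac_simps)
  finally show ?thesis .
qed

lemma bform_add: "bform d (x + y) z = bform d x z + bform d y z" "bform d z (x + y) = bform d z x + bform d z y"
  by (auto simp: bform_def pointwise algebra_simps sum.distrib)

lemma bform_scale: "bform d (\<lambda>l. c * x l) z = c * bform d x z" "bform d z (\<lambda>l. c * x l) = c * bform d z x"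
  by (auto simp: bform_def sum_distrib_left ac_simps)

lemma srefl_eq: "srefl i x = x + (\<lambda>l. - pairing i x * simple i l)"
  by (auto simp: srefl_def fun_eq_iff pointwise simple_def)

lemma bform_srefl:
  assumes s: "symmetrizes \<theta> d a" and i: "i < \<theta>"
  shows "bform d (srefl i x) (srefl i y) = bform d x y"
proof -
  have 1: "bform d (simple i) y = d i * pairing i y" for y by (rule bform_simple_left[OF i])
  have 2: "bform d x (simple i) = d i * pairing i x" for x using 1 bform_sym[OF s] by metis
  show ?thesis
    unfolding srefl_eq bform_add bform_scale 1 2 using pairing_simple[OF i, of i] i by (simp add: algebra_simps)
qed

section \<open>Positive definite symmetrizations and bounded weights\<close>

definition posdef :: "(nat \<Rightarrow> int) \<Rightarrow> bool"
  where "posdef d \<longleftrightarrow> symmetrizes \<theta> d a \<and> (\<forall>x. (\<exists>i<\<theta>. x i \<noteq> 0) \<longrightarrow> bform d x x > 0)"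

lemma finite_cartan_posdef: "finite_cartan_matrix \<theta> a \<Longrightarrow> \<exists>d. posdef d"
proof -
  assume "finite_cartan_matrix \<theta> a"
  then obtain d where d: "symmetrizes \<theta> d a"
    "\<And>x :: nat \<Rightarrow> real. (\<exists>i<\<theta>. x i \<noteq> 0) \<Longrightarrow> (\<Sum>i<\<theta>. \<Sum>j<\<theta>. of_int (d i * a i j) * x i * x j) > 0"
    unfolding finite_cartan_matrix_def by blast
  have "bform d x x > 0" if x: "\<exists>i<\<theta>. x i \<noteq> 0" for x
  proof -
    have "(\<Sum>i<\<theta>. \<Sum>j<\<theta>. of_int (d i * a i j) * real_of_int (x i) * real_of_int (x j)) > 0"
      by (rule d(2)) (use x in simp)
    also have "(\<Sum>i<\<theta>. \<Sum>j<\<theta>. of_int (d i * a i j) * real_of_int (x i) * real_of_int (x j)) = real_of_int (bform d x x)"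
      by (simp add: bform_def)
    finally show ?thesis by simp
  qed
  then show ?thesis using d(1) unfolding posdef_def by blast
qed

lemma posdef_nonneg: "posdef d \<Longrightarrow> 0 \<le> bform d x x"
proof (cases "\<exists>i<\<theta>. x i \<noteq> 0")
  case False then show ?thesis by (simp add: bform_def)
qed (auto simp: posdef_def intro: less_imp_le)

lemma cauchy_schwarz:
  assumes d: "posdef d" and x: "bform d x x > 0"
  shows "(bform d x y)\<^sup>2 \<le> bform d x x * bform d y y"
proof -
  have s: "symmetrizes \<theta> d a" using d by (simp add: posdef_def)
  let ?P = "bform d x x" and ?Q = "bform d x y" and ?R = "bform d y y"
  \<comment> \<open>The component of \<open>y\<close> orthogonal to \<open>x\<close>, scaled by the
    norm of \<open>x\<close> to stay integral.\<close>
  let ?z = "(\<lambda>l. ?P * y l) + (\<lambda>l. - ?Q * x l)"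
  have "bform d ?z ?z = ?P * (?P * ?R - ?Q\<^sup>2)"
    unfolding bform_add bform_scale bform_sym[OF s, of y x] by (simp add: algebra_simps power2_eq_square)
  then have "0 \<le> ?P * (?P * ?R - ?Q\<^sup>2)" using posdef_nonneg[OF d, of ?z] by simp
  then show ?thesis using x by (simp add: zero_le_mult_iff)
qed

lemma bform_simple_simple: "i < \<theta> \<Longrightarrow> bform d (simple i) (simple i) = 2 * d i"
  by (simp add: bform_simple_left pairing_simple)

text \<open>Positive weights with the norm of a simple root. Reflections preserve the form, so the
  weights of every chain are of this kind.\<close>

definition real_like :: "(nat \<Rightarrow> int) \<Rightarrow> (nat \<Rightarrow> int) set"
  where "real_like d = {\<beta>. pos \<beta> \<and> (\<exists>j<\<theta>. bform d \<beta> \<beta> = 2 * d j)}"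

text \<open>Positive definiteness makes a weight determined by its pairings with the simple coroots,
  and Cauchy-Schwarz bounds these pairings.\<close>

lemma finite_real_like:
  assumes d: "posdef d" shows "finite (real_like d)"
proof -
  have s: "symmetrizes \<theta> d a" using d by (simp add: posdef_def)
  then have dp: "d i > 0" if "i < \<theta>" for i using that by (simp add: symmetrizes_def)
  define M where "M = (\<Sum>i<\<theta>. 2 * d i)"
  have M: "2 * d i \<le> M" if "i < \<theta>" for i
    unfolding M_def using that dp by (intro member_le_sum[of i _ "\<lambda>i. 2 * d i"]) (auto intro: less_imp_le)
  let ?f = "\<lambda>\<beta> i. if i < \<theta> then pairing i \<beta> else 0"
  have inj: "inj_on ?f (real_like d)"
  proof (rule inj_onI)
    fix x y assume xy: "x \<in> real_like d" "y \<in> real_like d" and e: "?f x = ?f y"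
    have "pairing i (x - y) = 0" if "i < \<theta>" for i
      using fun_cong[OF e, of i] that by (simp add: pairing_def pointwise right_diff_distrib sum_subtractf)
    then have "bform d (x - y) (x - y) = 0"
      by (simp add: bform_def pairing_def sum_distrib_left[symmetric] mult.assoc)
        (simp add: mult.left_commute[of "a _ _"] sum_distrib_left[symmetric])
    then have "\<forall>i<\<theta>. (x - y) i = 0" using d unfolding posdef_def by (metis less_irrefl)
    moreover have "\<forall>i\<ge>\<theta>. x i = 0 \<and> y i = 0" using xy by (simp add: real_like_def pos_def)
    ultimately show "x = y" by (intro ext) (metis eq_iff_diff_eq_0 minus_apply not_le)
  qed
  have "?f ` real_like d \<subseteq> {\<beta>. \<forall>l. (l \<in> {..<\<theta>} \<longrightarrow> \<beta> l \<in> {- M..M}) \<and> (l \<notin> {..<\<theta>} \<longrightarrow> \<beta> l = 0)}"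
  proof
    fix f assume "f \<in> ?f ` real_like d"
    then obtain \<beta> where \<beta>: "\<beta> \<in> real_like d" "f = ?f \<beta>" by blast
    obtain j where j: "j < \<theta>" "bform d \<beta> \<beta> = 2 * d j" using \<beta>(1) by (auto simp: real_like_def)
    have "\<bar>pairing i \<beta>\<bar> \<le> M" if i: "i < \<theta>" for i
    proof -
      have "(d i * pairing i \<beta>)\<^sup>2 \<le> (2 * d i) * (2 * d j)"
        using cauchy_schwarz[OF d, of "simple i" \<beta>] dp[OF i] j(2)
        by (simp add: bform_simple_left[OF i] pairing_simple[OF i] i)
      also have "\<dots> \<le> M * M" using M[OF i] M[OF j(1)] dp[OF i] dp[OF j(1)] by (intro mult_mono) auto
      finally have "(d i * pairing i \<beta>)\<^sup>2 \<le> M\<^sup>2" by (simp add: power2_eq_square)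
      moreover have "0 \<le> M" using M[OF i] dp[OF i] by linarith
      ultimately have "\<bar>d i * pairing i \<beta>\<bar> \<le> M" using abs_le_square_iff[of "d i * pairing i \<beta>" M] by simp
      moreover have "1 * \<bar>pairing i \<beta>\<bar> \<le> d i * \<bar>pairing i \<beta>\<bar>" using dp[OF i] by (intro mult_right_mono) auto
      ultimately show ?thesis using dp[OF i] by (simp add: abs_mult)
    qed
    then show "f \<in> {\<beta>. \<forall>l. (l \<in> {..<\<theta>} \<longrightarrow> \<beta> l \<in> {- M..M}) \<and> (l \<notin> {..<\<theta>} \<longrightarrow> \<beta> l = 0)}"
      by (auto simp: \<beta>(2) abs_le_iff minus_le_iff)
  qed
  moreover have "finite {\<beta> :: nat \<Rightarrow> int. \<forall>l. (l \<in> {..<\<theta>} \<longrightarrow> \<beta> l \<in> {- M..M}) \<and> (l \<notin> {..<\<theta>} \<longrightarrow> \<beta> l = 0)}"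
    by (rule finite_set_of_finite_funs) auto
  ultimately have "finite (?f ` real_like d)" by (rule finite_subset)
  then show ?thesis by (rule finite_imageD[OF _ inj])
qed

lemma partial_chain_real_like:
  assumes "partial_chain q S X" "cbraid q" "coideal_subalg q S" and d: "symmetrizes \<theta> d a"
  shows "X \<subseteq> real_like d"
proof -
  have "\<forall>\<beta>\<in>X. \<exists>j<\<theta>. bform d \<beta> \<beta> = 2 * d j"
    using assms(1)
  proof (induction rule: partial_chain.induct)
    case (partial_chain_step i S q X)
    then show ?case using bform_simple_simple[of i d] bform_srefl[OF d, of i] by auto
  qed simp
  then show ?thesis using partial_chain_pos[OF assms(1-3)] by (auto simp: real_like_def)
qed

lemma full_chain_finite_type:
  assumes "finite_cartan_matrix \<theta> a" "cbraid q" shows "\<exists>X. full_chain q (nich \<theta> q) X"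
proof -
  obtain d where d: "posdef d" using finite_cartan_posdef[OF assms(1)] by blast
  then have s: "symmetrizes \<theta> d a" by (simp add: posdef_def)
  have "card X \<le> card (real_like d)" if "partial_chain q (nich \<theta> q) X" for X
    by (rule card_mono[OF finite_real_like[OF d] partial_chain_real_like[OF that assms(2) coideal_subalg_nich s]])
  from full_chain_exists[OF this assms(2) coideal_subalg_nich] show ?thesis .
qed

end

section \<open>Polynomial growth forces Cartan type\<close>

text \<open>The kernel and the image of \<open>f\<close> on \<open>U\<close> each have at least the
  dimension of \<open>N\<close>.\<close>

lemma dim_le_of_surj:
  fixes f :: "('x \<Rightarrow> 'k::field) \<Rightarrow> 'x \<Rightarrow> 'k"
  assumes lin: "Vector_Spaces.linear fun_scale fun_scale f"
    and U: "fv.subspace U" "U \<subseteq> fv.span F" "finite F"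
    and N: "N \<subseteq> U" "\<And>x. x \<in> N \<Longrightarrow> f x = 0" and im: "N \<subseteq> f ` U"
  shows "2 * fv.dim N \<le> fv.dim U"
proof -
  interpret f: Vector_Spaces.linear fun_scale fun_scale f by (rule lin)
  have "fv.dim N \<le> fv.dim {x \<in> U. f x = 0}"
    by (rule dim_mono_fin[OF _ _ U(3)]) (use N U(2) in auto)
  moreover have "f ` U \<subseteq> fv.span (f ` F)" using U(2) f.span_image[of F] by auto
  then have "fv.dim N \<le> fv.dim (f ` U)" by (rule dim_mono_fin[OF im]) (use U(3) in simp)
  ultimately show ?thesis using dim_kernel_image[OF lin U] by simp
qed

context letters
begin

text \<open>The span of the ordered products of the \<open>jpow i j k\<close> over sets of exponents
  \<open>k < m\<close>. The recursion omits or appends the factor with the greatest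
  exponent.\<close>

primrec adspan :: "(nat \<Rightarrow> nat \<Rightarrow> 'k::field_char_0) \<Rightarrow> nat \<Rightarrow> nat \<Rightarrow> nat \<Rightarrow> (nat list \<Rightarrow> 'k) set"
  where
    "adspan q i j 0 = range (\<lambda>c. fun_scale c sone)"
  | "adspan q i j (Suc m) = {u + qsh q v (jpow i j m) | u v. u \<in> adspan q i j m \<and> v \<in> adspan q i j m}"

text \<open>No coefficient in \<open>badj_jpow\<close> vanishes, so each \<open>jpow\<close> is
  recovered from the adjoint of the preceding one by division.\<close>

lemma jpow_nich:
  assumes nz: "\<And>k l. q k l \<noteq> 0" and i: "i < \<theta>" and j: "j < \<theta>" and r: "\<not> root_of_one (q i i)"
    and n: "\<And>m. q i j * q j i * q i i ^ m \<noteq> 1"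
  shows "jpow i j m \<in> nich \<theta> (q :: nat \<Rightarrow> nat \<Rightarrow> 'k::field_char_0)"
proof (induction m)
  case 0 then show ?case using j by (simp add: jpow_0 nich_letter)
next
  case (Suc m)
  let ?c = "(inverse (q i j) * inverse (q i i) ^ m - q j i) * qnum (Suc m) (q i i)"
  have e: "inverse (q i j) * inverse (q i i) ^ m = inverse (q i j * q i i ^ m)"
    unfolding power_inverse inverse_mult_distrib ..
  have "inverse (q i j * q i i ^ m) \<noteq> q j i"
  proof
    assume "inverse (q i j * q i i ^ m) = q j i"
    then have "q i j * q i i ^ m * q j i = 1" using nz by (metis mult_eq_0_iff power_not_zero right_inverse)
    then show False using n[of m] by (simp add: mult.assoc mult.commute[of "q j i"])
  qed
  then have "inverse (q i j) * inverse (q i i) ^ m - q j i \<noteq> 0" unfolding e right_minus_eq .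
  then have c: "?c \<noteq> 0" using qnum_nonzero[OF r zero_less_Suc, of m] unfolding mult_eq_0_iff by blast
  have "badj q i (jpow i j m) \<in> nich \<theta> q" by (rule nich_badj[OF i Suc])
  then have "fun_scale (inverse ?c) (fun_scale ?c (jpow i j (Suc m))) \<in> nich \<theta> q"
    unfolding badj_jpow[of q i, OF nz] by (rule nich_scale)
  then show ?case unfolding fv.scale_scale left_inverse[OF c] fun_scale_zero_one .
qed

lemma adspan_der:
  fixes q :: "nat \<Rightarrow> nat \<Rightarrow> 'k::field_char_0"
  assumes nz: "\<And>k l. q k l \<noteq> 0" and ij: "i \<noteq> j"
  shows "f \<in> adspan q i j m \<Longrightarrow> der i f = 0 \<and> (\<forall>k\<ge>m. (der i ^^ k) (der j f) = 0)"
proof (induction m arbitrary: f)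
  case 0 then show ?case by (auto simp: funpow_der_linear)
next
  case (Suc m)
  then obtain u v where f: "f = u + qsh q v (jpow i j m)" and uv: "u \<in> adspan q i j m" "v \<in> adspan q i j m" by auto
  note I = Suc.IH[OF uv(1)] Suc.IH[OF uv(2)]
  have z: "der i (jpow i j m) = (0 :: nat list \<Rightarrow> 'k)" "der j (jpow i j m) = (dpow i m :: nat list \<Rightarrow> 'k)" using ij by (auto simp: der_jpow)
  have "(der i ^^ k) (der j (qsh q v (jpow i j m))) = 0" if k: "k \<ge> Suc m" for k
  proof -
    have "(der i ^^ k) (qsh q v (dpow i m)) = qsh q v ((der i ^^ k) (dpow i m))"
      using I(2) by (intro funpow_der_qsh_left) simp
    moreover have "(der i ^^ k) (qsh q (der j v) (twist (q j) (jpow i j m)))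
      = qsh q ((der i ^^ k) (der j v)) (twist (\<lambda>l. q i l ^ k) (twist (q j) (jpow i j m)))"
      using z by (intro funpow_der_qsh_right) simp
    ultimately show ?thesis using I(2) k z by (simp add: der_qsh funpow_der_linear funpow_der_dpow)
  qed
  then show ?case using I z unfolding f by (auto simp: der_qsh funpow_der_linear)
qed

text \<open>The operator reads off what stands in front of \<open>jpow i j m\<close>, and by
  \<open>adspan_der\<close> it kills the products with smaller exponents. Hence every stage at least
  doubles the dimension.\<close>

lemma adspan_top:
  fixes q :: "nat \<Rightarrow> nat \<Rightarrow> 'k::field_char_0"
  assumes nz: "\<And>k l. q k l \<noteq> 0" and ij: "i \<noteq> j" and uv: "u \<in> adspan q i j m" "v \<in> adspan q i j m"
  shows "(der i ^^ m) (der j (u + qsh q v (jpow i j m))) = v"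
proof -
  note I = adspan_der[OF nz ij uv(1)] adspan_der[OF nz ij uv(2)]
  have z: "der i (jpow i j m) = (0 :: nat list \<Rightarrow> 'k)" "der j (jpow i j m) = (dpow i m :: nat list \<Rightarrow> 'k)" using ij by (auto simp: der_jpow)
  have "(der i ^^ m) (qsh q v (dpow i m)) = qsh q v ((der i ^^ m) (dpow i m))"
    using I(2) by (intro funpow_der_qsh_left) simp
  moreover have "(der i ^^ m) (qsh q (der j v) (twist (q j) (jpow i j m)))
      = qsh q ((der i ^^ m) (der j v)) (twist (\<lambda>l. q i l ^ m) (twist (q j) (jpow i j m)))"
    using z by (intro funpow_der_qsh_right) simp
  ultimately show ?thesis using I z by (simp add: der_qsh funpow_der_linear funpow_der_dpow)
qed

lemma subspace_adspan: "fv.subspace (adspan q i j m)"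
proof (induction m)
  case 0
  then show ?case by (auto simp: fv.span_singleton[symmetric])
next
  case (Suc m)
  show ?case
  proof (rule fv.subspaceI)
    show "0 \<in> adspan q i j (Suc m)"
      using fv.subspace_0[OF Suc] by (auto intro!: exI[of _ 0])
    fix x y c assume x: "x \<in> adspan q i j (Suc m)"
    then obtain u v where x': "x = u + qsh q v (jpow i j m)" "u \<in> adspan q i j m" "v \<in> adspan q i j m" by auto
    show "fun_scale c x \<in> adspan q i j (Suc m)"
      using fv.subspace_scale[OF Suc x'(2), of c] fv.subspace_scale[OF Suc x'(3), of c] unfolding x'(1)
      by (auto simp: fv.scale_right_distrib qsh_scale_left[symmetric])
    assume "y \<in> adspan q i j (Suc m)"
    then obtain u' v' where y': "y = u' + qsh q v' (jpow i j m)" "u' \<in> adspan q i j m" "v' \<in> adspan q i j m" by auto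
    have "x + y = (u + u') + qsh q (v + v') (jpow i j m)" by (simp add: x'(1) y'(1) qsh_add_left)
    then show "x + y \<in> adspan q i j (Suc m)"
      using fv.subspace_add[OF Suc x'(2) y'(2)] fv.subspace_add[OF Suc x'(3) y'(3)] by auto
  qed
qed

lemma adspan_length: "f \<in> adspan q i j m \<Longrightarrow> f w \<noteq> 0 \<Longrightarrow> length w \<le> m * m"
proof (induction m arbitrary: f w)
  case 0 then show ?case by (auto simp: sone_def pointwise split: if_splits)
next
  case (Suc m)
  then obtain u v where f: "f = u + qsh q v (jpow i j m)" and uv: "u \<in> adspan q i j m" "v \<in> adspan q i j m" by auto
  from Suc.prems(2) f consider "u w \<noteq> 0" | "qsh q v (jpow i j m) w \<noteq> 0"
    unfolding f pointwise by fastforce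
  then show ?case
  proof cases
    case 1 then show ?thesis using Suc.IH[OF uv(1)] by fastforce
  next
    case 2
    from qsh_nonzero[OF this] obtain x y where xy: "v x \<noteq> 0" "jpow i j m y \<noteq> (0::'a)" "length w = length x + length y"
      by blast
    have "length y = Suc m" using xy(2) by (auto simp: jpow_def split: if_splits)
    then show ?thesis using Suc.IH[OF uv(2) xy(1)] xy(3) by simp
  qed
qed

lemma growth_cartan:
  fixes q :: "nat \<Rightarrow> nat \<Rightarrow> 'k::field_char_0"
  assumes nz: "\<And>k l. q k l \<noteq> 0" and ij: "i < \<theta>" "j < \<theta>" "i \<noteq> j" and r: "\<not> root_of_one (q i i)"
    and g: "growth (nich \<theta> q) d"
  shows "\<exists>m. q i j * q j i * q i i ^ m = 1"
proof (rule ccontr)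
  assume "\<nexists>m. q i j * q j i * q i i ^ m = 1"
  then have n: "\<And>m. q i j * q j i * q i i ^ m \<noteq> 1" by blast
  note jn = jpow_nich[OF nz ij(1,2) r n]
  let ?U = "adspan q i j"
  have sub: "?U m \<subseteq> nich \<theta> q" for m
  proof (induction m)
    case 0 then show ?case by (auto intro: nich_scale nich_sone)
  next
    case (Suc m) then show ?case using jn by (auto intro!: nich_add nich_qsh)
  qed
  have pt: "?U m \<subseteq> part (nich \<theta> q) (wball (m * m))" for m
  proof
    fix f assume f: "f \<in> ?U m"
    have "wt w \<in> wball (m * m)" if w: "f w \<noteq> 0" for w
    proof -
      have s: "set w \<subseteq> {..<\<theta>}" using nich_set[of f \<theta> q w] sub f w by blast
      then have "\<forall>l\<ge>\<theta>. count_list w l = 0" by (auto simp: count_list_0_iff)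
      moreover have "int (length w) \<le> int (m * m)" using adspan_length[OF f w] by (simp only: of_nat_le_iff)
      ultimately show ?thesis using wt_length[OF s] wt_nonneg by (simp add: wball_def) (simp add: wt_def)
    qed
    then show "f \<in> part (nich \<theta> q) (wball (m * m))" using f sub by (auto simp: part_def supported_def)
  qed
  have dim: "2 ^ m \<le> fv.dim (?U m)" for m
  proof (induction m)
    case 0
    have "fv.independent {sone :: nat list \<Rightarrow> 'k}"
      using fv.independent_insert[of sone "{}"] by (auto simp: fun_eq_iff sone_def pointwise)
    then have "fv.dim (fv.span {sone :: nat list \<Rightarrow> 'k}) = 1" using fv.dim_span_eq_card_independent by fastforce
    then show ?case by (simp add: fv.span_singleton)
  next
    case (Suc m)
    obtain F where F: "finite F" "?U (Suc m) \<subseteq> fv.span F"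
      using part_finite[OF order_refl finite_wball] pt by (meson order_trans)
    let ?D = "\<lambda>f. (der i ^^ m) (der j f)"
    have lin: "Vector_Spaces.linear fun_scale fun_scale ?D"
      unfolding Vector_Spaces.linear_iff using fv.vector_space_axioms by (auto simp: funpow_der_linear)
    have "2 * fv.dim (?U m) \<le> fv.dim (?U (Suc m))"
    proof (rule dim_le_of_surj[OF lin subspace_adspan F(2,1)])
      show "?U m \<subseteq> ?U (Suc m)"
      proof
        fix x assume "x \<in> ?U m"
        moreover have "x = x + qsh q 0 (jpow i j m)" by simp
        ultimately show "x \<in> ?U (Suc m)" using fv.subspace_0[OF subspace_adspan[of q i j m]]
          unfolding adspan.simps mem_Collect_eq by blast
      qed
      show "?D x = 0" if "x \<in> ?U m" for x using adspan_der[OF nz ij(3) that] by simp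
      show "?U m \<subseteq> ?D ` ?U (Suc m)"
      proof
        fix v assume v: "v \<in> ?U m"
        have "v = ?D (0 + qsh q v (jpow i j m))"
          by (rule adspan_top[OF nz ij(3) fv.subspace_0[OF subspace_adspan] v, symmetric])
        moreover have "0 + qsh q v (jpow i j m) \<in> ?U (Suc m)"
          using v fv.subspace_0[OF subspace_adspan[of q i j m]] unfolding adspan.simps mem_Collect_eq by blast
        ultimately show "v \<in> ?D ` ?U (Suc m)" by blast
      qed
    qed
    then show ?case using Suc by simp
  qed
  obtain c where c: "\<And>n. hdim (nich \<theta> q) (wball n) \<le> c * (n + 1) ^ d" using g unfolding growth_def by blast
  have "2 ^ m \<le> c * (m * m + 1) ^ d" for m
  proof -
    obtain F where F: "finite F" "part (nich \<theta> q) (wball (m * m)) \<subseteq> fv.span F"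
      using part_finite[OF order_refl finite_wball] by blast
    have "2 ^ m \<le> fv.dim (?U m)" by (rule dim)
    also have "\<dots> \<le> hdim (nich \<theta> q) (wball (m * m))" unfolding hdim_def by (rule dim_mono_fin[OF pt F(2,1)])
    also have "\<dots> \<le> c * (m * m + 1) ^ d" by (rule c)
    finally show ?thesis .
  qed
  note le = this
  \<comment> \<open>For \<open>m = 2^(2t)\<close> one has \<open>m^2 + 1 \<le> 2^(4t + 1)\<close>,
    so comparing exponents in \<open>2^m \<le> c (m^2 + 1)^d\<close> gives
    \<open>m \<le> c + (4t + 1) d\<close>. This is linear in \<open>t\<close>, while
    \<open>m \<ge> (t + 1)^2\<close>; the value of \<open>t\<close> is large enough for a
    contradiction.\<close>
  define t where "t = c + 4 * d + 4"
  define m :: nat where "m = 2 ^ (2 * t)"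
  have t: "t + 1 \<le> 2 ^ t" using less_exp[of t] by linarith
  have "2 ^ m \<le> c * (m * m + 1) ^ d" by (rule le)
  also have "\<dots> \<le> 2 ^ c * (2 ^ (4 * t + 1)) ^ d"
  proof (intro mult_le_mono power_mono)
    have "m * m = 2 ^ (4 * t)" unfolding m_def by (simp flip: power_add)
    moreover have "(1::nat) \<le> 2 ^ (4 * t)" by simp
    ultimately show "m * m + 1 \<le> 2 ^ (4 * t + 1)" by (simp only: power_add power_one_right)
  qed (auto intro: less_imp_le less_exp)
  also have "\<dots> = 2 ^ (c + (4 * t + 1) * d)" by (simp only: power_add power_mult)
  finally have "m \<le> c + (4 * t + 1) * d" by (simp only: power_increasing_iff one_less_numeral_iff semiring_norm)
  moreover have "(t + 1) * (t + 1) \<le> m"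
    using mult_le_mono[OF t t] unfolding m_def by (simp flip: power_add add: mult_2)
  moreover have "c + (4 * t + 1) * d < (t + 1) * (t + 1)"
  proof -
    have "4 * t * d + c + d < t * (c + 4 * d + 4) + 2 * t + 1" by (simp add: t_def algebra_simps)
    also have "t * (c + 4 * d + 4) = t * t" by (simp add: t_def)
    finally show ?thesis by (simp add: algebra_simps)
  qed
  ultimately show False by simp
qed

end

section \<open>Braidings of Cartan type and of Drinfeld-Jimbo type\<close>

lemma power_int_prod: "finite A \<Longrightarrow> (\<Prod>x\<in>A. f x) powi n = (\<Prod>x\<in>A. (f x :: 'k::field) powi n)"
  by (induction A rule: finite_induct) (auto simp: power_int_mult_distrib)

lemma power_int_sum: "finite A \<Longrightarrow> (x :: 'k::field) \<noteq> 0 \<Longrightarrow> x powi (\<Sum>k\<in>A. f k) = (\<Prod>k\<in>A. x powi f k)"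
  by (induction A rule: finite_induct) (auto simp: power_int_add)

context cartan
begin

text \<open>The bicharacter of the root lattice with the values \<open>q k l\<close> on simple
  roots; \<open>sbichar\<close> is its symmetrization.\<close>

definition bichar :: "(nat \<Rightarrow> nat \<Rightarrow> 'k::field_char_0) \<Rightarrow> (nat \<Rightarrow> int) \<Rightarrow> (nat \<Rightarrow> int) \<Rightarrow> 'k"
  where "bichar q x y = (\<Prod>k<\<theta>. \<Prod>l<\<theta>. q k l powi (x k * y l))"

definition sbichar :: "(nat \<Rightarrow> nat \<Rightarrow> 'k::field_char_0) \<Rightarrow> (nat \<Rightarrow> int) \<Rightarrow> (nat \<Rightarrow> int) \<Rightarrow> 'k"
  where "sbichar q x y = bichar q x y * bichar q y x"

lemma bichar_add:
  assumes q: "cbraid q"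
  shows "bichar q (x + y) z = bichar q x z * bichar q y z" "bichar q z (x + y) = bichar q z x * bichar q z y"
  using cbraid_nz[OF q] by (auto simp: bichar_def pointwise distrib_left distrib_right power_int_add prod.distrib)

lemma bichar_scale:
  "bichar q (\<lambda>l. c * x l) z = bichar q x z powi c" "bichar q z (\<lambda>l. c * x l) = bichar q z x powi c"
  by (auto simp: bichar_def power_int_prod power_int_mult[symmetric] ac_simps)

lemma sbichar_sym: "sbichar q x y = sbichar q y x"
  by (simp add: sbichar_def mult.commute)

lemma bichar_simple_left: "k < \<theta> \<Longrightarrow> bichar q (simple k) y = (\<Prod>l<\<theta>. q k l powi y l)"
proof -
  assume k: "k < \<theta>"
  have "bichar q (simple k) y = (\<Prod>i<\<theta>. if i = k then \<Prod>l<\<theta>. q k l powi y l else 1)"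
    unfolding bichar_def by (intro prod.cong) (auto simp: simple_def)
  then show ?thesis using k by simp
qed

lemma bichar_simple_right: "k < \<theta> \<Longrightarrow> bichar q y (simple k) = (\<Prod>l<\<theta>. q l k powi y l)"
proof -
  assume k: "k < \<theta>"
  have "bichar q y (simple k) = (\<Prod>i<\<theta>. \<Prod>l<\<theta>. if l = k then q i k powi y i else 1)"
    unfolding bichar_def by (intro prod.cong) (auto simp: simple_def)
  then show ?thesis using k by simp
qed

lemma bichar_simple: "k < \<theta> \<Longrightarrow> l < \<theta> \<Longrightarrow> bichar q (simple k) (simple l) = q k l"
proof -
  assume *: "k < \<theta>" "l < \<theta>"
  have "bichar q (simple k) (simple l) = (\<Prod>m<\<theta>. if m = l then q k l else 1)"
    unfolding bichar_simple_left[OF *(1)] by (intro prod.cong) (auto simp: simple_def)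
  then show ?thesis using * by simp
qed

lemma sbichar_simple:
  assumes q: "cbraid q" and k: "k < \<theta>"
  shows "sbichar q (simple k) y = q k k powi pairing k y"
proof -
  have "sbichar q (simple k) y = (\<Prod>l<\<theta>. (q k l * q l k) powi y l)"
    unfolding sbichar_def bichar_simple_left[OF k] bichar_simple_right[OF k]
    by (simp add: prod.distrib power_int_mult_distrib)
  also have "\<dots> = (\<Prod>l<\<theta>. q k k powi (a k l * y l))"
    using q k by (intro prod.cong refl) (auto simp: cbraid_def power_int_mult)
  also have "\<dots> = q k k powi pairing k y"
    unfolding pairing_def using cbraid_nz[OF q] by (simp add: power_int_sum)
  finally show ?thesis .
qed

lemma sbichar_bilinear:
  assumes q: "cbraid q"
  shows "sbichar q (x + y) z = sbichar q x z * sbichar q y z" "sbichar q z (x + y) = sbichar q z x * sbichar q z y"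
    "sbichar q (\<lambda>l. c * x l) z = sbichar q x z powi c" "sbichar q z (\<lambda>l. c * x l) = sbichar q z x powi c"
  by (auto simp: sbichar_def bichar_add[OF q] bichar_scale power_int_mult_distrib)

lemma sbichar_srefl:
  assumes q: "cbraid q" and k: "k < \<theta>"
  shows "sbichar q (srefl k x) (srefl k y) = sbichar q x y"
proof -
  have 2: "sbichar q x (simple k) = q k k powi pairing k x" for x
    using sbichar_simple[OF q k] sbichar_sym by metis
  let ?Q = "q k k" and ?c = "pairing k x" and ?e = "pairing k y"
  have nz: "?Q \<noteq> 0" by (rule cbraid_nz[OF q])
  have l: "sbichar q (srefl k x) z = sbichar q x z * ?Q powi (- ?c * pairing k z)" for z
    unfolding srefl_eq sbichar_bilinear[OF q] sbichar_simple[OF q k] by (simp add: power_int_mult[symmetric] mult.commute)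
  have r: "sbichar q x (srefl k y) = sbichar q x y * ?Q powi (- ?e * ?c)"
    unfolding srefl_eq sbichar_bilinear[OF q] 2 by (simp add: power_int_mult[symmetric] mult.commute)
  have "?Q powi (- ?e * ?c) * ?Q powi (- ?c * pairing k (srefl k y)) = 1"
    unfolding pairing_srefl[OF k] using nz by (simp flip: power_int_add add: mult.commute)
  then show ?thesis unfolding l r by (simp add: mult.assoc)
qed

text \<open>The bicharacter itself need not be invariant, but on the diagonal only its
  symmetrization with a simple root enters, which in Cartan type is a power of
  \<open>q k k\<close>.\<close>

lemma bichar_srefl_diag:
  assumes q: "cbraid q" and k: "k < \<theta>"
  shows "bichar q (srefl k x) (srefl k x) = bichar q x x"
proof -
  let ?Q = "q k k" and ?c = "pairing k x"
  have nz: "?Q \<noteq> 0" by (rule cbraid_nz[OF q])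
  have s: "bichar q x (simple k) * bichar q (simple k) x = ?Q powi ?c"
    using sbichar_simple[OF q k, of x] by (simp add: sbichar_def mult.commute)
  have "bichar q (srefl k x) (srefl k x)
    = bichar q x x * ((bichar q x (simple k) * bichar q (simple k) x) powi (- ?c) * ?Q powi (?c * ?c))"
    unfolding srefl_eq bichar_add[OF q] bichar_scale bichar_simple[OF k k]
    by (simp add: power_int_mult[symmetric] power_int_mult_distrib ac_simps)
  also have "(bichar q x (simple k) * bichar q (simple k) x) powi (- ?c) * ?Q powi (?c * ?c) = 1"
    unfolding s using nz by (simp flip: power_int_mult power_int_add)
  finally show ?thesis by simp
qed

text \<open>The properties of the orbit of \<open>simple i\<close> that survive reflections. The
  integer \<open>n\<close> is the pairing of \<open>y\<close> with the coroot of \<beta>.\<close>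

definition root_like :: "(nat \<Rightarrow> nat \<Rightarrow> 'k::field_char_0) \<Rightarrow> (nat \<Rightarrow> int) \<Rightarrow> nat \<Rightarrow> (nat \<Rightarrow> int) \<Rightarrow> bool"
  where "root_like q d i \<beta> \<longleftrightarrow> bichar q \<beta> \<beta> = q i i \<and> bform d \<beta> \<beta> = 2 * d i \<and>
    (\<forall>y. \<exists>n. n * d i = bform d \<beta> y \<and> sbichar q \<beta> y = q i i powi n)"

lemma root_like_simple: "cbraid q \<Longrightarrow> i < \<theta> \<Longrightarrow> root_like q d i (simple i)"
  unfolding root_like_def by (simp add: bichar_simple bform_simple_simple, simp add: bform_simple_left sbichar_simple mult.commute, blast)

lemma root_like_srefl:
  assumes "cbraid q" "k < \<theta>" "symmetrizes \<theta> d a" "root_like q d i \<beta>"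
  shows "root_like q d i (srefl k \<beta>)"
proof -
  have "\<exists>n. n * d i = bform d (srefl k \<beta>) y \<and> sbichar q (srefl k \<beta>) y = q i i powi n" for y
    using assms(4) bform_srefl[OF assms(3,2), of \<beta> "srefl k y"] sbichar_srefl[OF assms(1,2), of \<beta> "srefl k y"] assms(2)
    unfolding root_like_def by simp
  then show ?thesis
    using assms(4) bform_srefl[OF assms(3,2)] bichar_srefl_diag[OF assms(1,2)] unfolding root_like_def by simp
qed

text \<open>Follow the path. If \<beta> pairs nontrivially with \<alpha>_l but is orthogonal to the
  neighbour \<alpha>_m, reflecting \<beta> in \<alpha>_l adds a nonzero multiple of \<alpha>_l,
  which is not orthogonal to \<alpha>_m.\<close>

lemma root_like_exists:
  assumes q: "cbraid q" and d: "posdef d" and i: "i < \<theta>" and path: "(i, l) \<in> (dynkin_edges \<theta> a)\<^sup>*"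
  shows "\<exists>\<beta>. root_like q d i \<beta> \<and> bform d \<beta> (simple l) \<noteq> 0"
  using path
proof (induction rule: rtrancl_induct)
  have s: "symmetrizes \<theta> d a" using d by (simp add: posdef_def)
  {
    case base
    have "d i > 0" using s i by (simp add: symmetrizes_def)
    then show ?case using root_like_simple[OF q i] bform_simple_simple[OF i, of d] by fastforce
  next
    case (step l m)
    then obtain \<beta> where \<beta>: "root_like q d i \<beta>" "bform d \<beta> (simple l) \<noteq> 0" by blast
    have lm: "l < \<theta>" "m < \<theta>" "a l m \<noteq> 0" using step(2) by (auto simp: dynkin_edges_def)
    show ?case
    proof (cases "bform d \<beta> (simple m) = 0")
      case True
      have "bform d \<beta> (simple l) = d l * pairing l \<beta>" using bform_sym[OF s] bform_simple_left[OF lm(1)] by metis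
      then have p: "d l \<noteq> 0" "pairing l \<beta> \<noteq> 0" using \<beta>(2) by auto
      have "bform d (srefl l \<beta>) (simple m) = - pairing l \<beta> * (d l * a l m)"
        unfolding srefl_eq bform_add bform_scale True bform_simple_left[OF lm(1)] pairing_simple[OF lm(2)] by simp
      then have "bform d (srefl l \<beta>) (simple m) \<noteq> 0" using p lm(3) by simp
      then show ?thesis using root_like_srefl[OF q lm(1) s \<beta>(1)] by blast
    qed (use \<beta> in blast)
  }
qed

lemma bichar_cong: "(\<And>k. k < \<theta> \<Longrightarrow> x k = x' k) \<Longrightarrow> bichar q x x = bichar q x' x'"
  unfolding bichar_def by (intro prod.cong refl) auto

text \<open>An edge relates only powers of the two diagonal entries, so following a path could lose
  a root of unity. Instead an element \<beta> from the orbit of \<alpha>_i is compared with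
  \<alpha>_j directly: \<open>q i i powi n = q j j powi m\<close>, where \<open>n\<close> and
  \<open>m\<close> are coroot pairings with product between 1 and 4. Then \<open>n\<close> is 1 up
  to sign, or \<beta> equals \<alpha>_j up to sign.\<close>

lemma diagonal_relation:
  assumes q: "cbraid q" and d: "posdef d" and ij: "i < \<theta>" "j < \<theta>" and path: "(i, j) \<in> (dynkin_edges \<theta> a)\<^sup>*"
    and le: "d j \<le> d i"
  shows "\<exists>r. d i = r * d j \<and> q i i = q j j powi r"
proof -
  have s: "symmetrizes \<theta> d a" using d by (simp add: posdef_def)
  have dp: "d i > 0" "d j > 0" using s ij by (auto simp: symmetrizes_def)
  obtain \<beta> where \<beta>: "root_like q d i \<beta>" "bform d \<beta> (simple j) \<noteq> 0"
    using root_like_exists[OF q d ij(1) path] by blast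
  then obtain n where n: "n * d i = bform d \<beta> (simple j)" "sbichar q \<beta> (simple j) = q i i powi n"
    unfolding root_like_def by blast
  define m where "m = pairing j \<beta>"
  have m: "bform d \<beta> (simple j) = d j * m" "sbichar q \<beta> (simple j) = q j j powi m"
    using bform_sym[OF s] bform_simple_left[OF ij(2)] sbichar_sym sbichar_simple[OF q ij(2)]
    unfolding m_def by metis+
  have eq: "n * d i = m * d j" using n(1) m(1) by (simp add: mult.commute)
  have nz: "n \<noteq> 0" "m \<noteq> 0" using \<beta>(2) n(1) m(1) by auto
  have bb: "bform d \<beta> \<beta> = 2 * d i" using \<beta>(1) by (simp add: root_like_def)
  have "(bform d \<beta> (simple j))\<^sup>2 \<le> (2 * d i) * (2 * d j)"
    using cauchy_schwarz[OF d, of \<beta> "simple j"] bb dp by (simp add: bform_simple_simple[OF ij(2)])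
  moreover have "(bform d \<beta> (simple j))\<^sup>2 = (n * m) * (d i * d j)"
    using n(1) eq by (simp add: power2_eq_square) (metis mult.assoc mult.commute mult.left_commute)
  ultimately have "(n * m) * (d i * d j) \<le> 4 * (d i * d j)" by (simp add: ac_simps)
  then have nm4: "n * m \<le> 4" using dp by (simp add: mult_le_cancel_right mult_less_0_iff)
  have nm0: "0 < n * m"
  proof -
    have "n * m * d j = n * n * d i" using eq by (simp add: mult.assoc)
    also have "\<dots> > 0" using nz dp by (simp add: zero_less_mult_iff not_less) (metis not_less_iff_gr_or_eq)
    finally show ?thesis using dp by (simp add: zero_less_mult_iff)
  qed
  have abs: "\<bar>n\<bar> \<le> \<bar>m\<bar>"
  proof -
    have "\<bar>n\<bar> * d j \<le> \<bar>n\<bar> * d i" using le by (intro mult_left_mono) auto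
    also have "\<dots> = \<bar>m\<bar> * d j" using arg_cong[OF eq, of abs] dp by (simp add: abs_mult)
    finally show ?thesis using dp by simp
  qed
  have abs4: "\<bar>n\<bar> * \<bar>m\<bar> \<le> 4" using nm4 nm0 by (simp flip: abs_mult)
  have qeq: "q i i powi n = q j j powi m" using n(2) m(2) by simp
  have n2: "\<bar>n\<bar> \<le> 2"
  proof (rule ccontr)
    assume "\<not> \<bar>n\<bar> \<le> 2"
    then have "3 * 3 \<le> \<bar>n\<bar> * \<bar>m\<bar>" using abs by (intro mult_mono) auto
    then show False using abs4 by simp
  qed
  consider "n = 1" | "n = - 1" | "\<bar>n\<bar> = 2" using n2 nz by linarith
  then show ?thesis
  proof cases
    case 1
    then show ?thesis using eq qeq by (intro exI[of _ m]) simp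
  next
    case 2
    then have "inverse (q i i) = q j j powi m" using qeq by (simp add: power_int_minus)
    then have "q i i = q j j powi (- m)" by (metis inverse_inverse_eq power_int_minus)
    then show ?thesis using eq 2 by (intro exI[of _ "- m"]) simp
  next
    case 3
    have "\<bar>m\<bar> \<le> 2" using abs4 3 by simp
    then have "\<bar>m\<bar> = 2" using abs 3 by simp
    then have mn: "m = n" using nm0 3 by (auto simp: abs_if zero_less_mult_iff split: if_splits)
    then have dd: "d i = d j" using eq nz by simp
    have "n = 2 * 1 \<or> n = 2 * (- 1)" using 3 by (auto simp: abs_if split: if_splits)
    then obtain e where e: "n = 2 * e" "e * e = 1" by (metis mult_1 minus_mult_minus)
    \<comment> \<open>Equality holds in the Cauchy-Schwarz inequality, so this difference has norm 0
      and \<beta> agrees with \<alpha>_j up to the sign \<open>e\<close>.\<close>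
    let ?z = "\<beta> + (\<lambda>l. - e * simple j l)"
    have bs: "bform d \<beta> (simple j) = 2 * e * d i" using n(1) e(1) by simp
    have "bform d ?z ?z = 2 * d i - e * (2 * e * d i) - e * (2 * e * d i) + e * e * (2 * d i)"
      unfolding bform_add bform_scale bb bform_sym[OF s, of "simple j" \<beta>] bs bform_simple_simple[OF ij(2)] dd[symmetric]
      by (simp add: algebra_simps)
    also have "\<dots> = 2 * d i - (e * e) * (2 * d i)" by (simp add: algebra_simps)
    also have "\<dots> = 0" by (simp add: e(2))
    finally have "\<forall>k<\<theta>. ?z k = 0" using d unfolding posdef_def by (metis less_irrefl)
    then have "\<beta> k = e * simple j k" if "k < \<theta>" for k using that by (simp add: pointwise)
    then have "bichar q \<beta> \<beta> = bichar q (\<lambda>l. e * simple j l) (\<lambda>l. e * simple j l)" by (rule bichar_cong)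
    also have "\<dots> = q j j powi (e * e)"
      unfolding bichar_scale bichar_simple[OF ij(2,2)] by (simp add: power_int_mult)
    finally have "q i i = q j j" using \<beta>(1) e(2) by (simp add: root_like_def)
    then show ?thesis using dd by (intro exI[of _ 1]) simp
  qed
qed

section \<open>From Cartan type to Drinfeld-Jimbo type and back\<close>

lemma dynkin_sym: "(i, j) \<in> dynkin_edges \<theta> a \<Longrightarrow> (j, i) \<in> dynkin_edges \<theta> a"
  using gcm by (auto simp: dynkin_edges_def generalized_cartan_matrix_def)

lemma dynkin_rtrancl_sym: "(i, j) \<in> (dynkin_edges \<theta> a)\<^sup>* \<Longrightarrow> (j, i) \<in> (dynkin_edges \<theta> a)\<^sup>*"
proof -
  have "sym (dynkin_edges \<theta> a)" using dynkin_sym by (auto simp: sym_def)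
  then show "(i, j) \<in> (dynkin_edges \<theta> a)\<^sup>* \<Longrightarrow> (j, i) \<in> (dynkin_edges \<theta> a)\<^sup>*" by (meson sym_rtrancl symD)
qed

lemma dynkin_component_eq:
  "(i, j) \<in> (dynkin_edges \<theta> a)\<^sup>* \<Longrightarrow> (dynkin_edges \<theta> a)\<^sup>* `` {i} = (dynkin_edges \<theta> a)\<^sup>* `` {j}"
  using dynkin_rtrancl_sym by (auto intro: rtrancl_trans)

lemma dynkin_component_bound: "i < \<theta> \<Longrightarrow> (i, j) \<in> (dynkin_edges \<theta> a)\<^sup>* \<Longrightarrow> j < \<theta>"
  by (erule rtrancl_induct) (auto simp: dynkin_edges_def)

text \<open>The diagonal of a DJ-type matrix consists of the powers with exponents
  \<open>2 * r i\<close> of the parameter, so the parameter of a component is a square root of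
  \<open>q j j\<close> at a vertex with least \<open>d j\<close>. By
  \<open>diagonal_relation\<close> the other diagonal entries are integral powers of that one, with
  the ratios \<open>r i\<close> of the old integers as exponents and as new symmetrizing
  integers.\<close>

lemma cartan_DJ_type:
  fixes q :: "nat \<Rightarrow> nat \<Rightarrow> 'k::{alg_closed_field, field_char_0}"
  assumes q: "cbraid q" and fin: "finite_cartan_matrix \<theta> a"
  shows "\<exists>q'. twist_equivalent \<theta> q q' \<and> DJ_type \<theta> q' a"
proof -
  obtain d where d: "posdef d" using finite_cartan_posdef[OF fin] by blast
  then have s: "symmetrizes \<theta> d a" by (simp add: posdef_def)
  have dp: "d i > 0" if "i < \<theta>" for i using s that by (simp add: symmetrizes_def)
  let ?C = "\<lambda>i. (dynkin_edges \<theta> a)\<^sup>* `` {i}"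
  \<comment> \<open>The vertex is chosen from the component as a set, so it is the same for all
    members.\<close>
  define b where "b J = (SOME j. j \<in> J \<and> (\<forall>k\<in>J. d j \<le> d k))" for J
  have b: "b (?C i) \<in> ?C i \<and> (\<forall>k\<in>?C i. d (b (?C i)) \<le> d k)" if i: "i < \<theta>" for i
  proof -
    have "?C i \<subseteq> {..<\<theta>}"
    proof
      fix k assume "k \<in> ?C i"
      then show "k \<in> {..<\<theta>}" using dynkin_component_bound[OF i, of k] by blast
    qed
    then have f: "finite (d ` ?C i)" by (intro finite_imageI) (rule finite_subset[OF _ finite_lessThan])
    have "Min (d ` ?C i) \<in> d ` ?C i" by (rule Min_in[OF f]) blast
    then obtain j where j: "j \<in> ?C i" "d j = Min (d ` ?C i)" by (metis imageE)
    have "\<forall>k\<in>?C i. d j \<le> d k" unfolding j(2) using Min_le[OF f] by blast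
    with j(1) have "j \<in> ?C i \<and> (\<forall>k\<in>?C i. d j \<le> d k)" ..
    then show ?thesis unfolding b_def by (rule someI[where P = "\<lambda>j. j \<in> ?C i \<and> (\<forall>k\<in>?C i. d j \<le> d k)"])
  qed
  define j where "j i = b (?C i)" for i
  have jprop: "j i < \<theta>" "(i, j i) \<in> (dynkin_edges \<theta> a)\<^sup>*" "d (j i) \<le> d i" if "i < \<theta>" for i
    using b[OF that] dynkin_component_bound[OF that] unfolding j_def by auto
  have jeq: "j i = j k" if "(i, k) \<in> (dynkin_edges \<theta> a)\<^sup>*" for i k
    using dynkin_component_eq[OF that] by (simp add: j_def)
  have "\<exists>r. \<forall>i<\<theta>. d i = r i * d (j i) \<and> q i i = q (j i) (j i) powi r i"
    using diagonal_relation[OF q d _ jprop(1) jprop(2) jprop(3)] by metis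
  then obtain r where r: "\<And>i. i < \<theta> \<Longrightarrow> d i = r i * d (j i)" "\<And>i. i < \<theta> \<Longrightarrow> q i i = q (j i) (j i) powi r i"
    by blast
  have "\<exists>y. y ^ 2 = x" for x :: 'k using nth_root_exists[of 2 x] by auto
  then obtain sq :: "'k \<Rightarrow> 'k" where sq: "\<And>x. (sq x)\<^sup>2 = x" by metis
  define Q where "Q J = sq (q (b J) (b J))" for J
  have Q2: "(Q (?C i))\<^sup>2 = q (j i) (j i)" for i by (simp add: Q_def sq j_def)
  have Qnz: "Q (?C i) \<noteq> 0" for i using Q2[of i] cbraid_nz[OF q] by (metis zero_power2)
  have Qr: "\<not> root_of_one (Q (?C i))" if i: "i < \<theta>" for i
  proof
    assume "root_of_one (Q (?C i))"
    then obtain n where n: "n > 0" "Q (?C i) ^ n = 1" unfolding root_of_one_def by blast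
    have "q (j i) (j i) ^ n = (Q (?C i) ^ n) ^ 2" unfolding Q2[symmetric] by (simp flip: power_mult add: mult.commute)
    then have "root_of_one (q (j i) (j i))" using n unfolding root_of_one_def by auto
    then show False using cbraid_not_root[OF q jprop(1)[OF i]] by simp
  qed
  have qQ: "q i i = Q (?C i) powi (2 * r i)" if "i < \<theta>" for i
    using r(2)[OF that] unfolding Q2[symmetric] by (simp add: power_int_mult)
  have edge: "(i, k) \<in> (dynkin_edges \<theta> a)\<^sup>*" if "i < \<theta>" "k < \<theta>" "a i k \<noteq> 0" for i k
    using that by (cases "i = k") (auto simp: dynkin_edges_def)
  have azero: "a k i = 0" if "i < \<theta>" "k < \<theta>" "a i k = 0" for i k
    using that gcm by (cases "i = k") (auto simp: generalized_cartan_matrix_def)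
  have rs: "symmetrizes \<theta> r a"
    unfolding symmetrizes_def
  proof (intro conjI allI impI)
    fix i assume i: "i < \<theta>"
    show "r i > 0" using r(1)[OF i] dp[OF i] dp[OF jprop(1)[OF i]] by (simp add: zero_less_mult_iff)
    fix k assume k: "k < \<theta>"
    show "r i * a i k = r k * a k i"
    proof (cases "a i k = 0")
      case False
      have "j i = j k" by (rule jeq[OF edge[OF i k False]])
      moreover have "d i * a i k = d k * a k i" using s i k by (simp add: symmetrizes_def)
      ultimately have "(r i * a i k) * d (j i) = (r k * a k i) * d (j i)"
        unfolding r(1)[OF i] r(1)[OF k] by (simp add: ac_simps)
      then show ?thesis using dp[OF jprop(1)[OF i]] by simp
    qed (simp add: azero[OF i k])
  qed
  define q' where "q' i k = Q (?C i) powi (r i * a i k)" for i k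
  have "twist_equivalent \<theta> q q'"
    unfolding twist_equivalent_def
  proof (intro conjI allI impI)
    fix i assume i: "i < \<theta>"
    then show "q i i = q' i i" unfolding qQ[OF i] by (simp add: q'_def mult.commute)
    fix k assume k: "k < \<theta>"
    have p: "q i k * q k i = q i i powi a i k" using q i k by (simp add: cbraid_def)
    show "q i k * q k i = q' i k * q' k i"
    proof (cases "a i k = 0")
      case True
      then show ?thesis unfolding p by (simp add: q'_def azero[OF i k])
    next
      case False
      have c: "?C k = ?C i" by (rule dynkin_component_eq[OF edge[OF i k False], symmetric])
      have "q' i k * q' k i = Q (?C i) powi (r i * a i k + r k * a k i)"
        unfolding q'_def c using Qnz by (simp add: power_int_add)
      also have "r i * a i k + r k * a k i = 2 * r i * a i k" using rs i k by (simp add: symmetrizes_def)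
      also have "Q (?C i) powi (2 * r i * a i k) = q i i powi a i k" unfolding qQ[OF i] by (rule power_int_mult)
      finally show ?thesis unfolding p by simp
    qed
  qed
  moreover have "DJ_type \<theta> q' a"
    unfolding DJ_type_def
  proof (intro conjI gcm exI[of _ r] rs ballI)
    fix J assume "J \<in> dynkin_components \<theta> a"
    then obtain i where i: "i < \<theta>" "J = ?C i" by (auto simp: dynkin_components_def)
    have "\<forall>k\<in>J. \<forall>l<\<theta>. q' k l = Q J powi (r k * a k l)"
    proof (intro ballI allI impI)
      fix k l assume "k \<in> J"
      then have "?C k = J" using dynkin_component_eq[of i k] i by auto
      then show "q' k l = Q J powi (r k * a k l)" by (simp add: q'_def)
    qed
    then show "\<exists>qJ. qJ \<noteq> 0 \<and> \<not> root_of_one qJ \<and> (\<forall>i\<in>J. \<forall>l<\<theta>. q' i l = qJ powi (r i * a i l))"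
      using Qnz Qr[OF i(1)] unfolding i(2) by blast
  qed
  ultimately show ?thesis by blast
qed

end

text \<open>Within a component \<open>d i * a i j + d j * a j i = 2 * d i * a i j\<close>, which is
  the Cartan condition in exponents; between components both entries are 1.\<close>

lemma DJ_type_cbraid:
  fixes q :: "nat \<Rightarrow> nat \<Rightarrow> 'k::field_char_0"
  assumes nz: "\<And>i j. q i j \<noteq> 0" and tw: "twist_equivalent \<theta> q q'" and DJ: "DJ_type \<theta> q' a"
  shows "cartan \<theta> a" "cartan.cbraid \<theta> a q"
proof -
  obtain d where g: "generalized_cartan_matrix \<theta> a" and s: "symmetrizes \<theta> d a"
    and J: "\<And>J. J \<in> dynkin_components \<theta> a \<Longrightarrow> \<exists>qJ. qJ \<noteq> 0 \<and> \<not> root_of_one qJ \<and> (\<forall>i\<in>J. \<forall>j<\<theta>. q' i j = qJ powi (d i * a i j))"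
    using DJ unfolding DJ_type_def by blast
  show c: "cartan \<theta> a" using g by unfold_locales
  interpret cartan \<theta> a by (rule c)
  have i: "\<not> root_of_one (q i i) \<and> (\<forall>j<\<theta>. q i j * q j i = q i i powi a i j)" if i: "i < \<theta>" for i
  proof -
    let ?J = "(dynkin_edges \<theta> a)\<^sup>* `` {i}"
    have "?J \<in> dynkin_components \<theta> a" using i by (auto simp: dynkin_components_def)
    then obtain Q where Q: "Q \<noteq> 0" "\<not> root_of_one Q" "\<And>k j. k \<in> ?J \<Longrightarrow> j < \<theta> \<Longrightarrow> q' k j = Q powi (d k * a k j)"
      using J by blast
    have di: "d i > 0" using s i by (simp add: symmetrizes_def)
    have qii: "q i i = Q powi (2 * d i)"
      using Q(3)[of i i] i tw by (simp add: twist_equivalent_def mult.commute)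
    have "\<not> root_of_one (q i i)"
    proof
      assume "root_of_one (q i i)"
      then obtain n where n: "n > 0" "q i i ^ n = 1" unfolding root_of_one_def by blast
      have "q i i ^ n = Q powi (int (nat (2 * d i) * n))"
        unfolding qii using di by (simp add: power_int_power')
      then have "Q ^ (nat (2 * d i) * n) = 1" using n(2) by (simp only: power_int_of_nat)
      moreover have "nat (2 * d i) * n > 0" using n di by simp
      ultimately show False using Q(2) unfolding root_of_one_def by blast
    qed
    moreover have "q i j * q j i = q i i powi a i j" if j: "j < \<theta>" for j
    proof -
      have e: "q i j * q j i = q' i j * q' j i" using tw i j by (simp add: twist_equivalent_def)
      have sj: "d j * a j i = d i * a i j" using s i j by (simp add: symmetrizes_def)
      show ?thesis
      proof (cases "j \<in> ?J")
        case True
        have "q' i j * q' j i = Q powi (d i * a i j + d j * a j i)"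
          using Q(1) Q(3)[of i j] Q(3)[OF True i] j by (simp add: power_int_add)
        also have "\<dots> = q i i powi a i j" unfolding qii sj power_int_mult[symmetric] by (simp add: algebra_simps)
        finally show ?thesis unfolding e .
      next
        case False
        then have aij: "a i j = 0" using i j by (auto simp: dynkin_edges_def)
        then have aji: "a j i = 0" using g i j False by (auto simp: generalized_cartan_matrix_def)
        let ?J' = "(dynkin_edges \<theta> a)\<^sup>* `` {j}"
        have "?J' \<in> dynkin_components \<theta> a" using j by (auto simp: dynkin_components_def)
        then obtain Q' where "\<And>k l. k \<in> ?J' \<Longrightarrow> l < \<theta> \<Longrightarrow> q' k l = Q' powi (d k * a k l)" using J by blast
        then have "q' j i = 1" using i aji by auto
        moreover have "q' i j = 1" using Q(3)[of i j] j aij by simp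
        ultimately show ?thesis unfolding e aij by simp
      qed
    qed
    ultimately show ?thesis by blast
  qed
  show "cbraid q" unfolding cbraid_def using nz i by blast
qed

theorem growth_iff_DJ_type:
  fixes q :: "nat \<Rightarrow> nat \<Rightarrow> 'k::{alg_closed_field, field_char_0}"
  assumes nz: "\<And>i j. q i j \<noteq> 0" and gen: "\<And>i. i < \<theta> \<Longrightarrow> \<not> root_of_one (q i i)"
  shows "(\<exists>d. letters.growth \<theta> (nich \<theta> q) d) \<longleftrightarrow>
    (\<exists>q' a. twist_equivalent \<theta> q q' \<and> DJ_type \<theta> q' a \<and> finite_cartan_matrix \<theta> a)"
proof
  assume "\<exists>d. letters.growth \<theta> (nich \<theta> q) d"
  then obtain d where g: "letters.growth \<theta> (nich \<theta> q) d" by blast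
  have ex: "\<exists>m. q i j * q j i * q i i ^ m = 1" if "i < \<theta>" "j < \<theta>" "i \<noteq> j" for i j
    by (rule letters.growth_cartan[OF nz that gen[OF that(1)] g])
  \<comment> \<open>Taking the least exponent makes \<open>M i j = 0\<close> equivalent to
    \<open>q i j * q j i = 1\<close>, a symmetric condition, as a generalized Cartan matrix
    requires.\<close>
  define M where "M i j = (LEAST m. q i j * q j i * q i i ^ m = 1)" for i j
  have M: "q i j * q j i * q i i ^ M i j = 1" if "i < \<theta>" "j < \<theta>" "i \<noteq> j" for i j
    unfolding M_def using ex[OF that] by (rule LeastI_ex)
  define a where "a i j = (if i = j then 2 else - int (M i j))" for i j
  have gcm: "generalized_cartan_matrix \<theta> a"
    unfolding generalized_cartan_matrix_def
  proof (intro conjI allI impI)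
    fix i j assume ij: "i < \<theta>" "j < \<theta>" "i \<noteq> j"
    show "a i j \<le> 0" using ij by (simp add: a_def)
    assume "a i j = 0"
    then have "M i j = 0" using ij by (simp add: a_def)
    then have "q j i * q i j * q j j ^ 0 = 1" using M[OF ij] by (simp add: mult.commute)
    then have "M j i \<le> 0" unfolding M_def by (rule Least_le)
    then show "a j i = 0" using ij by (simp add: a_def)
  qed (simp add: a_def)
  interpret cartan \<theta> a by unfold_locales (rule gcm)
  have "q i j * q j i = q i i powi a i j" if "i < \<theta>" "j < \<theta>" for i j
  proof (cases "i = j")
    case True then show ?thesis by (simp add: a_def power2_eq_square)
  next
    case False
    from M[OF that False] have "q i j * q j i = inverse (q i i ^ M i j)"
      by (metis inverse_unique mult.commute)
    then show ?thesis using False by (simp add: a_def power_int_minus)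
  qed
  then have cb: "cbraid q" unfolding cbraid_def using nz gen by blast
  obtain X where "full_chain q (nich \<theta> q) X"
    using full_chain_exists[OF growth_partial_chain[OF g _ cb coideal_subalg_nich] cb coideal_subalg_nich] by blast
  from finite_type[OF this cb] have fin: "finite_cartan_matrix \<theta> a" .
  from cartan_DJ_type[OF cb this] fin
  show "\<exists>q' a. twist_equivalent \<theta> q q' \<and> DJ_type \<theta> q' a \<and> finite_cartan_matrix \<theta> a" by blast
next
  assume "\<exists>q' a. twist_equivalent \<theta> q q' \<and> DJ_type \<theta> q' a \<and> finite_cartan_matrix \<theta> a"
  then obtain q' a where *: "twist_equivalent \<theta> q q'" "DJ_type \<theta> q' a" "finite_cartan_matrix \<theta> a" by blast
  note DJ = DJ_type_cbraid[OF nz *(1,2)]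
  interpret cartan \<theta> a by (rule DJ(1))
  obtain X where "full_chain q (nich \<theta> q) X" using full_chain_finite_type[OF *(3) DJ(2)] by blast
  from full_chain_growth[OF this DJ(2) coideal_subalg_nich] show "\<exists>d. growth (nich \<theta> q) d" by blast
qed

section \<open>The tensor algebra in coordinates\<close>

locale diagonal_braiding = vector_space scale
  for scale :: "'k::field_char_0 \<Rightarrow> 'v::ab_group_add \<Rightarrow> 'v" +
  fixes c :: "('v, 'k) tensor \<Rightarrow> ('v, 'k) tensor" and xs :: "'v list" and q :: "nat \<Rightarrow> nat \<Rightarrow> 'k"
  assumes braided: "braided_vector_space scale c" and diag: "diagonal_type scale c xs q"
    and qnz: "\<And>i j. q i j \<noteq> 0"
begin

abbreviation \<theta> :: nat where "\<theta> \<equiv> length xs"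

abbreviation lin :: "('v \<Rightarrow> 'k) \<Rightarrow> bool" where "lin \<equiv> Vector_Spaces.linear scale (*)"

abbreviation T :: "('v, 'k) tensor set" where "T \<equiv> carrier (tensor_algebra scale)"

abbreviation T2 :: "('v, 'k) tensor2 set" where "T2 \<equiv> tensor2_of T T"

definition words :: "nat \<Rightarrow> nat list set"
  where "words n = {w. length w = n \<and> set w \<subseteq> {..<\<theta>}}"

definition dual :: "nat \<Rightarrow> 'v \<Rightarrow> 'k"
  where "dual i v = representation (set xs) v (xs ! i)"

definition pt :: "nat list \<Rightarrow> ('v, 'k) tensor"
  where "pt w = pure_tensor scale (map ((!) xs) w)"

lemma xs_props: "distinct xs" "independent (set xs)" "span (set xs) = UNIV"
  using diag by (auto simp: diagonal_type_def)

lemma c_basis: "i < \<theta> \<Longrightarrow> j < \<theta> \<Longrightarrow>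
    c (pure_tensor scale [xs ! i, xs ! j]) = fun_scale (q i j) (pure_tensor scale [xs ! j, xs ! i])"
  using diag by (auto simp: diagonal_type_def)

lemma lin_dual: "lin (dual i)"
proof -
  have "dual i = (\<lambda>v. representation (set xs) v (xs ! i))" by (rule ext) (simp add: dual_def)
  then show ?thesis using linear_representation[OF xs_props(2,3)] by simp
qed

lemma dual_basis: "i < \<theta> \<Longrightarrow> j < \<theta> \<Longrightarrow> dual i (xs ! j) = (if i = j then 1 else 0)"
  using xs_props by (auto simp: dual_def representation_basis nth_eq_iff_index_eq)

lemma sum_dual: "(\<Sum>i<\<theta>. scale (dual i v) (xs ! i)) = v"
proof -
  have "(\<Sum>b\<in>set xs. scale (representation (set xs) v b) b) = v"
    using xs_props by (intro sum_representation_eq) auto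
  moreover have "(\<Sum>b\<in>set xs. scale (representation (set xs) v b) b) = (\<Sum>i<\<theta>. scale (dual i v) (xs ! i))"
    unfolding dual_def using xs_props(1)
    by (intro sum.reindex_bij_betw[symmetric, where h = "(!) xs", simplified]) (rule bij_betw_nth, auto)
  ultimately show ?thesis by simp
qed

lemma lin_sum_dual: "lin f \<Longrightarrow> f v = (\<Sum>i<\<theta>. dual i v * f (xs ! i))"
proof -
  assume f: "lin f"
  interpret f: Vector_Spaces.linear scale "(*)" f by (rule f)
  have "f v = f (\<Sum>i<\<theta>. scale (dual i v) (xs ! i))" by (simp only: sum_dual)
  also have "\<dots> = (\<Sum>i<\<theta>. dual i v * f (xs ! i))" by (simp add: f.sum f.scale)
  finally show ?thesis .
qed

section \<open>Pure tensors and coordinates\<close>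

lemma pure_tensor_Nil: "pure_tensor scale [] fs = (if fs = [] then 1 else 0)"
  by (auto simp: pure_tensor_def)

lemma pure_tensor_Cons_Nil: "pure_tensor scale (v # vs) [] = 0"
  by (simp add: pure_tensor_def)

lemma pure_tensor_Cons: "pure_tensor scale (v # vs) (f # fs) = (if lin f then f v * pure_tensor scale vs fs else 0)"
  by (auto simp: pure_tensor_def prod.lessThan_Suc_shift simp del: prod.lessThan_Suc)

lemmas pure_tensor_simps = pure_tensor_Nil pure_tensor_Cons_Nil pure_tensor_Cons

lemma pure_tensor_length: "length fs \<noteq> length vs \<Longrightarrow> pure_tensor scale vs fs = 0"
  by (simp add: pure_tensor_def)

lemma pure_tensor_append:
  "length fs = length us \<Longrightarrow> pure_tensor scale (us @ vs) (fs @ gs) = pure_tensor scale us fs * pure_tensor scale vs gs"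
  by (induction fs us rule: list_induct2) (auto simp: pure_tensor_simps)

lemma pure_tensor_split: "pure_tensor scale (us @ vs) fs
    = pure_tensor scale us (take (length us) fs) * pure_tensor scale vs (drop (length us) fs)"
proof (cases "length us \<le> length fs")
  case True
  then show ?thesis
    using pure_tensor_append[of "take (length us) fs" us vs "drop (length us) fs"] by simp
next
  case False
  then show ?thesis by (simp add: pure_tensor_length)
qed

lemma words_0: "words 0 = {[]}"
  by (auto simp: words_def)

lemma finite_words: "finite (words n)"
  unfolding words_def using finite_lists_length_eq[of "{..<\<theta>}" n] by (simp add: conj_commute)

lemma sum_words_Suc: "(\<Sum>w\<in>words (Suc n). g w) = (\<Sum>i<\<theta>. \<Sum>w\<in>words n. g (i # w))"
proof -
  have "words (Suc n) = (\<lambda>(i, w). i # w) ` ({..<\<theta>} \<times> words n)"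
    by (auto simp: words_def image_iff length_Suc_conv)
  moreover have "inj_on (\<lambda>(i, w). i # w) ({..<\<theta>} \<times> words n)" by (auto simp: inj_on_def)
  ultimately show ?thesis by (simp add: sum.reindex sum.cartesian_product split_def)
qed

lemma pt_simps: "pt [] fs = (if fs = [] then 1 else 0)" "pt (i # w) [] = 0"
  "pt (i # w) (f # fs) = (if lin f then f (xs ! i) * pt w fs else 0)"
  by (auto simp: pt_def pure_tensor_simps)

lemma pt_length: "length fs \<noteq> length w \<Longrightarrow> pt w fs = 0"
  by (simp add: pt_def pure_tensor_length)

lemma pt_dual: "set w \<subseteq> {..<\<theta>} \<Longrightarrow> set v \<subseteq> {..<\<theta>} \<Longrightarrow> pt w (map dual v) = (if v = w then 1 else 0)"
proof (induction w arbitrary: v)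
  case Nil then show ?case by (auto simp: pt_simps)
next
  case (Cons i w)
  then show ?case by (cases v) (auto simp: pt_simps lin_dual dual_basis)
qed

lemma pure_tensor_expand: "pure_tensor scale vs fs = (\<Sum>w\<in>words (length fs). pure_tensor scale vs (map dual w) * pt w fs)"
proof (induction vs arbitrary: fs)
  case Nil
  show ?case
  proof (cases fs)
    case (Cons f fs')
    have "(\<Sum>w\<in>words (length fs). pure_tensor scale [] (map dual w) * pt w fs) = 0"
      by (intro sum.neutral) (auto simp: pure_tensor_simps words_def Cons)
    then show ?thesis by (simp add: pure_tensor_simps Cons)
  qed (simp add: words_0 pure_tensor_simps pt_simps)
next
  case (Cons v vs)
  show ?case
  proof (cases fs)
    case Nil
    then show ?thesis by (simp add: words_0 pure_tensor_simps)
  next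
    case C: (Cons f fs')
    show ?thesis
    proof (cases "lin f")
      case True
      have "(\<Sum>w\<in>words (length fs). pure_tensor scale (v # vs) (map dual w) * pt w fs)
        = (\<Sum>i<\<theta>. \<Sum>w\<in>words (length fs'). (dual i v * f (xs ! i)) * (pure_tensor scale vs (map dual w) * pt w fs'))"
        using True by (simp add: C sum_words_Suc pure_tensor_simps pt_simps lin_dual ac_simps)
      also have "\<dots> = (\<Sum>i<\<theta>. dual i v * f (xs ! i)) * pure_tensor scale vs fs'"
        unfolding Cons.IH[of fs'] sum_distrib_right by (simp add: sum_distrib_left)
      also have "\<dots> = pure_tensor scale (v # vs) fs"
        using True lin_sum_dual[OF True, of v] by (simp add: C pure_tensor_simps)
      finally show ?thesis by simp
    next
      case False
      then have "(\<Sum>w\<in>words (length fs). pure_tensor scale (v # vs) (map dual w) * pt w fs) = 0"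
        by (simp add: C sum_words_Suc pt_simps)
      then show ?thesis using False by (simp add: C pure_tensor_simps)
    qed
  qed
qed

lemma T_def': "T = fv.span (range (pure_tensor scale))"
  by (simp add: tensor_algebra_def)

lemma subspace_T: "fv.subspace T"
  unfolding T_def' by (rule fv.subspace_span)

lemma pure_T: "pure_tensor scale vs \<in> T"
  unfolding T_def' by (intro fv.span_base) simp

lemma pt_T: "pt w \<in> T"
  by (simp add: pt_def pure_T)

text \<open>The values at lists of coordinate functionals are the coordinates in the basis
  \<open>pt w\<close>; by linearity it is enough to check pure tensors.\<close>

lemma T_expand: "t \<in> T \<Longrightarrow> t fs = (\<Sum>w\<in>words (length fs). t (map dual w) * pt w fs)"
proof -
  assume "t \<in> T"
  then show ?thesis
    unfolding T_def'
  proof (induction arbitrary: fs rule: fv.span_induct_alt)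
    case base show ?case by (simp add: pointwise)
  next
    case (step a p t)
    then obtain vs where p: "p = pure_tensor scale vs" by blast
    have "(fun_scale a p + t) fs = a * p fs + t fs" by (simp add: pointwise)
    also have "\<dots> = (\<Sum>w\<in>words (length fs). (a * p (map dual w) + t (map dual w)) * pt w fs)"
      using pure_tensor_expand[of vs fs] step(2)[of fs] unfolding p
      by (simp add: sum_distrib_left sum.distrib distrib_right mult.assoc)
    finally show ?case by (simp add: pointwise)
  qed
qed

lemma T_bounded: "t \<in> T \<Longrightarrow> \<exists>N. \<forall>fs. length fs > N \<longrightarrow> t fs = 0"
proof -
  assume "t \<in> T"
  then show ?thesis
    unfolding T_def'
  proof (induction rule: fv.span_induct_alt)
    case base show ?case by (simp add: pointwise)
  next
    case (step a p t)
    then obtain vs N where p: "p = pure_tensor scale vs" and N: "\<forall>fs. length fs > N \<longrightarrow> t fs = 0" by blast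
    show ?case
      by (intro exI[of _ "max N (length vs)"]) (auto simp: N p pointwise pure_tensor_length)
  qed
qed

lemma T_span: "T = fv.span (pt ` {w. set w \<subseteq> {..<\<theta>}})"
proof
  show "fv.span (pt ` {w. set w \<subseteq> {..<\<theta>}}) \<subseteq> T"
    by (rule fv.span_minimal[OF _ subspace_T]) (auto simp: pt_T)
  show "T \<subseteq> fv.span (pt ` {w. set w \<subseteq> {..<\<theta>}})"
  proof
    fix t assume t: "t \<in> T"
    obtain N where N: "\<forall>fs. length fs > N \<longrightarrow> t fs = 0" using T_bounded[OF t] by blast
    have "t = (\<Sum>w\<in>wordsn \<theta> N. fun_scale (t (map dual w)) (pt w))"
    proof
      fix fs
      have "t fs = (\<Sum>w\<in>words (length fs). t (map dual w) * pt w fs)" by (rule T_expand[OF t])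
      also have "\<dots> = (\<Sum>w\<in>wordsn \<theta> N. t (map dual w) * pt w fs)"
      proof (cases "length fs \<le> N")
        case True
        then show ?thesis
          by (intro sum.mono_neutral_left) (auto simp: words_def wordsn_def finite_wordsn[unfolded wordsn_def], metis pt_length)
      next
        case False
        have "(\<Sum>w\<in>words (length fs). t (map dual w) * pt w fs) = 0"
          using N False by (intro sum.neutral) (auto simp: words_def)
        moreover have "(\<Sum>w\<in>wordsn \<theta> N. t (map dual w) * pt w fs) = 0"
          using False by (intro sum.neutral) (auto simp: wordsn_def pt_length)
        ultimately show ?thesis by simp
      qed
      finally show "t fs = (\<Sum>w\<in>wordsn \<theta> N. fun_scale (t (map dual w)) (pt w)) fs"
        by (simp add: sum_fun_apply pointwise)
    qed
    then show "t \<in> fv.span (pt ` {w. set w \<subseteq> {..<\<theta>}})"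
      by (metis (mono_tags, lifting) fv.span_sum fv.span_scale fv.span_base imageI mem_Collect_eq wordsn_def)
  qed
qed

lemma T_induct [consumes 1, case_names zero add]:
  assumes "t \<in> T" "P 0"
    "\<And>a w t. set w \<subseteq> {..<\<theta>} \<Longrightarrow> t \<in> T \<Longrightarrow> P t \<Longrightarrow> P (fun_scale a (pt w) + t)"
  shows "P t"
proof -
  have "t \<in> T \<and> P t"
    using assms(1) unfolding T_span
  proof (induction rule: fv.span_induct_alt)
    case base
    then show ?case using assms(2) by (simp add: fv.span_zero)
  next
    case (step a p t)
    then obtain w where w: "p = pt w" "set w \<subseteq> {..<\<theta>}" by blast
    have "fun_scale a (pt w) + t \<in> T" using step(2) pt_T
      unfolding T_span[symmetric] by (blast intro: fv.subspace_add[OF subspace_T] fv.subspace_scale[OF subspace_T])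
    then show ?case using step(2) assms(3)[OF w(2), of t a] unfolding w(1) T_span by blast
  qed
  then show ?thesis by blast
qed

lemma T_eqI: "s \<in> T \<Longrightarrow> t \<in> T \<Longrightarrow> (\<And>w. set w \<subseteq> {..<\<theta>} \<Longrightarrow> s (map dual w) = t (map dual w)) \<Longrightarrow> s = t"
proof
  fix fs assume *: "s \<in> T" "t \<in> T" "\<And>w. set w \<subseteq> {..<\<theta>} \<Longrightarrow> s (map dual w) = t (map dual w)"
  show "s fs = t fs"
    unfolding T_expand[OF *(1), of fs] T_expand[OF *(2), of fs] using *(3) by (intro sum.cong) (auto simp: words_def)
qed

subsection \<open>Multiplication\<close>

lemma tensor_mult_linear:
  "tensor_mult (s + s') t = tensor_mult s t + tensor_mult s' t"
  "tensor_mult s (t + t') = tensor_mult s t + tensor_mult s t'"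
  "tensor_mult (fun_scale a s) t = fun_scale a (tensor_mult s t)"
  "tensor_mult s (fun_scale a t) = fun_scale a (tensor_mult s t)"
  "tensor_mult 0 t = 0" "tensor_mult s 0 = 0"
  by (auto simp: tensor_mult_def fun_eq_iff pointwise algebra_simps sum.distrib sum_distrib_left)

lemma tensor_mult_pure: "tensor_mult (pure_tensor scale us) (pure_tensor scale vs) = pure_tensor scale (us @ vs)"
proof
  fix fs
  have "tensor_mult (pure_tensor scale us) (pure_tensor scale vs) fs
    = (\<Sum>i\<le>length fs. if i = length us then pure_tensor scale us (take i fs) * pure_tensor scale vs (drop i fs) else 0)"
    unfolding tensor_mult_def by (intro sum.cong) (auto simp: pure_tensor_length)
  also have "\<dots> = pure_tensor scale (us @ vs) fs"
    unfolding pure_tensor_split by (auto simp: pure_tensor_length)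
  finally show "tensor_mult (pure_tensor scale us) (pure_tensor scale vs) fs = pure_tensor scale (us @ vs) fs" .
qed

lemma tensor_mult_pt: "tensor_mult (pt u) (pt v) = pt (u @ v)"
  by (simp add: pt_def tensor_mult_pure)

lemma tensor_mult_T: "s \<in> T \<Longrightarrow> t \<in> T \<Longrightarrow> tensor_mult s t \<in> T"
proof (induction rule: T_induct)
  case zero then show ?case by (simp add: tensor_mult_linear fv.subspace_0[OF subspace_T])
next
  case (add a u s)
  have "tensor_mult (pt u) t \<in> T"
    using add(4)
  proof (induction rule: T_induct)
    case zero show ?case by (simp add: tensor_mult_linear fv.subspace_0[OF subspace_T])
  next
    case (add a w t)
    then show ?case
      by (simp add: tensor_mult_linear tensor_mult_pt fv.subspace_add[OF subspace_T] fv.subspace_scale[OF subspace_T] pt_T)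
  qed
  then show ?case using add
    by (simp add: tensor_mult_linear fv.subspace_add[OF subspace_T] fv.subspace_scale[OF subspace_T])
qed

lemma tensor_mult_assoc:
  assumes "r \<in> T" "s \<in> T" "t \<in> T" shows "tensor_mult (tensor_mult r s) t = tensor_mult r (tensor_mult s t)"
  using assms(1)
proof (induction rule: T_induct)
  case (add a u r)
  have "tensor_mult (tensor_mult (pt u) s) t = tensor_mult (pt u) (tensor_mult s t)"
    using assms(2)
  proof (induction rule: T_induct)
    case (add a v s)
    have "tensor_mult (tensor_mult (pt u) (pt v)) t = tensor_mult (pt u) (tensor_mult (pt v) t)"
      using assms(3)
    proof (induction rule: T_induct)
      case (add a w t)
      then show ?case by (simp add: tensor_mult_linear tensor_mult_pt)
    qed (simp add: tensor_mult_linear)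
    then show ?case using add by (simp add: tensor_mult_linear)
  qed (simp add: tensor_mult_linear)
  then show ?case using add by (simp add: tensor_mult_linear)
qed (simp add: tensor_mult_linear)

lemma tensor_mult_one: "t \<in> T \<Longrightarrow> tensor_mult (pt []) t = t" "t \<in> T \<Longrightarrow> tensor_mult t (pt []) = t"
proof -
  assume "t \<in> T"
  then show "tensor_mult (pt []) t = t" by (induction rule: T_induct) (simp_all add: tensor_mult_linear tensor_mult_pt)
next
  assume "t \<in> T"
  then show "tensor_mult t (pt []) = t" by (induction rule: T_induct) (simp_all add: tensor_mult_linear tensor_mult_pt)
qed

lemma tensor_algebra_simps [simp]:
  "mult (tensor_algebra scale) = tensor_mult" "one (tensor_algebra scale) = pt []"
  "zero (tensor_algebra scale) = 0" "add (tensor_algebra scale) = (+)"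
  by (auto simp: tensor_algebra_def pt_def)

lemma ring_T: "ring (tensor_algebra scale)"
proof (rule ringI)
  show "abelian_group (tensor_algebra scale)"
  proof (rule abelian_groupI)
    fix x assume "x \<in> T"
    then have "- x \<in> T" by (rule fv.subspace_neg[OF subspace_T])
    then show "\<exists>y\<in>T. y \<oplus>\<^bsub>tensor_algebra scale\<^esub> x = \<zero>\<^bsub>tensor_algebra scale\<^esub>" by (intro bexI[of _ "- x"]) auto
  qed (auto simp: fv.subspace_add[OF subspace_T] fv.subspace_0[OF subspace_T] algebra_simps)
  show "Group.monoid (tensor_algebra scale)"
    by (rule monoidI) (auto simp: tensor_mult_T tensor_mult_assoc tensor_mult_one pt_T)
qed (auto simp: tensor_mult_linear)

subsection \<open>Tensors of two factors\<close>

definition P2 :: "nat list \<Rightarrow> nat list \<Rightarrow> ('v, 'k) tensor2"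
  where "P2 u v = tensor2_pure (pt u) (pt v)"

lemma tensor2_pure_linear:
  "tensor2_pure (s + s') t = tensor2_pure s t + tensor2_pure s' t"
  "tensor2_pure s (t + t') = tensor2_pure s t + tensor2_pure s t'"
  "tensor2_pure (fun_scale a s) t = fun_scale a (tensor2_pure s t)"
  "tensor2_pure s (fun_scale a t) = fun_scale a (tensor2_pure s t)"
  "tensor2_pure 0 t = 0" "tensor2_pure s 0 = 0"
  by (auto simp: tensor2_pure_def fun_eq_iff pointwise algebra_simps)

lemma subspace_T2: "fv.subspace T2"
  unfolding tensor2_of_def by (rule fv.subspace_span)

lemma tensor2_pure_T2: "s \<in> T \<Longrightarrow> t \<in> T \<Longrightarrow> tensor2_pure s t \<in> T2"
  unfolding tensor2_of_def by (intro fv.span_base) blast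

lemma P2_T2: "P2 u v \<in> T2"
  by (simp add: P2_def tensor2_pure_T2 pt_T)

lemma T2_span: "T2 = fv.span {P2 u v | u v. set u \<subseteq> {..<\<theta>} \<and> set v \<subseteq> {..<\<theta>}}"
proof
  let ?S = "fv.span {P2 u v | u v. set u \<subseteq> {..<\<theta>} \<and> set v \<subseteq> {..<\<theta>}}"
  have st: "tensor2_pure s t \<in> ?S" if "s \<in> T" "t \<in> T" for s t
    using that(1)
  proof (induction rule: T_induct)
    case zero show ?case by (simp add: tensor2_pure_linear fv.span_zero)
  next
    case (add a u s)
    note u = add(1)
    have "tensor2_pure (pt u) t \<in> ?S"
      using that(2)
    proof (induction rule: T_induct)
      case zero show ?case by (simp add: tensor2_pure_linear fv.span_zero)
    next
      case (add a v t)
      have "tensor2_pure (pt u) (pt v) \<in> ?S" using u add(1) by (intro fv.span_base) (auto simp: P2_def)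
      then show ?case unfolding tensor2_pure_linear by (intro fv.span_add fv.span_scale add)
    qed
    then show ?case unfolding tensor2_pure_linear by (intro fv.span_add fv.span_scale add)
  qed
  show "T2 \<subseteq> ?S"
    unfolding tensor2_of_def by (rule fv.span_minimal[OF _ fv.subspace_span]) (use st in auto)
  show "?S \<subseteq> T2" by (rule fv.span_minimal[OF _ subspace_T2]) (auto simp: P2_T2)
qed

lemma T2_induct [consumes 1, case_names zero add]:
  assumes "x \<in> T2" "P 0"
    "\<And>a u v x. set u \<subseteq> {..<\<theta>} \<Longrightarrow> set v \<subseteq> {..<\<theta>} \<Longrightarrow> x \<in> T2 \<Longrightarrow> P x \<Longrightarrow> P (fun_scale a (P2 u v) + x)"
  shows "P x"
proof -
  have "x \<in> T2 \<and> P x"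
    using assms(1) unfolding T2_span
  proof (induction rule: fv.span_induct_alt)
    case base
    then show ?case using assms(2) by (simp add: fv.span_zero)
  next
    case (step a p x)
    then obtain u v where w: "p = P2 u v" "set u \<subseteq> {..<\<theta>}" "set v \<subseteq> {..<\<theta>}" by blast
    have "fun_scale a (P2 u v) + x \<in> T2" using step(2) P2_T2
      unfolding T2_span[symmetric] by (blast intro: fv.subspace_add[OF subspace_T2] fv.subspace_scale[OF subspace_T2])
    then show ?case using step(2) assms(3)[OF w(2,3), of x a] unfolding w(1) T2_span by blast
  qed
  then show ?thesis by blast
qed

text \<open>Allows a map on \<open>T\<close> to be applied to one tensor factor, as the product of
  \<open>T \<otimes> T\<close> and the antipode equations do.\<close>

lemma slice_T: "x \<in> T2 \<Longrightarrow> (\<lambda>fs. x (fs, gs)) \<in> T" "x \<in> T2 \<Longrightarrow> (\<lambda>fs. x (gs, fs)) \<in> T"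
proof -
  assume "x \<in> T2"
  then show "(\<lambda>fs. x (fs, gs)) \<in> T"
  proof (induction rule: T2_induct)
    case zero
    have "(\<lambda>fs. (0 :: ('v, 'k) tensor2) (fs, gs)) = 0" by (auto simp: fun_eq_iff pointwise)
    then show ?case by (simp add: fv.subspace_0[OF subspace_T])
  next
    case (add a u v x)
    have "(\<lambda>fs. (fun_scale a (P2 u v) + x) (fs, gs)) = fun_scale (a * pt v gs) (pt u) + (\<lambda>fs. x (fs, gs))"
      by (auto simp: fun_eq_iff pointwise P2_def tensor2_pure_def)
    then show ?case using add by (simp add: fv.subspace_add[OF subspace_T] fv.subspace_scale[OF subspace_T] pt_T)
  qed
next
  assume "x \<in> T2"
  then show "(\<lambda>fs. x (gs, fs)) \<in> T"
  proof (induction rule: T2_induct)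
    case zero
    have "(\<lambda>fs. (0 :: ('v, 'k) tensor2) (gs, fs)) = 0" by (auto simp: fun_eq_iff pointwise)
    then show ?case by (simp add: fv.subspace_0[OF subspace_T])
  next
    case (add a u v x)
    have "(\<lambda>fs. (fun_scale a (P2 u v) + x) (gs, fs)) = fun_scale (a * pt u gs) (pt v) + (\<lambda>fs. x (gs, fs))"
      by (auto simp: fun_eq_iff pointwise P2_def tensor2_pure_def)
    then show ?case using add by (simp add: fv.subspace_add[OF subspace_T] fv.subspace_scale[OF subspace_T] pt_T)
  qed
qed

end

section \<open>The coproduct of the tensor algebra\<close>

context diagonal_braiding
begin

lemmas T_simps = subspace_T[THEN fv.subspace_0] subspace_T[THEN fv.subspace_add] subspace_T[THEN fv.subspace_scale] pt_T
lemmas T2_simps = subspace_T2[THEN fv.subspace_0] subspace_T2[THEN fv.subspace_add] subspace_T2[THEN fv.subspace_scale] P2_T2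

lemma pt_append: "length fs = length u \<Longrightarrow> pt (u @ v) (fs @ gs) = pt u fs * pt v gs"
  by (simp add: pt_def pure_tensor_append)

section \<open>The braiding on basis monomials\<close>

lemma subspace_tensor_power: "fv.subspace (tensor_power scale n)"
  unfolding tensor_power_def by (rule fv.subspace_span)

lemma pt_tensor_power: "length w = n \<Longrightarrow> pt w \<in> tensor_power scale n"
  unfolding tensor_power_def pt_def by (intro fv.span_base) force

lemma c_linear:
  "s \<in> tensor_power scale 2 \<Longrightarrow> t \<in> tensor_power scale 2 \<Longrightarrow> c (s + t) = c s + c t"
  "s \<in> tensor_power scale 2 \<Longrightarrow> c (fun_scale a s) = fun_scale a (c s)"
  using braided by (auto simp: braided_vector_space_def linear_on_subspace_def)

lemma c_zero: "c 0 = 0"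
  using c_linear(2)[OF fv.subspace_0[OF subspace_tensor_power], of 0] by simp

lemma c_pt: "i < \<theta> \<Longrightarrow> j < \<theta> \<Longrightarrow> c (pt [i, j]) = fun_scale (q i j) (pt [j, i])"
  using c_basis by (simp add: pt_def)

text \<open>The element of \<open>V \<otimes> V\<close> to which \<open>braid_at\<close> applies
  \<open>c\<close>, with the outer arguments frozen.\<close>

definition middle :: "('v \<Rightarrow> 'k) list \<Rightarrow> ('v \<Rightarrow> 'k) list \<Rightarrow> ('v, 'k) tensor \<Rightarrow> ('v, 'k) tensor"
  where "middle as bs t = (\<lambda>gs. if length gs = 2 then t (as @ gs @ bs) else 0)"

lemma middle_linear: "middle as bs (s + t) = middle as bs s + middle as bs t"
  "middle as bs (fun_scale a t) = fun_scale a (middle as bs t)" "middle as bs 0 = 0"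
  by (auto simp: middle_def fun_eq_iff pointwise)

lemma middle_pt:
  assumes "length u = length as" "length v = length bs"
  shows "middle as bs (pt (u @ i # j # v)) = fun_scale (pt u as * pt v bs) (pt [i, j])"
proof
  fix gs show "middle as bs (pt (u @ i # j # v)) gs = fun_scale (pt u as * pt v bs) (pt [i, j]) gs"
  proof (cases "length gs = 2")
    case True
    then have "pt (u @ [i, j] @ v) (as @ gs @ bs) = pt u as * (pt [i, j] gs * pt v bs)"
      using assms by (subst pt_append, simp, subst pt_append, simp, simp)
    then show ?thesis using True by (simp add: middle_def pointwise)
  qed (simp add: middle_def pointwise pt_length)
qed

lemma middle_pt_0: "length w \<noteq> length as + 2 + length bs \<Longrightarrow> middle as bs (pt w) = 0"
  by (auto simp: middle_def fun_eq_iff pointwise pt_length)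

lemma split_at_two: "p + 2 \<le> length w \<Longrightarrow> \<exists>u i j v. w = u @ i # j # v \<and> length u = p"
proof -
  assume p: "p + 2 \<le> length w"
  then have "drop p w = w ! p # w ! Suc p # drop (Suc (Suc p)) w"
    by (metis Cons_nth_drop_Suc Suc_le_eq add_2_eq_Suc' less_imp_le_nat less_le_trans lessI)
  then have "w = take p w @ w ! p # w ! Suc p # drop (Suc (Suc p)) w" by (metis append_take_drop_id)
  then show ?thesis using p by (intro exI[of _ "take p w"]) auto
qed

text \<open>Needed because \<open>c\<close> is known to be linear only on
  \<open>tensor_power scale 2\<close>.\<close>

lemma middle_tensor_power: "t \<in> T \<Longrightarrow> middle as bs t \<in> tensor_power scale 2"
proof (induction rule: T_induct)
  case (add a w t)
  have "middle as bs (pt w) \<in> tensor_power scale 2"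
  proof (cases "length w = length as + 2 + length bs")
    case True
    then obtain u i j v where "w = u @ i # j # v" "length u = length as"
      using split_at_two[of "length as" w] by auto
    then show ?thesis using True
      by (simp add: middle_pt fv.subspace_scale[OF subspace_tensor_power] pt_tensor_power)
  qed (simp add: middle_pt_0 fv.subspace_0[OF subspace_tensor_power])
  then show ?case using add
    by (simp add: middle_linear fv.subspace_add[OF subspace_tensor_power] fv.subspace_scale[OF subspace_tensor_power])
qed (simp add: middle_linear fv.subspace_0[OF subspace_tensor_power])

lemma braid_at_middle: "braid_at c p t = (\<lambda>fs. if p + 2 \<le> length fs
    then c (middle (take p fs) (drop (p + 2) fs) t) (take 2 (drop p fs)) else 0)"
  unfolding braid_at_def middle_def by (rule refl)

lemma braid_at_linear:
  "s \<in> T \<Longrightarrow> t \<in> T \<Longrightarrow> braid_at c p (s + t) = braid_at c p s + braid_at c p t"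
  "t \<in> T \<Longrightarrow> braid_at c p (fun_scale a t) = fun_scale a (braid_at c p t)"
  "braid_at c p 0 = 0"
  by (auto simp: braid_at_middle fun_eq_iff pointwise middle_linear c_linear middle_tensor_power c_zero)

lemma braid_at_pt:
  assumes "i < \<theta>" "j < \<theta>"
  shows "braid_at c (length u) (pt (u @ i # j # v)) = fun_scale (q i j) (pt (u @ j # i # v))"
proof
  fix fs show "braid_at c (length u) (pt (u @ i # j # v)) fs = fun_scale (q i j) (pt (u @ j # i # v)) fs"
  proof (cases "length fs = length u + 2 + length v")
    case True
    let ?a = "take (length u) fs" and ?b = "drop (length u + 2) fs" and ?m = "take 2 (drop (length u) fs)"
    have fs: "fs = ?a @ ?m @ ?b" by (metis append_take_drop_id drop_drop add.commute)
    have l: "length ?a = length u" "length ?b = length v" "length ?m = 2" using True by auto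
    have "braid_at c (length u) (pt (u @ i # j # v)) fs = (pt u ?a * pt v ?b) * (q i j * pt [j, i] ?m)"
      using True assms l
      by (simp add: braid_at_middle middle_pt c_linear pt_tensor_power c_pt) (simp add: pointwise)
    also have "pt (u @ [j, i] @ v) (?a @ ?m @ ?b) = pt u ?a * (pt [j, i] ?m * pt v ?b)"
      using l by (subst pt_append, simp, subst pt_append, simp, simp)
    then have "(pt u ?a * pt v ?b) * (q i j * pt [j, i] ?m) = fun_scale (q i j) (pt (u @ j # i # v)) fs"
      using fs by (simp add: pointwise)
    finally show ?thesis .
  next
    case False
    have "pt (u @ j # i # v) fs = 0" using False by (intro pt_length) auto
    moreover have "braid_at c (length u) (pt (u @ i # j # v)) fs = 0"
      using False by (auto simp: braid_at_middle middle_pt_0 c_zero pointwise)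
    ultimately show ?thesis by (simp add: pointwise)
  qed
qed

lemma braid_at_pt_0: "length w < p + 2 \<Longrightarrow> braid_at c p (pt w) = 0"
  by (auto simp: braid_at_middle fun_eq_iff middle_pt_0 c_zero pointwise)

lemma braid_at_T: "t \<in> T \<Longrightarrow> braid_at c p t \<in> T"
proof (induction rule: T_induct)
  case (add a w t)
  have "braid_at c p (pt w) \<in> T"
  proof (cases "p + 2 \<le> length w")
    case True
    then obtain u i j v where "w = u @ i # j # v" "length u = p" using split_at_two by blast
    then show ?thesis using add(1) by (auto simp: braid_at_pt T_simps)
  qed (simp add: braid_at_pt_0 T_simps)
  then show ?case using add by (simp add: braid_at_linear T_simps)
qed (simp add: braid_at_linear T_simps)

text \<open>The scalar produced when the block \<open>u\<close> is braided past the block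
  \<open>w\<close>.\<close>

definition chi :: "nat list \<Rightarrow> nat list \<Rightarrow> 'k"
  where "chi u w = (\<Prod>k\<leftarrow>u. \<Prod>x\<leftarrow>w. q k x)"

lemma chi_simps [simp]: "chi [] w = 1" "chi u [] = 1"
  "chi (u @ u') w = chi u w * chi u' w" "chi u (w @ w') = chi u w * chi u w'"
proof -
  show "chi u [] = 1" by (induction u) (auto simp: chi_def)
  show "chi u (w @ w') = chi u w * chi u w'" by (induction u) (auto simp: chi_def)
qed (auto simp: chi_def)

lemma chi_Cons: "chi (k # u) w = chi [k] w * chi u w"
  by (simp add: chi_def)

lemma chi_Cons_right: "chi u (x # w) = chi u [x] * chi u w"
  using chi_simps(4)[of u "[x]" w] by simp

lemma chi_nonzero [simp]: "chi u w \<noteq> 0"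
  by (auto simp: chi_def prod_list_zero_iff qnz)

lemma chi_letters: "chi [k] [x] = q k x"
  by (simp add: chi_def)

lemma fold_braid_linear:
  "s \<in> T \<Longrightarrow> fold (braid_at c) ps s \<in> T"
  "s \<in> T \<Longrightarrow> t \<in> T \<Longrightarrow> fold (braid_at c) ps (s + t) = fold (braid_at c) ps s + fold (braid_at c) ps t"
  "t \<in> T \<Longrightarrow> fold (braid_at c) ps (fun_scale a t) = fun_scale a (fold (braid_at c) ps t)"
  "fold (braid_at c) ps 0 = 0"
  by (induction ps arbitrary: s t) (auto simp: braid_at_linear braid_at_T)

text \<open>The letter travels to the left, so the crossing at the last position of the block comes
  first; hence the reversed interval.\<close>

lemma fold_braid_letter:
  "set u \<subseteq> {..<\<theta>} \<Longrightarrow> x < \<theta> \<Longrightarrow>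
    fold (braid_at c) (rev [length a..<length a + length u]) (pt (a @ u @ x # b))
      = fun_scale (chi u [x]) (pt (a @ x # u @ b))"
proof (induction u arbitrary: b rule: rev_induct)
  case (snoc k u)
  have "braid_at c (length (a @ u)) (pt ((a @ u) @ k # x # b)) = fun_scale (q k x) (pt ((a @ u) @ x # k # b))"
    using snoc.prems by (intro braid_at_pt) auto
  moreover have "rev [length a..<length a + length (u @ [k])] = length (a @ u) # rev [length a..<length a + length u]"
    by simp
  moreover have "fold (braid_at c) (rev [length a..<length a + length u]) (pt (a @ u @ x # k # b))
      = fun_scale (chi u [x]) (pt (a @ x # u @ k # b))"
    using snoc by simp
  ultimately show ?case
    by (simp add: fold_braid_linear T_simps chi_letters mult.commute del: upt_Suc)
qed simp

lemma fold_braid_block: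
  "set u \<subseteq> {..<\<theta>} \<Longrightarrow> set w \<subseteq> {..<\<theta>} \<Longrightarrow>
    fold (braid_at c) (concat (map (\<lambda>j. rev [j..<j + length u]) [length a..<length a + length w])) (pt (a @ u @ w))
      = fun_scale (chi u w) (pt (a @ w @ u))"
proof (induction w arbitrary: a)
  case (Cons x w)
  have "[length a..<length a + length (x # w)] = length a # [length (a @ [x])..<length (a @ [x]) + length w]"
    by (subst upt_conv_Cons) auto
  then show ?case
    using Cons.prems Cons.IH[of "a @ [x]"] fold_braid_letter[of u x a w]
    by (simp add: fold_braid_linear T_simps chi_Cons_right[of _ x w])
qed simp

lemma block_braid_pt:
  "set u \<subseteq> {..<\<theta>} \<Longrightarrow> set w \<subseteq> {..<\<theta>} \<Longrightarrow>
    block_braid c (length u) (length w) (pt (u @ w)) = fun_scale (chi u w) (pt (w @ u))"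
  using fold_braid_block[of u w "[]"] by (simp add: block_braid_def)

text \<open>The component of bidegree \<open>(m, n)\<close>, regarded as a single tensor as in
  \<open>tensor2_braid\<close>.\<close>

definition join :: "nat \<Rightarrow> nat \<Rightarrow> ('v, 'k) tensor2 \<Rightarrow> ('v, 'k) tensor"
  where "join m n x = (\<lambda>fs. if length fs = m + n then x (take m fs, drop m fs) else 0)"

lemma join_linear: "join m n (x + y) = join m n x + join m n y"
  "join m n (fun_scale a x) = fun_scale a (join m n x)" "join m n 0 = 0"
  by (auto simp: join_def fun_eq_iff pointwise)

lemma join_P2: "join m n (P2 u v) = (if length u = m \<and> length v = n then pt (u @ v) else 0)"
proof (cases "length u = m \<and> length v = n")
  case True
  have "pt (u @ v) fs = pt u (take m fs) * pt v (drop m fs)" for fs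
    using True pure_tensor_split[of "map ((!) xs) u" "map ((!) xs) v" fs] by (simp add: pt_def)
  moreover have "pt (u @ v) fs = 0" if "length fs \<noteq> m + n" for fs using that True by (intro pt_length) auto
  ultimately show ?thesis using True by (auto simp: join_def P2_def tensor2_pure_def fun_eq_iff)
next
  case False
  then show ?thesis by (auto simp: join_def P2_def tensor2_pure_def fun_eq_iff pointwise pt_length)
qed

lemma join_T: "x \<in> T2 \<Longrightarrow> join m n x \<in> T"
proof (induction rule: T2_induct)
  case (add a u v x)
  then show ?case by (simp add: join_linear join_P2 T_simps)
qed (simp add: join_linear T_simps)

lemma tensor2_braid_join: "tensor2_braid c x (gs, hs) = block_braid c (length hs) (length gs) (join (length hs) (length gs) x) (gs @ hs)"
  by (simp add: tensor2_braid_def join_def)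

lemma tensor2_braid_linear:
  "x \<in> T2 \<Longrightarrow> y \<in> T2 \<Longrightarrow> tensor2_braid c (x + y) = tensor2_braid c x + tensor2_braid c y"
  "x \<in> T2 \<Longrightarrow> tensor2_braid c (fun_scale a x) = fun_scale a (tensor2_braid c x)"
  "tensor2_braid c 0 = 0"
  by (auto simp: fun_eq_iff tensor2_braid_join join_linear block_braid_def fold_braid_linear join_T pointwise)

lemma tensor2_braid_P2:
  assumes "set u \<subseteq> {..<\<theta>}" "set v \<subseteq> {..<\<theta>}"
  shows "tensor2_braid c (P2 u v) = fun_scale (chi u v) (P2 v u)"
proof
  fix z show "tensor2_braid c (P2 u v) z = fun_scale (chi u v) (P2 v u) z"
  proof (cases z)
    case (Pair gs hs)
    show ?thesis
    proof (cases "length u = length hs \<and> length v = length gs")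
      case True
      then have "tensor2_braid c (P2 u v) (gs, hs) = chi u v * pt (v @ u) (gs @ hs)"
        using block_braid_pt[OF assms] by (simp add: tensor2_braid_join join_P2 pointwise)
      then show ?thesis using True by (simp add: Pair pt_append pointwise P2_def tensor2_pure_def)
    next
      case False
      then have "P2 v u (gs, hs) = 0" by (auto simp: P2_def tensor2_pure_def pt_length)
      moreover have "tensor2_braid c (P2 u v) (gs, hs) = 0"
        using False by (auto simp: tensor2_braid_join join_P2 block_braid_def fold_braid_linear pointwise)
      ultimately show ?thesis by (simp add: Pair pointwise)
    qed
  qed
qed

lemma tensor2_mult_pure: "tensor2_mult c x y = (\<lambda>(fs, gs). \<Sum>i\<le>length fs. \<Sum>j\<le>length gs.
    tensor2_braid c (tensor2_pure (\<lambda>us. x (take i fs, us)) (\<lambda>ws. y (ws, drop j gs))) (drop i fs, take j gs))"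
  by (simp add: tensor2_mult_def tensor2_pure_def split_def)

lemma slice_linear:
  "(\<lambda>us. (x + y) (fs, us)) = (\<lambda>us. x (fs, us)) + (\<lambda>us. y (fs, us))"
  "(\<lambda>us. (x + y) (us, fs)) = (\<lambda>us. x (us, fs)) + (\<lambda>us. y (us, fs))"
  "(\<lambda>us. fun_scale a x (fs, us)) = fun_scale a (\<lambda>us. x (fs, us))"
  "(\<lambda>us. fun_scale a x (us, fs)) = fun_scale a (\<lambda>us. x (us, fs))"
  "(\<lambda>us. (0 :: 'a \<times> 'a \<Rightarrow> 'k) (fs, us)) = 0" "(\<lambda>us. (0 :: 'a \<times> 'a \<Rightarrow> 'k) (us, fs)) = 0"
  by (auto simp: fun_eq_iff pointwise)

lemma slice_P2: "(\<lambda>us. P2 u v (fs, us)) = fun_scale (pt u fs) (pt v)"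
  "(\<lambda>us. P2 u v (us, fs)) = fun_scale (pt v fs) (pt u)"
  by (auto simp: P2_def tensor2_pure_def fun_eq_iff pointwise)

lemma tensor2_mult_linear:
  "x \<in> T2 \<Longrightarrow> x' \<in> T2 \<Longrightarrow> y \<in> T2 \<Longrightarrow> tensor2_mult c (x + x') y = tensor2_mult c x y + tensor2_mult c x' y"
  "x \<in> T2 \<Longrightarrow> y \<in> T2 \<Longrightarrow> y' \<in> T2 \<Longrightarrow> tensor2_mult c x (y + y') = tensor2_mult c x y + tensor2_mult c x y'"
  "x \<in> T2 \<Longrightarrow> y \<in> T2 \<Longrightarrow> tensor2_mult c (fun_scale a x) y = fun_scale a (tensor2_mult c x y)"
  "x \<in> T2 \<Longrightarrow> y \<in> T2 \<Longrightarrow> tensor2_mult c x (fun_scale a y) = fun_scale a (tensor2_mult c x y)"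
  "tensor2_mult c 0 y = 0" "tensor2_mult c x 0 = 0"
  unfolding tensor2_mult_pure slice_linear tensor2_pure_linear fun_eq_iff
  by (auto simp: tensor2_braid_linear tensor2_pure_T2 slice_T pointwise sum.distrib sum_distrib_left)

lemma tensor2_mult_P2:
  assumes "set u \<subseteq> {..<\<theta>}" "set v \<subseteq> {..<\<theta>}" "set u' \<subseteq> {..<\<theta>}" "set v' \<subseteq> {..<\<theta>}"
  shows "tensor2_mult c (P2 u v) (P2 u' v') = fun_scale (chi v u') (P2 (u @ u') (v @ v'))"
proof
  fix z :: "('v \<Rightarrow> 'k) list \<times> ('v \<Rightarrow> 'k) list"
  obtain fs gs where z: "z = (fs, gs)" by fastforce
  have P: "tensor2_pure (pt v) (pt u') = P2 v u'" by (simp add: P2_def)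
  have "tensor2_mult c (P2 u v) (P2 u' v') z
      = (\<Sum>i\<le>length fs. \<Sum>j\<le>length gs. chi v u' * ((pt u (take i fs) * pt u' (drop i fs)) * (pt v (take j gs) * pt v' (drop j gs))))"
    unfolding z tensor2_mult_pure slice_P2 tensor2_pure_linear P
    using assms
    by (simp add: tensor2_braid_linear T2_simps tensor2_braid_P2) (simp add: pointwise P2_def tensor2_pure_def ac_simps)
  also have "\<dots> = chi v u' * (tensor_mult (pt u) (pt u') fs * tensor_mult (pt v) (pt v') gs)"
    unfolding tensor_mult_def sum_product by (simp add: sum_distrib_left)
  also have "\<dots> = fun_scale (chi v u') (P2 (u @ u') (v @ v')) z"
    by (simp add: tensor_mult_pt z pointwise P2_def tensor2_pure_def)
  finally show "tensor2_mult c (P2 u v) (P2 u' v') z = fun_scale (chi v u') (P2 (u @ u') (v @ v')) z" .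
qed

lemma tensor2_mult_T2: "x \<in> T2 \<Longrightarrow> y \<in> T2 \<Longrightarrow> tensor2_mult c x y \<in> T2"
proof (induction rule: T2_induct)
  case (add a u v x)
  note uv = add(1,2)
  have "tensor2_mult c (P2 u v) y \<in> T2"
    using add(5)
  proof (induction rule: T2_induct)
    case (add b u' v' y)
    then show ?case by (simp add: tensor2_mult_linear T2_simps tensor2_mult_P2 uv)
  qed (simp add: tensor2_mult_linear T2_simps)
  then show ?case using add by (simp add: tensor2_mult_linear T2_simps)
qed (simp add: tensor2_mult_linear T2_simps)

lemma tensor2_mult_assoc:
  assumes "x \<in> T2" "y \<in> T2" "z \<in> T2"
  shows "tensor2_mult c (tensor2_mult c x y) z = tensor2_mult c x (tensor2_mult c y z)"
  using assms(1)
proof (induction rule: T2_induct)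
  case (add a u v x)
  note uv = add(1,2)
  have "tensor2_mult c (tensor2_mult c (P2 u v) y) z = tensor2_mult c (P2 u v) (tensor2_mult c y z)"
    using assms(2)
  proof (induction rule: T2_induct)
    case (add a u' v' y)
    note uv' = add(1,2)
    have "tensor2_mult c (tensor2_mult c (P2 u v) (P2 u' v')) z = tensor2_mult c (P2 u v) (tensor2_mult c (P2 u' v') z)"
      using assms(3)
    proof (induction rule: T2_induct)
      case (add a u'' v'' z)
      have "tensor2_mult c (tensor2_mult c (P2 u v) (P2 u' v')) (P2 u'' v'')
        = tensor2_mult c (P2 u v) (tensor2_mult c (P2 u' v') (P2 u'' v''))"
        using uv uv' add(1,2) by (simp add: tensor2_mult_linear T2_simps tensor2_mult_P2 ac_simps)
      then show ?case using add by (simp add: tensor2_mult_linear T2_simps tensor2_mult_T2)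
    qed (simp add: tensor2_mult_linear)
    then show ?case using add assms(3) by (simp add: tensor2_mult_linear T2_simps tensor2_mult_T2)
  qed (simp add: tensor2_mult_linear)
  then show ?case using add assms(2,3) by (simp add: tensor2_mult_linear T2_simps tensor2_mult_T2)
qed (simp add: tensor2_mult_linear)

lemma tensor2_mult_one: "x \<in> T2 \<Longrightarrow> tensor2_mult c (P2 [] []) x = x"
proof (induction rule: T2_induct)
  case (add a u v x)
  then show ?case by (simp add: tensor2_mult_linear T2_simps tensor2_mult_P2)
qed (simp add: tensor2_mult_linear)

section \<open>Construction and uniqueness of the coproduct\<close>

primrec cop_word :: "nat list \<Rightarrow> ('v, 'k) tensor2"
  where "cop_word [] = P2 [] []"
  | "cop_word (j # w) = tensor2_mult c (P2 [j] [] + P2 [] [j]) (cop_word w)"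

lemma cop_word_T2: "cop_word w \<in> T2"
  by (induction w) (auto simp: tensor2_mult_T2 T2_simps)

lemma cop_word_append: "cop_word (u @ w) = tensor2_mult c (cop_word u) (cop_word w)"
  by (induction u) (auto simp: tensor2_mult_one cop_word_T2 tensor2_mult_assoc T2_simps)

lemma cop_word_Cons: "j < \<theta> \<Longrightarrow> cop_word (j # w) = tensor2_mult c (P2 [j] []) (cop_word w) + tensor2_mult c (P2 [] [j]) (cop_word w)"
  by (simp add: tensor2_mult_linear T2_simps cop_word_T2)

text \<open>Records that a coproduct only distributes the letters of the word over the two factors,
  so that it preserves the total degree.\<close>

definition shuffles_of :: "nat list \<Rightarrow> ('v, 'k) tensor2 set"
  where "shuffles_of w = fv.span {P2 u v | u v. mset u + mset v = mset w}"

lemma cop_word_shuffles: "set w \<subseteq> {..<\<theta>} \<Longrightarrow> cop_word w \<in> shuffles_of w"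
proof (induction w)
  case Nil show ?case by (auto simp: shuffles_of_def intro!: fv.span_base)
next
  case (Cons j w)
  then have j: "j < \<theta>" and w: "set w \<subseteq> {..<\<theta>}" and "cop_word w \<in> shuffles_of w" by auto
  have "x \<in> T2 \<and> tensor2_mult c (P2 [j] []) x \<in> shuffles_of (j # w) \<and> tensor2_mult c (P2 [] [j]) x \<in> shuffles_of (j # w)"
    if "x \<in> shuffles_of w" for x
    using that unfolding shuffles_of_def
  proof (induction rule: fv.span_induct_alt)
    case base show ?case by (simp add: tensor2_mult_linear T2_simps fv.span_zero)
  next
    case (step a p x)
    then obtain u v where p: "p = P2 u v" and uv: "mset u + mset v = mset w" by blast
    have "set u \<subseteq> {..<\<theta>}" "set v \<subseteq> {..<\<theta>}"
      using w arg_cong[OF uv, of set_mset] by auto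
    then have "tensor2_mult c (P2 [j] []) p = fun_scale (chi [] u) (P2 (j # u) v)"
      "tensor2_mult c (P2 [] [j]) p = fun_scale (chi [j] u) (P2 u (j # v))"
      using j by (simp_all add: p tensor2_mult_P2)
    moreover have "P2 (j # u) v \<in> fv.span {P2 u v | u v. mset u + mset v = mset (j # w)}"
      "P2 u (j # v) \<in> fv.span {P2 u v | u v. mset u + mset v = mset (j # w)}"
    proof -
      have "mset (j # u) + mset v = mset (j # w)" "mset u + mset (j # v) = mset (j # w)" using uv by auto
      then show "P2 (j # u) v \<in> fv.span {P2 u v | u v. mset u + mset v = mset (j # w)}"
        "P2 u (j # v) \<in> fv.span {P2 u v | u v. mset u + mset v = mset (j # w)}"
        by (blast intro: fv.span_base)+
    qed
    ultimately show ?case using step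
      by (simp add: p tensor2_mult_linear T2_simps fv.span_add fv.span_scale)
  qed
  then show ?case using \<open>cop_word w \<in> shuffles_of w\<close> j
    unfolding cop_word_Cons[OF j] shuffles_of_def by (blast intro: fv.span_add)
qed

lemma shuffles_of_degree: "x \<in> shuffles_of w \<Longrightarrow> length fs + length gs \<noteq> length w \<Longrightarrow> x (fs, gs) = 0"
  unfolding shuffles_of_def
proof (induction rule: fv.span_induct_alt)
  case base show ?case by (simp add: pointwise)
next
  case (step a p x)
  then obtain u v where p: "p = P2 u v" and uv: "mset u + mset v = mset w" by blast
  then have "length u + length v = length w" by (metis size_mset size_union)
  then have "length fs \<noteq> length u \<or> length gs \<noteq> length v" using step(3) by auto
  then show ?case using step by (auto simp: p P2_def tensor2_pure_def pointwise pt_length)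
qed

text \<open>Linear extension of \<open>cop_word\<close>, written through coordinates to be defined
  on all functions. Words of other lengths would contribute 0 at \<open>(fs, gs)\<close>.\<close>

definition cop :: "('v, 'k) tensor \<Rightarrow> ('v, 'k) tensor2"
  where "cop t = (\<lambda>(fs, gs). \<Sum>w\<in>words (length fs + length gs). t (map dual w) * cop_word w (fs, gs))"

lemma cop_linear: "cop (s + t) = cop s + cop t" "cop (fun_scale a t) = fun_scale a (cop t)" "cop 0 = 0"
  by (auto simp: cop_def fun_eq_iff pointwise distrib_right sum.distrib sum_distrib_left mult.assoc)

lemma cop_sum: "cop (\<Sum>i\<in>A. f i) = (\<Sum>i\<in>A. cop (f i))"
  by (induction A rule: infinite_finite_induct) (simp_all add: cop_linear)

lemma cop_pt: "set w \<subseteq> {..<\<theta>} \<Longrightarrow> cop (pt w) = cop_word w"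
proof
  fix z :: "('v \<Rightarrow> 'k) list \<times> ('v \<Rightarrow> 'k) list"
  assume w: "set w \<subseteq> {..<\<theta>}"
  obtain fs gs where z: "z = (fs, gs)" by fastforce
  have "cop (pt w) z = (\<Sum>v\<in>words (length fs + length gs). if v = w then cop_word w (fs, gs) else 0)"
    unfolding z cop_def using w by (auto intro!: sum.cong simp: words_def pt_dual)
  also have "\<dots> = (if length w = length fs + length gs then cop_word w (fs, gs) else 0)"
    using w by (simp add: finite_words) (simp add: words_def)
  also have "\<dots> = cop_word w z" using shuffles_of_degree[OF cop_word_shuffles[OF w], of fs gs] by (auto simp: z)
  finally show "cop (pt w) z = cop_word w z" .
qed

lemma cop_T2: "t \<in> T \<Longrightarrow> cop t \<in> T2"
  by (induction rule: T_induct) (simp_all add: cop_linear cop_pt cop_word_T2 T2_simps)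

lemma cop_mult: "s \<in> T \<Longrightarrow> t \<in> T \<Longrightarrow> cop (tensor_mult s t) = tensor2_mult c (cop s) (cop t)"
proof (induction rule: T_induct)
  case (add a u s)
  note u = add(1)
  have "cop (tensor_mult (pt u) t) = tensor2_mult c (cop (pt u)) (cop t)"
    using add(4)
  proof (induction rule: T_induct)
    case (add a w t)
    then show ?case
      using u by (simp add: tensor_mult_linear cop_linear tensor2_mult_linear cop_T2 T_simps T2_simps tensor_mult_pt cop_pt cop_word_append cop_word_T2)
  qed (simp add: tensor_mult_linear cop_linear tensor2_mult_linear)
  then show ?case using add
    by (simp add: tensor_mult_linear cop_linear tensor2_mult_linear cop_T2 T_simps T2_simps)
qed (simp add: tensor_mult_linear cop_linear tensor2_mult_linear)

lemma pure_tensor_letter: "pure_tensor scale [v] = (\<Sum>i<\<theta>. fun_scale (dual i v) (pt [i]))"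
proof (rule T_eqI)
  fix w show "pure_tensor scale [v] (map dual w) = (\<Sum>i<\<theta>. fun_scale (dual i v) (pt [i])) (map dual w)"
  proof (cases w)
    case Nil
    then show ?thesis by (simp add: sum_fun_apply pointwise pt_simps pure_tensor_simps)
  next
    case (Cons k w')
    then show ?thesis using lin_sum_dual[OF lin_dual, of k v]
      by (cases w') (simp_all add: sum_fun_apply pointwise pt_simps pure_tensor_simps lin_dual)
  qed
qed (auto simp: pure_T intro!: fv.subspace_sum[OF subspace_T] T_simps)

lemma tensor2_pure_sum: "tensor2_pure (\<Sum>i\<in>A. f i) t = (\<Sum>i\<in>A. tensor2_pure (f i) t)"
  "tensor2_pure t (\<Sum>i\<in>A. f i) = (\<Sum>i\<in>A. tensor2_pure t (f i))"
  by (induction A rule: infinite_finite_induct) (simp_all add: tensor2_pure_linear)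

lemma is_coproduct_cop: "is_coproduct scale c (restrict cop T)"
proof -
  have one: "pure_tensor scale [] = pt []" by (simp add: pt_def)
  have "cop (pure_tensor scale [v]) = tensor2_pure (pure_tensor scale [v]) (pt []) + tensor2_pure (pt []) (pure_tensor scale [v])" for v
  proof -
    have "cop (pt [i]) = tensor2_pure (pt [i]) (pt []) + tensor2_pure (pt []) (pt [i])" if "i < \<theta>" for i
      using that by (simp add: cop_pt tensor2_mult_linear T2_simps tensor2_mult_P2) (simp add: P2_def)
    then show ?thesis
      by (simp add: pure_tensor_letter cop_sum cop_linear tensor2_pure_sum tensor2_pure_linear
          fv.scale_right_distrib sum.distrib)
  qed
  moreover have "cop (pt []) = tensor2_pure (pt []) (pt [])" by (simp add: cop_pt P2_def)
  ultimately show ?thesis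
    unfolding is_coproduct_def linear_on_subspace_def one
    by (auto simp: cop_T2 cop_linear T_simps cop_mult tensor_mult_T pure_T)
qed

text \<open>Multiplicativity and the values on the generators fix the map on words.\<close>

lemma is_coproduct_unique:
  assumes D: "is_coproduct scale c D" and D': "is_coproduct scale c D'" shows "D = D'"
proof (rule PiE_ext[where k = T and s = "\<lambda>_. T2"])
  show "D \<in> T \<rightarrow>\<^sub>E T2" "D' \<in> T \<rightarrow>\<^sub>E T2" using D D' by (simp_all add: is_coproduct_def)
  have one: "D (pt []) = P2 [] []" if "is_coproduct scale c D" for D
    using that by (simp add: is_coproduct_def pt_def P2_def)
  have letter: "D (pt [i]) = P2 [i] [] + P2 [] [i]" if "is_coproduct scale c D" for D i
    using that by (simp add: is_coproduct_def pt_def P2_def)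
  have mult: "D (tensor_mult s t) = tensor2_mult c (D s) (D t)" if "is_coproduct scale c D" "s \<in> T" "t \<in> T" for D s t
    using that by (simp add: is_coproduct_def)
  have lin: "D (s + t) = D s + D t" "D (fun_scale a s) = fun_scale a (D s)" if "is_coproduct scale c D" "s \<in> T" "t \<in> T" for D s t a
    using that by (simp_all add: is_coproduct_def linear_on_subspace_def)
  have word: "D (pt w) = cop_word w" if "is_coproduct scale c D" for D w
  proof (induction w)
    case (Cons i w)
    have "D (pt (i # w)) = D (tensor_mult (pt [i]) (pt w))" by (simp add: tensor_mult_pt)
    also have "\<dots> = cop_word (i # w)" using Cons by (simp add: mult[OF that] letter[OF that] pt_T)
    finally show ?case .
  qed (simp add: one[OF that])
  have zero: "D 0 = 0" if "is_coproduct scale c D" for D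
    using lin(2)[OF that, of 0 0 0] by (simp add: T_simps)
  fix t assume "t \<in> T"
  then show "D t = D' t"
  proof (induction rule: T_induct)
    case (add a w t)
    then show ?case by (simp add: lin[OF D] lin[OF D'] word[OF D] word[OF D'] T_simps)
  qed (simp add: zero[OF D] zero[OF D'])
qed

lemma coproduct_eq: "t \<in> T \<Longrightarrow> coproduct scale c t = cop t"
proof -
  have "coproduct scale c = restrict cop T"
    unfolding coproduct_def by (rule the_equality) (use is_coproduct_cop is_coproduct_unique in blast)+
  then show "t \<in> T \<Longrightarrow> coproduct scale c t = cop t" by simp
qed

end

section \<open>The antipode\<close>

context diagonal_braiding
begin

lemma sum_words_pick: "(\<Sum>v\<in>words n. if v = w then g v else 0) = (if w \<in> words n then g w else 0)"
  by (simp add: finite_words)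

text \<open>This is \<open>\<mu> (S \<otimes> id)\<close>, and \<open>conv_right S\<close> is
  \<open>\<mu> (id \<otimes> S)\<close>.\<close>

definition conv_left :: "(('v, 'k) tensor \<Rightarrow> ('v, 'k) tensor) \<Rightarrow> ('v, 'k) tensor2 \<Rightarrow> ('v, 'k) tensor"
  where "conv_left S x = (\<lambda>fs. \<Sum>i\<le>length fs. S (\<lambda>us. x (us, drop i fs)) (take i fs))"

definition conv_right :: "(('v, 'k) tensor \<Rightarrow> ('v, 'k) tensor) \<Rightarrow> ('v, 'k) tensor2 \<Rightarrow> ('v, 'k) tensor"
  where "conv_right S x = (\<lambda>fs. \<Sum>i\<le>length fs. S (\<lambda>us. x (take i fs, us)) (drop i fs))"

lemma conv_linear:
  assumes S: "linear_on_subspace T S"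
  shows "x \<in> T2 \<Longrightarrow> y \<in> T2 \<Longrightarrow> conv_left S (x + y) = conv_left S x + conv_left S y"
    "x \<in> T2 \<Longrightarrow> conv_left S (fun_scale a x) = fun_scale a (conv_left S x)"
    "x \<in> T2 \<Longrightarrow> y \<in> T2 \<Longrightarrow> conv_right S (x + y) = conv_right S x + conv_right S y"
    "x \<in> T2 \<Longrightarrow> conv_right S (fun_scale a x) = fun_scale a (conv_right S x)"
  using S unfolding conv_left_def conv_right_def slice_linear linear_on_subspace_def fun_eq_iff
  by (auto simp: slice_T pointwise sum.distrib sum_distrib_left)

lemma linear_on_zero: "linear_on_subspace T S \<Longrightarrow> S 0 = 0"
  unfolding linear_on_subspace_def using fv.subspace_0[OF subspace_T] by (metis fun_scale_zero_one(1))

lemma conv_zero: "linear_on_subspace T S \<Longrightarrow> conv_left S 0 = 0" "linear_on_subspace T S \<Longrightarrow> conv_right S 0 = 0"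
  unfolding conv_left_def conv_right_def slice_linear by (simp_all add: linear_on_zero fun_eq_iff pointwise)

lemma conv_P2:
  assumes S: "linear_on_subspace T S"
  shows "conv_left S (P2 u v) = tensor_mult (S (pt u)) (pt v)"
    "conv_right S (P2 u v) = tensor_mult (pt u) (S (pt v))"
proof -
  have "S (fun_scale a (pt w)) = fun_scale a (S (pt w))" for a w
    using S by (simp add: linear_on_subspace_def pt_T)
  then show "conv_left S (P2 u v) = tensor_mult (S (pt u)) (pt v)"
    "conv_right S (P2 u v) = tensor_mult (pt u) (S (pt v))"
    unfolding conv_left_def conv_right_def slice_P2 tensor_mult_def by (auto simp: fun_eq_iff pointwise mult.commute)
qed

lemma is_antipode_conv: "is_antipode scale c S \<longleftrightarrow> S \<in> T \<rightarrow>\<^sub>E T \<and> linear_on_subspace T S \<and>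
    (\<forall>t\<in>T. conv_left S (cop t) = fun_scale (t []) (pt []) \<and> conv_right S (cop t) = fun_scale (t []) (pt []))"
  unfolding is_antipode_def conv_left_def conv_right_def counit_def
  by (intro conj_cong ball_cong refl) (auto simp: coproduct_eq pt_def)

text \<open>A sign for each letter times the braiding scalars of all pairs of letters: the
  coefficient of the reversed word in the antipode of a word.\<close>

primrec rev_coeff :: "nat list \<Rightarrow> 'k"
  where "rev_coeff [] = 1" | "rev_coeff (j # w) = - (chi [j] w * rev_coeff w)"

lemma rev_coeff_snoc: "rev_coeff (w @ [j]) = - (chi w [j] * rev_coeff w)"
proof (induction w)
  case (Cons k w)
  then show ?case using chi_Cons[of k w "[j]"] by simp
qed simp

definition anti :: "('v, 'k) tensor \<Rightarrow> ('v, 'k) tensor"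
  where "anti t = (\<lambda>fs. \<Sum>w\<in>words (length fs). t (map dual w) * (rev_coeff w * pt (rev w) fs))"

lemma anti_linear: "anti (s + t) = anti s + anti t" "anti (fun_scale a t) = fun_scale a (anti t)" "anti 0 = 0"
  by (auto simp: anti_def fun_eq_iff pointwise distrib_right sum.distrib sum_distrib_left mult.assoc)

lemma anti_pt: "set w \<subseteq> {..<\<theta>} \<Longrightarrow> anti (pt w) = fun_scale (rev_coeff w) (pt (rev w))"
proof
  fix fs :: "('v \<Rightarrow> 'k) list" assume w: "set w \<subseteq> {..<\<theta>}"
  have "anti (pt w) fs = (\<Sum>v\<in>words (length fs). if v = w then rev_coeff v * pt (rev v) fs else 0)"
    unfolding anti_def using w by (auto intro!: sum.cong simp: words_def pt_dual)
  also have "\<dots> = fun_scale (rev_coeff w) (pt (rev w)) fs"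
    unfolding sum_words_pick using w by (auto simp: words_def pt_length pointwise)
  finally show "anti (pt w) fs = fun_scale (rev_coeff w) (pt (rev w)) fs" .
qed

lemma anti_T: "t \<in> T \<Longrightarrow> anti t \<in> T"
  by (induction rule: T_induct) (simp_all add: anti_linear anti_pt T_simps)

lemma linear_anti: "linear_on_subspace T anti"
  by (simp add: linear_on_subspace_def anti_linear)

lemma cop_word_letter: "j < \<theta> \<Longrightarrow> cop_word [j] = P2 [j] [] + P2 [] [j]"
  by (simp add: tensor2_mult_linear T2_simps tensor2_mult_P2)

lemma tensor_mult_minus: "tensor_mult (- s) t = - tensor_mult s t" "tensor_mult s (- t) = - tensor_mult s t"
  by (auto simp: tensor_mult_def fun_eq_iff pointwise sum_negf)

text \<open>The two terms of the coproduct of a letter cancel. The letter stands on the left for the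
  left convolution and on the right for the right one, because only then do both terms yield the
  same word.\<close>

lemma conv_anti_letter:
  assumes "j < \<theta>" "x \<in> T2"
  shows "conv_left anti (tensor2_mult c (P2 [j] [] + P2 [] [j]) x) = 0"
    "conv_right anti (tensor2_mult c x (P2 [j] [] + P2 [] [j])) = 0"
proof -
  have word: "conv_left anti (tensor2_mult c (P2 [j] [] + P2 [] [j]) (P2 u v)) = 0"
    "conv_right anti (tensor2_mult c (P2 u v) (P2 [j] [] + P2 [] [j])) = 0"
    if "set u \<subseteq> {..<\<theta>}" "set v \<subseteq> {..<\<theta>}" for u v
  proof -
    have "tensor2_mult c (P2 [j] [] + P2 [] [j]) (P2 u v) = P2 (j # u) v + fun_scale (chi [j] u) (P2 u (j # v))"
      "tensor2_mult c (P2 u v) (P2 [j] [] + P2 [] [j]) = fun_scale (chi v [j]) (P2 (u @ [j]) v) + P2 u (v @ [j])"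
      using that assms(1) by (simp_all add: tensor2_mult_linear T2_simps tensor2_mult_P2)
    then show "conv_left anti (tensor2_mult c (P2 [j] [] + P2 [] [j]) (P2 u v)) = 0"
      "conv_right anti (tensor2_mult c (P2 u v) (P2 [j] [] + P2 [] [j])) = 0"
      using that assms(1)
      by (simp_all add: T2_simps conv_linear[OF linear_anti] conv_P2[OF linear_anti]
        anti_pt tensor_mult_linear tensor_mult_minus tensor_mult_pt rev_coeff_snoc)
  qed
  define d where "d = P2 [j] [] + P2 [] [j]"
  have d: "d \<in> T2" by (simp add: d_def T2_simps)
  show "conv_left anti (tensor2_mult c (P2 [j] [] + P2 [] [j]) x) = 0"
    using assms(2) unfolding d_def[symmetric]
  proof (induction rule: T2_induct)
    case (add a u v x)
    then show ?case using word(1)[of u v, folded d_def] d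
      by (simp add: tensor2_mult_linear T2_simps tensor2_mult_T2 conv_linear[OF linear_anti])
  qed (simp add: tensor2_mult_linear conv_zero[OF linear_anti])
  show "conv_right anti (tensor2_mult c x (P2 [j] [] + P2 [] [j])) = 0"
    using assms(2) unfolding d_def[symmetric]
  proof (induction rule: T2_induct)
    case (add a u v x)
    then show ?case using word(2)[of u v, folded d_def] d
      by (simp add: tensor2_mult_linear T2_simps tensor2_mult_T2 conv_linear[OF linear_anti])
  qed (simp add: tensor2_mult_linear conv_zero[OF linear_anti])
qed

lemma conv_anti:
  assumes "t \<in> T"
  shows "conv_left anti (cop t) = fun_scale (t []) (pt []) \<and> conv_right anti (cop t) = fun_scale (t []) (pt [])"
  using assms
proof (induction rule: T_induct)
  case zero show ?case unfolding zero_fun_def[symmetric] by (simp add: cop_linear conv_zero[OF linear_anti]) (simp add: pointwise)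
next
  case (add a w t)
  have "conv_left anti (cop (pt w)) = fun_scale (pt w []) (pt []) \<and> conv_right anti (cop (pt w)) = fun_scale (pt w []) (pt [])"
  proof (cases "w = []")
    case True
    then show ?thesis by (simp add: cop_pt conv_P2[OF linear_anti] anti_pt tensor_mult_pt pt_simps)
  next
    case False
    obtain j u where ju: "w = j # u" using False by (cases w) auto
    obtain k v where kv: "w = v @ [k]" using False by (cases w rule: rev_cases) auto
    have z: "pt w [] = 0" using False by (intro pt_length) auto
    have "conv_left anti (cop_word w) = 0"
      using add(1) by (simp add: ju conv_anti_letter cop_word_T2)
    moreover have "conv_right anti (cop_word w) = 0"
    proof -
      have "k < \<theta>" using add(1) kv by simp
      then show ?thesis unfolding kv cop_word_append by (simp only: cop_word_letter conv_anti_letter cop_word_T2)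
    qed
    ultimately show ?thesis using add(1) by (simp add: cop_pt z)
  qed
  moreover have "(fun_scale a (pt w) + t) [] = a * pt w [] + t []" by (simp add: pointwise)
  ultimately show ?case using add
    by (simp add: cop_linear conv_linear[OF linear_anti] cop_T2 T_simps T2_simps fv.scale_left_distrib)
qed

lemma is_antipode_anti: "is_antipode scale c (restrict anti T)"
proof -
  have eq: "conv_left (restrict anti T) x = conv_left anti x" "conv_right (restrict anti T) x = conv_right anti x" if "x \<in> T2" for x
    unfolding conv_left_def conv_right_def using that by (simp_all add: slice_T)
  have "linear_on_subspace T (restrict anti T)"
    by (simp add: linear_on_subspace_def anti_linear T_simps)
  then show ?thesis unfolding is_antipode_conv using conv_anti by (simp add: eq cop_T2 anti_T)
qed

text \<open>For uniqueness of the antipode: apart from \<open>P2 w []\<close> all left factors are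
  shorter than \<open>w\<close>, so the left convolution equation can be solved for the value at
  \<open>w\<close>.\<close>

lemma cop_word_leading: "set w \<subseteq> {..<\<theta>} \<Longrightarrow>
  \<exists>x\<in>fv.span {P2 u v | u v. length u < length w \<and> set u \<subseteq> {..<\<theta>} \<and> set v \<subseteq> {..<\<theta>}}. cop_word w = P2 w [] + x"
proof (induction w)
  case Nil show ?case by (auto intro!: bexI[of _ 0] fv.span_zero)
next
  case (Cons j w)
  let ?L = "\<lambda>n. fv.span {P2 u v | u v. length u < n \<and> set u \<subseteq> {..<\<theta>} \<and> set v \<subseteq> {..<\<theta>}}"
  have j: "j < \<theta>" and w: "set w \<subseteq> {..<\<theta>}" using Cons.prems by auto
  obtain x where x: "x \<in> ?L (length w)" "cop_word w = P2 w [] + x" using Cons.IH[OF w] by blast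
  have in_L: "P2 u v \<in> ?L n" if "length u < n" "set u \<subseteq> {..<\<theta>}" "set v \<subseteq> {..<\<theta>}" for u v n
    using that by (intro fv.span_base) blast
  have "x \<in> T2 \<and> tensor2_mult c (P2 [j] [] + P2 [] [j]) x \<in> ?L (Suc (length w))"
    using x(1)
  proof (induction rule: fv.span_induct_alt)
    case base show ?case by (simp add: tensor2_mult_linear T2_simps fv.span_zero)
  next
    case (step a p x)
    then obtain u v where p: "p = P2 u v" and uv: "length u < length w" "set u \<subseteq> {..<\<theta>}" "set v \<subseteq> {..<\<theta>}" by blast
    have "tensor2_mult c (P2 [j] [] + P2 [] [j]) (P2 u v) = P2 (j # u) v + fun_scale (chi [j] u) (P2 u (j # v))"
      using j uv by (simp add: tensor2_mult_linear T2_simps tensor2_mult_P2)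
    then have "tensor2_mult c (P2 [j] [] + P2 [] [j]) p \<in> ?L (Suc (length w))"
      unfolding p using j uv by (simp only:) (intro fv.span_add fv.span_scale in_L; auto)
    moreover have "tensor2_mult c (P2 [j] [] + P2 [] [j]) (fun_scale a p + x)
        = fun_scale a (tensor2_mult c (P2 [j] [] + P2 [] [j]) p) + tensor2_mult c (P2 [j] [] + P2 [] [j]) x"
      using step by (simp add: p tensor2_mult_linear(2,4)[of "P2 [j] [] + P2 [] [j]"] T2_simps)
    ultimately show ?case using step by (simp add: p T2_simps fv.span_add fv.span_scale del: tensor2_mult_linear)
  qed
  moreover have "tensor2_mult c (P2 [j] [] + P2 [] [j]) (P2 w []) = P2 (j # w) [] + fun_scale (chi [j] w) (P2 w [j])"
    using j w by (simp add: tensor2_mult_linear T2_simps tensor2_mult_P2)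
  ultimately have "cop_word (j # w) = P2 (j # w) [] + (fun_scale (chi [j] w) (P2 w [j]) + tensor2_mult c (P2 [j] [] + P2 [] [j]) x)"
    by (simp add: x(2) tensor2_mult_linear[of "P2 [j] [] + P2 [] [j]"] T2_simps)
  moreover have "fun_scale (chi [j] w) (P2 w [j]) + tensor2_mult c (P2 [j] [] + P2 [] [j]) x \<in> ?L (length (j # w))"
    using j w \<open>x \<in> T2 \<and> _\<close> by (intro fv.span_add fv.span_scale in_L) auto
  ultimately show ?case by blast
qed

lemma is_antipode_unique:
  assumes S: "is_antipode scale c S" and S': "is_antipode scale c S'" shows "S = S'"
proof (rule PiE_ext[where k = T and s = "\<lambda>_. T"])
  note S = S[unfolded is_antipode_conv] and S' = S'[unfolded is_antipode_conv]
  show "S \<in> T \<rightarrow>\<^sub>E T" "S' \<in> T \<rightarrow>\<^sub>E T" using S S' by simp_all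
  have lin: "linear_on_subspace T S" "linear_on_subspace T S'" using S S' by simp_all
  have word: "set w \<subseteq> {..<\<theta>} \<Longrightarrow> S (pt w) = S' (pt w)" for w
  proof (induction "length w" arbitrary: w rule: less_induct)
    case less
    obtain x where x: "x \<in> fv.span {P2 u v | u v. length u < length w \<and> set u \<subseteq> {..<\<theta>} \<and> set v \<subseteq> {..<\<theta>}}"
      "cop_word w = P2 w [] + x" using cop_word_leading[OF less.prems] by blast
    have *: "x \<in> T2 \<and> conv_left S x = conv_left S' x"
      using x(1)
    proof (induction rule: fv.span_induct_alt)
      case base show ?case by (simp add: T2_simps conv_zero lin)
    next
      case (step a p x)
      then obtain u v where "p = P2 u v" "length u < length w" "set u \<subseteq> {..<\<theta>}" by blast
      then show ?case using step less.hyps[of u]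
        by (simp add: conv_linear[OF lin(1)] conv_linear[OF lin(2)] conv_P2[OF lin(1)] conv_P2[OF lin(2)] T2_simps)
    qed
    have "conv_left F (cop_word w) = tensor_mult (F (pt w)) (pt []) + conv_left F x" if "linear_on_subspace T F" for F
      unfolding x(2) using * by (simp add: conv_linear[OF that] conv_P2[OF that] T2_simps)
    moreover have "conv_left S (cop_word w) = conv_left S' (cop_word w)"
      using S S' pt_T[of w] cop_pt[OF less.prems] by metis
    ultimately have "tensor_mult (S (pt w)) (pt []) = tensor_mult (S' (pt w)) (pt [])"
      using lin * by simp
    moreover have "S (pt w) \<in> T" "S' (pt w) \<in> T" using S S' pt_T[of w] by auto
    ultimately show ?case by (simp add: tensor_mult_one)
  qed
  fix t assume "t \<in> T"
  then show "S t = S' t"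
  proof (induction rule: T_induct)
    case zero then show ?case by (simp add: linear_on_zero lin)
  next
    case (add a w t)
    then show ?case using lin word[of w] by (simp add: linear_on_subspace_def T_simps)
  qed
qed

lemma antipode_eq: "t \<in> T \<Longrightarrow> antipode scale c t = anti t"
proof -
  have "antipode scale c = restrict anti T"
    unfolding antipode_def by (rule the_equality) (use is_antipode_anti is_antipode_unique in blast)+
  then show "t \<in> T \<Longrightarrow> antipode scale c t = anti t" by simp
qed

end

section \<open>The Nichols ideal as a kernel\<close>

context diagonal_braiding
begin

primrec letter_prod :: "nat list \<Rightarrow> nat list \<Rightarrow> 'k"
  where "letter_prod [] = sone" | "letter_prod (j # w) = qsh q (letter j) (letter_prod w)"

text \<open>In each degree this is the quantum symmetrizer, written in coordinates.\<close>

definition sh_map :: "('v, 'k) tensor \<Rightarrow> nat list \<Rightarrow> 'k"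
  where "sh_map t v = (\<Sum>w\<in>words (length v). t (map dual w) * letter_prod w v)"

lemma letter_prod_append: "letter_prod (u @ w) = qsh q (letter_prod u) (letter_prod w)"
  by (induction u) (auto simp: qsh_assoc)

lemma mset_eq_if_wt_eq: "wt u = wt v \<Longrightarrow> mset u = mset v"
  by (rule multiset_eqI) (auto simp: wt_def fun_eq_iff count_mset)

lemma letter_prod_support: "letter_prod w v \<noteq> 0 \<Longrightarrow> mset v = mset w"
proof (induction w arbitrary: v)
  case Nil then show ?case by (auto simp: sone_def split: if_splits)
next
  case (Cons j w)
  from Cons.prems have "qsh q (letter j) (letter_prod w) v \<noteq> 0" by simp
  from qsh_nonzero[OF this] obtain x y where *: "letter j x \<noteq> (0::'k)" "letter_prod w y \<noteq> 0" "wt v = wt x + wt y" by blast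
  from *(1) have x: "x = [j]" by (auto simp: letter_def split: if_splits)
  from *(3) x have "mset v = mset (j # y)" by (intro mset_eq_if_wt_eq) simp
  then show ?case using Cons.IH[OF *(2)] by simp
qed

lemma letter_prod_length: "length v \<noteq> length w \<Longrightarrow> letter_prod w v = 0"
  using letter_prod_support[of w v] by (metis size_mset)

lemma chi_mset: "mset u = mset v \<Longrightarrow> chi [j] u = chi [j] v"
  by (simp add: chi_def flip: prod_mset_prod_list)

lemma twist_letter_prod: "twist (q j) (letter_prod w) = fun_scale (chi [j] w) (letter_prod w)"
proof
  fix v show "twist (q j) (letter_prod w) v = fun_scale (chi [j] w) (letter_prod w) v"
  proof (cases "letter_prod w v = 0")
    case False
    then have "chi [j] v = chi [j] w" by (intro chi_mset letter_prod_support)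
    then show ?thesis by (simp add: twist_def chi_def pointwise)
  qed (simp add: twist_def pointwise)
qed

lemma sh_map_linear: "sh_map (s + t) = sh_map s + sh_map t" "sh_map (fun_scale a t) = fun_scale a (sh_map t)" "sh_map 0 = 0"
  by (auto simp: sh_map_def fun_eq_iff pointwise distrib_right sum.distrib sum_distrib_left mult.assoc)

lemma sh_map_diff: "sh_map (s - t) = sh_map s - sh_map t"
  by (auto simp: sh_map_def fun_eq_iff pointwise left_diff_distrib sum_subtractf)

lemma sh_map_pt: "set w \<subseteq> {..<\<theta>} \<Longrightarrow> sh_map (pt w) = letter_prod w"
proof
  fix v assume w: "set w \<subseteq> {..<\<theta>}"
  have "sh_map (pt w) v = (\<Sum>u\<in>words (length v). if u = w then letter_prod u v else 0)"
    unfolding sh_map_def using w by (auto intro!: sum.cong simp: words_def pt_dual)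
  also have "\<dots> = letter_prod w v"
    unfolding sum_words_pick using w by (auto simp: words_def letter_prod_length)
  finally show "sh_map (pt w) v = letter_prod w v" .
qed

lemma sh_map_mult: "s \<in> T \<Longrightarrow> t \<in> T \<Longrightarrow> sh_map (tensor_mult s t) = qsh q (sh_map s) (sh_map t)"
proof (induction rule: T_induct)
  case (add a u s)
  note u = add(1)
  have "sh_map (tensor_mult (pt u) t) = qsh q (sh_map (pt u)) (sh_map t)"
    using add(4)
  proof (induction rule: T_induct)
    case (add a w t)
    then show ?case
      using u by (simp add: tensor_mult_linear sh_map_linear qsh_linear tensor_mult_pt sh_map_pt letter_prod_append)
  qed (simp add: tensor_mult_linear sh_map_linear)
  then show ?case using add by (simp add: tensor_mult_linear sh_map_linear qsh_linear)
qed (simp add: tensor_mult_linear sh_map_linear)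

lemma letter_prod_nich: "set w \<subseteq> {..<\<theta>} \<Longrightarrow> letter_prod w \<in> nich \<theta> q"
  by (induction w) (auto intro: nich.intros)

lemma sh_map_T: "t \<in> T \<Longrightarrow> sh_map t \<in> nich \<theta> q"
  by (induction rule: T_induct) (auto simp: sh_map_linear sh_map_pt intro: nich.intros nich_zero letter_prod_nich)

lemma sh_map_onto: "f \<in> nich \<theta> q \<Longrightarrow> \<exists>t\<in>T. sh_map t = f"
proof (induction rule: nich.induct)
  case nich_sone then show ?case by (intro bexI[of _ "pt []"]) (auto simp: sh_map_pt pt_T)
next
  case (nich_add f g) then show ?case using T_simps(2) sh_map_linear(1) by metis
next
  case (nich_scale f a) then show ?case using T_simps(3) sh_map_linear(2) by metis
next
  case (nich_letter_mult i f)
  then obtain t where t: "t \<in> T" "sh_map t = f" by blast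
  have "sh_map (tensor_mult (pt [i]) t) = qsh q (letter i) f"
    using t nich_letter_mult.hyps by (simp add: sh_map_mult pt_T sh_map_pt)
  then show ?case using tensor_mult_T[OF pt_T t(1)] by blast
qed

subsection \<open>Compatibility with the coproduct\<close>

text \<open>The new letter goes into the initial part \<open>u\<close> of the word, or past it into
  the final part \<open>v\<close>, which costs \<open>chi [j] u\<close>.\<close>

lemma letter_append: "qsh q (letter j) g (v @ u)
    = qsh q (letter j) (\<lambda>x. g (v @ x)) u + chi [j] u * qsh q (letter j) (\<lambda>y. g (y @ u)) v"
proof (induction v arbitrary: g)
  case (Cons k v)
  have "qsh q (letter j) g ((k # v) @ u) = qsh q (letter j) (der k g) (v @ u) + (if j = k then twist (q j) g (v @ u) else 0)"
    by (simp add: der_letter pointwise)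
  also have "qsh q (letter j) (der k g) (v @ u) = qsh q (letter j) (\<lambda>x. g (k # v @ x)) u
      + chi [j] u * qsh q (letter j) (der k (\<lambda>y. g (y @ u))) v"
    unfolding Cons.IH by (simp add: der_def)
  also have "twist (q j) g (v @ u) = chi [j] u * twist (q j) (\<lambda>y. g (y @ u)) v" for k
    by (simp add: twist_def chi_def)
  finally show ?case by (simp add: der_letter pointwise algebra_simps)
qed simp

definition sh_map2 :: "('v, 'k) tensor2 \<Rightarrow> nat list \<Rightarrow> nat list \<Rightarrow> 'k"
  where "sh_map2 x u v = sh_map (\<lambda>fs. sh_map (\<lambda>gs. x (fs, gs)) v) u"

lemma sh_map2_linear: "sh_map2 (x + y) u v = sh_map2 x u v + sh_map2 y u v"
  "sh_map2 (fun_scale a x) u v = a * sh_map2 x u v" "sh_map2 0 u v = 0"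
  unfolding sh_map2_def sh_map_def
  by (auto simp: pointwise distrib_right sum.distrib sum_distrib_left sum_distrib_right mult.assoc)

lemma sh_map2_pure: "sh_map2 (tensor2_pure s t) u v = sh_map s u * sh_map t v"
proof -
  have "sh_map (\<lambda>gs. a * t gs) v = a * sh_map t v" for a
    by (simp add: sh_map_def sum_distrib_left mult.assoc)
  moreover have "sh_map (\<lambda>fs. s fs * a) u = sh_map s u * a" for a
    by (simp add: sh_map_def sum_distrib_left mult_ac)
  ultimately show ?thesis by (simp add: sh_map2_def tensor2_pure_def)
qed

lemma sh_map2_P2: "set u \<subseteq> {..<\<theta>} \<Longrightarrow> set v \<subseteq> {..<\<theta>} \<Longrightarrow>
    sh_map2 (P2 u v) u' v' = letter_prod u u' * letter_prod v v'"
  by (simp add: P2_def sh_map2_pure sh_map_pt)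

lemma sh_map2_letter:
  assumes j: "j < \<theta>" and "x \<in> T2"
  shows "sh_map2 (tensor2_mult c (P2 [j] [] + P2 [] [j]) x) u' v'
    = qsh q (letter j) (\<lambda>y. sh_map2 x y v') u' + chi [j] u' * qsh q (letter j) (\<lambda>y. sh_map2 x u' y) v'"
  using assms(2)
proof (induction rule: T2_induct)
  case zero
  have "(\<lambda>y. sh_map2 0 y v') = 0" "(\<lambda>y. sh_map2 0 u' y) = 0" by (auto simp: fun_eq_iff sh_map2_linear pointwise)
  then show ?case unfolding zero_fun_def[symmetric] by (simp add: tensor2_mult_linear sh_map2_linear) (simp add: pointwise)
next
  case (add a u v x)
  define d where "d = P2 [j] [] + P2 [] [j]"
  have d: "d \<in> T2" by (simp add: d_def T2_simps)
  have "tensor2_mult c d (P2 u v) = P2 (j # u) v + fun_scale (chi [j] u) (P2 u (j # v))"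
    unfolding d_def using add(1,2) j by (simp add: tensor2_mult_linear T2_simps tensor2_mult_P2)
  then have "tensor2_mult c d (fun_scale a (P2 u v) + x)
      = fun_scale a (P2 (j # u) v + fun_scale (chi [j] u) (P2 u (j # v))) + tensor2_mult c d x"
    using add(3) d by (simp add: tensor2_mult_linear T2_simps)
  then have L: "sh_map2 (tensor2_mult c d (fun_scale a (P2 u v) + x)) u' v'
    = a * (letter_prod (j # u) u' * letter_prod v v' + chi [j] u * letter_prod u u' * letter_prod (j # v) v')
      + sh_map2 (tensor2_mult c d x) u' v'"
    using add(1,2) j by (simp only: sh_map2_linear) (simp add: sh_map2_P2 mult.assoc)
  \<comment> \<open>On the support of \<open>letter_prod u\<close> the words have the same letters
    as \<open>u\<close>.\<close>
  have chi: "chi [j] u * letter_prod u u' = chi [j] u' * letter_prod u u'"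
    using chi_mset[OF letter_prod_support[of u u'], of j] by (cases "letter_prod u u' = 0") auto
  have "(\<lambda>y. sh_map2 (fun_scale a (P2 u v) + x) y v') = fun_scale (a * letter_prod v v') (letter_prod u) + (\<lambda>y. sh_map2 x y v')"
    "(\<lambda>y. sh_map2 (fun_scale a (P2 u v) + x) u' y) = fun_scale (a * letter_prod u u') (letter_prod v) + (\<lambda>y. sh_map2 x u' y)"
    using add(1,2) by (auto simp: fun_eq_iff sh_map2_linear sh_map2_P2 pointwise)
  then show ?case
    unfolding d_def[symmetric] L using add(4)[folded d_def] chi
    by (auto simp: qsh_linear) (auto simp: pointwise algebra_simps)
qed

lemma sh_map2_cop_word: "set w \<subseteq> {..<\<theta>} \<Longrightarrow> sh_map2 (cop_word w) u v = letter_prod w (v @ u)"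
proof (induction w arbitrary: u v)
  case Nil then show ?case by (simp add: sh_map2_P2 sone_def)
next
  case (Cons j w)
  then show ?case by (simp add: sh_map2_letter cop_word_T2 letter_append)
qed

text \<open>The coproduct becomes deconcatenation of words. As lists run from right to left, the
  first tensor factor \<open>u\<close> is the rear part of the list.\<close>

lemma sh_map2_cop: "t \<in> T \<Longrightarrow> sh_map2 (cop t) u v = sh_map t (v @ u)"
proof (induction rule: T_induct)
  case zero show ?case unfolding zero_fun_def[symmetric] by (simp add: cop_linear sh_map2_linear sh_map_linear) (simp add: pointwise)
next
  case (add a w t)
  then show ?case by (simp add: cop_linear sh_map2_linear sh_map_linear cop_pt sh_map2_cop_word sh_map_pt) (simp add: pointwise)
qed

subsection \<open>Compatibility with the antipode\<close>

text \<open>The antipode of the shuffle algebra; \<open>sh_map_anti\<close> shows that it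
  corresponds to \<open>anti\<close>.\<close>

definition rev_twist :: "(nat list \<Rightarrow> 'k) \<Rightarrow> nat list \<Rightarrow> 'k"
  where "rev_twist f v = rev_coeff v * f (rev v)"

lemma rev_twist_linear: "rev_twist (f + g) = rev_twist f + rev_twist g" "rev_twist (fun_scale a f) = fun_scale a (rev_twist f)" "rev_twist 0 = 0"
  by (auto simp: rev_twist_def fun_eq_iff pointwise algebra_simps)

lemma rev_twist_letter: "rev_twist (qsh q (letter j) f) v = - qsh q (rev_twist (twist (q j) f)) (letter j) v"
proof (induction v arbitrary: f)
  case (Cons k v)
  \<comment> \<open>Reversal moves the head \<open>k\<close> to the end of the list, and
    \<open>h\<close> freezes it there.\<close>
  define h where "h = (\<lambda>y. f (y @ [k]))"
  let ?A = "rev_twist (twist (q j) h)"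
  have "twist (q j) f (rev v @ [k]) = q j k * twist (q j) h (rev v)" for v
    by (simp add: twist_def h_def)
  then have der: "der k (rev_twist (twist (q j) f)) = fun_scale (- q j k) (twist (q k) ?A)"
    by (auto simp: fun_eq_iff der_def rev_twist_def pointwise twist_def[of "q k"] chi_def)
  have "qsh q (rev_twist (twist (q j) f)) (letter j) (k # v)
      = qsh q (rev_twist (twist (q j) f)) (der k (letter j)) v + qsh q (fun_scale (- q j k) (twist (q k) ?A)) (twist (q k) (letter j)) v"
    using der by simp
  also have "qsh q (fun_scale (- q j k) (twist (q k) ?A)) (twist (q k) (letter j)) v = - q j k * twist (q k) (qsh q ?A (letter j)) v"
    unfolding twist_qsh qsh_linear by (simp add: pointwise)
  also have "\<dots> = - q j k * chi [k] v * qsh q ?A (letter j) v"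
    by (simp add: twist_def chi_def)
  also have "qsh q ?A (letter j) v = - rev_twist (qsh q (letter j) h) v" using Cons.IH[of h] by simp
  also have "qsh q (rev_twist (twist (q j) f)) (der k (letter j)) v = (if j = k then rev_coeff v * (chi [k] v * f (rev v)) else 0)"
    by (auto simp: der_letter pointwise rev_twist_def twist_def chi_def rev_map[symmetric])
  finally have R: "qsh q (rev_twist (twist (q j) f)) (letter j) (k # v)
    = (if j = k then rev_coeff v * (chi [k] v * f (rev v)) else 0) + q j k * chi [k] v * rev_twist (qsh q (letter j) h) v"
    by simp
  have "qsh q (letter j) f (rev v @ [k]) = qsh q (letter j) (\<lambda>x. f (rev v @ x)) [k] + chi [j] [k] * qsh q (letter j) h (rev v)"
    unfolding letter_append h_def ..
  moreover have "qsh q (letter j) (\<lambda>x. f (rev v @ x)) [k] = (if j = k then f (rev v) else 0)"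
    by (simp add: der_letter pointwise)
  ultimately show ?case
    unfolding R by (simp add: rev_twist_def chi_letters algebra_simps)
qed (simp add: rev_twist_def)

lemma rev_twist_letter_prod: "rev_twist (letter_prod w) = fun_scale (rev_coeff w) (letter_prod (rev w))"
proof (induction w)
  case Nil show ?case by (auto simp: rev_twist_def sone_def fun_eq_iff pointwise)
next
  case (Cons j w)
  have "rev_twist (letter_prod (j # w)) = - qsh q (rev_twist (twist (q j) (letter_prod w))) (letter j)"
    by (auto simp: fun_eq_iff rev_twist_letter pointwise)
  then show ?case
    by (simp add: twist_letter_prod rev_twist_linear Cons.IH qsh_linear letter_prod_append)
qed

lemma sh_map_anti: "t \<in> T \<Longrightarrow> sh_map (anti t) = rev_twist (sh_map t)"
proof (induction rule: T_induct)
  case zero show ?case by (simp add: anti_linear sh_map_linear rev_twist_linear)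
next
  case (add a w t)
  then show ?case by (simp add: anti_linear sh_map_linear rev_twist_linear anti_pt sh_map_pt rev_twist_letter_prod)
qed

subsection \<open>The kernel is the Nichols ideal\<close>

definition sh_ker :: "('v, 'k) tensor set"
  where "sh_ker = {t \<in> T. sh_map t = 0}"

lemma subspace_sh_ker: "fv.subspace sh_ker"
  by (auto simp: fv.subspace_def sh_ker_def T_simps sh_map_linear)

lemma ideal_sh_ker: "ideal sh_ker (tensor_algebra scale)"
proof (rule idealI[OF ring_T])
  interpret TA: ring "tensor_algebra scale" by (rule ring_T)
  show "subgroup sh_ker (add_monoid (tensor_algebra scale))"
  proof (rule TA.add.subgroupI)
    fix t assume t: "t \<in> sh_ker"
    have "t \<in> T" using t by (simp add: sh_ker_def)
    have "- t \<in> sh_ker" using t by (rule fv.subspace_neg[OF subspace_sh_ker])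
    then show "\<ominus>\<^bsub>tensor_algebra scale\<^esub> t \<in> sh_ker"
      using \<open>t \<in> T\<close> TA.minus_equality[of "- t" t] by (simp add: sh_ker_def)
  qed (use fv.subspace_0[OF subspace_sh_ker] fv.subspace_add[OF subspace_sh_ker] in \<open>auto simp: sh_ker_def\<close>)
qed (auto simp: sh_ker_def tensor_mult_T sh_map_mult)

lemma T2_zeroI:
  assumes "x \<in> T2" "\<And>u v. set u \<subseteq> {..<\<theta>} \<Longrightarrow> set v \<subseteq> {..<\<theta>} \<Longrightarrow> x (map dual u, map dual v) = 0"
  shows "x = 0"
proof -
  have "(\<lambda>gs. x (map dual u, gs)) = 0" if "set u \<subseteq> {..<\<theta>}" for u
    by (rule T_eqI) (use assms that in \<open>auto simp: slice_T T_simps(1) pointwise\<close>)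
  then have *: "x (map dual u, gs) = 0" if "set u \<subseteq> {..<\<theta>}" for u gs
    using that by (auto simp: fun_eq_iff pointwise)
  have "(\<lambda>fs. x (fs, gs)) = 0" for gs
    by (rule T_eqI) (use assms(1) * in \<open>auto simp: slice_T T_simps(1) pointwise\<close>)
  then show ?thesis by (auto simp: fun_eq_iff pointwise)
qed

text \<open>Modulo the span on the right-hand side, every tensor is a combination of the
  \<open>P2 u v\<close> with \<open>u, v\<close> from a set of words whose images form a basis.\<close>

lemma sh_map2_kernel:
  assumes x: "x \<in> T2" and zero: "\<And>u v. sh_map2 x u v = 0"
  shows "x \<in> fv.span (tensor2_of sh_ker T \<union> tensor2_of T sh_ker)"
proof -
  let ?E = "letter_prod ` {w. set w \<subseteq> {..<\<theta>}}"
  let ?L = "fv.span (tensor2_of sh_ker T \<union> tensor2_of T sh_ker)"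
  obtain B where B: "B \<subseteq> ?E" "fv.independent B" "?E \<subseteq> fv.span B"
    using fv.maximal_independent_subset[of ?E] by blast
  obtain W where W: "W \<subseteq> {w. set w \<subseteq> {..<\<theta>}}" "inj_on letter_prod W" "B = letter_prod ` W"
    using B(1) unfolding subset_image_inj by blast
  let ?S = "fv.span {P2 u v | u v. u \<in> W \<and> v \<in> W}"
  have lift: "\<exists>s\<in>fv.span (pt ` W). sh_map s = f" if "f \<in> fv.span B" for f
    using that unfolding W(3)
  proof (induction rule: fv.span_induct_alt)
    case base show ?case by (intro bexI[of _ 0]) (auto simp: sh_map_linear fv.span_zero)
  next
    case (step a p f)
    then obtain w s where w: "w \<in> W" "p = letter_prod w" and s: "s \<in> fv.span (pt ` W)" "sh_map s = f" by blast
    then have "sh_map (fun_scale a (pt w) + s) = fun_scale a p + f"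
      using W(1) by (auto simp: sh_map_linear sh_map_pt)
    moreover have "fun_scale a (pt w) + s \<in> fv.span (pt ` W)"
      using w s by (intro fv.span_add fv.span_scale) (auto intro: fv.span_base)
    ultimately show ?case by blast
  qed
  have span_T: "fv.span (pt ` W) \<subseteq> T"
    by (rule fv.span_minimal[OF _ subspace_T]) (auto simp: pt_T)
  have word: "\<exists>s\<in>fv.span (pt ` W). pt w - s \<in> sh_ker" if "set w \<subseteq> {..<\<theta>}" for w
  proof -
    have "letter_prod w \<in> fv.span B" by (rule subsetD[OF B(3)]) (use that in simp)
    from lift[OF this] obtain s where s: "s \<in> fv.span (pt ` W)" "sh_map s = letter_prod w" ..
    have "s \<in> T" using s(1) span_T by blast
    then have "pt w - s \<in> T" by (intro fv.subspace_diff[OF subspace_T] pt_T)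
    then have "pt w - s \<in> sh_ker" using that s(2) by (simp add: sh_ker_def sh_map_diff sh_map_pt)
    then show ?thesis using s by blast
  qed
  have pure_S: "tensor2_pure s t \<in> ?S" if "s \<in> fv.span (pt ` W)" "t \<in> fv.span (pt ` W)" for s t
    using that(1)
  proof (induction rule: fv.span_induct_alt)
    case base show ?case by (simp add: tensor2_pure_linear fv.span_zero)
  next
    case (step a p s)
    then obtain u where u: "u \<in> W" "p = pt u" by blast
    have "tensor2_pure (pt u) t \<in> ?S"
      using that(2)
    proof (induction rule: fv.span_induct_alt)
      case base show ?case by (simp add: tensor2_pure_linear fv.span_zero)
    next
      case (step a p t)
      then obtain v where v: "v \<in> W" "p = pt v" by blast
      have "tensor2_pure (pt u) (pt v) \<in> ?S" using u(1) v(1) by (intro fv.span_base) (auto simp: P2_def)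
      then show ?case using step unfolding tensor2_pure_linear v(2) by (intro fv.span_add fv.span_scale)
    qed
    then show ?case using step unfolding tensor2_pure_linear u(2) by (intro fv.span_add fv.span_scale)
  qed
  have pure_L: "tensor2_pure s t \<in> ?L" if "s \<in> sh_ker \<and> t \<in> T \<or> s \<in> T \<and> t \<in> sh_ker" for s t
    using that unfolding tensor2_of_def by (intro fv.span_base) (blast intro: fv.span_base)
  have "\<exists>y\<in>?S. x - y \<in> ?L"
    using x
  proof (induction rule: T2_induct)
    case zero show ?case by (intro bexI[of _ 0]) (auto simp: fv.span_zero)
  next
    case (add a u v x)
    obtain s t where s: "s \<in> fv.span (pt ` W)" "pt u - s \<in> sh_ker" and t: "t \<in> fv.span (pt ` W)" "pt v - t \<in> sh_ker"
      using word add(1,2) by blast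
    obtain y where y: "y \<in> ?S" "x - y \<in> ?L" using add by blast
    have "P2 u v - tensor2_pure s t = tensor2_pure (pt u - s) (pt v) + tensor2_pure s (pt v - t)"
      by (auto simp: P2_def tensor2_pure_def fun_eq_iff pointwise algebra_simps)
    moreover have "\<dots> \<in> ?L" using s t span_T by (intro fv.span_add pure_L) (auto simp: pt_T)
    ultimately have "fun_scale a (P2 u v - tensor2_pure s t) + (x - y) \<in> ?L"
      using y by (intro fv.span_add fv.span_scale) simp_all
    moreover have "fun_scale a (P2 u v - tensor2_pure s t) + (x - y)
        = (fun_scale a (P2 u v) + x) - (fun_scale a (tensor2_pure s t) + y)"
      by (simp add: fv.scale_right_diff_distrib)
    ultimately have "(fun_scale a (P2 u v) + x) - (fun_scale a (tensor2_pure s t) + y) \<in> ?L"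
      by (simp only:)
    moreover have "fun_scale a (tensor2_pure s t) + y \<in> ?S"
      using y pure_S[OF s(1) t(1)] by (intro fv.span_add fv.span_scale)
    ultimately show ?case by (rule bexI)
  qed
  then obtain y where y: "y \<in> ?S" "x - y \<in> ?L" by blast
  have L0: "sh_map2 z u v = 0" if "z \<in> ?L" for z u v
  proof -
    have sub: "fv.subspace {z. sh_map2 z u v = 0}" by (auto simp: fv.subspace_def sh_map2_linear)
    have "?L \<subseteq> {z. sh_map2 z u v = 0}"
    proof (intro fv.span_minimal[OF _ sub] Un_least)
      show "tensor2_of sh_ker T \<subseteq> {z. sh_map2 z u v = 0}" "tensor2_of T sh_ker \<subseteq> {z. sh_map2 z u v = 0}"
        unfolding tensor2_of_def
        by (intro fv.span_minimal[OF _ sub]; auto simp: sh_map2_pure sh_ker_def pointwise)+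
    qed
    then show ?thesis using that by blast
  qed
  have y0: "sh_map2 y u v = 0" for u v
    using sh_map2_linear(1)[of "x - y" y u v] L0[OF y(2)] zero by simp
  have yT: "y \<in> T2 \<and> (\<forall>u v. set u \<subseteq> {..<\<theta>} \<longrightarrow> set v \<subseteq> {..<\<theta>} \<longrightarrow> u \<notin> W \<or> v \<notin> W \<longrightarrow> y (map dual u, map dual v) = 0)"
  proof -
    let ?D = "{y. \<forall>u v. set u \<subseteq> {..<\<theta>} \<longrightarrow> set v \<subseteq> {..<\<theta>} \<longrightarrow> u \<notin> W \<or> v \<notin> W \<longrightarrow> y (map dual u, map dual v) = 0}"
    have "P2 u v \<in> ?D" if "u \<in> W" "v \<in> W" for u v
      using that subsetD[OF W(1) that(1)] subsetD[OF W(1) that(2)] by (auto simp: P2_def tensor2_pure_def pt_dual)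
    moreover have "fv.subspace ?D" by (auto simp: fv.subspace_def pointwise)
    ultimately have "?S \<subseteq> ?D" by (intro fv.span_minimal) blast+
    moreover have "?S \<subseteq> T2" by (rule fv.span_minimal[OF _ subspace_T2]) (auto simp: P2_T2)
    ultimately show ?thesis using y(1) by blast
  qed
  \<comment> \<open>Coordinates at words outside \<open>W\<close> vanish by assumption, and the
    images of the words in \<open>W\<close> are independent, so all coordinates vanish. This is
    applied to one tensor factor after the other.\<close>
  have coords: "t (map dual v) = 0"
    if t: "\<And>v. set v \<subseteq> {..<\<theta>} \<Longrightarrow> v \<notin> W \<Longrightarrow> t (map dual v) = 0" "\<And>v'. sh_map t v' = 0" and v: "set v \<subseteq> {..<\<theta>}" for t v
  proof (cases "v \<in> W")
    case True
    let ?A = "words (length v) \<inter> W"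
    have fin: "finite ?A" using finite_words by blast
    have "(\<Sum>w\<in>?A. fun_scale (t (map dual w)) (letter_prod w)) = 0"
    proof
      fix v'
      show "(\<Sum>w\<in>?A. fun_scale (t (map dual w)) (letter_prod w)) v' = 0 v'"
      proof (cases "length v' = length v")
        case True
        have "(\<Sum>w\<in>?A. t (map dual w) * letter_prod w v') = sh_map t v'"
          unfolding sh_map_def True by (intro sum.mono_neutral_left finite_words) (auto simp: words_def t(1))
        then show ?thesis by (simp add: sum_fun_apply pointwise t(2))
      next
        case False
        then have "letter_prod w v' = 0" if "w \<in> ?A" for w
          using that by (intro letter_prod_length) (auto simp: words_def)
        then show ?thesis by (simp add: sum_fun_apply pointwise)
      qed
    qed
    moreover have inj: "inj_on letter_prod ?A" using W(2) by (rule inj_on_subset) auto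
    ultimately have "(\<Sum>f\<in>letter_prod ` ?A. fun_scale (t (map dual (the_inv_into ?A letter_prod f))) f) = 0"
      by (simp add: sum.reindex the_inv_into_f_f)
    then have "t (map dual (the_inv_into ?A letter_prod (letter_prod v))) = 0"
      using fv.independentD[OF B(2), of "letter_prod ` ?A" "\<lambda>f. t (map dual (the_inv_into ?A letter_prod f))" "letter_prod v"]
        fin W(3) True v by (auto simp: words_def)
    then show ?thesis using the_inv_into_f_f[OF inj, of v] True v by (simp add: words_def)
  qed (use t v in auto)
  have outer: "sh_map (\<lambda>gs. y (map dual u, gs)) v' = 0" if u: "set u \<subseteq> {..<\<theta>}" for u v'
  proof (rule coords[of "\<lambda>fs. sh_map (\<lambda>gs. y (fs, gs)) v'"])
    fix w assume "set w \<subseteq> {..<\<theta>}" "w \<notin> W"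
    then show "sh_map (\<lambda>gs. y (map dual w, gs)) v' = 0"
      unfolding sh_map_def using yT by (intro sum.neutral) (auto simp: words_def)
  qed (use y0 u in \<open>auto simp: sh_map2_def\<close>)
  have "y (map dual u, map dual v) = 0" if "set u \<subseteq> {..<\<theta>}" "set v \<subseteq> {..<\<theta>}" for u v
    by (rule coords[of "\<lambda>gs. y (map dual u, gs)"]) (use yT that outer in auto)
  then have "y = 0" using yT by (intro T2_zeroI) auto
  then show ?thesis using y(2) by simp
qed

section \<open>Homogeneous components and low degrees\<close>

lemma T_component: "t \<in> T \<Longrightarrow> tensor_component n t \<in> T"
proof (induction rule: T_induct)
  case zero
  have "tensor_component n 0 = (0 :: ('v, 'k) tensor)" by (auto simp: tensor_component_def fun_eq_iff pointwise)
  then show ?case by (simp add: T_simps)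
next
  case (add a w t)
  have "tensor_component n (fun_scale a (pt w) + t) = fun_scale (if length w = n then a else 0) (pt w) + tensor_component n t"
    by (auto simp: tensor_component_def fun_eq_iff pointwise pt_length)
  then show ?case using add by (simp only: T_simps)
qed

lemma sh_map_component: "sh_map (tensor_component n t) v = (if length v = n then sh_map t v else 0)"
  by (auto simp: sh_map_def tensor_component_def words_def intro!: sum.cong sum.neutral)

lemma sh_map_nil: "sh_map t [] = t []"
  by (simp add: sh_map_def words_0)

lemma sh_map_letter: "sh_map t [k] = (if k < \<theta> then t [dual k] else 0)"
  by (auto simp: sh_map_def sum_words_Suc words_0 letter_def if_distrib[of "\<lambda>x. _ * x"] cong: if_cong)

lemma span_low_degree: "t \<in> fv.span (tensor_power scale 1 \<union> tensor_power scale 0) \<Longrightarrow> t \<in> T \<and> (\<forall>fs. length fs > 1 \<longrightarrow> t fs = 0)"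
proof -
  let ?D = "{t \<in> T. \<forall>fs. length fs > 1 \<longrightarrow> t fs = 0}"
  have sub: "fv.subspace ?D" by (auto simp: fv.subspace_def T_simps pointwise)
  have "tensor_power scale 1 \<subseteq> ?D" "tensor_power scale 0 \<subseteq> ?D"
    unfolding tensor_power_def
    by (intro fv.span_minimal[OF _ sub]; auto simp: pure_T pure_tensor_length pure_tensor_Nil)+
  then have "fv.span (tensor_power scale 1 \<union> tensor_power scale 0) \<subseteq> ?D"
    by (intro fv.span_minimal[OF _ sub] Un_least)
  then show "t \<in> fv.span (tensor_power scale 1 \<union> tensor_power scale 0) \<Longrightarrow> ?thesis" by blast
qed

lemma T_component_power: "t \<in> T \<Longrightarrow> tensor_component n t \<in> tensor_power scale n"
proof (induction rule: T_induct)
  case zero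
  have "tensor_component n 0 = (0 :: ('v, 'k) tensor)" by (auto simp: tensor_component_def fun_eq_iff pointwise)
  then show ?case by (simp add: fv.subspace_0[OF subspace_tensor_power])
next
  case (add a w t)
  have "tensor_component n (fun_scale a (pt w) + t) = (if length w = n then fun_scale a (pt w) else 0) + tensor_component n t"
    by (auto simp: tensor_component_def fun_eq_iff pointwise pt_length)
  then show ?case using add
    by (auto simp: pt_tensor_power fv.subspace_add[OF subspace_tensor_power] fv.subspace_scale[OF subspace_tensor_power])
qed

theorem nichols_ideal_eq: "nichols_ideal scale c = sh_ker"
  unfolding nichols_ideal_def
proof (rule Greatest_equality)
  have "coproduct scale c ` sh_ker \<subseteq> fv.span (tensor2_of sh_ker T \<union> tensor2_of T sh_ker)"
    by (auto simp: sh_ker_def[of] coproduct_eq cop_T2 sh_map2_cop pointwise intro!: sh_map2_kernel[unfolded sh_ker_def])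
  moreover have "counit ` sh_ker \<subseteq> {0}"
    using sh_map_nil by (auto simp: sh_ker_def counit_def) (metis zero_fun_app)
  moreover have "antipode scale c ` sh_ker \<subseteq> sh_ker"
    by (auto simp: sh_ker_def antipode_eq anti_T sh_map_anti rev_twist_linear)
  moreover have "homogeneous sh_ker"
    by (auto simp: homogeneous_def sh_ker_def T_component fun_eq_iff sh_map_component pointwise)
  \<comment> \<open>In degrees 0 and 1 \<open>sh_map\<close> only copies coordinates, hence is
    injective there.\<close>
  moreover have "sh_ker \<inter> fv.span (tensor_power scale 1 \<union> tensor_power scale 0) = {0}"
  proof (intro equalityI subsetI)
    fix t assume t: "t \<in> sh_ker \<inter> fv.span (tensor_power scale 1 \<union> tensor_power scale 0)"
    then have low: "t \<in> T" "\<forall>fs. length fs > 1 \<longrightarrow> t fs = 0" and ker: "sh_map t = 0"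
      using span_low_degree by (auto simp: sh_ker_def)
    have "t = 0"
    proof (rule T_eqI[OF low(1) T_simps(1)])
      fix w assume w: "set w \<subseteq> {..<\<theta>}"
      show "t (map dual w) = 0 (map dual w)"
      proof (cases w)
        case Nil
        then show ?thesis using sh_map_nil[of t] ker by (simp add: pointwise)
      next
        case (Cons k w')
        then show ?thesis using low(2) w sh_map_letter[of t k] ker
          by (cases w') (simp_all add: pointwise)
      qed
    qed
    then show "t \<in> {0}" by simp
  qed (auto simp: fv.span_zero fv.subspace_0[OF subspace_sh_ker])
  ultimately show "hopf_ideal scale c sh_ker \<and> homogeneous sh_ker \<and> sh_ker \<inter> fv.span (tensor_power scale 1 \<union> tensor_power scale 0) = {0}"
    unfolding hopf_ideal_def using ideal_sh_ker by blast
next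
  fix J assume J: "hopf_ideal scale c J \<and> homogeneous J \<and> J \<inter> fv.span (tensor_power scale 1 \<union> tensor_power scale 0) = {0}"
  interpret J: ideal J "tensor_algebra scale" using J by (simp add: hopf_ideal_def)
  have JT: "J \<subseteq> T" using J.a_subset by simp
  have Jadd: "s + t \<in> J" if "s \<in> J" "t \<in> J" for s t
    using additive_subgroup.a_closed[OF J.is_additive_subgroup that] by simp
  have Jscale: "fun_scale a t \<in> J" if "t \<in> J" for a t
  proof -
    have "t \<in> T" using that JT by blast
    then have "fun_scale a t = tensor_mult (fun_scale a (pt [])) t"
      by (simp add: tensor_mult_linear tensor_mult_one)
    moreover have "\<dots> \<in> J" using J.I_l_closed[OF that, of "fun_scale a (pt [])"] by (simp add: T_simps)
    ultimately show ?thesis by simp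
  qed
  have J0: "0 \<in> J" using additive_subgroup.zero_closed[OF J.is_additive_subgroup] by simp
  \<comment> \<open>The component of degree 1 is in \<open>J\<close> by homogeneity, so the trivial
    intersection makes it 0.\<close>
  have Jletter: "t [dual k] = 0" if "t \<in> J" for t k
  proof -
    have "tensor_component 1 t \<in> J" using J that by (auto simp: homogeneous_def)
    moreover have "tensor_component 1 t \<in> fv.span (tensor_power scale 1 \<union> tensor_power scale 0)"
      using T_component_power[of t 1] that JT by (intro fv.span_base) auto
    ultimately have "tensor_component 1 t = 0" using J by blast
    then show ?thesis by (simp add: tensor_component_def fun_eq_iff pointwise split: if_splits)
  qed
  \<comment> \<open>Evaluating the second factor at \<open>[dual k]\<close> is the skew derivation
    for \<open>k\<close>. It maps \<open>J \<otimes> T\<close> into \<open>J\<close>, and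
    \<open>T \<otimes> J\<close> to 0 by \<open>Jletter\<close>.\<close>
  have slice: "(\<lambda>fs. x (fs, [dual k])) \<in> J" if "x \<in> fv.span (tensor2_of J T \<union> tensor2_of T J)" for x k
  proof -
    let ?D = "{x. (\<lambda>fs. x (fs, [dual k])) \<in> J}"
    have sub: "fv.subspace ?D" unfolding fv.subspace_def mem_Collect_eq slice_linear using J0 Jadd Jscale by blast
    have pure: "(\<lambda>fs. tensor2_pure s t (fs, [dual k])) = fun_scale (t [dual k]) s" for s t
      by (simp add: tensor2_pure_def fun_eq_iff pointwise mult.commute)
    have "tensor2_of J T \<subseteq> ?D" "tensor2_of T J \<subseteq> ?D"
      unfolding tensor2_of_def by (intro fv.span_minimal[OF _ sub]; auto simp: pure Jscale Jletter J0)+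
    then have "fv.span (tensor2_of J T \<union> tensor2_of T J) \<subseteq> ?D" by (intro fv.span_minimal[OF _ sub] Un_least)
    then show ?thesis using that by blast
  qed
  have "sh_map t v = 0" if "t \<in> J" for t v
    using that
  proof (induction v arbitrary: t)
    case Nil
    have "counit ` J \<subseteq> {0}" using J by (simp add: hopf_ideal_def)
    then show ?case using Nil by (auto simp: sh_map_nil counit_def)
  next
    case (Cons k v)
    have t: "t \<in> T" using Cons.prems JT by blast
    have "cop t \<in> fv.span (tensor2_of J T \<union> tensor2_of T J)"
      using J Cons.prems coproduct_eq[OF t] by (auto simp: hopf_ideal_def)
    then have s: "(\<lambda>fs. cop t (fs, [dual k])) \<in> J" by (rule slice)
    have "sh_map t ([k] @ v) = sh_map2 (cop t) v [k]" using sh_map2_cop[OF t] by simp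
    also have "\<dots> = sh_map (\<lambda>fs. if k < \<theta> then cop t (fs, [dual k]) else 0) v"
      by (simp add: sh_map2_def sh_map_letter)
    also have "\<dots> = 0" using Cons.IH[OF s] by (cases "k < \<theta>") (simp_all add: sh_map_def)
    finally show ?case by simp
  qed
  then show "J \<le> sh_ker" using JT by (auto simp: sh_ker_def fun_eq_iff pointwise)
qed

end

section \<open>Gelfand-Kirillov dimension\<close>

text \<open>Transfers dimensions over a subfield of a ring to dimensions of spaces of functions:
  \<open>val\<close> is an injective linear map and \<open>e\<close> embeds the ground
  field.\<close>

locale linear_model = ring R for R (structure) +
  fixes val :: "'a \<Rightarrow> 'x \<Rightarrow> 'k::field" and e :: "'k \<Rightarrow> 'a"
  assumes val_inj: "inj_on val (carrier R)"
    and val_add: "x \<in> carrier R \<Longrightarrow> y \<in> carrier R \<Longrightarrow> val (x \<oplus> y) = val x + val y"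
    and e_closed: "e a \<in> carrier R"
    and val_e_mult: "x \<in> carrier R \<Longrightarrow> val (e a \<otimes> x) = fun_scale a (val x)"
    and val_one: "val \<one> \<noteq> 0"
begin

lemma val_zero: "val \<zero> = 0"
  using val_add[of \<zero> \<zero>] by simp

lemma val_e: "val (e a) = fun_scale a (val \<one>)"
  using val_e_mult[of \<one> a] e_closed by simp

lemma val_eqI: "x \<in> carrier R \<Longrightarrow> y \<in> carrier R \<Longrightarrow> val x = val y \<Longrightarrow> x = y"
  using val_inj by (auto dest: inj_onD)

lemma e_hom: "e a \<otimes> e b = e (a * b)" "e a \<oplus> e b = e (a + b)" "e 1 = \<one>" "e 0 = \<zero>"
proof -
  note v = e_closed val_e_mult val_e val_add val_zero fv.scale_left_distrib
  show "e a \<otimes> e b = e (a * b)" by (rule val_eqI) (simp_all add: v)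
  show "e a \<oplus> e b = e (a + b)" by (rule val_eqI) (simp_all add: v)
  show "e 1 = \<one>" by (rule val_eqI) (simp_all add: v)
  show "e 0 = \<zero>" by (rule val_eqI) (simp_all add: v)
qed

lemma e_eq_iff: "e a = e b \<longleftrightarrow> a = b"
proof
  assume "e a = e b"
  then have "fun_scale a (val \<one>) = fun_scale b (val \<one>)" unfolding val_e[symmetric] by simp
  then show "a = b" using val_one by simp
qed simp

lemma subfield_e: "subfield (range e) R"
proof (rule subfieldI)
  have "\<ominus> e a = e (- a)" for a
    by (rule minus_equality) (simp_all add: e_hom e_closed)
  then show "subcring (range e) R"
    by (intro subcringI subringI) (auto simp: e_closed e_hom mult.commute intro: e_hom(3)[symmetric])
  show "Units (R \<lparr>carrier := range e\<rparr>) = range e - {\<zero>}"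
  proof (intro equalityI subsetI)
    fix x assume "x \<in> Units (R \<lparr>carrier := range e\<rparr>)"
    then obtain a b where ab: "x = e a" "e a \<otimes> e b = \<one>" by (auto simp: Units_def)
    then have "a * b = 1" using e_eq_iff[of "a * b" 1] by (simp add: e_hom)
    then have "x \<noteq> \<zero>" using ab(1) e_eq_iff[of a 0] by (auto simp: e_hom)
    then show "x \<in> range e - {\<zero>}" using ab by blast
  next
    fix x assume "x \<in> range e - {\<zero>}"
    then obtain a where a: "x = e a" "a \<noteq> 0" using e_hom(4) by auto
    then have "e a \<otimes> e (inverse a) = \<one>" "e (inverse a) \<otimes> e a = \<one>" by (simp_all add: e_hom)
    then show "x \<in> Units (R \<lparr>carrier := range e\<rparr>)" by (auto simp: Units_def a(1))
  qed
qed

lemma e_carrier: "range e \<subseteq> carrier R"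
  using e_closed by blast

lemma val_Span: "set us \<subseteq> carrier R \<Longrightarrow> val ` Span (range e) us = fv.span (val ` set us)"
proof (induction us)
  case Nil show ?case by (simp add: val_zero)
next
  case (Cons u us)
  then have u: "u \<in> carrier R" and us: "set us \<subseteq> carrier R" and IH: "val ` Span (range e) us = fv.span (val ` set us)" by auto
  have S: "Span (range e) us \<subseteq> carrier R" by (rule Span_in_carrier[OF e_carrier us])
  have val: "val (e a \<otimes> u \<oplus> x) = fun_scale a (val u) + val x" if "x \<in> Span (range e) us" for a x
    using that S u by (auto simp: val_add val_e_mult e_closed)
  have "val ` Span (range e) (u # us) = {f. \<exists>a. f - fun_scale a (val u) \<in> fv.span (val ` set us)}"
  proof (intro equalityI subsetI)
    fix f assume "f \<in> val ` Span (range e) (u # us)"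
    then obtain a x where "x \<in> Span (range e) us" "f = val (e a \<otimes> u \<oplus> x)"
      by (auto simp: line_extension_mem_iff)
    then have "f - fun_scale a (val u) \<in> fv.span (val ` set us)" using val IH by auto
    then show "f \<in> {f. \<exists>a. f - fun_scale a (val u) \<in> fv.span (val ` set us)}" by blast
  next
    fix f assume "f \<in> {f. \<exists>a. f - fun_scale a (val u) \<in> fv.span (val ` set us)}"
    then obtain a x where x: "x \<in> Span (range e) us" "f - fun_scale a (val u) = val x"
      unfolding IH[symmetric] by blast
    then have "f = val (e a \<otimes> u \<oplus> x)" using val by (simp add: algebra_simps)
    moreover have "e a \<otimes> u \<oplus> x \<in> Span (range e) (u # us)" using x(1) by (auto simp: line_extension_mem_iff)
    ultimately show "f \<in> val ` Span (range e) (u # us)" by blast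
  qed
  then show ?case by (simp add: fv.span_insert)
qed

lemma independent_val: "local.independent (range e) us \<Longrightarrow> fv.independent (val ` set us) \<and> card (val ` set us) = length us"
proof (induction us)
  case Nil show ?case by (simp add: fv.independent_empty)
next
  case (Cons u us)
  note li = independent_backwards[OF Cons.prems]
  have us: "set us \<subseteq> carrier R" using li(2) independent_in_carrier by blast
  have "val u \<notin> fv.span (val ` set us)"
  proof
    assume "val u \<in> fv.span (val ` set us)"
    then obtain x where x: "x \<in> Span (range e) us" "val u = val x" unfolding val_Span[OF us, symmetric] by blast
    then have "u = x" using Span_in_carrier[OF e_carrier us] li(3) by (intro val_eqI) auto
    then show False using x li(1) by simp
  qed
  moreover then have "val u \<notin> val ` set us" using fv.span_base by blast
  ultimately show ?case using Cons.IH[OF li(2)] by (simp add: fv.independent_insert)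
qed

text \<open>A basis is extracted from the spanning list on the ring side, and \<open>val\<close>
  keeps it independent.\<close>

lemma dim_Span:
  assumes "set us \<subseteq> carrier R" shows "dim (range e) (Span (range e) us) = fv.dim (fv.span (val ` set us))"
proof -
  obtain vs where vs: "set vs \<subseteq> carrier R" "local.independent (range e) vs" "Span (range e) vs = Span (range e) us"
    using filter_base[OF subfield_e assms] by blast
  have "dim (range e) (Span (range e) us) = length vs"
    using dimI[OF subfield_e dimension_independent[OF vs(2)]] vs(3) by (simp add: over_def)
  also have "\<dots> = fv.dim (fv.span (val ` set vs))"
    using independent_val[OF vs(2)] by (simp add: fv.dim_eq_card_independent)
  also have "fv.span (val ` set vs) = fv.span (val ` set us)"
    using val_Span[OF vs(1)] val_Span[OF assms] vs(3) by simp
  finally show ?thesis .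
qed

end

section \<open>Logarithmic growth and polynomial bounds\<close>

lemma set_monomials_upto: "set (monomials_upto R n us) = {foldr (\<otimes>\<^bsub>R\<^esub>) ws \<one>\<^bsub>R\<^esub> | ws. set ws \<subseteq> set us \<and> length ws \<le> n}"
  by (auto simp: monomials_upto_def set_n_lists simp del: upt_Suc)

text \<open>The additional 1 absorbs the constant: \<open>C (2n)^d \<le> n^(d + 1)\<close> as soon
  as \<open>n \<ge> C * 2^d\<close>.\<close>

lemma limsup_log_poly:
  fixes g :: "nat \<Rightarrow> nat"
  assumes "\<And>n. g n \<le> C * (n + 1) ^ d"
  shows "limsup (\<lambda>n. ereal (ln (real (g n)) / ln (real n))) \<le> ereal (real d + 1)"
proof (rule Limsup_bounded)
  have "ln (real (g n)) / ln (real n) \<le> real d + 1" if n: "n \<ge> 2" "n \<ge> C * 2 ^ d" for n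
  proof -
    have "g n \<le> C * (2 * n) ^ d"
      by (rule order.trans[OF assms], intro mult_le_mono2 power_mono) (use n in auto)
    also have "\<dots> = (C * 2 ^ d) * n ^ d" by (simp add: power_mult_distrib)
    also have "\<dots> \<le> n ^ Suc d" using n(2) by simp
    finally have "real (g n) \<le> real n ^ Suc d" by (metis of_nat_le_iff of_nat_power)
    then have "ln (real (g n)) \<le> ln (real n ^ Suc d)" if "g n > 0" using that by (subst ln_le_cancel_iff) auto
    moreover have "0 \<le> ln (real n ^ Suc d)" using n by (intro ln_ge_zero one_le_power) auto
    \<comment> \<open>If \<open>g n = 0\<close>, its logarithm is 0 by convention.\<close>
    ultimately have "ln (real (g n)) \<le> ln (real n ^ Suc d)" by (cases "g n = 0") auto
    also have "\<dots> = (real d + 1) * ln (real n)" using n by (subst ln_realpow) (auto simp: add.commute)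
    finally show ?thesis using n by (simp add: divide_le_eq)
  qed
  then show "\<forall>\<^sub>F n in sequentially. ereal (ln (real (g n)) / ln (real n)) \<le> ereal (real d + 1)"
    by (intro eventually_sequentiallyI[of "max 2 (C * 2 ^ d)"]) simp
qed

text \<open>Beyond some \<open>M\<close>, at least 2 so that \<open>ln M\<close> is positive, the
  values are at most \<open>n ^ d\<close>; the earlier ones are bounded by \<open>g M\<close>
  through monotonicity, which goes into the constant.\<close>

lemma poly_of_limsup_log:
  fixes g :: "nat \<Rightarrow> nat"
  assumes lim: "limsup (\<lambda>n. ereal (ln (real (g n)) / ln (real n))) < \<infinity>" and mono: "\<And>m n. m \<le> n \<Longrightarrow> g m \<le> g n"
  shows "\<exists>C d. \<forall>n. g n \<le> C * (n + 1) ^ d"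
proof -
  obtain d :: nat where "limsup (\<lambda>n. ereal (ln (real (g n)) / ln (real n))) < ereal (real d)"
    using less_PInf_Ex_of_nat lim less_imp_neq by blast
  then have "\<forall>\<^sub>F n in sequentially. ereal (ln (real (g n)) / ln (real n)) < ereal (real d)" by (rule Limsup_lessD)
  then obtain N where N: "\<And>n. n \<ge> N \<Longrightarrow> ln (real (g n)) / ln (real n) < real d"
    by (auto simp: eventually_sequentially)
  define M where "M = max 2 N"
  have big: "g n \<le> n ^ d" if n: "n \<ge> M" for n
  proof (cases "g n = 0")
    case False
    have "n \<ge> 2" using n by (simp add: M_def)
    then have "ln (real (g n)) < real d * ln (real n)" using N[of n] n by (simp add: M_def divide_less_eq)
    also have "\<dots> = ln (real n ^ d)" using \<open>n \<ge> 2\<close> by (subst ln_realpow) auto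
    finally have "ln (real (g n)) < ln (real n ^ d)" .
    moreover have "0 < real (g n)" "0 < real n ^ d" using False \<open>n \<ge> 2\<close> by auto
    ultimately have "real (g n) < real n ^ d" by (simp only: ln_less_cancel_iff)
    then have "real (g n) < real (n ^ d)" by simp
    then show ?thesis by (simp only: of_nat_less_iff less_imp_le)
  qed simp
  have "g n \<le> (g M + 1) * (n + 1) ^ d" for n
  proof (cases "n \<ge> M")
    case True
    have "g n \<le> n ^ d" by (rule big[OF True])
    also have "\<dots> \<le> (n + 1) ^ d" by (rule power_mono) auto
    also have "\<dots> = 1 * (n + 1) ^ d" by simp
    also have "\<dots> \<le> (g M + 1) * (n + 1) ^ d" by (rule mult_le_mono1) simp
    finally show ?thesis .
  next
    case False
    then have "g n \<le> g M" by (intro mono) simp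
    also have "\<dots> \<le> (g M + 1) * 1" by simp
    also have "\<dots> \<le> (g M + 1) * (n + 1) ^ d" by (rule mult_le_mono2) simp
    finally show ?thesis .
  qed
  then show ?thesis by blast
qed

context diagonal_braiding
begin

section \<open>The Nichols algebra and its finitely generated subspaces\<close>

interpretation L: letters \<theta> .

abbreviation coset :: "('v, 'k) tensor \<Rightarrow> ('v, 'k) tensor set"
  where "coset t \<equiv> sh_ker +>\<^bsub>tensor_algebra scale\<^esub> t"

text \<open>\<open>sh_map\<close> is constant on cosets of its kernel, so the choice of a
  representative is harmless.\<close>

definition coset_val :: "('v, 'k) tensor set \<Rightarrow> nat list \<Rightarrow> 'k"
  where "coset_val X = sh_map (SOME t. t \<in> X)"

lemma coset_val: "t \<in> T \<Longrightarrow> coset_val (coset t) = sh_map t"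
proof -
  assume t: "t \<in> T"
  have "sh_map s = sh_map t" if "s \<in> coset t" for s
    using that by (auto simp: a_r_coset_def r_coset_def sh_ker_def sh_map_linear)
  moreover have "\<exists>s. s \<in> coset t"
    using fv.subspace_0[OF subspace_sh_ker] by (auto simp: a_r_coset_def r_coset_def)
  ultimately show ?thesis unfolding coset_val_def by (metis someI_ex)
qed

abbreviation Nic where "Nic \<equiv> nichols_algebra scale c"

lemma Nic_eq: "Nic = tensor_algebra scale Quot sh_ker"
  by (simp add: nichols_algebra_def nichols_ideal_eq)

lemma carrier_Nic: "carrier Nic = coset ` T"
  by (auto simp: Nic_eq FactRing_def A_RCOSETS_def RCOSETS_def a_r_coset_def)

lemma Nic_ops:
  assumes "s \<in> T" "t \<in> T"
  shows "coset s \<otimes>\<^bsub>Nic\<^esub> coset t = coset (tensor_mult s t)" "coset s \<oplus>\<^bsub>Nic\<^esub> coset t = coset (s + t)"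
    "\<one>\<^bsub>Nic\<^esub> = coset (pt [])"
proof -
  interpret I: ideal sh_ker "tensor_algebra scale" by (rule ideal_sh_ker)
  show "coset s \<otimes>\<^bsub>Nic\<^esub> coset t = coset (tensor_mult s t)"
    using I.rcoset_mult_add[OF assms] by (simp add: Nic_eq FactRing_def)
  show "coset s \<oplus>\<^bsub>Nic\<^esub> coset t = coset (s + t)"
    using I.a_rcos_sum[OF assms] by (simp add: Nic_eq FactRing_def)
  show "\<one>\<^bsub>Nic\<^esub> = coset (pt [])" by (simp add: Nic_eq FactRing_def)
qed

lemma coset_eqI: "s \<in> T \<Longrightarrow> t \<in> T \<Longrightarrow> sh_map s = sh_map t \<Longrightarrow> coset s = coset t"
proof -
  interpret TA: ring "tensor_algebra scale" by (rule ring_T)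
  assume st: "s \<in> T" "t \<in> T" "sh_map s = sh_map t"
  have "\<ominus>\<^bsub>tensor_algebra scale\<^esub> t = - t"
    using st(2) fv.subspace_neg[OF subspace_T st(2)] by (intro TA.minus_equality) auto
  then have "s \<ominus>\<^bsub>tensor_algebra scale\<^esub> t = s - t" by (simp add: a_minus_def)
  moreover have "s - t \<in> sh_ker"
    using st fv.subspace_diff[OF subspace_T st(1,2)] by (simp add: sh_ker_def sh_map_diff)
  ultimately show "coset s = coset t"
    using TA.quotient_eq_iff_same_a_r_cos[OF ideal_sh_ker st(1,2)] by simp
qed

sublocale NA: linear_model Nic coset_val "\<lambda>a. coset (fun_scale a (pt []))"
proof (intro linear_model.intro linear_model_axioms.intro)
  show "ring Nic" unfolding Nic_eq by (rule ideal.quotient_is_ring[OF ideal_sh_ker])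
  show "inj_on coset_val (carrier Nic)"
  proof (rule inj_onI)
    fix X Y assume "X \<in> carrier Nic" "Y \<in> carrier Nic" and eq: "coset_val X = coset_val Y"
    then obtain s t where st: "s \<in> T" "t \<in> T" "X = coset s" "Y = coset t" by (auto simp: carrier_Nic)
    then show "X = Y" using eq coset_eqI[OF st(1,2)] by (simp add: coset_val)
  qed
  show "coset_val \<one>\<^bsub>Nic\<^esub> \<noteq> 0"
    using sone_nil by (auto simp: Nic_ops(3)[OF pt_T pt_T] coset_val pt_T sh_map_pt fun_eq_iff pointwise intro!: exI[of _ "[]"])
qed (auto simp: carrier_Nic Nic_ops coset_val T_simps sh_map_linear tensor_mult_linear tensor_mult_one)

lemma coset_val_nich: "X \<in> carrier Nic \<Longrightarrow> coset_val X \<in> nich \<theta> q"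
  by (auto simp: carrier_Nic coset_val sh_map_T)

lemma coset_val_mult: "X \<in> carrier Nic \<Longrightarrow> Y \<in> carrier Nic \<Longrightarrow> coset_val (X \<otimes>\<^bsub>Nic\<^esub> Y) = qsh q (coset_val X) (coset_val Y)"
  by (auto simp: carrier_Nic coset_val Nic_ops tensor_mult_T sh_map_mult)

lemma coset_val_one: "coset_val \<one>\<^bsub>Nic\<^esub> = sone"
  by (simp add: Nic_ops(3)[OF pt_T pt_T] coset_val pt_T sh_map_pt)

lemma foldr_Nic: "set ws \<subseteq> carrier Nic \<Longrightarrow>
    foldr (\<otimes>\<^bsub>Nic\<^esub>) ws \<one>\<^bsub>Nic\<^esub> \<in> carrier Nic \<and>
    coset_val (foldr (\<otimes>\<^bsub>Nic\<^esub>) ws \<one>\<^bsub>Nic\<^esub>) = foldr (qsh q) (map coset_val ws) sone"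
  by (induction ws) (auto simp: coset_val_one coset_val_mult)

definition prods :: "(nat list \<Rightarrow> 'k) set \<Rightarrow> nat \<Rightarrow> (nat list \<Rightarrow> 'k) set"
  where "prods F n = {foldr (qsh q) fs sone | fs. set fs \<subseteq> F \<and> length fs \<le> n}"

lemma dim_Nic:
  assumes us: "set us \<subseteq> carrier Nic"
  shows "ring.dim Nic (nichols_scalars scale c) (ring.Span Nic (nichols_scalars scale c) (monomials_upto Nic n us))
    = fv.dim (fv.span (prods (coset_val ` set us) n))"
proof -
  have K: "nichols_scalars scale c = range (\<lambda>a. coset (fun_scale a (pt [])))"
    by (simp add: nichols_scalars_def nichols_ideal_eq pt_def)
  have m: "set (monomials_upto Nic n us) \<subseteq> carrier Nic"
    unfolding set_monomials_upto using us foldr_Nic by blast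
  have "coset_val ` set (monomials_upto Nic n us) = prods (coset_val ` set us) n"
  proof (intro equalityI subsetI)
    fix f assume "f \<in> coset_val ` set (monomials_upto Nic n us)"
    then obtain ws where ws: "set ws \<subseteq> set us" "length ws \<le> n" "f = coset_val (foldr (\<otimes>\<^bsub>Nic\<^esub>) ws \<one>\<^bsub>Nic\<^esub>)"
      unfolding set_monomials_upto by blast
    then have "f = foldr (qsh q) (map coset_val ws) sone" using foldr_Nic[of ws] us by auto
    then show "f \<in> prods (coset_val ` set us) n" using ws unfolding prods_def by (intro CollectI exI[of _ "map coset_val ws"]) auto
  next
    fix f assume "f \<in> prods (coset_val ` set us) n"
    then obtain fs where fs: "f = foldr (qsh q) fs sone" "set fs \<subseteq> coset_val ` set us" "length fs \<le> n"
      unfolding prods_def by blast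
    have "fs \<in> lists (coset_val ` set us)" using fs(2) by (simp add: lists_eq_set)
    then have "fs \<in> map coset_val ` lists (set us)" by (simp only: lists_image)
    then obtain ws where ws: "fs = map coset_val ws" "set ws \<subseteq> set us" by (auto simp: lists_eq_set)
    then have "f = coset_val (foldr (\<otimes>\<^bsub>Nic\<^esub>) ws \<one>\<^bsub>Nic\<^esub>)" using foldr_Nic[of ws] us fs(1) by auto
    then show "f \<in> coset_val ` set (monomials_upto Nic n us)"
      unfolding set_monomials_upto using ws fs(3) by auto
  qed
  then show ?thesis unfolding K using NA.dim_Span[OF m] by simp
qed

lemma part_wball: "f \<in> L.part (nich \<theta> q) (L.wball n) \<longleftrightarrow> f \<in> nich \<theta> q \<and> (\<forall>w. length w > n \<longrightarrow> f w = 0)"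
proof -
  have wt: "wt w \<in> L.wball n \<longleftrightarrow> length w \<le> n" if "set w \<subseteq> {..<\<theta>}" for w
  proof -
    have "wt w l = 0" if "l \<ge> \<theta>" for l
      using \<open>set w \<subseteq> _\<close> that by (auto simp: wt_def count_list_0_iff)
    then show ?thesis using L.wt_length[OF that] by (auto simp: L.wball_def wt_nonneg)
  qed
  have "(f w \<noteq> 0 \<longrightarrow> wt w \<in> L.wball n) \<longleftrightarrow> (length w > n \<longrightarrow> f w = 0)" if "f \<in> nich \<theta> q" for w
    using wt nich_set[OF that, of w] by (cases "f w = 0") auto
  then show ?thesis by (auto simp: L.part_def supported_def)
qed

lemma prods_nich: "F \<subseteq> nich \<theta> q \<Longrightarrow> prods F n \<subseteq> nich \<theta> q"
proof -
  assume F: "F \<subseteq> nich \<theta> q"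
  have "set fs \<subseteq> F \<Longrightarrow> foldr (qsh q) fs sone \<in> nich \<theta> q" for fs
    using F by (induction fs) (auto intro: nich_sone nich_qsh)
  then show ?thesis by (auto simp: prods_def)
qed

lemma prods_degree:
  assumes "\<And>f w. f \<in> F \<Longrightarrow> length w > d \<Longrightarrow> f w = 0"
  shows "set fs \<subseteq> F \<Longrightarrow> length w > d * length fs \<Longrightarrow> foldr (qsh q) fs sone w = 0"
proof (induction fs arbitrary: w)
  case Nil then show ?case by (auto simp: sone_def)
next
  case (Cons f fs)
  show ?case
  proof (rule ccontr)
    assume "foldr (qsh q) (f # fs) sone w \<noteq> 0"
    then have "qsh q f (foldr (qsh q) fs sone) w \<noteq> 0" by simp
    from qsh_nonzero[OF this] obtain u v where *: "f u \<noteq> 0" "foldr (qsh q) fs sone v \<noteq> 0" "length w = length u + length v" by blast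
    have "length u \<le> d" using assms[of f u] *(1) Cons.prems(1) by force
    moreover have "length v \<le> d * length fs" using Cons.IH[of v] *(2) Cons.prems(1) by force
    ultimately show False using *(3) Cons.prems(2) by simp
  qed
qed

text \<open>Finitely many elements have degrees bounded by some \<open>d\<close>, and degrees add up
  under the product.\<close>

lemma span_prods_le:
  assumes "finite F" "F \<subseteq> nich \<theta> q"
  shows "\<exists>d. \<forall>n. fv.dim (fv.span (prods F n)) \<le> L.hdim (nich \<theta> q) (L.wball (d * n))"
proof -
  have "\<exists>d. \<forall>f\<in>F. \<forall>w. length w > d \<longrightarrow> f w = 0"
    using assms
  proof (induction rule: finite_induct)
    case (insert f F)
    then obtain d where d: "\<forall>f\<in>F. \<forall>w. length w > d \<longrightarrow> f w = 0" by auto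
    obtain e where e: "\<forall>w. length w > e \<longrightarrow> f w = 0" using nich_length_bounded insert.prems by blast
    show ?case by (intro exI[of _ "max d e"]) (use d e in auto)
  qed simp
  then obtain d where d: "\<And>f w. f \<in> F \<Longrightarrow> length w > d \<Longrightarrow> f w = 0" by blast
  have "fv.dim (fv.span (prods F n)) \<le> L.hdim (nich \<theta> q) (L.wball (d * n))" for n
  proof -
    have "prods F n \<subseteq> L.part (nich \<theta> q) (L.wball (d * n))"
    proof
      fix f assume f: "f \<in> prods F n"
      then obtain fs where fs: "f = foldr (qsh q) fs sone" "set fs \<subseteq> F" "length fs \<le> n" by (auto simp: prods_def)
      have "f w = 0" if "length w > d * n" for w
      proof -
        have "d * length fs < length w" using that fs(3) by (meson le_less_trans mult_le_mono2)
        then show ?thesis unfolding fs(1) by (intro prods_degree[of F d, OF _ fs(2)] d)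
      qed
      then show "f \<in> L.part (nich \<theta> q) (L.wball (d * n))" using f prods_nich[OF assms(2)] by (auto simp: part_wball)
    qed
    then have "fv.span (prods F n) \<subseteq> L.part (nich \<theta> q) (L.wball (d * n))"
      by (rule fv.span_minimal) (rule L.subspace_part[OF subspace_nich])
    moreover obtain G where "finite G" "L.part (nich \<theta> q) (L.wball (d * n)) \<subseteq> fv.span G"
      using L.part_finite[OF order.refl L.finite_wball] by blast
    ultimately show ?thesis unfolding L.hdim_def by (intro dim_mono_fin[of _ _ G])
  qed
  then show ?thesis by blast
qed

text \<open>Letters generate and have degree 1, so the filtration by the number of factors is the
  filtration by degree.\<close>

lemma span_prods_letters: "fv.span (prods (letter ` {..<\<theta>}) n) = L.part (nich \<theta> q) (L.wball n)"
proof
  have sub: "letter ` {..<\<theta>} \<subseteq> nich \<theta> q" using nich_letter by blast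
  show "fv.span (prods (letter ` {..<\<theta>}) n) \<subseteq> L.part (nich \<theta> q) (L.wball n)"
  proof (rule fv.span_minimal[OF _ L.subspace_part[OF subspace_nich]], rule)
    fix f assume f: "f \<in> prods (letter ` {..<\<theta>}) n"
    then obtain fs where fs: "f = foldr (qsh q) fs sone" "set fs \<subseteq> letter ` {..<\<theta>}" "length fs \<le> n" by (auto simp: prods_def)
    have "f w = 0" if "length w > n" for w
      unfolding fs(1) using that fs(3) by (intro prods_degree[where d = 1 and F = "letter ` {..<\<theta>}", OF _ fs(2)]) (auto simp: letter_def)
    then show "f \<in> L.part (nich \<theta> q) (L.wball n)" using f prods_nich[OF sub] by (auto simp: part_wball)
  qed
  show "L.part (nich \<theta> q) (L.wball n) \<subseteq> fv.span (prods (letter ` {..<\<theta>}) n)"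
  proof
    fix f assume "f \<in> L.part (nich \<theta> q) (L.wball n)"
    then have f: "f \<in> nich \<theta> q" "\<And>w. length w > n \<Longrightarrow> f w = 0" by (auto simp: part_wball)
    obtain t where t: "t \<in> T" "sh_map t = f" using sh_map_onto[OF f(1)] by blast
    have "f = (\<Sum>w\<in>wordsn \<theta> n. fun_scale (t (map dual w)) (letter_prod w))"
    proof
      fix v
      show "f v = (\<Sum>w\<in>wordsn \<theta> n. fun_scale (t (map dual w)) (letter_prod w)) v"
      proof (cases "length v \<le> n")
        case True
        have "f v = (\<Sum>w\<in>words (length v). t (map dual w) * letter_prod w v)" using t(2) by (auto simp: sh_map_def)
        also have "\<dots> = (\<Sum>w\<in>wordsn \<theta> n. t (map dual w) * letter_prod w v)"
          by (rule sum.mono_neutral_left[OF finite_wordsn])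
            (use True in \<open>auto simp: words_def wordsn_def\<close>, metis letter_prod_length)
        finally show ?thesis by (simp add: sum_fun_apply pointwise)
      next
        case False
        then have "(\<Sum>w\<in>wordsn \<theta> n. t (map dual w) * letter_prod w v) = 0"
          by (intro sum.neutral) (auto simp: wordsn_def letter_prod_length)
        then show ?thesis using f(2)[of v] False by (simp add: sum_fun_apply pointwise)
      qed
    qed
    also have "\<dots> \<in> fv.span (prods (letter ` {..<\<theta>}) n)"
    proof (intro fv.span_sum fv.span_scale fv.span_base)
      fix w assume w: "w \<in> wordsn \<theta> n"
      have "letter_prod w = foldr (qsh q) (map letter w) sone" by (induction w) auto
      then show "letter_prod w \<in> prods (letter ` {..<\<theta>}) n"
        unfolding prods_def using w by (intro CollectI exI[of _ "map letter w"]) (auto simp: wordsn_def)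
    qed
    finally show "f \<in> fv.span (prods (letter ` {..<\<theta>}) n)" .
  qed
qed

text \<open>The list of letters realizes the growth of the whole algebra. Any other list is compared
  with it by \<open>span_prods_le\<close>, which only rescales the radius by a constant.\<close>

theorem GKdim_finite_iff: "GKdim (nichols_scalars scale c) Nic < \<infinity> \<longleftrightarrow> (\<exists>d. L.growth (nich \<theta> q) d)"
proof
  assume fin: "GKdim (nichols_scalars scale c) Nic < \<infinity>"
  define us where "us = map (\<lambda>i. coset (pt [i])) [0..<\<theta>]"
  have us: "set us \<subseteq> carrier Nic" by (auto simp: us_def carrier_Nic pt_T)
  have "coset_val (coset (pt [i])) = letter i" if "i < \<theta>" for i
    using that by (simp add: coset_val pt_T sh_map_pt)
  then have val: "coset_val ` set us = letter ` {..<\<theta>}" by (force simp: us_def image_image)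
  let ?g = "\<lambda>n. L.hdim (nich \<theta> q) (L.wball n)"
  have "limsup (\<lambda>n. ereal (ln (real (?g n)) / ln (real n))) \<le> GKdim (nichols_scalars scale c) Nic"
    unfolding GKdim_def
    by (rule SUP_upper2[of us]) (use us in simp, simp only: dim_Nic[OF us] val span_prods_letters L.hdim_def order.refl)
  then have lim: "limsup (\<lambda>n. ereal (ln (real (?g n)) / ln (real n))) < \<infinity>" using fin by (rule le_less_trans)
  have "?g m \<le> ?g n" if "m \<le> n" for m n
  proof -
    obtain G where G: "finite G" "L.part (nich \<theta> q) (L.wball n) \<subseteq> fv.span G"
      using L.part_finite[OF order.refl L.finite_wball] by blast
    have "L.part (nich \<theta> q) (L.wball m) \<subseteq> L.part (nich \<theta> q) (L.wball n)" using that by (auto simp: part_wball)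
    then show ?thesis unfolding L.hdim_def by (rule dim_mono_fin[OF _ G(2,1)])
  qed
  from poly_of_limsup_log[OF lim this] show "\<exists>d. L.growth (nich \<theta> q) d" unfolding L.growth_def by blast
next
  assume "\<exists>d. L.growth (nich \<theta> q) d"
  then obtain d C where C: "\<And>n. L.hdim (nich \<theta> q) (L.wball n) \<le> C * (n + 1) ^ d" by (auto simp: L.growth_def)
  have "GKdim (nichols_scalars scale c) Nic \<le> ereal (real d + 1)"
    unfolding GKdim_def
  proof (rule SUP_least)
    fix us assume "us \<in> {us. set us \<subseteq> carrier Nic}"
    then have us: "set us \<subseteq> carrier Nic" by simp
    have F: "finite (coset_val ` set us)" "coset_val ` set us \<subseteq> nich \<theta> q" using us coset_val_nich by auto
    obtain b where b: "\<And>n. fv.dim (fv.span (prods (coset_val ` set us) n)) \<le> L.hdim (nich \<theta> q) (L.wball (b * n))"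
      using span_prods_le[OF F] by blast
    have "fv.dim (fv.span (prods (coset_val ` set us) n)) \<le> (C * (b + 1) ^ d) * (n + 1) ^ d" for n
    proof -
      have "fv.dim (fv.span (prods (coset_val ` set us) n)) \<le> C * (b * n + 1) ^ d" using b C order.trans by blast
      also have "\<dots> \<le> C * ((b + 1) * (n + 1)) ^ d" by (intro mult_le_mono2 power_mono) auto
      finally show ?thesis by (simp only: power_mult_distrib mult.assoc)
    qed
    from limsup_log_poly[OF this]
    show "limsup (\<lambda>n. ereal (ln (real (ring.dim Nic (nichols_scalars scale c)
        (ring.Span Nic (nichols_scalars scale c) (monomials_upto Nic n us)))) / ln (real n))) \<le> ereal (real d + 1)"
      by (simp only: dim_Nic[OF us])
  qed
  then show "GKdim (nichols_scalars scale c) Nic < \<infinity>" by (rule le_less_trans) simp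
qed

end

text \<open>A diagonal braiding constrains \<open>q i j\<close> only for indices below \<open>\<theta>\<close>; the other entries are set
  to 1 to make the matrix invertible everywhere.\<close>

definition normalized :: "nat \<Rightarrow> (nat \<Rightarrow> nat \<Rightarrow> 'k::field) \<Rightarrow> nat \<Rightarrow> nat \<Rightarrow> 'k"
  where "normalized \<theta> q i j = (if i < \<theta> \<and> j < \<theta> then q i j else 1)"

lemma twist_equivalent_normalized: "twist_equivalent \<theta> (normalized \<theta> q) q' \<longleftrightarrow> twist_equivalent \<theta> q q'"
  by (simp add: twist_equivalent_def normalized_def)

lemma diagonal_braiding_normalized:
  fixes q :: "nat \<Rightarrow> nat \<Rightarrow> 'k::field_char_0"
  assumes "vector_space scale" "braided_vector_space scale c" "diagonal_type scale c xs q"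
  shows "diagonal_braiding scale c xs (normalized (length xs) q)"
  using assms
  by (auto simp: diagonal_braiding_def diagonal_braiding_axioms_def diagonal_type_def normalized_def)

theorem lemma1p2:
  fixes scale :: "'k::{alg_closed_field, field_char_0} \<Rightarrow> 'v::ab_group_add \<Rightarrow> 'v"
    and c :: "('v, 'k) tensor \<Rightarrow> ('v, 'k) tensor"
  assumes "\<exists>B. finite_dimensional_vector_space scale B"
    and "braided_vector_space scale c"
    and "generic_braiding scale c"
  shows "GKdim (nichols_scalars scale c) (nichols_algebra scale c) < \<infinity> \<longleftrightarrow>
    (\<exists>xs q q' a. diagonal_type scale c xs q \<and>
       twist_equivalent (length xs) q q' \<and>
       DJ_type (length xs) q' a \<and>
       finite_cartan_matrix (length xs) a)"
proof -
  have vs: "vector_space scale"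
    using assms(1) by (auto simp: finite_dimensional_vector_space_def)
  \<comment> \<open>The equivalence for one fixed basis with generic matrix; the two directions
    apply it to possibly different bases.\<close>
  have main: "GKdim (nichols_scalars scale c) (nichols_algebra scale c) < \<infinity> \<longleftrightarrow>
      (\<exists>q' a. twist_equivalent (length xs) q q' \<and> DJ_type (length xs) q' a \<and> finite_cartan_matrix (length xs) a)"
    if diag: "diagonal_type scale c xs q" and gen: "\<And>i. i < length xs \<Longrightarrow> \<not> root_of_one (q i i)" for xs q
  proof -
    note db = diagonal_braiding_normalized[OF vs assms(2) diag]
    have gen': "\<not> root_of_one (normalized (length xs) q i i)" if "i < length xs" for i
      using gen that by (simp add: normalized_def)
    have "(\<exists>d. letters.growth (length xs) (nich (length xs) (normalized (length xs) q)) d) \<longleftrightarrow>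
      (\<exists>q' a. twist_equivalent (length xs) (normalized (length xs) q) q' \<and> DJ_type (length xs) q' a \<and> finite_cartan_matrix (length xs) a)"
      by (intro growth_iff_DJ_type diagonal_braiding.qnz[OF db] gen')
    then show ?thesis
      unfolding diagonal_braiding.GKdim_finite_iff[OF db] twist_equivalent_normalized by simp
  qed
  show ?thesis
  proof
    assume "GKdim (nichols_scalars scale c) (nichols_algebra scale c) < \<infinity>"
    moreover obtain xs q where "diagonal_type scale c xs q" "\<forall>i<length xs. \<not> root_of_one (q i i)"
      using assms(3) by (auto simp: generic_braiding_def)
    ultimately show "\<exists>xs q q' a. diagonal_type scale c xs q \<and> twist_equivalent (length xs) q q' \<and>
       DJ_type (length xs) q' a \<and> finite_cartan_matrix (length xs) a"
      using main by blast
  next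
    assume "\<exists>xs q q' a. diagonal_type scale c xs q \<and> twist_equivalent (length xs) q q' \<and>
       DJ_type (length xs) q' a \<and> finite_cartan_matrix (length xs) a"
    then obtain xs q q' a where *: "diagonal_type scale c xs q" "twist_equivalent (length xs) q q'"
      "DJ_type (length xs) q' a" "finite_cartan_matrix (length xs) a" by blast
    note db = diagonal_braiding_normalized[OF vs assms(2) *(1)]
    note DJ = DJ_type_cbraid[of "normalized (length xs) q", OF diagonal_braiding.qnz[OF db] iffD2[OF twist_equivalent_normalized *(2)] *(3)]
    \<comment> \<open>This basis need not be the one provided by \<open>generic_braiding\<close>, so
      its diagonal entries are seen not to be roots of one from the DJ type.\<close>
    have "\<not> root_of_one (q i i)" if "i < length xs" for i
      using DJ(2) that unfolding cartan.cbraid_def[OF DJ(1)] by (simp add: normalized_def)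
    then show "GKdim (nichols_scalars scale c) (nichols_algebra scale c) < \<infinity>"
      using main[OF *(1)] *(2-4) by blast
  qed
qed

end
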